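(* Let $d\ge5$ and let $\mathrm H$ be a uniform recurrent sandpile on $\mathbb Z^d$. Then there exist constants $0<a\le A<\infty$, depending only on $d$, such that for every $n\ge1$, $$a n^{-2}\le\mathbb P\bigl(\mathrm{diam}_{\mathrm{ext}}(\mathrm{AvC}_0(\mathrm H))\ge n\bigr)\le A n^{-2},$$ $$a n^{-1/2}\le\mathbb P\bigl(|\mathrm{AvC}_0(\mathrm H)|\ge n\bigr)\le A n^{-1/2},\qquad a n^{-1/2}\le\mathbb P\bigl(|\mathrm{Av}_0(\mathrm H)|\ge n\bigr)\le A n^{-1/2}.$$
   Context: Let $G=(V,E)$ be a connected, locally finite, infinite graph (here $\mathbb Z^d$ with nearest-neighbour edges). A sandpile on $K\subseteq V$ is a function $\eta:K\to\{0,1,2,\dots\}$; it is stable at $x$ if $\eta(x)<\deg(x)$, unstable at $x$ otherwise, and stable if it is stable at every $x\in K$. If $\eta$ is unstable at $x$, toppling $\eta$ at $x$ replaces $\eta(x)$ by $\eta(x)-\deg(x)$ and increases $\eta(y)$ by the number of edges between $x$ and $y$ for each $y\in K\setminus\{x\}$ (grains sent to $V\setminus K$ are lost). For finite $K\ne V$, successive topplings of unstable vertices always lead to a stable configuration that does not depend on the order. Consider the Markov chain on stable sandpiles on $K$ that at each step adds a grain at a uniformly random vertex of $K$ and stabilizes; it has a unique closed communicating class, whose elements are called recurrent configurations. If every component of the wired uniform spanning forest of $G$ is one-ended almost surely (which holds for the graphs considered here), then for any increasing sequence of finite sets $V_n$ with union $V$, the uniform measures on recurrent configurations on $V_n$ converge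 weakly to a probability measure on sandpiles on $V$, independent of the exhaustion; a random sandpile $\mathrm H$ with this law is called a uniform recurrent sandpile on $G$. Add one grain at $v$ to $\mathrm H$ and topple unstable vertices in order to stabilize. The avalanche $\mathrm{Av}_v(\mathrm H)$ is the multiset of vertices that topple, counted according to the number of times they topple (the number of times $u$ topples being the supremum over finite legal toppling sequences), and $|\mathrm{Av}_v(\mathrm H)|$ is the total number of topplings. The avalanche cluster $\mathrm{AvC}_v(\mathrm H)$ is the set of vertices that topple at least once. $\mathrm{diam}_{\mathrm{ext}}(K)$ is the supremal graph distance in $G$ between two vertices of $K$ (zero if $K=\emptyset$). *)

theory Defs
  imports "HOL-Probability.Probability"
begin

section \<open>Sandpiles on a locally finite simple graph\<close>

text \<open>
  A simple graph on the whole type \<open>'v\<close> is its (symmetric, irreflexive) adjacency relation \<open>E\<close>.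
  A sandpile on \<open>K\<close> is represented by a function on all vertices that vanishes off \<open>K\<close>.
\<close>

type_synonym 'v sandpile = "'v \<Rightarrow> nat"

definition deg :: "('v \<Rightarrow> 'v \<Rightarrow> bool) \<Rightarrow> 'v \<Rightarrow> nat" where
  "deg E x = card {y. E x y}"

definition graph_dist :: "('v \<Rightarrow> 'v \<Rightarrow> bool) \<Rightarrow> 'v \<Rightarrow> 'v \<Rightarrow> enat" where
  "graph_dist E x y = (INF n\<in>{n. (E ^^ n) x y}. enat n)"

definition diam_ext :: "('v \<Rightarrow> 'v \<Rightarrow> bool) \<Rightarrow> 'v set \<Rightarrow> enat" where
  "diam_ext E K = (SUP x\<in>K. SUP y\<in>K. graph_dist E x y)"

definition sandpiles :: "'v set \<Rightarrow> 'v sandpile set" where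
  "sandpiles K = {\<eta>. \<forall>x. x \<notin> K \<longrightarrow> \<eta> x = 0}"

definition stable :: "('v \<Rightarrow> 'v \<Rightarrow> bool) \<Rightarrow> 'v set \<Rightarrow> 'v sandpile \<Rightarrow> bool" where
  "stable E K \<eta> \<longleftrightarrow> (\<forall>x\<in>K. \<eta> x < deg E x)"

definition stable_sandpiles :: "('v \<Rightarrow> 'v \<Rightarrow> bool) \<Rightarrow> 'v set \<Rightarrow> 'v sandpile set" where
  "stable_sandpiles E K = {\<eta> \<in> sandpiles K. stable E K \<eta>}"

definition add_grain :: "'v \<Rightarrow> 'v sandpile \<Rightarrow> 'v sandpile" where
  "add_grain v \<eta> = \<eta>(v := \<eta> v + 1)"

text \<open>Only meaningful when \<open>\<eta>\<close> is unstable at \<open>x\<close>, so that the subtraction does not truncate.\<close>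

definition topple :: "('v \<Rightarrow> 'v \<Rightarrow> bool) \<Rightarrow> 'v set \<Rightarrow> 'v \<Rightarrow> 'v sandpile \<Rightarrow> 'v sandpile" where
  "topple E K x \<eta> =
    (\<lambda>y. if y = x then \<eta> x - deg E x
         else if y \<in> K \<and> E x y then \<eta> y + 1
         else \<eta> y)"

primrec legal :: "('v \<Rightarrow> 'v \<Rightarrow> bool) \<Rightarrow> 'v set \<Rightarrow> 'v sandpile \<Rightarrow> 'v list \<Rightarrow> bool" where
  "legal E K \<eta> [] \<longleftrightarrow> True"
| "legal E K \<eta> (x # xs) \<longleftrightarrow> x \<in> K \<and> deg E x \<le> \<eta> x \<and> legal E K (topple E K x \<eta>) xs"

text \<open>
  The result of stabilizing is unique by the abelian property; it exists whenever the graph is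
  connected, infinite and locally finite and \<open>K\<close> is finite.
\<close>

definition stabilize :: "('v \<Rightarrow> 'v \<Rightarrow> bool) \<Rightarrow> 'v set \<Rightarrow> 'v sandpile \<Rightarrow> 'v sandpile" where
  "stabilize E K \<eta> =
    (THE \<xi>. stable E K \<xi> \<and> (\<exists>xs. legal E K \<eta> xs \<and> \<xi> = fold (topple E K) xs \<eta>))"


section \<open>Recurrent configurations\<close>

definition sandpile_step ::
    "('v \<Rightarrow> 'v \<Rightarrow> bool) \<Rightarrow> 'v set \<Rightarrow> 'v sandpile \<Rightarrow> 'v sandpile pmf" where
  "sandpile_step E K \<eta> = map_pmf (\<lambda>v. stabilize E K (add_grain v \<eta>)) (pmf_of_set K)"

definition reachable ::
    "('v \<Rightarrow> 'v \<Rightarrow> bool) \<Rightarrow> 'v set \<Rightarrow> 'v sandpile \<Rightarrow> 'v sandpile \<Rightarrow> bool" where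
  "reachable E K = (\<lambda>\<eta> \<xi>. \<xi> \<in> set_pmf (sandpile_step E K \<eta>))\<^sup>*\<^sup>*"

text \<open>
  The set of states reachable from any element of \<open>C\<close> is exactly \<open>C\<close>: the inclusion in \<open>C\<close> says
  that \<open>C\<close> is closed, the other one that the elements of \<open>C\<close> communicate.
\<close>

definition closed_communicating_class ::
    "('v \<Rightarrow> 'v \<Rightarrow> bool) \<Rightarrow> 'v set \<Rightarrow> 'v sandpile set \<Rightarrow> bool" where
  "closed_communicating_class E K C \<longleftrightarrow>
    C \<noteq> {} \<and> C \<subseteq> stable_sandpiles E K \<and> (\<forall>\<eta>\<in>C. {\<xi>. reachable E K \<eta> \<xi>} = C)"

text \<open>There is exactly one such class when \<open>K\<close> is finite and nonempty.\<close>

definition recurrent :: "('v \<Rightarrow> 'v \<Rightarrow> bool) \<Rightarrow> 'v set \<Rightarrow> 'v sandpile set" where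
  "recurrent E K = \<Union> {C. closed_communicating_class E K C}"


section \<open>The uniform recurrent sandpile on an infinite graph\<close>

definition weakly_converges :: "(nat \<Rightarrow> 'a::topological_space measure) \<Rightarrow> 'a measure \<Rightarrow> bool" where
  "weakly_converges N M \<longleftrightarrow>
    (\<forall>f :: 'a \<Rightarrow> real. continuous_on UNIV f \<and> bounded (range f) \<longrightarrow>
       (\<lambda>n. \<integral>\<eta>. f \<eta> \<partial>N n) \<longlonglongrightarrow> (\<integral>\<eta>. f \<eta> \<partial>M))"

text \<open>
  The topology on sandpiles is the product topology of the discrete topology on \<open>nat\<close>. The values
  \<open>0\<close> off \<open>K\<close> do not affect weak limits along exhaustions.
\<close>

definition uniform_recurrent_on ::
    "('v \<Rightarrow> 'v \<Rightarrow> bool) \<Rightarrow> 'v set \<Rightarrow> 'v sandpile measure" where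
  "uniform_recurrent_on E K = distr (measure_pmf (pmf_of_set (recurrent E K))) borel (\<lambda>\<eta>. \<eta>)"

definition exhaustion :: "(nat \<Rightarrow> 'v set) \<Rightarrow> bool" where
  "exhaustion V \<longleftrightarrow> incseq V \<and> (\<forall>n. finite (V n)) \<and> (\<Union>n. V n) = UNIV"

definition uniform_recurrent_law ::
    "('v \<Rightarrow> 'v \<Rightarrow> bool) \<Rightarrow> 'v sandpile measure \<Rightarrow> bool" where
  "uniform_recurrent_law E M \<longleftrightarrow>
    prob_space M \<and> sets M = sets borel \<and>
    (\<forall>V. exhaustion V \<longrightarrow> weakly_converges (\<lambda>n. uniform_recurrent_on E (V n)) M)"


section \<open>Avalanches\<close>

text \<open>
  The avalanche is a multiset of vertices, given by its multiplicities, which a priori may be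
  infinite.
\<close>

definition avalanche :: "('v \<Rightarrow> 'v \<Rightarrow> bool) \<Rightarrow> 'v \<Rightarrow> 'v sandpile \<Rightarrow> 'v \<Rightarrow> enat" where
  "avalanche E v \<eta> u =
    (SUP xs\<in>{xs. legal E UNIV (add_grain v \<eta>) xs}. enat (count_list xs u))"

definition avalanche_size :: "('v \<Rightarrow> 'v \<Rightarrow> bool) \<Rightarrow> 'v \<Rightarrow> 'v sandpile \<Rightarrow> enat" where
  "avalanche_size E v \<eta> = (\<Sum>\<^sub>\<infinity>u. avalanche E v \<eta> u)"

definition avalanche_cluster :: "('v \<Rightarrow> 'v \<Rightarrow> bool) \<Rightarrow> 'v \<Rightarrow> 'v sandpile \<Rightarrow> 'v set" where
  "avalanche_cluster E v \<eta> = {u. avalanche E v \<eta> u \<ge> 1}"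

text \<open>Unlike \<open>card\<close>, this is infinite on infinite sets.\<close>

definition ecard :: "'a set \<Rightarrow> enat" where
  "ecard A = (if finite A then enat (card A) else \<infinity>)"


section \<open>The hypercubic lattice\<close>

definition lattice_adj :: "int ^ 'd \<Rightarrow> int ^ 'd \<Rightarrow> bool" where
  "lattice_adj x y \<longleftrightarrow> (\<Sum>i\<in>UNIV. \<bar>x $ i - y $ i\<bar>) = 1"

end

theory Submission
  imports Defs
begin

text \<open>
  An avalanche started at \<open>v\<close> in a finite set splits into waves, in each of which \<open>v\<close> topples once and
  every other vertex at most once. A wave is determined by a recurrent configuration on the complement
  of \<open>v\<close>, and the number of configurations with a prescribed wave equals the number of spanning forests
  with a prescribed component of the root \<open>v\<close>, because both numbers satisfy the burning recursion. So,
  up to constants, the tails of an avalanche are those of the radius and of the volume of the tree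
  hanging from \<open>v\<close> in a uniform spanning forest of a finite set.

  Redirecting the forest along the last exits of a random walk preserves its law, and this bounds the
  probability that the tree is high by the inverse of a capacity, which a finite bubble diagram controls.
  Path counting and an exponential moment turn this into upper bounds for volume and radius. For the
  lower bounds, mass transport gives the first moment averaged over the position of \<open>v\<close>, and the bubble
  diagram bounds the second moment. The lattice enters only through a superharmonic function with a
  finite bubble sum, which exists in dimension at least five. Avalanche events are open and can be
  approximated by cylinder events, which carries the estimates over to infinite volume.
\<close>

section \<open>Weighted rooted forests\<close>

text \<open>No random walk and no infinite forest is ever constructed. Hitting probabilities and
  Green functions are ratios of weighted forest counts on a finite set, and each estimate on a walk
  becomes a comparison with a superharmonic function. The constants depend only on the degree and on
  bounds for such functions, so they survive the passage to the limit. The main obstacle is the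
  bound O(1/n) for the probability that the tree has height n: the mean number of descendants in the
  first n generations is only known to be O(n), which gives no decay. The gain comes from capacity.
  A line of descent of length n has energy of order n on average, so walks that refresh the forest
  destroy it at a rate of order n, while they create new branches at the root at a bounded rate;
  comparing heights n and 3n closes a recursion. Finite sets have no translation symmetry, so lower
  bounds are available only on average over the position of the root. The average disappears in the
  limit, because translated exhaustions have the same limiting law.\<close>

inductive leads :: "'v set => ('v => 'v) => 'v => 'v => bool" for D f where
 stop: "r \<notin> D ==> leads D f r r"
| step: "x \<in> D ==> leads D f (f x) r ==> leads D f x r"

lemma leads_notin: "leads D f x r ==> r \<notin> D"
 by (induction rule: leads.induct) auto

lemma leads_out: "x \<notin> D ==> leads D f x r \<longleftrightarrow> r = x"
 by (auto elim: leads.cases intro: leads.stop)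

lemma leads_in: "x \<in> D ==> leads D f x r \<longleftrightarrow> leads D f (f x) r"
 by (auto elim: leads.cases intro: leads.step)

lemma leads_unique: "leads D f x r ==> leads D f x s ==> r = s"
 by (induction rule: leads.induct) (auto simp: leads_out leads_in)

lemma leads_cong: "leads D f x r ==> (!!y. y \<in> D ==> f y = g y) ==> leads D g x r"
 by (induction rule: leads.induct) (auto simp: leads_out leads_in)

lemma leads_cong_iff: "(!!y. y \<in> D ==> f y = g y) ==> leads D f x r \<longleftrightarrow> leads D g x r"
 using leads_cong[of D f x r g] leads_cong[of D g x r f] by auto

lemma leads_trans: "leads D' f x b ==> D' \<subseteq> D ==> leads D f b r ==> leads D f x r"
 by (induction rule: leads.induct) (auto simp: leads_in)

text \<open>Stop the orbit at its first visit to \<open>B\<close>; if it misses \<open>B\<close>,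
  then \<open>b\<close> is the root itself.\<close>

lemma leads_mid: "leads D f x r ==> \<exists>b. leads (D - B) f x b & leads D f b r"
proof (induction rule: leads.induct)
 case (stop r)
 then show ?case by (auto intro!: exI[of _ r] leads.stop)
next
 case (step x r)
 then obtain b where b: "leads (D - B) f (f x) b" "leads D f b r" by blast
 show ?case
 proof (cases "x \<in> B")
  case True
  then show ?thesis using step by (intro exI[of _ x]) (auto intro: leads.intros)
 next
  case False
  then show ?thesis using step b by (intro exI[of _ b]) (auto intro: leads.intros)
 qed
qed

text \<open>If \<open>f x\<close> came back to \<open>x\<close>, a vertex flowing to
  \<open>x\<close> would keep flowing to \<open>x\<close> forever and could not have a root. The
  induction shows that no vertex with a root flows to \<open>x\<close>.\<close>

lemma leads_no_cycle:
 assumes "leads D f x r" "x \<in> D"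
 shows "\<not> leads (D - {x}) f (f x) x"
proof
 assume C: "leads (D - {x}) f (f x) x"
 have "leads D f z s ==> \<not> leads (D - {x}) f z x" for z s
 proof (induction rule: leads.induct)
  case (stop r)
  then show ?case using assms by (auto simp: leads_out)
 next
  case (step z s)
  then show ?case using C by (cases "z = x") (auto simp: leads_in)
 qed
 from this[of "f x" r] assms C show False by (auto simp: leads_in)
qed

text \<open>Vertices off \<open>D\<close> are roots, so these are the oriented spanning forests of
  \<open>D\<close> wired to its complement. Acyclicity is encoded by the demand that every orbit
  leaves \<open>D\<close>; extensionality makes each forest a single function.\<close>

definition forests :: "('v => 'v set) => 'v set => ('v => 'v) set" where
 "forests N D = {f \<in> PiE D N. \<forall>x\<in>D. \<exists>r. leads D f x r}"

lemma finite_forests: "finite D ==> (!!x. x \<in> D ==> finite (N x)) ==> finite (forests N D)"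
 unfolding forests_def by (rule finite_subset[of _ "PiE D N"]) (auto intro: finite_PiE)

lemma forests_leads: "f \<in> forests N D ==> \<exists>r. leads D f x r"
 by (cases "x \<in> D") (auto simp: forests_def intro: leads.stop)

lemma forests_arc: "f \<in> forests N D ==> x \<in> D ==> f x \<in> N x"
 by (auto simp: forests_def)

text \<open>The second conclusion allows the old arc to be restored, and the third says that the
  root of \<open>x\<close> before the exchange is the root of the old target after it. Together they
  make the exchange of the arc at \<open>x\<close> with a spare arc an involution, as
  \<open>hit_harmonic\<close> requires.\<close>

lemma forests_update:
 assumes f: "f \<in> forests N D" and x: "x \<in> D" and y: "y \<in> N x"
  and nl: "\<not> leads (D - {x}) f y x"
 shows "f(x := y) \<in> forests N D" "\<not> leads (D - {x}) (f(x := y)) (f x) x"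
  "leads D f x v \<longleftrightarrow> leads D (f(x := y)) (f x) v"
proof -
 let ?g = "f(x := y)"
 have cong: "leads (D - {x}) f z b \<longleftrightarrow> leads (D - {x}) ?g z b" for z b
  by (rule leads_cong_iff) auto
 obtain r where "leads D f y r" using forests_leads[OF f] by blast
 then obtain b where b: "leads (D - {x}) f y b" using leads_mid[of D f y r "{x}"] by blast
 with nl leads_notin[OF b] have bD: "b \<notin> D" by auto
 have "leads (D - {x}) ?g y b" using b cong by simp
 then have gy: "leads D ?g y b" using leads_trans[OF _ Diff_subset leads.stop[OF bD]] by blast
 then have gx: "leads D ?g x b" using leads.step[OF x, of ?g b] by simp
 have "\<exists>r. leads D ?g z r" for z
 proof -
  obtain r where "leads D f z r" using forests_leads[OF f] by blast
  then obtain b' where b': "leads (D - {x}) f z b'" using leads_mid[of D f z r "{x}"] by blast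
  then have "leads (D - {x}) ?g z b'" using cong by simp
  moreover have "\<exists>r. leads D ?g b' r"
  proof (cases "b' = x")
   case True
   then show ?thesis using gx by blast
  next
   case False
   then show ?thesis using leads_notin[OF b'] leads.stop[of b' D ?g] by blast
  qed
  ultimately show ?thesis using leads_trans[of "D - {x}" ?g z b' D] by blast
 qed
 moreover have "?g \<in> PiE D N" using f x y unfolding forests_def by (auto simp: PiE_iff extensional_def)
 ultimately show "?g \<in> forests N D" unfolding forests_def by blast
 obtain s where s: "leads D f x s" using forests_leads[OF f] by blast
 from leads_no_cycle[OF s x] cong show nc: "\<not> leads (D - {x}) ?g (f x) x" by simp
 obtain b' where b': "leads (D - {x}) f (f x) b'"
  using leads_mid[of D f "f x" s "{x}"] s leads_in[OF x, of f s] by blast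
 have gb': "leads (D - {x}) ?g (f x) b'" using b' cong by simp
 have b'D: "b' \<notin> D" using leads_notin[OF b'] gb' nc by auto
 have 1: "leads D f (f x) b'" using leads_trans[OF b' Diff_subset leads.stop[OF b'D]] .
 have 2: "leads D ?g (f x) b'" using leads_trans[OF gb' Diff_subset leads.stop[OF b'D]] .
 show "leads D f x v \<longleftrightarrow> leads D ?g (f x) v"
  using leads_unique[OF 1, of v] leads_unique[OF 2, of v] 1 2 leads_in[OF x, of f v] by auto
qed

lemma forests_restrict:
 assumes "f \<in> forests N D"
 shows "restrict f (D - B) \<in> forests N (D - B)"
proof -
 have "\<exists>r. leads (D - B) (restrict f (D - B)) x r" for x
 proof -
  obtain r where "leads D f x r" using forests_leads[OF assms] by blast
  then obtain b where "leads (D - B) f x b" using leads_mid by metis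
  then show ?thesis using leads_cong[of "D - B" f x b "restrict f (D - B)"] by auto
 qed
 then show ?thesis using assms by (auto simp: forests_def)
qed

lemma forests_extend:
 assumes g: "g \<in> forests N (D - {x})" and x: "x \<in> D" and y: "y \<in> N x"
  and nl: "\<not> leads (D - {x}) g y x"
 shows "g(x := y) \<in> forests N D"
proof -
 let ?g = "g(x := y)"
 have cong: "leads (D - {x}) g z b \<longleftrightarrow> leads (D - {x}) ?g z b" for z b
  by (rule leads_cong_iff) auto
 obtain b where b: "leads (D - {x}) g y b" using forests_leads[OF g] by blast
 with nl leads_notin[OF b] have bD: "b \<notin> D" by auto
 have "leads (D - {x}) ?g y b" using b cong by simp
 then have gy: "leads D ?g y b" using leads_trans[OF _ Diff_subset leads.stop[OF bD]] by blast
 then have gx: "leads D ?g x b" using leads.step[OF x, of ?g b] by simp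
 have "\<exists>r. leads D ?g z r" for z
 proof -
  obtain b' where b': "leads (D - {x}) g z b'" using forests_leads[OF g] by blast
  then have "leads (D - {x}) ?g z b'" using cong by simp
  moreover have "\<exists>r. leads D ?g b' r"
  proof (cases "b' = x")
   case True
   then show ?thesis using gx by blast
  next
   case False
   then show ?thesis using leads_notin[OF b'] leads.stop[of b' D ?g] by blast
  qed
  ultimately show ?thesis using leads_trans[of "D - {x}" ?g z b' D] by blast
 qed
 moreover have "?g \<in> PiE D N" using g x y unfolding forests_def by (auto simp: PiE_iff extensional_def)
 ultimately show ?thesis unfolding forests_def by blast
qed

text \<open>Cutting the arc at \<open>x\<close> turns \<open>x\<close> into a root, and gluing it
  back is allowed exactly when no cycle arises. This deletion step is the source of the recursions
  for weighted counts.\<close>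

lemma forests_split:
 assumes x: "x \<in> D" and y: "y \<in> N x"
 shows "bij_betw (%g. g(x := y)) {g \<in> forests N (D - {x}). \<not> leads (D - {x}) g y x}
      {f \<in> forests N D. f x = y}"
proof (rule bij_betw_byWitness[where f' = "%f. restrict f (D - {x})"])
 show "\<forall>g\<in>{g \<in> forests N (D - {x}). \<not> leads (D - {x}) g y x}. restrict (g(x := y)) (D - {x}) = g"
  by (auto simp: forests_def restrict_def fun_eq_iff PiE_def extensional_def)
 show "\<forall>f\<in>{f \<in> forests N D. f x = y}. (restrict f (D - {x}))(x := y) = f"
  using x by (auto simp: forests_def restrict_def fun_eq_iff PiE_def extensional_def)
 show "(%g. g(x := y)) ` {g \<in> forests N (D - {x}). \<not> leads (D - {x}) g y x}
   \<subseteq> {f \<in> forests N D. f x = y}"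
  using forests_extend[of _ N D x y] x y by auto
 show "(%f. restrict f (D - {x})) ` {f \<in> forests N D. f x = y}
   \<subseteq> {g \<in> forests N (D - {x}). \<not> leads (D - {x}) g y x}"
 proof clarify
  fix f assume f: "f \<in> forests N D" and y: "y = f x"
  obtain s where s: "leads D f x s" using forests_leads[OF f] by blast
  have "\<not> leads (D - {x}) (restrict f (D - {x})) (f x) x"
   using leads_no_cycle[OF s x] leads_cong_iff[of "D - {x}" f "restrict f (D - {x})"] by auto
  then show "restrict f (D - {x}) \<in> forests N (D - {x}) &
    \<not> leads (D - {x}) (restrict f (D - {x})) (f x) x"
   using forests_restrict[OF f] by auto
 qed
qed

section \<open>Weighted forest sums and hitting probabilities\<close>

definition nb :: "('v => 'v => real) => 'v => 'v set" where
 "nb c x = {y. c x y ~= 0}"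

definition wt :: "('v => 'v => real) => 'v set => ('v => 'v) => real" where
 "wt c D f = (\<Prod>x\<in>D. c x (f x))"

definition wforests :: "('v => 'v => real) => 'v set => ('v => 'v) set" where
 "wforests c D = forests (nb c) D"

text \<open>Unnormalized expectation under the weighted forest measure; keeping the factor
  \<open>partn c D\<close> avoids divisions when the domain changes.\<close>

definition fosum :: "('v => 'v => real) => 'v set => (('v => 'v) => real) => real" where
 "fosum c D Y = (\<Sum>f\<in>wforests c D. wt c D f * Y f)"

definition partn :: "('v => 'v => real) => 'v set => real" where
 "partn c D = fosum c D (%_. 1)"

text \<open>In terms of walks this is harmonic measure: the probability that the walk from
  \<open>x\<close> with rates \<open>c\<close> leaves \<open>D\<close> at \<open>v\<close>.\<close>

definition hit :: "('v => 'v => real) => 'v set => 'v => 'v => real" where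
 "hit c D v x = fosum c D (%f. of_bool (leads D f x v)) / partn c D"

definition csum :: "('v => 'v => real) => 'v => real" where
 "csum c x = (\<Sum>y\<in>nb c x. c x y)"

text \<open>Normalized so that the Laplacian with diagonal \<open>csum\<close> sends it to an
  indicator (\<open>green_eq\<close>). The diagonal value is a ratio of partition functions, as
  Cramer's rule and the matrix-tree theorem suggest.\<close>

definition green :: "('v => 'v => real) => 'v set => 'v => 'v => real" where
 "green c D x v = (if v \<in> D then hit c (D - {v}) v x * partn c (D - {v}) / partn c D else 0)"

text \<open>No symmetry is demanded, since the weights with killing introduced below are not
  symmetric. \<open>escape\<close> makes every partition function positive and drives the maximum
  principle.\<close>

locale weights =
 fixes c :: "'v => 'v => real"
 assumes c_nonneg: "0 <= c x y"
  and finite_nb: "finite (nb c x)"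
  and escape: "finite P ==> P ~= {} ==> \<exists>x\<in>P. \<exists>y. y \<notin> P & c x y > 0"
begin

lemma finite_wforests: "finite D ==> finite (wforests c D)"
 unfolding wforests_def by (intro finite_forests finite_nb)

lemma wt_nonneg: "0 <= wt c D f"
 unfolding wt_def by (intro prod_nonneg) (auto simp: c_nonneg)

lemma fosum_mono: "(!!f. f \<in> wforests c D ==> Y f <= Y' f) ==> fosum c D Y <= fosum c D Y'"
 unfolding fosum_def by (intro sum_mono mult_left_mono wt_nonneg)

lemma fosum_nonneg: "(!!f. f \<in> wforests c D ==> 0 <= Y f) ==> 0 <= fosum c D Y"
 unfolding fosum_def by (intro sum_nonneg mult_nonneg_nonneg wt_nonneg)

lemma fosum_add: "fosum c D (%f. Y f + Y' f) = fosum c D Y + fosum c D Y'"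
 unfolding fosum_def by (simp add: algebra_simps sum.distrib)

lemma fosum_diff: "fosum c D (%f. Y f - Y' f) = fosum c D Y - fosum c D Y'"
 unfolding fosum_def by (simp add: algebra_simps sum_subtractf)

lemma fosum_cmult: "fosum c D (%f. a * Y f) = a * fosum c D Y"
 unfolding fosum_def by (simp add: sum_distrib_left algebra_simps)

lemma fosum_const: "fosum c D (%f. a) = a * partn c D"
 unfolding partn_def using fosum_cmult[of D a "%_. 1"] by simp

lemma fosum_sum: "fosum c D (%f. \<Sum>i\<in>I. Y i f) = (\<Sum>i\<in>I. fosum c D (Y i))"
proof -
 have "fosum c D (%f. \<Sum>i\<in>I. Y i f) = (\<Sum>f\<in>wforests c D. \<Sum>i\<in>I. wt c D f * Y i f)"
  unfolding fosum_def by (simp add: sum_distrib_left)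
 also have "... = (\<Sum>i\<in>I. fosum c D (Y i))"
  unfolding fosum_def by (rule sum.swap)
 finally show ?thesis .
qed

lemma fosum_cong: "(!!f. f \<in> wforests c D ==> Y f = Y' f) ==> fosum c D Y = fosum c D Y'"
 unfolding fosum_def by (intro sum.cong) auto

lemma wt_update: "finite D ==> x \<in> D ==> wt c D (f(x := y)) = c x y * wt c (D - {x}) f"
 unfolding wt_def by (subst prod.remove[of D x]) (auto intro!: prod.cong)

lemma wt_remove: "finite D ==> x \<in> D ==> wt c D f = c x (f x) * wt c (D - {x}) f"
 unfolding wt_def by (rule prod.remove)

lemma wt_cong: "(!!x. x \<in> D ==> f x = g x) ==> wt c D f = wt c D g"
 unfolding wt_def by (intro prod.cong) auto

lemma fosum_arc:
 assumes D: "finite D" "x \<in> D"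
 shows "fosum c D (%f. of_bool (f x = y) * Y f) =
  c x y * fosum c (D - {x}) (%g. of_bool (\<not> leads (D - {x}) g y x) * Y (g(x := y)))"
proof (cases "y \<in> nb c x")
 case True
 have "fosum c D (%f. of_bool (f x = y) * Y f) = (\<Sum>f\<in>{f \<in> wforests c D. f x = y}. wt c D f * Y f)"
  unfolding fosum_def by (rule sum.mono_neutral_cong_right) (auto simp: finite_wforests D)
 also have "... = (\<Sum>g\<in>{g \<in> wforests c (D - {x}). \<not> leads (D - {x}) g y x}.
    wt c D (g(x := y)) * Y (g(x := y)))"
  unfolding wforests_def
  by (rule sum.reindex_bij_betw[OF forests_split[of x D y "nb c", OF D(2) True], symmetric])
 also have "... = (\<Sum>g\<in>{g \<in> wforests c (D - {x}). \<not> leads (D - {x}) g y x}.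
    c x y * (wt c (D - {x}) g * Y (g(x := y))))"
  by (simp add: wt_update D mult.assoc)
 also have "... = (\<Sum>g\<in>wforests c (D - {x}). c x y * (wt c (D - {x}) g *
   (of_bool (\<not> leads (D - {x}) g y x) * Y (g(x := y)))))"
  by (rule sum.mono_neutral_cong_left) (auto simp: finite_wforests D)
 also have "... = c x y * fosum c (D - {x}) (%g. of_bool (\<not> leads (D - {x}) g y x) * Y (g(x := y)))"
  unfolding fosum_def by (rule sum_distrib_left[symmetric])
 finally show ?thesis .
next
 case False
 have "of_bool (f x = y) = (0::real)" if "f \<in> wforests c D" for f
  using that False D unfolding wforests_def by (auto dest: forests_arc)
 then have "fosum c D (%f. of_bool (f x = y) * Y f) = fosum c D (%_. 0)" by (intro fosum_cong) auto
 then show ?thesis using False by (simp add: nb_def fosum_def)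
qed

text \<open>Remove a vertex with an arc leaving \<open>D\<close>: this arc can be added to any
  forest of the rest without closing a cycle.\<close>

lemma partn_pos: "finite D ==> 0 < partn c D"
proof (induction "card D" arbitrary: D)
 case 0
 then have "D = {}" by simp
 moreover have "wforests c {} = {%_. undefined}" by (auto simp: wforests_def forests_def)
 ultimately show ?case by (simp add: partn_def fosum_def wt_def)
next
 case (Suc n)
 then have "D ~= {}" by auto
 then obtain x y where xy: "x \<in> D" "y \<notin> D" "c x y > 0" using escape[of D] Suc by blast
 have "0 < c x y * partn c (D - {x})" using xy Suc by (intro mult_pos_pos Suc(1)) auto
 also have "... = fosum c D (%f. of_bool (f x = y) * 1)"
  unfolding fosum_arc[OF \<open>finite D\<close> xy(1), of y "%_. 1"] partn_def
  using xy by (intro arg_cong2[where f="(*)"] fosum_cong) (auto simp: leads_out)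
 also have "... <= partn c D" unfolding partn_def by (rule fosum_mono) auto
 finally show ?case .
qed

lemma hit_nonneg: "finite D ==> 0 <= hit c D v x"
 unfolding hit_def using partn_pos by (intro divide_nonneg_nonneg fosum_nonneg) (auto intro: less_imp_le)

lemma hit_self: "finite D ==> v \<notin> D ==> hit c D v v = 1"
 unfolding hit_def using partn_pos[of D] by (simp add: leads_out partn_def)

lemma hit_out: "x \<notin> D ==> x ~= v ==> hit c D v x = 0"
 unfolding hit_def by (simp add: leads_out fosum_def)

text \<open>Double counting of pairs of a forest and a spare arc at \<open>x\<close>. If the target
  \<open>y\<close> flows to \<open>x\<close>, both have the same root and the pair is kept.
  Otherwise the spare arc is exchanged with the arc used at \<open>x\<close>, which preserves the
  product of weights and turns the root of \<open>x\<close> into the root of the spare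
  target.\<close>

lemma hit_harmonic:
 assumes D: "finite D" "x \<in> D"
 shows "csum c x * hit c D v x = (\<Sum>y\<in>nb c x. c x y * hit c D v y)"
proof -
 let ?F = "wforests c D" and ?N = "nb c x"
 let ?t = "%(f, y). if leads (D - {x}) f y x then (f, y) else (f(x := y), f x)"
 have upd: "f(x := y) \<in> ?F & \<not> leads (D - {x}) (f(x := y)) (f x) x &
   (leads D f x v \<longleftrightarrow> leads D (f(x := y)) (f x) v)"
  if "f \<in> ?F" "y \<in> ?N" "\<not> leads (D - {x}) f y x" for f y
  using that forests_update[of f "nb c" D x y] D by (auto simp: wforests_def)
 have arc: "f x \<in> ?N" if "f \<in> ?F" for f using that D by (auto simp: wforests_def dest: forests_arc)
 have "(\<Sum>p\<in>?F \<times> ?N. wt c D (fst p) * c x (snd p) * of_bool (leads D (fst p) x v)) =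
    (\<Sum>p\<in>?F \<times> ?N. wt c D (fst p) * c x (snd p) * of_bool (leads D (fst p) (snd p) v))"
 proof (rule sum.reindex_bij_witness[where i = ?t and j = ?t])
  fix p assume p: "p \<in> ?F \<times> ?N"
  obtain f y where fy: "p = (f, y)" "f \<in> ?F" "y \<in> ?N" using p by auto
  show "?t (?t p) = p" using fy upd[of f y] by (auto simp: fun_eq_iff)
  show "?t p \<in> ?F \<times> ?N" using fy upd[of f y] arc by (auto simp: fun_eq_iff)
  have "wt c D (f(x := y)) * c x (f x) = wt c D f * c x y"
   using wt_update[OF D, of f y] wt_remove[OF D, of f] by simp
  moreover have "leads D f x v \<longleftrightarrow> leads D f y v" if l: "leads (D - {x}) f y x"
  proof -
   obtain r where r: "leads D f x r" using fy forests_leads by (metis wforests_def)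
   then have "leads D f y r" using leads_trans[OF l, of D r] by auto
   then show ?thesis using r leads_unique by metis
  qed
  ultimately show "wt c D (fst (?t p)) * c x (snd (?t p)) * of_bool (leads D (fst (?t p)) (snd (?t p)) v) =
    wt c D (fst p) * c x (snd p) * of_bool (leads D (fst p) x v)"
   using fy upd[of f y] by auto
 next
  fix p assume p: "p \<in> ?F \<times> ?N"
  obtain f y where fy: "p = (f, y)" "f \<in> ?F" "y \<in> ?N" using p by auto
  show "?t (?t p) = p" using fy upd[of f y] by (auto simp: fun_eq_iff)
  show "?t p \<in> ?F \<times> ?N" using fy upd[of f y] arc by (auto simp: fun_eq_iff)
 qed
 then have "(\<Sum>f\<in>?F. \<Sum>y\<in>?N. wt c D f * c x y * of_bool (leads D f x v)) =
    (\<Sum>f\<in>?F. \<Sum>y\<in>?N. wt c D f * c x y * of_bool (leads D f y v))"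
  by (simp add: sum.cartesian_product case_prod_unfold)
 moreover have "(\<Sum>f\<in>?F. \<Sum>y\<in>?N. wt c D f * c x y * of_bool (leads D f x v)) =
   csum c x * fosum c D (%f. of_bool (leads D f x v))"
  unfolding fosum_def csum_def sum_product by (subst sum.swap) (simp add: mult.assoc mult.left_commute)
 moreover have "(\<Sum>f\<in>?F. \<Sum>y\<in>?N. wt c D f * c x y * of_bool (leads D f y v)) =
   (\<Sum>y\<in>?N. c x y * fosum c D (%f. of_bool (leads D f y v)))"
  unfolding fosum_def sum_distrib_left by (subst sum.swap) (simp add: algebra_simps)
 ultimately show ?thesis unfolding hit_def
  by (simp add: sum_divide_distrib)
qed

text \<open>Sum over the arc at \<open>v\<close>; the target \<open>y\<close> closes no cycle with
  probability \<open>1 - hit c (D - {v}) v y\<close>.\<close>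

lemma partn_remove:
 assumes D: "finite D" "v \<in> D"
 shows "partn c D = partn c (D - {v}) * (csum c v - (\<Sum>y\<in>nb c v. c v y * hit c (D - {v}) v y))"
proof -
 have "partn c D = fosum c D (%f. \<Sum>y\<in>nb c v. of_bool (f v = y) * 1)"
  unfolding partn_def
 proof (rule fosum_cong)
  fix f assume "f \<in> wforests c D"
  then have "f v \<in> nb c v" using D by (auto simp: wforests_def dest: forests_arc)
  then show "1 = (\<Sum>y\<in>nb c v. of_bool (f v = y) * (1::real))"
   using finite_nb by (simp add: of_bool_def)
 qed
 also have "... = (\<Sum>y\<in>nb c v. c v y * fosum c (D - {v}) (%g. of_bool (\<not> leads (D - {v}) g y v) * 1))"
  unfolding fosum_sum by (intro sum.cong refl fosum_arc[OF D])
 also have "... = (\<Sum>y\<in>nb c v. c v y * (partn c (D - {v}) * (1 - hit c (D - {v}) v y)))"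
 proof (intro sum.cong refl arg_cong2[where f="(*)"])
  fix y
  have "fosum c (D - {v}) (%g. of_bool (\<not> leads (D - {v}) g y v) * 1) =
    fosum c (D - {v}) (%g. 1 - of_bool (leads (D - {v}) g y v))"
   by (intro fosum_cong) auto
  also have "... = partn c (D - {v}) * (1 - hit c (D - {v}) v y)"
   using partn_pos[of "D - {v}"] D unfolding fosum_diff hit_def by (simp add: partn_def field_simps)
  finally show "fosum c (D - {v}) (%g. of_bool (\<not> leads (D - {v}) g y v) * 1) =
    partn c (D - {v}) * (1 - hit c (D - {v}) v y)" .
 qed
 also have "... = partn c (D - {v}) * (csum c v - (\<Sum>y\<in>nb c v. c v y * hit c (D - {v}) v y))"
  unfolding csum_def right_diff_distrib sum_subtractf sum_distrib_left
  by (simp add: mult_ac)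
 finally show ?thesis .
qed

section \<open>Green functions and the maximum principle\<close>

lemma green_nonneg: "finite D ==> 0 <= green c D x v"
 using hit_nonneg[of "D - {v}" v x] partn_pos[of D] partn_pos[of "D - {v}"]
 by (simp add: green_def zero_le_mult_iff zero_le_divide_iff)

lemma green_out: "x \<notin> D ==> green c D x v = 0"
 unfolding green_def by (cases "x = v") (auto simp: hit_out)

lemma green_diag: "finite D ==> v \<in> D ==> green c D v v = partn c (D - {v}) / partn c D"
 unfolding green_def by (simp add: hit_self)

lemma green_hit: "finite D ==> v \<in> D ==> green c D x v = hit c (D - {v}) v x * green c D v v"
 unfolding green_def by (simp add: hit_self)

text \<open>The operator \<open>u \<mapsto> (x \<mapsto> csum c x * u x - (\<Sum>y\<in>D. c x y * u y))\<close> is the Dirichlet Laplacian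
 on \<open>D\<close>.\<close>

lemma sum_nb_eq:
 assumes "finite D" "!!y. y \<notin> D ==> u y = 0"
 shows "(\<Sum>y\<in>nb c x. c x y * u y) = (\<Sum>y\<in>D. c x y * (u y :: real))"
proof -
 have "(\<Sum>y\<in>nb c x. c x y * u y) = (\<Sum>y\<in>nb c x \<inter> D. c x y * u y)"
  using assms by (intro sum.mono_neutral_right) (auto simp: finite_nb)
 also have "... = (\<Sum>y\<in>D. c x y * u y)"
  using assms by (intro sum.mono_neutral_left) (auto simp: nb_def)
 finally show ?thesis .
qed

text \<open>Off the diagonal this is harmonicity of \<open>hit\<close>; at \<open>v\<close> it is
  the deletion identity \<open>partn_remove\<close> divided by \<open>partn c D\<close>.\<close>

lemma green_eq:
 assumes D: "finite D" "v \<in> D" "x \<in> D"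
 shows "csum c x * green c D x v - (\<Sum>y\<in>D. c x y * green c D y v) = of_bool (x = v)"
proof -
 let ?k = "partn c (D - {v}) / partn c D"
 have g: "green c D y v = hit c (D - {v}) v y * ?k" for y using D by (simp add: green_def)
 have "(\<Sum>y\<in>D. c x y * green c D y v) = (\<Sum>y\<in>nb c x. c x y * green c D y v)"
  using D by (intro sum_nb_eq[symmetric]) (auto simp: green_out)
 also have "... = (\<Sum>y\<in>nb c x. c x y * hit c (D - {v}) v y) * ?k"
  unfolding g sum_distrib_right by (simp only: mult.assoc)
 finally have s: "(\<Sum>y\<in>D. c x y * green c D y v) = (\<Sum>y\<in>nb c x. c x y * hit c (D - {v}) v y) * ?k" .
 show ?thesis
 proof (cases "x = v")
  case False
  then have "(\<Sum>y\<in>nb c x. c x y * hit c (D - {v}) v y) = csum c x * hit c (D - {v}) v x"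
   using D by (intro hit_harmonic[symmetric]) auto
  then show ?thesis using False unfolding s by (simp add: g)
 next
  case True
  have "csum c x * green c D x v - (\<Sum>y\<in>D. c x y * green c D y v) =
    (csum c v - (\<Sum>y\<in>nb c v. c v y * hit c (D - {v}) v y)) * ?k"
   unfolding s unfolding g True using D by (simp add: hit_self left_diff_distrib diff_divide_distrib)
  also have "... = partn c D / partn c D" using partn_remove[of D v] D by (simp add: mult.commute)
  also have "... = 1" using partn_pos[of D] D by simp
  finally show ?thesis using True by simp
 qed
qed

text \<open>On the set where a negative minimum is attained, \<open>escape\<close> provides an arc
  to a vertex with a larger value, where values off \<open>D\<close> count as 0. This contradicts
  superharmonicity at the tail of the arc.\<close>

lemma max_principle:
 assumes D: "finite D" and u: "!!x. x \<in> D ==> (\<Sum>y\<in>D. c x y * u y) <= csum c x * u x"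
  and x: "x \<in> D"
 shows "0 <= u x"
proof (rule ccontr)
 assume neg: "\<not> 0 <= u x"
 define m where "m = Min (u ` D)"
 have m: "m <= u y" if "y \<in> D" for y using that D by (auto simp: m_def)
 have m0: "m < 0" using m[OF x] neg by simp
 define P where "P = {y \<in> D. u y = m}"
 have "m \<in> u ` D" using D x unfolding m_def by (intro Min_in) auto
 then have "P ~= {}" by (auto simp: P_def)
 then obtain z y where zy: "z \<in> P" "y \<notin> P" "c z y > 0" using escape[of P] D by (auto simp: P_def)
 define u' where "u' = (%y. if y \<in> D then u y else 0)"
 have m': "m <= u' w" for w using m m0 by (auto simp: u'_def)
 have zD: "z \<in> D" "u z = m" using zy by (auto simp: P_def)
 have "(\<Sum>w\<in>D. c z w * u w) = (\<Sum>w\<in>nb c z. c z w * u' w)"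
  using D by (subst sum_nb_eq[of D]) (auto simp: u'_def)
 also have "... > (\<Sum>w\<in>nb c z. c z w * m)"
 proof (rule sum_strict_mono_ex1)
  show "\<forall>w\<in>nb c z. c z w * m <= c z w * u' w" using m' c_nonneg by (auto intro: mult_left_mono)
  have "u' y > m" using zy m0 m[of y] by (cases "y \<in> D") (auto simp: u'_def P_def less_le)
  then show "\<exists>w\<in>nb c z. c z w * m < c z w * u' w" using zy by (intro bexI[of _ y]) (auto simp: nb_def)
 qed (rule finite_nb)
 also have "(\<Sum>w\<in>nb c z. c z w * m) = csum c z * u z" using zD by (simp add: csum_def sum_distrib_right)
 finally show False using u[OF zD(1)] by simp
qed

lemma green_diag_ge:
 assumes "finite D" "v \<in> D"
 shows "1 <= csum c v * green c D v v"
proof -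
 have "0 <= (\<Sum>y\<in>D. c v y * green c D y v)"
  using assms by (intro sum_nonneg mult_nonneg_nonneg c_nonneg green_nonneg)
 then show ?thesis using green_eq[of D v v] assms by simp
qed

lemma green_le_super:
 assumes D: "finite D" "v \<in> D" "x \<in> D"
  and u: "!!x. x \<in> D ==> of_bool (x = v) <= csum c x * u x - (\<Sum>y\<in>D. c x y * u y)"
 shows "green c D x v <= u x"
proof -
 have "0 <= u x - green c D x v"
 proof (rule max_principle[OF D(1) _ D(3)])
  fix z assume z: "z \<in> D"
  show "(\<Sum>y\<in>D. c z y * (u y - green c D y v)) <= csum c z * (u z - green c D z v)"
   using u[OF z] green_eq[OF D(1,2) z] by (simp add: algebra_simps sum_subtractf)
 qed
 then show ?thesis by simp
qed

lemma laplace_sym: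
 assumes D: "finite D" and sym: "!!x y. x \<in> D ==> y \<in> D ==> c x y = c y x"
 shows "(\<Sum>x\<in>D. g x * (csum c x * u x - (\<Sum>y\<in>D. c x y * u y))) =
  (\<Sum>x\<in>D. (csum c x * g x - (\<Sum>y\<in>D. c x y * g y)) * (u x :: real))"
proof -
 have "(\<Sum>x\<in>D. \<Sum>y\<in>D. g x * (c x y * u y)) = (\<Sum>x\<in>D. \<Sum>y\<in>D. c x y * g y * u x)"
  by (subst sum.swap) (auto intro!: sum.cong simp: sym algebra_simps)
 then show ?thesis
  unfolding right_diff_distrib left_diff_distrib sum_subtractf sum_distrib_left sum_distrib_right
  by (simp add: mult_ac)
qed

text \<open>Move the Laplacian onto the Green function by symmetry; \<open>green_eq\<close> then
  leaves only the value at \<open>v\<close>.\<close>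

lemma green_dual:
 assumes D: "finite D" "v \<in> D" and sym: "!!x y. x \<in> D ==> y \<in> D ==> c x y = c y x"
 shows "(\<Sum>x\<in>D. green c D x v * (csum c x * u x - (\<Sum>y\<in>D. c x y * u y))) = u v"
proof -
 have "(\<Sum>x\<in>D. green c D x v * (csum c x * u x - (\<Sum>y\<in>D. c x y * u y))) =
   (\<Sum>x\<in>D. of_bool (x = v) * u x)"
  by (subst laplace_sym[OF D(1) sym]) (auto intro!: sum.cong simp: green_eq D)
 also have "... = (\<Sum>x\<in>D. if x = v then u x else 0)" by (intro sum.cong) auto
 also have "... = u v" using D by simp
 finally show ?thesis .
qed

end

section \<open>Path weights\<close>

text \<open>Lists run away from the root: the head is a child of \<open>v\<close> and each entry is
  the parent of the next one, so a chain is a line of descent.\<close>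

primrec chain :: "'v set => ('v => 'v) => 'v => 'v list => bool" where
 "chain D f v [] \<longleftrightarrow> True"
| "chain D f v (y # ys) \<longleftrightarrow> y \<in> D & f y = v & chain D f y ys"

lemma chain_subset: "chain D f v ys ==> set ys \<subseteq> D"
 by (induction ys arbitrary: v) auto

lemma chain_append: "chain D f v (xs @ ys) \<longleftrightarrow> chain D f v xs & chain D f (last (v # xs)) ys"
 by (induction xs arbitrary: v) auto

lemma chain_cong:
 "set ys \<subseteq> D ==> set ys \<subseteq> D' ==> (!!y. y \<in> set ys ==> f y = g y) ==>
  chain D f v ys \<longleftrightarrow> chain D' g v ys"
 by (induction ys arbitrary: v) auto

text \<open>Ancestors are determined by \<open>f\<close>, so two lines of descent with the same end
  agree backwards; since \<open>v\<close> lies off \<open>D\<close>, they also start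
  together.\<close>

lemma chain_inj:
 "v \<notin> D ==> chain D f v xs ==> chain D f v ys ==> last (v # xs) = last (v # ys) ==> xs = ys"
proof (induction xs arbitrary: ys rule: rev_induct)
 case Nil
 have sub: "set ys \<subseteq> D" using chain_subset[OF Nil(3)] .
 have "ys = []"
 proof (rule ccontr)
  assume ne: "ys ~= []"
  then have "last ys = v" using Nil(4) by simp
  then show False using last_in_set[OF ne] sub Nil(1) by blast
 qed
 then show ?case by simp
next
 case (snoc x xs)
 note v = snoc.prems(1) and cx = snoc.prems(2) and cy = snoc.prems(3) and eq = snoc.prems(4)
 have x: "chain D f v xs" "x \<in> D" "f x = last (v # xs)"
  using cx unfolding chain_append chain.simps by blast+
 have "ys ~= []" using eq v x(2) by auto
 then obtain zs z where ys: "ys = zs @ [z]" by (metis rev_exhaust)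
 have z: "chain D f v zs" "f z = last (v # zs)"
  using cy unfolding ys chain_append chain.simps by blast+
 have "z = x" using eq unfolding ys by simp
 then have "xs = zs" using snoc.IH[OF v x(1) z(1)] x(3) z(2) by simp
 then show ?case using ys \<open>z = x\<close> by simp
qed

lemma chain_distinct: "v \<notin> D ==> chain D f v xs ==> distinct xs"
proof (induction xs rule: rev_induct)
 case (snoc x xs)
 have "x \<notin> set xs"
 proof
  assume "x \<in> set xs"
  then obtain as bs where s: "xs = as @ x # bs" by (meson split_list)
  have "chain D f v (as @ [x])" using snoc(3) s by (auto simp: chain_append)
  then have "as @ [x] = xs @ [x]" using snoc by (intro chain_inj[of v D f]) auto
  then show False using s by auto
 qed
 then show ?case using snoc by (auto simp: chain_append)
qed simp

lemma chain_leads: "v \<notin> D ==> chain D f v xs ==> leads D f (last (v # xs)) v"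
proof (induction xs rule: rev_induct)
 case Nil
 then show ?case by (simp add: leads.stop)
next
 case (snoc x xs)
 then show ?case using leads.step[of x D f v] by (auto simp: chain_append)
qed

lemma leads_chain: "leads D f x v ==> \<exists>xs. chain D f v xs & last (v # xs) = x"
proof (induction rule: leads.induct)
 case (stop r)
 then show ?case by (intro exI[of _ "[]"]) auto
next
 case (step x r)
 then obtain xs where "chain D f r xs" "last (r # xs) = f x" by blast
 then show ?case using step by (intro exI[of _ "xs @ [x]"]) (auto simp: chain_append)
qed

primrec pathc :: "('v => 'v => real) => 'v => 'v list => real" where
 "pathc c v [] = 1"
| "pathc c v (y # ys) = c y v * pathc c y ys"

lemma pathc_append: "pathc c v (xs @ ys) = pathc c v xs * pathc c (last (v # xs)) ys"
 by (induction xs arbitrary: v) auto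

text \<open>For distinct \<open>ys\<close> in \<open>D\<close> this is the probability that a random
  forest contains the chain \<open>ys\<close> below \<open>v\<close>
  (\<open>fosum_chain_pw\<close>).\<close>

definition pw :: "('v => 'v => real) => 'v set => 'v => 'v list => real" where
 "pw c D v ys = pathc c v ys * partn c (D - set ys) / partn c D"

definition plists :: "'v set => nat => 'v list set" where
 "plists D n = {ys. set ys \<subseteq> D & distinct ys & length ys <= n}"

lemma finite_plists: "finite D ==> finite (plists D n)"
 unfolding plists_def by (rule finite_subset[OF _ finite_lists_length_le[of D n]]) auto

lemma chain_plists: "v \<notin> D ==> chain D f v ys ==> length ys <= n ==> ys \<in> plists D n"
 using chain_distinct[of v D f ys] chain_subset[of D f v ys] by (auto simp: plists_def)

context weights
begin

lemma pathc_nonneg: "0 <= pathc c v ys"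
 by (induction ys arbitrary: v) (auto simp: c_nonneg)

lemma pw_nonneg: "finite D ==> 0 <= pw c D v ys"
 unfolding pw_def using partn_pos[of D] partn_pos[of "D - set ys"] pathc_nonneg[of v ys]
 by (simp add: zero_le_mult_iff zero_le_divide_iff)

lemma pw_Nil [simp]: "finite D ==> pw c D v [] = 1"
 unfolding pw_def using partn_pos[of D] by simp

lemma pw_append:
 assumes "finite D"
 shows "pw c D v (xs @ ys) = pw c D v xs * pw c (D - set xs) (last (v # xs)) ys"
 unfolding pw_def pathc_append using partn_pos[of "D - set xs"] assms
 by (simp add: Diff_eq Int_assoc)

lemma pw_Cons:
 assumes "finite D"
 shows "pw c D v (y # ys) = c y v * (partn c (D - {y}) / partn c D) * pw c (D - {y}) y ys"
 using pw_append[OF assms, of v "[y]" ys] by (simp add: pw_def)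

text \<open>Spatial Markov property: given the chain, the arcs off it form a weighted forest of
  \<open>D - set ys\<close>. No cycle condition survives, because each arc of the chain points to a
  vertex that has already left the domain.\<close>

lemma fosum_chain:
 "finite D ==> v \<notin> D ==> set ys \<subseteq> D ==> distinct ys ==>
  fosum c D (%f. of_bool (chain D f v ys) * Y (restrict f (D - set ys))) =
  pathc c v ys * fosum c (D - set ys) Y"
proof (induction ys arbitrary: D v)
 case (Nil D v)
 have r: "restrict f D = f" if "f \<in> wforests c D" for f
  using that by (auto simp: wforests_def forests_def PiE_def extensional_restrict)
 have "fosum c D (%f. of_bool (chain D f v []) * Y (restrict f (D - set []))) = fosum c D Y"
  by (rule fosum_cong) (simp only: list.set Diff_empty r chain.simps of_bool_eq mult_1)
 then show ?case
  unfolding list.set Diff_empty pathc.simps mult_1 .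
next
 case (Cons y ys D v)
 have "fosum c D (%f. of_bool (chain D f v (y # ys)) * Y (restrict f (D - set (y # ys)))) =
   fosum c D (%f. of_bool (f y = v) * (of_bool (chain D f y ys) * Y (restrict f (D - set (y # ys)))))"
  using Cons by (intro fosum_cong) auto
 also have "... = c y v * fosum c (D - {y}) (%g. of_bool (\<not> leads (D - {y}) g v y) *
   (of_bool (chain D (g(y := v)) y ys) * Y (restrict (g(y := v)) (D - set (y # ys)))))"
  using Cons by (intro fosum_arc) auto
 also have "... = c y v * fosum c (D - {y}) (%g. of_bool (chain (D - {y}) g y ys) *
   Y (restrict g (D - {y} - set ys)))"
 proof (rule arg_cong2[where f="(*)", OF refl], rule fosum_cong)
  fix g
  have "chain D (g(y := v)) y ys \<longleftrightarrow> chain (D - {y}) g y ys"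
   using Cons by (intro chain_cong) auto
  moreover have "restrict (g(y := v)) (D - set (y # ys)) = restrict g (D - {y} - set ys)"
   by (auto simp: restrict_def fun_eq_iff)
  moreover have "\<not> leads (D - {y}) g v y" using Cons by (auto simp: leads_out)
  ultimately show "of_bool (\<not> leads (D - {y}) g v y) *
   (of_bool (chain D (g(y := v)) y ys) * Y (restrict (g(y := v)) (D - set (y # ys)))) =
   of_bool (chain (D - {y}) g y ys) * Y (restrict g (D - {y} - set ys))" by simp
 qed
 also have "fosum c (D - {y}) (%g. of_bool (chain (D - {y}) g y ys) * Y (restrict g (D - {y} - set ys))) =
   pathc c y ys * fosum c (D - {y} - set ys) Y"
  using Cons by (intro Cons.IH) auto
 also have "D - {y} - set ys = D - set (y # ys)" by auto
 finally show ?case by simp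
qed

lemma fosum_chain_pw:
 assumes "finite D" "v \<notin> D" "set ys \<subseteq> D" "distinct ys"
 shows "fosum c D (%f. of_bool (chain D f v ys)) = pw c D v ys * partn c D"
 using fosum_chain[OF assms, of "%_. 1"] partn_pos[OF assms(1)]
 by (simp add: pw_def partn_def)

text \<open>Exchange the sum over paths with the forest sum: a vertex is the end of at most one
  chain from \<open>v\<close>, and of one only if it flows to \<open>v\<close>.\<close>

lemma sum_paths_le:
 assumes D: "finite D" "v \<notin> D" and p: "!!x. 0 <= (p x :: real)"
 shows "(\<Sum>ys\<in>plists D n. pw c D v ys * p (last (v # ys))) <= p v + (\<Sum>x\<in>D. hit c D v x * p x)"
proof -
 have Z: "partn c D > 0" by (rule partn_pos[OF D(1)])
 have "(\<Sum>ys\<in>plists D n. pw c D v ys * p (last (v # ys))) * partn c D =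
   (\<Sum>ys\<in>plists D n. p (last (v # ys)) * fosum c D (%f. of_bool (chain D f v ys)))"
  unfolding sum_distrib_right using D
  by (intro sum.cong refl) (auto simp: fosum_chain_pw plists_def)
 also have "... = fosum c D (%f. \<Sum>ys\<in>plists D n. p (last (v # ys)) * of_bool (chain D f v ys))"
  by (simp add: fosum_sum fosum_cmult)
 also have "... <= fosum c D (%f. \<Sum>x\<in>insert v D. p x * of_bool (leads D f x v))"
 proof (rule fosum_mono)
  fix f
  let ?S = "{ys \<in> plists D n. chain D f v ys}"
  have "(\<Sum>ys\<in>plists D n. p (last (v # ys)) * of_bool (chain D f v ys)) =
    (\<Sum>ys\<in>?S. p (last (v # ys)))"
   by (rule sum.mono_neutral_cong_right) (auto simp: finite_plists D)
  also have "... = (\<Sum>x\<in>(%ys. last (v # ys)) ` ?S. p x)"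
   using chain_inj[OF D(2)] by (subst sum.reindex) (auto intro!: inj_onI)
  also have "... <= (\<Sum>x\<in>{x \<in> insert v D. leads D f x v}. p x)"
  proof (rule sum_mono2)
   show "(%ys. last (v # ys)) ` ?S \<subseteq> {x \<in> insert v D. leads D f x v}"
   proof clarify
    fix ys assume "ys \<in> plists D n" and c: "chain D f v ys"
    then show "last (v # ys) \<in> insert v D & leads D f (last (v # ys)) v"
     using chain_leads[OF D(2) c] chain_subset[OF c] subsetD[OF _ last_in_set[of ys], of D]
     by (cases "ys = []") auto
   qed
  qed (auto simp: D p)
  also have "... = (\<Sum>x\<in>insert v D. p x * of_bool (leads D f x v))"
   by (rule sum.mono_neutral_cong_left) (auto simp: D)
  finally show "(\<Sum>ys\<in>plists D n. p (last (v # ys)) * of_bool (chain D f v ys)) <=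
    (\<Sum>x\<in>insert v D. p x * of_bool (leads D f x v))" .
 qed
 also have "... = (\<Sum>x\<in>insert v D. p x * (hit c D v x * partn c D))"
  using Z by (simp add: fosum_sum fosum_cmult hit_def)
 also have "... = (p v + (\<Sum>x\<in>D. hit c D v x * p x)) * partn c D"
  using D by (simp add: hit_self algebra_simps sum_distrib_left)
 finally show ?thesis using Z by simp
qed

lemma csum_eq: "finite S ==> nb c x \<subseteq> S ==> csum c x = (\<Sum>y\<in>S. c x y)"
 unfolding csum_def by (rule sum.mono_neutral_left) (auto simp: nb_def)

end

section \<open>Killing\<close>

text \<open>Killing at rate \<open>\<mu>\<close> is modelled by an extra arc from every vertex to a vertex \<open>z\<close> outside of the
 domain.\<close>

definition kill :: "('v => 'v => real) => real => 'v => 'v => 'v => real" where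
 "kill c \<mu> z x y = c x y + (if y = z then \<mu> else 0)"

context weights
begin

lemma nb_kill_subset: "nb (kill c \<mu> z) x \<subseteq> insert z (nb c x)"
 by (auto simp: nb_def kill_def split: if_splits)

lemma weights_kill: "0 <= \<mu> ==> weights (kill c \<mu> z)"
proof
 assume mu: "0 <= \<mu>"
 show "0 <= kill c \<mu> z x y" for x y using mu c_nonneg by (simp add: kill_def)
 show "finite (nb (kill c \<mu> z) x)" for x
  by (rule finite_subset[OF nb_kill_subset]) (simp add: finite_nb)
 show "\<exists>x\<in>P. \<exists>y. y \<notin> P & 0 < kill c \<mu> z x y" if P: "finite P" "P ~= {}" for P
 proof -
  obtain x y where "x \<in> P" "y \<notin> P" "c x y > 0" using escape[OF P] by blast
  then show ?thesis using mu by (intro bexI[of _ x] exI[of _ y]) (auto simp: kill_def)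
 qed
qed

lemma csum_kill:
 assumes "0 <= \<mu>"
 shows "csum (kill c \<mu> z) x = csum c x + \<mu>"
proof -
 let ?S = "insert z (nb c x)"
 have "csum (kill c \<mu> z) x = (\<Sum>y\<in>?S. kill c \<mu> z x y)"
  by (rule weights.csum_eq[OF weights_kill[OF assms]]) (use nb_kill_subset finite_nb in auto)
 also have "... = (\<Sum>y\<in>?S. c x y) + (\<Sum>y\<in>?S. if y = z then \<mu> else 0)"
  unfolding kill_def by (rule sum.distrib)
 also have "(\<Sum>y\<in>?S. c x y) = csum c x" using finite_nb by (intro csum_eq[symmetric]) auto
 also have "(\<Sum>y\<in>?S. if y = z then \<mu> else 0) = \<mu>" using finite_nb[of x] by simp
 finally show ?thesis .
qed

text \<open>First-order resolvent expansion: the difference of the two Green functions is \<mu>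
  times their product, and the killed one is bounded by the original. The sum of squares is a bubble
  diagram.\<close>

lemma green_kill_ge:
 assumes D: "finite D" "v \<in> D" "z \<notin> D" and mu: "0 <= \<mu>"
  and sym: "!!x y. x \<in> D ==> y \<in> D ==> c x y = c y x"
 shows "green c D v v - \<mu> * (\<Sum>x\<in>D. (green c D x v)\<^sup>2) <= green (kill c \<mu> z) D v v"
proof -
 interpret K: weights "kill c \<mu> z" by (rule weights_kill[OF mu])
 let ?g = "%x. green c D x v" and ?h = "%x. green (kill c \<mu> z) D x v"
 have kc: "kill c \<mu> z x y = c x y" if "y \<in> D" for x y using that D by (auto simp: kill_def)
 have hg: "?h x <= ?g x" if x: "x \<in> D" for x
 proof (rule K.green_le_super[OF D(1,2) x])
  fix y assume y: "y \<in> D"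
  have "0 <= \<mu> * ?g y" using mu green_nonneg[OF D(1)] by simp
  then show "of_bool (y = v) <= csum (kill c \<mu> z) y * ?g y - (\<Sum>w\<in>D. kill c \<mu> z y w * ?g w)"
   using green_eq[OF D(1,2) y] by (simp add: kc csum_kill[OF mu] algebra_simps)
 qed
 have "?g v - ?h v = (\<Sum>x\<in>D. ?g x * (csum c x * (?g x - ?h x) - (\<Sum>y\<in>D. c x y * (?g y - ?h y))))"
  using green_dual[OF D(1,2) sym, of "%x. ?g x - ?h x"] by simp
 also have "... = (\<Sum>x\<in>D. ?g x * (\<mu> * ?h x))"
 proof (intro sum.cong refl arg_cong2[where f="(*)"])
  fix x assume x: "x \<in> D"
  show "csum c x * (?g x - ?h x) - (\<Sum>y\<in>D. c x y * (?g y - ?h y)) = \<mu> * ?h x"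
   using green_eq[OF D(1,2) x] K.green_eq[OF D(1,2) x]
   by (simp add: kc csum_kill[OF mu] algebra_simps sum_subtractf)
 qed
 also have "... <= (\<Sum>x\<in>D. ?g x * (\<mu> * ?g x))"
  using hg mu green_nonneg[OF D(1)] by (intro sum_mono mult_left_mono) auto
 also have "... = \<mu> * (\<Sum>x\<in>D. (?g x)\<^sup>2)" by (simp add: sum_distrib_left power2_eq_square algebra_simps)
 finally show ?thesis by simp
qed

end

section \<open>Transient regular graphs with a finite bubble diagram\<close>

text \<open>\<open>gh\<close> stands for a Green function of the whole graph: being a supersolution,
  it dominates all finite ones (\<open>green_le_gh\<close>). \<open>B\<close> bounds its bubble
  diagram; on the lattice, finiteness of this bound is what requires dimension five.\<close>

locale tgraph =
 fixes E :: "'v => 'v => bool" and dg :: nat and gh :: "'v => 'v => real" and B :: real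
 assumes E_sym: "E x y ==> E y x"
  and E_irrefl: "\<not> E x x"
  and E_card: "card {y. E x y} = dg"
  and dg_pos: "0 < dg"
  and infinite_V: "infinite (UNIV :: 'v set)"
  and E_escape: "finite P ==> P ~= {} ==> \<exists>x\<in>P. \<exists>y. y \<notin> P & E x y"
  and gh_nonneg: "0 <= gh x y"
  and gh_sym: "gh x y = gh y x"
  and gh_super: "(\<Sum>y\<in>{y. E x y}. gh y v) + of_bool (x = v) <= dg * gh x v"
  and gh_bubble: "finite D ==> (\<Sum>x\<in>D. (gh x v)\<^sup>2) <= B"
begin

definition w :: "'v => 'v => real" where "w x y = of_bool (E x y)"

lemma finite_E: "finite {y. E x y}"
 using E_card[of x] dg_pos by (intro card_ge_0_finite) simp

lemma nb_w: "nb w x = {y. E x y}"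
 by (auto simp: nb_def w_def)

sublocale W: weights w
proof
 show "finite (nb w x)" for x by (simp add: nb_w finite_E)
 show "\<exists>x\<in>P. \<exists>y. y \<notin> P & 0 < w x y" if "finite P" "P ~= {}" for P
  using E_escape[OF that] by (auto simp: w_def)
qed (auto simp: w_def)

lemma w_sym: "w x y = w y x"
 using E_sym by (auto simp: w_def of_bool_def)

lemma csum_w: "csum w x = dg"
 by (simp add: csum_def nb_w w_def E_card)

lemma green_le_gh:
 assumes D: "finite D"
 shows "green w D x v <= gh x v"
proof (cases "v \<in> D & x \<in> D")
 case True
 show ?thesis
 proof (rule W.green_le_super[OF D])
  fix x
  have "(\<Sum>y\<in>D. w x y * gh y v) = (\<Sum>y\<in>D \<inter> {y. E x y}. gh y v)"
   using D by (intro sum.mono_neutral_cong_right) (auto simp: w_def)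
  also have "... <= (\<Sum>y\<in>{y. E x y}. gh y v)"
   by (intro sum_mono2) (auto simp: finite_E gh_nonneg)
  finally show "of_bool (x = v) <= csum w x * gh x v - (\<Sum>y\<in>D. w x y * gh y v)"
   using gh_super[where x = x and v = v] by (simp add: csum_w)
 qed (use True in auto)
next
 case False
 then have "green w D x v = 0" using W.green_out[of x D v] by (auto simp: green_def)
 then show ?thesis by (simp add: gh_nonneg)
qed

lemma green_bubble:
 assumes D: "finite D"
 shows "(\<Sum>x\<in>D. (green w D x v)\<^sup>2) <= B"
proof -
 have "(\<Sum>x\<in>D. (green w D x v)\<^sup>2) <= (\<Sum>x\<in>D. (gh x v)\<^sup>2)"
  using green_le_gh[OF D] W.green_nonneg[OF D] by (intro sum_mono power_mono) auto
 then show ?thesis using gh_bubble[OF D, of v] by simp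
qed

lemma gh_self: "1 <= dg * gh v v"
proof -
 have "0 <= (\<Sum>y\<in>{y. E v y}. gh y v)" by (intro sum_nonneg) (rule gh_nonneg)
 then show ?thesis using gh_super[of v v] by simp
qed

lemma B_pos: "0 < B"
proof -
 fix v
 have "0 < gh v v" using gh_self[of v] dg_pos gh_nonneg[of v v] by (cases "gh v v = 0") auto
 then have "0 < (gh v v)\<^sup>2" by simp
 also have "... <= B" using gh_bubble[of "{v}" v] by simp
 finally show "0 < B" .
qed

lemma green_kill_ratio:
 assumes D: "finite D" "v \<in> D" "z \<notin> D" and mu: "0 <= \<mu>"
 shows "green w D v v * (1 - dg * B * \<mu>) <= green (kill w \<mu> z) D v v"
proof -
 have "\<mu> * (\<Sum>x\<in>D. (green w D x v)\<^sup>2) <= \<mu> * B" using green_bubble[OF D(1)] mu by (intro mult_left_mono)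
 also have "... <= \<mu> * B * (dg * green w D v v)"
  using W.green_diag_ge[OF D(1,2)] mult_left_mono[of 1 "dg * green w D v v" "\<mu> * B"] B_pos mu
  by (simp add: csum_w)
 finally show ?thesis using W.green_kill_ge[OF D mu] w_sym by (simp add: algebra_simps)
qed

text \<open>A path weight is a product of diagonal Green functions along shrinking domains
  (\<open>pw_Cons\<close> with \<open>green_diag\<close>), and each of them loses at most the factor
  \<open>1 - dg * B * \<mu>\<close> under killing.\<close>

lemma pw_kill_ge:
 assumes mu: "0 <= \<mu>" "dg * B * \<mu> <= 1"
 shows "finite D ==> z \<notin> D ==> z ~= v ==> set ys \<subseteq> D ==> distinct ys ==>
  pw w D v ys * (1 - dg * B * \<mu>) ^ length ys <= pw (kill w \<mu> z) D v ys"
proof (induction ys arbitrary: D v)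
 case Nil
 then show ?case using weights.pw_Nil[OF W.weights_kill[OF mu(1)]] by simp
next
 case (Cons y ys)
 interpret K: weights "kill w \<mu> z" by (rule W.weights_kill[OF mu(1)])
 have y: "y \<in> D" "y ~= z" using Cons by auto
 let ?k = "1 - dg * B * \<mu>"
 have IH: "pw w (D - {y}) y ys * ?k ^ length ys <= pw (kill w \<mu> z) (D - {y}) y ys"
  using Cons y by (intro Cons.IH) auto
 have g: "green w D y y * ?k <= green (kill w \<mu> z) D y y"
  using Cons y mu by (intro green_kill_ratio) auto
 have "(green w D y y * ?k) * (pw w (D - {y}) y ys * ?k ^ length ys)
  <= green (kill w \<mu> z) D y y * pw (kill w \<mu> z) (D - {y}) y ys"
  using Cons mu by (intro mult_mono g IH mult_nonneg_nonneg K.green_nonneg W.pw_nonneg) auto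
 then have "w y v * ((green w D y y * ?k) * (pw w (D - {y}) y ys * ?k ^ length ys))
  <= w y v * (green (kill w \<mu> z) D y y * pw (kill w \<mu> z) (D - {y}) y ys)"
  by (intro mult_left_mono) (auto simp: w_def)
 moreover have "kill w \<mu> z y v = w y v" using Cons by (auto simp: kill_def)
 moreover have "pw w D v (y # ys) = w y v * green w D y y * pw w (D - {y}) y ys"
  using W.pw_Cons[of D v y ys] W.green_diag[of D y] Cons y by simp
 moreover have "pw (kill w \<mu> z) D v (y # ys) =
   kill w \<mu> z y v * green (kill w \<mu> z) D y y * pw (kill w \<mu> z) (D - {y}) y ys"
  using K.pw_Cons[of D v y ys] K.green_diag[of D y] Cons y by simp
 ultimately show ?case by (simp only: length_Cons power_Suc mult_ac)
qed

text \<open>Test the harmonic equation of \<open>hit\<close> against \<open>e\<close> and move the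
  adjacency matrix to \<open>e\<close>: killing gains \<mu>, the growth of \<open>e\<close> costs
  \<tau>, and the boundary value 1 at \<open>v\<close> is the only source.\<close>

lemma kill_hit_sum:
 fixes e :: "'v => real" and \<mu> \<tau> :: real
 assumes D: "finite D" "v \<notin> D" "z \<notin> D" "z ~= v" and mu: "0 <= \<tau>" "0 <= \<mu>"
  and e: "!!x. 0 <= (e x :: real)" "!!x. (\<Sum>y\<in>{y. E x y}. e y) <= (dg + \<tau>) * e x"
 shows "(\<mu> - \<tau>) * (\<Sum>x\<in>D. hit (kill w \<mu> z) D v x * e x) <= (dg + \<tau>) * e v"
proof -
 interpret K: weights "kill w \<mu> z" by (rule W.weights_kill[OF mu(2)])
 let ?h = "hit (kill w \<mu> z) D v"
 let ?D = "insert v D"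
 have h0: "0 <= ?h x" for x by (rule K.hit_nonneg[OF D(1)])
 have hx: "(dg + \<mu>) * ?h x = (\<Sum>y\<in>?D. w x y * ?h y)" if "x \<in> D" for x
 proof -
  have "(dg + \<mu>) * ?h x = (\<Sum>y\<in>nb (kill w \<mu> z) x. kill w \<mu> z x y * ?h y)"
   using K.hit_harmonic[OF D(1) that, of v] W.csum_kill[OF mu(2)] by (simp add: csum_w)
  also have "... = (\<Sum>y\<in>?D. kill w \<mu> z x y * ?h y)"
   using D by (intro K.sum_nb_eq) (auto simp: K.hit_out)
  also have "... = (\<Sum>y\<in>?D. w x y * ?h y)"
   using D by (intro sum.cong) (auto simp: kill_def)
  finally show ?thesis .
 qed
 have "(dg + \<mu>) * (\<Sum>x\<in>D. ?h x * e x) = (\<Sum>x\<in>D. (\<Sum>y\<in>?D. w x y * ?h y) * e x)"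
  by (simp add: sum_distrib_left hx[symmetric] mult.assoc)
 also have "... = (\<Sum>y\<in>?D. ?h y * (\<Sum>x\<in>D. w y x * e x))"
  unfolding sum_distrib_left sum_distrib_right
  by (subst sum.swap) (auto intro!: sum.cong simp: w_sym mult_ac)
 also have "... <= (\<Sum>y\<in>?D. ?h y * ((dg + \<tau>) * e y))"
 proof (intro sum_mono mult_left_mono h0)
  fix y
  have "(\<Sum>x\<in>D. w y x * e x) = (\<Sum>x\<in>D \<inter> {x. E y x}. e x)"
   using D by (intro sum.mono_neutral_cong_right) (auto simp: w_def)
  also have "... <= (\<Sum>x\<in>{x. E y x}. e x)"
   by (intro sum_mono2) (auto simp: finite_E e)
  finally show "(\<Sum>x\<in>D. w y x * e x) <= (dg + \<tau>) * e y" using e(2)[of y] by simp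
 qed
 also have "... = (dg + \<tau>) * (e v + (\<Sum>x\<in>D. ?h x * e x))"
  using D by (simp add: K.hit_self sum_distrib_left algebra_simps)
 finally show ?thesis by (simp add: algebra_simps)
qed

definition CS :: real where "CS = 4 + 8 * (real dg)\<^sup>2 * B"

definition kr :: "nat => real" where "kr n = 1 / (2 * dg * B * n)"

lemma CS_ge: "4 <= CS" using B_pos by (simp add: CS_def)

text \<open>Under killing at rate \<open>kr n\<close>, paths of length at most \<open>n\<close> keep half of their weight, while the
 walk survives for a time of order \<open>n\<close>.\<close>

lemma sum_pw_weighted:
 fixes e :: "'v => real" and \<tau> :: real
 assumes D: "finite D" "v \<notin> D" and n: "1 <= n" and tau: "0 <= \<tau>" "\<tau> <= kr n / 2"
  and e: "!!x. 0 <= (e x :: real)" "!!x. (\<Sum>y\<in>{y. E x y}. e y) <= (dg + \<tau>) * e x"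
 shows "(\<Sum>ys\<in>plists D n. pw w D v ys * e (last (v # ys))) <= CS * n * e v"
proof -
 let ?mu = "kr n"
 have mu: "0 < ?mu" using B_pos dg_pos n by (simp add: kr_def)
 have k: "dg * B * ?mu = 1 / (2 * n)" using B_pos dg_pos n by (simp add: kr_def)
 obtain z where z: "z \<notin> insert v D" using ex_new_if_finite[OF infinite_V, of "insert v D"] D by auto
 interpret K: weights "kill w ?mu z" using mu by (intro W.weights_kill) simp
 have half: "1 / 2 <= (1 - 1 / (2 * real n)) ^ l" if "l <= n" for l
 proof -
  have "1 / 2 = 1 + real n * (- (1 / (2 * real n)))" using n by simp
  also have "... <= (1 + (- (1 / (2 * real n)))) ^ n" using n by (intro Bernoulli_inequality) auto
  also have "... = (1 - 1 / (2 * real n)) ^ n" by simp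
  also have "... <= (1 - 1 / (2 * real n)) ^ l" using that n by (intro power_decreasing) auto
  finally show ?thesis .
 qed
 have "pw w D v ys * e (last (v # ys)) <= 2 * (pw (kill w ?mu z) D v ys * e (last (v # ys)))"
  if ys: "ys \<in> plists D n" for ys
 proof -
  have "pw w D v ys * (1 / 2) <= pw w D v ys * (1 - 1 / (2 * real n)) ^ length ys"
   using ys by (intro mult_left_mono half W.pw_nonneg D) (auto simp: plists_def)
  also have "... <= pw (kill w ?mu z) D v ys"
   using pw_kill_ge[of ?mu D z v ys] mu z D ys n k by (auto simp: plists_def)
  finally show ?thesis using mult_right_mono[OF _ e(1)[of "last (v # ys)"], of "pw w D v ys" "2 * pw (kill w ?mu z) D v ys"]
   by (simp add: mult.assoc)
 qed
 then have "(\<Sum>ys\<in>plists D n. pw w D v ys * e (last (v # ys))) <=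
   2 * (\<Sum>ys\<in>plists D n. pw (kill w ?mu z) D v ys * e (last (v # ys)))"
  unfolding sum_distrib_left by (rule sum_mono)
 also have "... <= 2 * (e v + (\<Sum>x\<in>D. hit (kill w ?mu z) D v x * e x))"
  using K.sum_paths_le[OF D, of e n] e(1) by simp
 finally have 1: "(\<Sum>ys\<in>plists D n. pw w D v ys * e (last (v # ys))) <=
   2 * (e v + (\<Sum>x\<in>D. hit (kill w ?mu z) D v x * e x))" .
 let ?H = "\<Sum>x\<in>D. hit (kill w ?mu z) D v x * e x"
 have H0: "0 <= ?H" by (intro sum_nonneg mult_nonneg_nonneg K.hit_nonneg D e)
 have "?mu / 2 * ?H <= (?mu - \<tau>) * ?H" using tau H0 by (intro mult_right_mono) auto
 also have "... <= (dg + \<tau>) * e v" using D z tau mu by (intro kill_hit_sum e) auto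
 also have "... <= (dg + ?mu / 2) * e v" using tau e(1) by (intro mult_right_mono) auto
 finally have "?H <= (dg + ?mu / 2) * e v / (?mu / 2)" using mu by (simp add: field_simps)
 also have "... = (2 * dg / ?mu + 1) * e v" using mu by (simp add: field_simps)
 also have "... = (4 * (real dg)\<^sup>2 * B * n + 1) * e v" by (simp add: kr_def power2_eq_square)
 finally have "2 * (e v + ?H) <= (4 + 8 * (real dg)\<^sup>2 * B * n) * e v" by (simp add: algebra_simps)
 also have "... <= CS * n * e v" unfolding CS_def using n e(1)
  by (intro mult_right_mono) (auto simp: algebra_simps)
 finally show ?thesis using 1 by simp
qed

text \<open>In probabilistic terms: in mean there are at most \<open>CS * n\<close> vertices within
  \<open>n\<close> generations of \<open>v\<close>, with \<open>v\<close> included.\<close>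

lemma sum_pw_le:
 assumes "finite D" "v \<notin> D" "1 <= n"
 shows "(\<Sum>ys\<in>plists D n. pw w D v ys) <= CS * n"
 using sum_pw_weighted[OF assms, of 0 "%_. 1"] B_pos dg_pos by (simp add: kr_def E_card)

end

section \<open>Stationarity of the forest under walks\<close>

text \<open>A state of the redirecting walk is its position \<open>x\<close> with a forest of
  \<open>D - {x}\<close> in which the start \<open>r\<close> flows to \<open>x\<close>. A step adds
  an arc at \<open>x\<close> and yields an arc function \<open>g\<close> on \<open>D\<close>; the
  marks are the positions from which \<open>g\<close> can have arisen.\<close>

definition marks :: "('v => 'v set) => 'v set => 'v => ('v => 'v) => 'v set" where
 "marks N D r g = {x \<in> D. restrict g (D - {x}) \<in> forests N (D - {x}) & leads (D - {x}) g r x}"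

lemma leads_pred:
 assumes "leads (D - {x}) g y x" "y ~= x"
 shows "\<exists>z\<in>D - {x}. g z = x & leads (D - {z}) g y z"
proof -
 have "leads D' g y s ==> D' = D - {x} ==> s = x ==> y ~= x ==>
   \<exists>z\<in>D - {x}. g z = x & leads (D - {z}) g y z" for D' s y
proof (induction rule: leads.induct)
 case (stop r)
 then show ?case by simp
next
 case (step y s)
 show ?case
 proof (cases "g y = x")
  case True
  then show ?thesis using step leads.stop[of y "D - {y}" g] by (intro bexI[of _ y]) auto
 next
  case False
  then obtain z where z: "z \<in> D - {x}" "g z = x" "leads (D - {z}) g (g y) z" using step by blast
  show ?thesis
  proof (cases "y = z")
   case True
   then show ?thesis using z leads.stop[of y "D - {y}" g] by (intro bexI[of _ z]) auto
  next
   case False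
   then have "leads (D - {z}) g y z" using z(3) step leads.step[of y "D - {z}" g z] by auto
   then show ?thesis using z by blast
  qed
 qed
qed
 then show ?thesis using assms by blast
qed

text \<open>If \<open>g\<close> is a forest, the marks form the path from \<open>r\<close> to its
  exit; otherwise they form the cycle of \<open>g\<close>. In both cases following \<open>g\<close>
  from the marks hits every mark, except for the start \<open>r\<close> in the forest case.\<close>

lemma marks_pred:
 assumes g: "g \<in> PiE D N" and x: "x \<in> marks N D r g"
 shows "(g \<in> forests N D & x = r) \<or> (\<exists>y\<in>marks N D r g. g y = x)"
proof -
 have xD: "x \<in> D" and F: "restrict g (D - {x}) \<in> forests N (D - {x})"
  and rx: "leads (D - {x}) g r x" using x by (auto simp: marks_def)
 have ex: "\<exists>b. leads (D - {x}) g z b" for z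
  using forests_leads[OF F, of z] leads_cong_iff[of "D - {x}" g "restrict g (D - {x})" z] by auto
 \<comment> \<open>All orbits in \<open>D - {x}\<close> end at \<open>x\<close> or at a root. Once
   \<open>x\<close> itself flows to \<open>y\<close>, cutting at \<open>y\<close> instead of
   \<open>x\<close> still leaves a forest in which \<open>r\<close> flows to the cut.\<close>
 have make: "y \<in> marks N D r g"
  if y: "y \<in> D" and xy: "leads (D - {y}) g x y" for y
 proof -
  have lead: "\<exists>b. leads (D - {y}) g z b" for z
  proof -
   obtain b where "leads (D - {x}) g z b" using ex by blast
   then obtain b' where b': "leads (D - {x} - {y}) g z b'" using leads_mid by metis
   show ?thesis
   proof (cases "b' = x")
    case True
    then show ?thesis using leads_trans[OF b', of "D - {y}" y] xy by auto
   next
    case False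
    then have "b' \<notin> D - {y}" using leads_notin[OF b'] by auto
    then show ?thesis using leads_trans[OF b', of "D - {y}" b'] leads.stop[of b' "D - {y}" g] by auto
   qed
  qed
  have "leads (D - {y}) g r y"
  proof -
   obtain b' where b': "leads (D - {x} - {y}) g r b'" "leads (D - {x}) g b' x"
    using leads_mid[OF rx] by blast
   have "b' = x \<or> b' = y"
   proof (rule ccontr)
    assume n: "\<not> (b' = x \<or> b' = y)"
    then have "b' \<notin> D - {x}" using leads_notin[OF b'(1)] by auto
    then show False using b'(2) n by (auto simp: leads_out)
   qed
   then show ?thesis
   proof
    assume "b' = x"
    then show ?thesis using leads_trans[OF b'(1), of "D - {y}" y] xy by auto
   next
    assume "b' = y"
    then show ?thesis using leads_trans[OF b'(1), of "D - {y}" y] leads.stop[of y "D - {y}" g] by auto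
   qed
  qed
  moreover have "restrict g (D - {y}) \<in> forests N (D - {y})"
  proof -
   have "\<exists>b. leads (D - {y}) (restrict g (D - {y})) z b" for z
    using lead[of z] leads_cong_iff[of "D - {y}" g "restrict g (D - {y})" z] by auto
   then show ?thesis using g by (auto simp: forests_def)
  qed
  ultimately show ?thesis using y by (auto simp: marks_def)
 qed
 show ?thesis
 proof (cases "leads (D - {x}) g (g x) x")
  case True
  show ?thesis
  proof (cases "g x = x")
   case False
   then obtain z where z: "z \<in> D - {x}" "g z = x" "leads (D - {z}) g (g x) z"
    using leads_pred[OF True] by blast
   then have "leads (D - {z}) g x z" using xD leads.step[of x "D - {z}" g z] by auto
   then show ?thesis using make[of z] z by blast
  qed (use x in blast)
 next
  case nl: False
  obtain b where b: "leads (D - {x}) g (g x) b" using ex by blast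
  then have bD: "b \<notin> D" using nl leads_notin[OF b] by auto
  have gx: "leads D g x b"
   using leads.step[OF xD leads_trans[OF b Diff_subset leads.stop[OF bD]]] .
  have "\<exists>s. leads D g z s" for z
  proof -
   obtain b' where b': "leads (D - {x}) g z b'" using ex by blast
   show ?thesis
   proof (cases "b' = x")
    case True
    then show ?thesis using leads_trans[OF b' Diff_subset] gx by blast
   next
    case False
    then have "b' \<notin> D" using leads_notin[OF b'] by auto
    then show ?thesis using leads_trans[OF b' Diff_subset leads.stop] by blast
   qed
  qed
  then have gF: "g \<in> forests N D" using g by (auto simp: forests_def)
  show ?thesis
  proof (cases "x = r")
   case False
   then obtain z where z: "z \<in> D - {x}" "g z = x" "leads (D - {z}) g r z"
    using leads_pred[OF rx] by blast
   have "restrict g (D - {z}) \<in> forests N (D - {z})" by (rule forests_restrict[OF gF])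
   then show ?thesis using z by (auto simp: marks_def)
  qed (use gF in blast)
 qed
qed

lemma marks_exit:
 assumes f: "f \<in> forests N D" and r: "r \<in> D"
 shows "\<exists>x\<in>marks N D r f. f x \<notin> D"
proof -
 have "leads D f r s ==> r \<in> D ==> \<exists>x\<in>D. leads (D - {x}) f r x & f x \<notin> D" for r s
 proof (induction rule: leads.induct)
  case (step y s)
  show ?case
  proof (cases "f y \<in> D")
   case True
   then obtain x where x: "x \<in> D" "leads (D - {x}) f (f y) x" "f x \<notin> D" using step by blast
   then have "y ~= x" using True by auto
   then have "leads (D - {x}) f y x" using step x leads.step[of y "D - {x}" f x] by auto
   then show ?thesis using x by blast
  next
   case False
   then show ?thesis using step leads.stop[of y "D - {y}" f] by blast
  qed
 qed simp
 then obtain x where "x \<in> D" "leads (D - {x}) f r x" "f x \<notin> D"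
  using forests_leads[OF f, of r] r by blast
 then show ?thesis using forests_restrict[OF f, of "{x}"] by (auto simp: marks_def)
qed

context weights
begin

text \<open>Change of variables from an arc function with a mark to a position, a forest off it and
  the next arc.\<close>

lemma sum_marks:
 assumes D: "finite D"
 shows "(\<Sum>g\<in>PiE D (nb c). \<Sum>x\<in>marks (nb c) D r g. wt c D g * h g x) =
  (\<Sum>x\<in>D. \<Sum>f\<in>{f \<in> wforests c (D - {x}). leads (D - {x}) f r x}. \<Sum>y\<in>nb c x.
    c x y * wt c (D - {x}) f * h (f(x := y)) x)"
proof -
 let ?G = "PiE D (nb c)"
 let ?F = "%x. {f \<in> wforests c (D - {x}). leads (D - {x}) f r x}"
 have finG: "finite ?G" using D by (intro finite_PiE) (auto simp: finite_nb)
 have finF: "finite (?F x)" for x using finite_wforests[of "D - {x}"] D by simp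
 have finM: "finite (marks (nb c) D r g)" for g using D by (auto simp: marks_def)
 have "(\<Sum>g\<in>?G. \<Sum>x\<in>marks (nb c) D r g. wt c D g * h g x) =
   (\<Sum>(g, x)\<in>(SIGMA g:?G. marks (nb c) D r g). wt c D g * h g x)"
  using finG finM by (intro sum.Sigma) auto
 also have "... = (\<Sum>(x, f, y)\<in>(SIGMA x:D. ?F x \<times> nb c x). c x y * wt c (D - {x}) f * h (f(x := y)) x)"
 proof (rule sum.reindex_bij_witness[where
    i = "%(x, f, y). (f(x := y), x)" and j = "%(g, x). (x, restrict g (D - {x}), g x)"])
  fix p assume p: "p \<in> (SIGMA g:?G. marks (nb c) D r g)"
  obtain g x where gx: "p = (g, x)" "g \<in> ?G" "x \<in> marks (nb c) D r g" using p by auto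
  have xD: "x \<in> D" using gx by (auto simp: marks_def)
  have eq: "(restrict g (D - {x}))(x := g x) = g"
   using gx xD by (auto simp: restrict_def fun_eq_iff PiE_def extensional_def)
  show "(case (case p of (g, x) => (x, restrict g (D - {x}), g x)) of (x, f, y) => (f(x := y), x)) = p"
   using gx eq by simp
  have "leads (D - {x}) (restrict g (D - {x})) r x"
   using gx leads_cong_iff[of "D - {x}" g "restrict g (D - {x})"] by (auto simp: marks_def)
  then show "(case p of (g, x) => (x, restrict g (D - {x}), g x)) \<in> (SIGMA x:D. ?F x \<times> nb c x)"
   using gx xD by (auto simp: marks_def wforests_def)
  have "wt c D g = c x (g x) * wt c (D - {x}) (restrict g (D - {x}))"
   using wt_remove[OF D xD, of g] wt_cong[of "D - {x}" g "restrict g (D - {x})"] by simp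
  then show "(case (case p of (g, x) => (x, restrict g (D - {x}), g x)) of
    (x, f, y) => c x y * wt c (D - {x}) f * h (f(x := y)) x) = (case p of (g, x) => wt c D g * h g x)"
   using gx eq by simp
 next
  fix q assume q: "q \<in> (SIGMA x:D. ?F x \<times> nb c x)"
  obtain x f y where xfy: "q = (x, f, y)" "x \<in> D" "f \<in> wforests c (D - {x})"
    "leads (D - {x}) f r x" "y \<in> nb c x" using q by auto
  have eq: "restrict (f(x := y)) (D - {x}) = f"
   using xfy by (auto simp: wforests_def forests_def restrict_def fun_eq_iff PiE_def extensional_def)
  show "(case (case q of (x, f, y) => (f(x := y), x)) of (g, x) => (x, restrict g (D - {x}), g x)) = q"
   using xfy eq by simp
  have "f(x := y) \<in> ?G"
   using xfy by (auto simp: wforests_def forests_def PiE_def extensional_def Pi_def)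
  moreover have "leads (D - {x}) (f(x := y)) r x"
   using xfy leads_cong_iff[of "D - {x}" f "f(x := y)"] by auto
  ultimately show "(case q of (x, f, y) => (f(x := y), x)) \<in> (SIGMA g:?G. marks (nb c) D r g)"
   using xfy eq by (auto simp: marks_def wforests_def)
 qed
 also have "... = (\<Sum>x\<in>D. \<Sum>(f, y)\<in>?F x \<times> nb c x. c x y * wt c (D - {x}) f * h (f(x := y)) x)"
  using D finF finite_nb by (intro sum.Sigma[symmetric]) auto
 also have "... = (\<Sum>x\<in>D. \<Sum>f\<in>?F x. \<Sum>y\<in>nb c x. c x y * wt c (D - {x}) f * h (f(x := y)) x)"
  by (simp add: sum.cartesian_product)
 finally show ?thesis .
qed

text \<open>Run a walk from \<open>r\<close> until it leaves \<open>D\<close> and redirect every visited vertex along its last exit: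
 the forest measure is invariant. The function \<open>U\<close> lives on the states during the walk.\<close>

lemma walk_stationary:
 assumes D: "finite D" "r \<in> D"
  and U: "!!x f. 0 <= (U x f :: real)" and W: "!!f. 0 <= (W f :: real)"
  and super: "!!x f. x \<in> D ==> f \<in> wforests c (D - {x}) ==>
   (\<Sum>y\<in>nb c x. c x y * (if y \<in> D then U y (restrict (f(x := y)) (D - {y})) else W (f(x := y))))
   <= csum c x * U x f"
 shows "fosum c D W <= fosum c D (%f. U r (restrict f (D - {r})))"
proof -
 let ?G = "PiE D (nb c)" and ?M = "%g. marks (nb c) D r g"
 let ?U = "%g x. U x (restrict g (D - {x}))"
 \<comment> \<open>\<open>T\<close> weighs the states before a step, \<open>A\<close> the outcomes
   of a step. The weight on states plays the part of the occupation measure of the walk, so that a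
   single balance replaces an iteration over time.\<close>
 define T where "T = (\<Sum>g\<in>?G. \<Sum>x\<in>?M g. wt c D g * ?U g x)"
 define A where "A = (\<Sum>g\<in>?G. \<Sum>x\<in>?M g. wt c D g * (if g x \<in> D then ?U g (g x) else W g))"
 let ?F = "%x. {f \<in> wforests c (D - {x}). leads (D - {x}) f r x}"
 have finG: "finite ?G" using D by (intro finite_PiE) (auto simp: finite_nb)
 have finM: "finite (?M g)" for g using D by (auto simp: marks_def)
 have FG: "wforests c D \<subseteq> ?G" by (auto simp: wforests_def forests_def)
 have fos: "fosum c D Y = (\<Sum>g\<in>?G. wt c D g * (if g \<in> wforests c D then Y g else 0))" for Y
  unfolding fosum_def using FG finG by (intro sum.mono_neutral_cong_left) auto
 have "A = (\<Sum>x\<in>D. \<Sum>f\<in>?F x. \<Sum>y\<in>nb c x. c x y * wt c (D - {x}) f *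
   (if y \<in> D then U y (restrict (f(x := y)) (D - {y})) else W (f(x := y))))"
  unfolding A_def sum_marks[OF D(1), where r = r and h = "%g x. if g x \<in> D then ?U g (g x) else W g"]
  by (simp cong: if_cong)
 also have "... <= (\<Sum>x\<in>D. \<Sum>f\<in>?F x. \<Sum>y\<in>nb c x. c x y * wt c (D - {x}) f * U x f)"
 proof (rule sum_mono, rule sum_mono)
  fix x f assume x: "x \<in> D" and f: "f \<in> ?F x"
  have "(\<Sum>y\<in>nb c x. c x y * wt c (D - {x}) f *
    (if y \<in> D then U y (restrict (f(x := y)) (D - {y})) else W (f(x := y)))) =
   wt c (D - {x}) f * (\<Sum>y\<in>nb c x. c x y *
    (if y \<in> D then U y (restrict (f(x := y)) (D - {y})) else W (f(x := y))))"
   unfolding sum_distrib_left by (intro sum.cong refl) (simp only: mult_ac)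
  also have "... <= wt c (D - {x}) f * (csum c x * U x f)"
   using f by (intro mult_left_mono super x wt_nonneg) auto
  also have "... = (\<Sum>y\<in>nb c x. c x y * wt c (D - {x}) f * U x f)"
   unfolding csum_def sum_distrib_left sum_distrib_right by (simp add: mult_ac)
  finally show "(\<Sum>y\<in>nb c x. c x y * wt c (D - {x}) f *
    (if y \<in> D then U y (restrict (f(x := y)) (D - {y})) else W (f(x := y)))) <=
   (\<Sum>y\<in>nb c x. c x y * wt c (D - {x}) f * U x f)" .
 qed
 also have "... = T"
  unfolding T_def sum_marks[OF D(1), where r = r and h = ?U]
 proof (intro sum.cong refl)
  fix x f y assume x: "x \<in> D" and f: "f \<in> ?F x"
  have "restrict (f(x := y)) (D - {x}) = f"
   using f by (auto simp: wforests_def forests_def restrict_def fun_eq_iff PiE_def extensional_def)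
  then show "c x y * wt c (D - {x}) f * U x f =
   c x y * wt c (D - {x}) f * U x (restrict (f(x := y)) (D - {x}))" by simp
 qed
 finally have AT: "A <= T" .
 \<comment> \<open>Balance: every state except the start is the outcome of a step from another mark,
   and every forest has a mark whose step exits from \<open>D\<close> and contributes
   \<open>W\<close>.\<close>
 have "fosum c D W + T <= fosum c D (%f. U r (restrict f (D - {r}))) + A"
  unfolding fos T_def A_def sum.distrib[symmetric] sum_distrib_left[symmetric] distrib_left[symmetric]
 proof (intro sum_mono mult_left_mono wt_nonneg)
  fix g assume g: "g \<in> ?G"
  let ?I = "{x \<in> ?M g. g x \<in> D}" and ?O = "{x \<in> ?M g. g x \<notin> D}"
  have split: "(\<Sum>x\<in>?M g. if g x \<in> D then ?U g (g x) else W g) =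
    (\<Sum>x\<in>?I. ?U g (g x)) + (\<Sum>x\<in>?O. W g)"
  proof -
   have "?M g \<inter> {x. g x \<in> D} = ?I" "?M g \<inter> - {x. g x \<in> D} = ?O" by auto
   then show ?thesis using sum.If_cases[OF finM[of g], of "%x. g x \<in> D" "%x. ?U g (g x)" "%x. W g"]
    by simp
  qed
  have 1: "(if g \<in> wforests c D then W g else 0) <= (\<Sum>x\<in>?O. W g)"
  proof (cases "g \<in> wforests c D")
   case True
   then obtain x where "x \<in> ?M g" "g x \<notin> D"
    using marks_exit[of g "nb c" D r] D by (auto simp: wforests_def)
   then have "(\<Sum>x\<in>{x}. W g) <= (\<Sum>x\<in>?O. W g)" using finM[of g] W by (intro sum_mono2) auto
   then show ?thesis using True by simp
  qed (simp add: W)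
  have sub: "?M g \<subseteq> (if g \<in> wforests c D then {r} else {}) \<union> g ` ?I"
  proof
   fix x assume x: "x \<in> ?M g"
   then have "x \<in> D" by (auto simp: marks_def)
   then show "x \<in> (if g \<in> wforests c D then {r} else {}) \<union> g ` ?I"
    using marks_pred[OF g x] by (auto simp: wforests_def)
  qed
  have "(\<Sum>x\<in>?M g. ?U g x) <= (\<Sum>x\<in>(if g \<in> wforests c D then {r} else {}) \<union> g ` ?I. ?U g x)"
   using finM[of g] by (intro sum_mono2 sub) (auto simp: U)
  also have "... <= (\<Sum>x\<in>(if g \<in> wforests c D then {r} else {}). ?U g x) + (\<Sum>x\<in>g ` ?I. ?U g x)"
   using finM[of g] by (subst sum_Un) (auto intro!: sum_nonneg simp: U)
  finally have 4: "(\<Sum>x\<in>?M g. ?U g x) <= (\<Sum>x\<in>(if g \<in> wforests c D then {r} else {}). ?U g x) +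
    (\<Sum>x\<in>g ` ?I. ?U g x)" .
  have 5: "(\<Sum>x\<in>g ` ?I. ?U g x) <= (\<Sum>x\<in>?I. ?U g (g x))"
   using finM[of g] by (intro order_trans[OF sum_image_le]) (auto simp: U)
  have 2: "(\<Sum>x\<in>?M g. ?U g x) <= (\<Sum>x\<in>(if g \<in> wforests c D then {r} else {}). ?U g x) +
    (\<Sum>x\<in>?I. ?U g (g x))" using 4 5 by (rule order_trans[OF _ add_left_mono])
  have 3: "(\<Sum>x\<in>(if g \<in> wforests c D then {r} else {}). ?U g x) =
    (if g \<in> wforests c D then U r (restrict g (D - {r})) else 0)" by simp
  show "(if g \<in> wforests c D then W g else 0) + (\<Sum>x\<in>?M g. ?U g x) <=
   (if g \<in> wforests c D then U r (restrict g (D - {r})) else 0) +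
   (\<Sum>x\<in>?M g. if g x \<in> D then ?U g (g x) else W g)"
   unfolding split using 1 2 unfolding 3 by linarith
 qed
 then show ?thesis using AT by simp
qed

end

section \<open>Heights and spines under the redirecting walk\<close>

definition tall :: "'v set => ('v => 'v) => 'v => nat => bool" where
 "tall D f v n \<longleftrightarrow> (\<exists>ys. chain D f v ys & length ys = n)"

lemma tall_mono:
 assumes "tall D f v n" "m <= n"
 shows "tall D f v m"
proof -
 obtain ys where ys: "chain D f v ys" "length ys = n" using assms by (auto simp: tall_def)
 have "chain D f v (take m ys)" using ys(1) chain_append[of D f v "take m ys" "drop m ys"] by simp
 then show ?thesis using ys assms unfolding tall_def by (intro exI[of _ "take m ys"]) auto
qed

definition spine :: "'v set => ('v => 'v) => 'v => nat => 'v list => bool" where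
 "spine D f v n ys \<longleftrightarrow> chain D f v ys & tall D f (last (v # ys)) n"

lemma spine_mono:
 assumes "spine D' f v n ys" "D' \<subseteq> D" "!!x. x \<in> D' ==> f x = g x"
 shows "spine D g v n ys"
proof -
 have *: "chain D g u zs" if "chain D' f u zs" for u zs
  using that chain_subset[OF that] chain_cong[of zs D' D f g u] assms(2,3) by blast
 show ?thesis using assms(1) * unfolding spine_def tall_def by blast
qed

text \<open>A step adds an arc from \<open>x\<close> to \<open>y\<close>, where \<open>y\<close> is
  cut out of the domain or is a root other than \<open>v\<close>. So \<open>x\<close> and its
  descendants are not in the tree of \<open>v\<close>: until it exits at \<open>v\<close>, the walk
  can destroy a spine but never creates one.\<close>

lemma spine_step:
 assumes s: "spine D' (f(x := y)) v n ys" and ne: "ys ~= []"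
  and D': "D' \<subseteq> D" "y \<notin> D'" "y ~= v"
 shows "x \<notin> set ys & spine (D - {x}) f v n ys"
proof -
 have key: "x \<notin> set zs" if c: "chain D' (f(x := y)) u zs" and u: "u ~= y" for u zs
 proof
  assume "x \<in> set zs"
  then obtain as bs where zs: "zs = as @ x # bs" by (meson split_list)
  then have "y = last (u # as)" using c by (auto simp: chain_append)
  moreover have "set as \<subseteq> D'" using chain_subset[OF c] zs by auto
  then have "as ~= [] ==> last as \<in> D'" using last_in_set[of as] by blast
  ultimately show False using u D'(2) by (cases "as = []") auto
 qed
 have tr: "chain (D - {x}) f u zs" if c: "chain D' (f(x := y)) u zs" and "u ~= y" for u zs
  using key[OF that] chain_subset[OF c] D'(1) c chain_cong[of zs D' "D - {x}" "f(x := y)" f u] by force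
 obtain zs where c: "chain D' (f(x := y)) v ys" "chain D' (f(x := y)) (last ys) zs" "length zs = n"
  using s ne by (auto simp: spine_def tall_def)
 have "last ys \<in> D'" using chain_subset[OF c(1)] last_in_set[OF ne] by blast
 then have "last ys ~= y" using D'(2) by blast
 then show ?thesis using key[OF c(1)] tr[OF c(1)] tr[OF c(2)] c(3) D'(3) ne
  by (auto simp: spine_def tall_def)
qed

context tgraph
begin

text \<open>The number of arcs from \<open>x\<close> that leave \<open>D\<close>; it serves as the
  rate at which walks enter \<open>D\<close> at \<open>x\<close>.\<close>

definition edeg :: "'v set => 'v => real" where
 "edeg D x = dg - (\<Sum>y\<in>D. w x y)"

lemma sum_w_le: "finite D ==> (\<Sum>y\<in>D. w x y) <= dg"
proof -
 assume "finite D"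
 then have "(\<Sum>y\<in>D. w x y) = (\<Sum>y\<in>D \<inter> {y. E x y}. w x y)"
  by (intro sum.mono_neutral_right) (auto simp: w_def)
 also have "... <= (\<Sum>y\<in>{y. E x y}. w x y)" by (intro sum_mono2) (auto simp: finite_E w_def)
 also have "... = dg" by (simp add: w_def E_card)
 finally show ?thesis .
qed

lemma edeg_nonneg: "finite D ==> 0 <= edeg D x"
 using sum_w_le by (simp add: edeg_def)

lemma divergence:
 fixes u :: "'v => real"
 assumes "finite D"
 shows "(\<Sum>x\<in>D. dg * u x - (\<Sum>y\<in>D. w x y * u y)) = (\<Sum>y\<in>D. edeg D y * u y)"
proof -
 have "(\<Sum>x\<in>D. \<Sum>y\<in>D. w x y * u y) = (\<Sum>y\<in>D. (\<Sum>x\<in>D. w y x) * u y)"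
  unfolding sum_distrib_right by (subst sum.swap) (simp add: w_sym)
 then show ?thesis by (simp add: edeg_def sum_subtractf left_diff_distrib)
qed

lemma edeg_sum_pos:
 assumes "finite D" "D ~= {}"
 shows "0 < (\<Sum>x\<in>D. edeg D x)"
proof -
 obtain x y where xy: "x \<in> D" "y \<notin> D" "E x y" using E_escape[OF assms] by blast
 have "(\<Sum>z\<in>insert y D. w x z) <= dg" using assms by (intro sum_w_le) auto
 then have "0 < edeg D x" using xy assms by (simp add: edeg_def w_def)
 then show ?thesis using xy assms by (intro sum_pos2[of D x]) (auto intro: edeg_nonneg)
qed

lemma nb_split_sum:
 assumes D: "finite D"
 shows "(\<Sum>y\<in>nb w x. w x y * (if y \<in> D then u y else k)) = (\<Sum>y\<in>D. w x y * u y) + edeg D x * k"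
proof -
 have "(\<Sum>y\<in>nb w x. w x y * (if y \<in> D then u y else k)) =
   (\<Sum>y\<in>nb w x. w x y * (if y \<in> D then u y - k else 0)) + (\<Sum>y\<in>nb w x. w x y * k)"
  unfolding sum.distrib[symmetric] by (intro sum.cong) (auto simp: algebra_simps)
 also have "(\<Sum>y\<in>nb w x. w x y * (if y \<in> D then u y - k else 0)) = (\<Sum>y\<in>D. w x y * (u y - k))"
  using D by (subst W.sum_nb_eq[of D]) auto
 also have "(\<Sum>y\<in>nb w x. w x y * k) = dg * k" using csum_w[of x] by (simp add: csum_def sum_distrib_right[symmetric])
 finally show ?thesis by (simp add: edeg_def algebra_simps sum_subtractf sum_distrib_right sum_distrib_left)
qed

text \<open>Summing the equation of \<open>hit w D v\<close> over \<open>D\<close> leaves the flux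
  through \<open>v\<close>. By reversibility, walks entering at unit rate along each boundary arc
  exit at \<open>v\<close> at rate at most \<open>dg\<close>.\<close>

lemma edeg_hit_sum:
 assumes D: "finite D" "v \<notin> D"
 shows "(\<Sum>x\<in>D. edeg D x * hit w D v x) <= dg"
proof -
 have "(\<Sum>x\<in>D. edeg D x * hit w D v x) = (\<Sum>x\<in>D. dg * hit w D v x - (\<Sum>y\<in>D. w x y * hit w D v y))"
  using divergence[OF D(1)] by simp
 also have "... = (\<Sum>x\<in>D. w x v)"
 proof (intro sum.cong refl)
  fix x assume x: "x \<in> D"
  have "dg * hit w D v x = (\<Sum>y\<in>nb w x. w x y * hit w D v y)"
   using W.hit_harmonic[OF D(1) x] by (simp add: csum_w)
  also have "... = (\<Sum>y\<in>insert v D. w x y * hit w D v y)"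
   using D by (intro W.sum_nb_eq) (auto simp: W.hit_out)
  finally show "dg * hit w D v x - (\<Sum>y\<in>D. w x y * hit w D v y) = w x v"
   using D by (simp add: W.hit_self)
 qed
 also have "... <= dg" using sum_w_le[OF D(1), of v] by (simp add: w_sym)
 finally show ?thesis .
qed

text \<open>A resolvent bound: in a time of order \<open>\<epsilon>\<close>, either a walk exits at \<open>v\<close> or the surviving paths
 have not been hit; \<open>H ys\<close> is the probability that a walk exits before hitting \<open>ys\<close>.\<close>

lemma excursion_bound:
 fixes H :: "'v list => 'v => real" and a \<kappa> :: "'v list => real" and \<epsilon> :: real
 assumes D: "finite D" "v \<notin> D" and G: "finite \<Gamma>" "!!ys. ys \<in> \<Gamma> ==> ys ~= []"
  and a: "!!ys. ys \<in> \<Gamma> ==> 0 <= a ys" and eps: "0 <= \<epsilon>"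
  and H0: "!!ys x. ys \<in> \<Gamma> ==> x \<in> D ==> 0 <= H ys x"
  and Hs: "!!ys x. ys \<in> \<Gamma> ==> x \<in> D ==> x \<notin> set ys ==> (\<Sum>y\<in>D. w x y * H ys y) + edeg D x <= dg * H ys x"
  and k0: "!!ys. ys \<in> \<Gamma> ==> 0 <= \<kappa> ys"
  and k: "!!ys. ys \<in> \<Gamma> ==> (\<Sum>x\<in>D. edeg D x * H ys x) <= (\<Sum>x\<in>D. edeg D x) - \<kappa> ys"
  and ne: "D ~= {}"
 shows "fosum w D (%f. min 1 (\<Sum>ys\<in>\<Gamma>. a ys * of_bool (spine D f v n ys))) <=
  dg * \<epsilon> * partn w D + (\<Sum>ys\<in>\<Gamma>. a ys / (1 + \<epsilon> * \<kappa> ys) * fosum w D (%f. of_bool (spine D f v n ys)))"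
proof -
 define al where "al ys = a ys / (1 + \<epsilon> * \<kappa> ys)" for ys
 define b where "b = (\<Sum>x\<in>D. edeg D x)"
 have b: "0 < b" unfolding b_def by (rule edeg_sum_pos[OF D(1) ne])
 have al0: "0 <= al ys" if "ys \<in> \<Gamma>" for ys
  unfolding al_def using a[OF that] k0[OF that] eps by simp
 define c0 where "c0 = dg * \<epsilon>"
 have c0: "0 <= c0" using eps by (simp add: c0_def)
 define g where "g D f ys = (of_bool (spine D f v n ys) :: real)" for D f ys
 \<comment> \<open>Think of walks entering at total rate \<open>b\<close> and of a clock with mean
   \<epsilon>. \<open>W\<close> accounts for the spines that survive until the clock rings,
   \<open>M\<close> bounds its mean after one walk from a uniform boundary arc, and \<open>q\<close>
   is the probability that the clock rings before the next walk.\<close>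
 define W where "W f = min 1 (c0 + (\<Sum>ys\<in>\<Gamma>. al ys * g D f ys))" for f
 define M where "M f = min 1 (dg / b + c0 + (\<Sum>ys\<in>\<Gamma>. al ys * (1 - \<kappa> ys / b) * g D f ys))" for f
 define \<psi> where "\<psi> f = min 1 (\<Sum>ys\<in>\<Gamma>. a ys * g D f ys)" for f
 define q where "q = 1 / (1 + \<epsilon> * b)"
 have eb: "0 <= \<epsilon> * b" using eps b by simp
 have q: "0 < q" "q <= 1" using eb by (auto simp: q_def)
 have g01: "0 <= g D f ys" "g D f ys <= 1" for D f ys by (auto simp: g_def)
 have W0: "0 <= W f" for f
  unfolding W_def using c0 al0 g01 by (auto intro!: add_nonneg_nonneg sum_nonneg mult_nonneg_nonneg)
 have pt: "q * \<psi> f + (1 - q) * M f <= W f" for f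
 proof (cases "c0 + (\<Sum>ys\<in>\<Gamma>. al ys * g D f ys) \<ge> 1")
  case True
  have "q * \<psi> f + (1 - q) * M f <= q * 1 + (1 - q) * 1"
   using q by (intro add_mono mult_left_mono) (auto simp: \<psi>_def M_def)
  then show ?thesis using True by (simp add: W_def)
 next
  case False
  have "q * \<psi> f + (1 - q) * M f <= q * (\<Sum>ys\<in>\<Gamma>. a ys * g D f ys) +
    (1 - q) * (dg / b + c0 + (\<Sum>ys\<in>\<Gamma>. al ys * (1 - \<kappa> ys / b) * g D f ys))"
   using q by (intro add_mono mult_left_mono) (auto simp: \<psi>_def M_def)
  also have "... = (1 - q) * (dg / b + c0) +
    (\<Sum>ys\<in>\<Gamma>. (q * a ys + (1 - q) * (al ys * (1 - \<kappa> ys / b))) * g D f ys)"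
   by (simp add: distrib_left distrib_right sum.distrib sum_distrib_left mult.assoc)
  also have "(1 - q) * (dg / b + c0) = c0"
  proof -
   have "1 - q = \<epsilon> * b / (1 + \<epsilon> * b)" using eb by (simp add: q_def field_simps)
   moreover have "dg / b + c0 = dg * (1 + \<epsilon> * b) / b" using b by (simp add: c0_def field_simps)
   ultimately have "(1 - q) * (dg / b + c0) = (\<epsilon> * b / (1 + \<epsilon> * b)) * (dg * (1 + \<epsilon> * b) / b)" by simp
   also have "... = c0" using b eb by (simp add: c0_def)
   finally show ?thesis .
  qed
  also have "(\<Sum>ys\<in>\<Gamma>. (q * a ys + (1 - q) * (al ys * (1 - \<kappa> ys / b))) * g D f ys) =
    (\<Sum>ys\<in>\<Gamma>. al ys * g D f ys)"
  proof (intro sum.cong refl arg_cong2[where f="(*)"])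
   fix ys assume ys: "ys \<in> \<Gamma>"
   have p: "0 < 1 + \<epsilon> * \<kappa> ys" using k0[OF ys] eps by (simp add: add_pos_nonneg)
   have a': "a ys = al ys * (1 + \<epsilon> * \<kappa> ys)" using p by (simp add: al_def)
   have "(q * a ys + (1 - q) * (al ys * (1 - \<kappa> ys / b))) =
    al ys * (q * (1 + \<epsilon> * \<kappa> ys) + (1 - q) * (1 - \<kappa> ys / b))" by (simp add: a' algebra_simps)
   also have "q * (1 + \<epsilon> * \<kappa> ys) + (1 - q) * (1 - \<kappa> ys / b) = 1 + \<kappa> ys * (q * \<epsilon> - (1 - q) / b)"
    by (simp add: algebra_simps diff_divide_distrib)
   also have "q * \<epsilon> - (1 - q) / b = 0"
   proof -
    have "1 - q = b * (\<epsilon> * q)" using eb by (simp add: q_def field_simps)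
    then show ?thesis using b by simp
   qed
   finally show "q * a ys + (1 - q) * (al ys * (1 - \<kappa> ys / b)) = al ys" by simp
  qed
  finally show ?thesis using False by (simp add: W_def)
 qed
 \<comment> \<open>One walk started at \<open>r\<close>: either it exits at \<open>v\<close>, or
   every spine present afterwards was present before and was not visited. \<open>hit\<close> and
   \<open>H\<close> solve the two exit problems.\<close>
 have stat: "fosum w D W <= fosum w D (%f. min 1 (hit w D v r + c0 + (\<Sum>ys\<in>\<Gamma>. al ys * g D f ys * H ys r)))"
  if r: "r \<in> D" for r
 proof -
  define U where "U x f = (if x \<in> D then min 1 (hit w D v x + c0 + (\<Sum>ys\<in>\<Gamma>. al ys * g (D - {x}) f ys * H ys x)) else 0)"
   for x f
  have U0: "0 <= U x f" for x f
   unfolding U_def using c0 al0 g01 H0 W.hit_nonneg[OF D(1)]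
   by (auto intro!: add_nonneg_nonneg sum_nonneg mult_nonneg_nonneg)
  have "fosum w D W <= fosum w D (%f. U r (restrict f (D - {r})))"
  proof (rule W.walk_stationary[OF D(1) r U0 W0])
   fix x f assume x: "x \<in> D" and f: "f \<in> wforests w (D - {x})"
   let ?R = "%y. if y \<in> D then U y (restrict (f(x := y)) (D - {y})) else W (f(x := y))"
   have R1: "?R y <= 1" for y by (auto simp: U_def W_def)
   have "(\<Sum>y\<in>nb w x. w x y * ?R y) <= (\<Sum>y\<in>nb w x. w x y * 1)"
    using R1 by (intro sum_mono mult_left_mono) (auto simp: w_def)
   then have one: "(\<Sum>y\<in>nb w x. w x y * ?R y) <= csum w x * 1" by (simp add: csum_def)
   let ?h = "hit w D v"
   let ?K = "%ys y. if y \<in> D then H ys y else 1"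
   have R2: "?R y <= ?h y + c0 + (\<Sum>ys\<in>\<Gamma>. al ys * (g (D - {x}) f ys * of_bool (x \<notin> set ys)) * ?K ys y)"
    (is "_ <= ?S y") for y
   proof (cases "y = v")
    case True
    have "0 <= (\<Sum>ys\<in>\<Gamma>. al ys * (g (D - {x}) f ys * of_bool (x \<notin> set ys)) * ?K ys y)"
     using al0 g01 H0 by (intro sum_nonneg mult_nonneg_nonneg) auto
    then show ?thesis using True D c0 by (simp add: W.hit_self W_def)
   next
    case yv: False
    have le: "g D' (f(x := y)) ys <= g (D - {x}) f ys * of_bool (x \<notin> set ys)"
     if "ys \<in> \<Gamma>" "D' \<subseteq> D" "y \<notin> D'" for D' ys
     using spine_step[of D' f x y v n ys D] G(2)[OF that(1)] that yv by (auto simp: g_def)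
    show ?thesis
    proof (cases "y \<in> D")
     case True
     have "?R y <= ?h y + c0 + (\<Sum>ys\<in>\<Gamma>. al ys * g (D - {y}) (restrict (f(x := y)) (D - {y})) ys * H ys y)"
      using True by (simp add: U_def)
     also have "... <= ?S y"
     proof (intro add_mono order_refl sum_mono)
      fix ys assume ys: "ys \<in> \<Gamma>"
      have "g (D - {y}) (restrict (f(x := y)) (D - {y})) ys <= g (D - {y}) (f(x := y)) ys"
       using spine_mono[of "D - {y}" "restrict (f(x := y)) (D - {y})" v n ys "D - {y}" "f(x := y)"]
       by (auto simp: g_def)
      also have "... <= g (D - {x}) f ys * of_bool (x \<notin> set ys)" using ys by (intro le) auto
      finally have "g (D - {y}) (restrict (f(x := y)) (D - {y})) ys <=
        g (D - {x}) f ys * of_bool (x \<notin> set ys)" .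
      from mult_right_mono[OF mult_left_mono[OF this al0[OF ys]] H0[OF ys True]]
      show "al ys * g (D - {y}) (restrict (f(x := y)) (D - {y})) ys * H ys y <=
        al ys * (g (D - {x}) f ys * of_bool (x \<notin> set ys)) * ?K ys y"
       by (simp only: True if_True)
     qed
     finally show ?thesis .
    next
     case False
     have "?R y <= c0 + (\<Sum>ys\<in>\<Gamma>. al ys * g D (f(x := y)) ys)"
      using False by (simp add: W_def)
     also have "... <= c0 + (\<Sum>ys\<in>\<Gamma>. al ys * (g (D - {x}) f ys * of_bool (x \<notin> set ys)))"
      using False by (intro add_mono order_refl sum_mono mult_left_mono le al0) auto
     also have "... <= ?S y" using False W.hit_nonneg[OF D(1), of v y] by simp
     finally show ?thesis .
    qed
   qed
   have w0: "0 <= w x y" for y by (simp add: w_def)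
   have "(\<Sum>y\<in>nb w x. w x y * ?R y) <= (\<Sum>y\<in>nb w x. w x y * ?S y)"
    by (rule sum_mono, rule mult_left_mono[OF R2 w0])
   also have "... = (\<Sum>y\<in>nb w x. w x y * ?h y) + (\<Sum>y\<in>nb w x. w x y) * c0 +
     (\<Sum>ys\<in>\<Gamma>. al ys * (g (D - {x}) f ys * of_bool (x \<notin> set ys)) * (\<Sum>y\<in>nb w x. w x y * ?K ys y))"
    unfolding distrib_left sum.distrib sum_distrib_left sum_distrib_right
     sum.swap[where A = "nb w x" and B = \<Gamma>]
    by (simp only: mult_ac)
   also have "... <= dg * ?h x + dg * c0 +
     (\<Sum>ys\<in>\<Gamma>. al ys * (g (D - {x}) f ys * of_bool (x \<notin> set ys)) * (dg * H ys x))"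
   proof (intro add_mono sum_mono)
    show "(\<Sum>y\<in>nb w x. w x y * ?h y) <= dg * ?h x"
     using W.hit_harmonic[OF D(1) x, of v] by (simp add: csum_w)
    show "(\<Sum>y\<in>nb w x. w x y) * c0 <= dg * c0" using csum_w[of x] by (simp add: csum_def)
    fix ys assume ys: "ys \<in> \<Gamma>"
    show "al ys * (g (D - {x}) f ys * of_bool (x \<notin> set ys)) * (\<Sum>y\<in>nb w x. w x y * ?K ys y) <=
     al ys * (g (D - {x}) f ys * of_bool (x \<notin> set ys)) * (dg * H ys x)"
    proof (cases "x \<in> set ys")
     case False
     have "(\<Sum>y\<in>nb w x. w x y * ?K ys y) <= dg * H ys x"
      using Hs[OF ys x False] nb_split_sum[OF D(1), of x "H ys" 1] by simp
     then show ?thesis using al0[OF ys] g01 by (intro mult_left_mono mult_nonneg_nonneg) auto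
    qed simp
   qed
   also have "... <= dg * (?h x + c0 + (\<Sum>ys\<in>\<Gamma>. al ys * g (D - {x}) f ys * H ys x))"
    unfolding distrib_left sum_distrib_left
   proof (intro add_mono order_refl sum_mono)
    fix ys assume ys: "ys \<in> \<Gamma>"
    have "al ys * (g (D - {x}) f ys * of_bool (x \<notin> set ys)) * (dg * H ys x) <=
      al ys * (g (D - {x}) f ys * 1) * (dg * H ys x)"
     using al0[OF ys] g01 H0[OF ys x] by (intro mult_right_mono mult_left_mono) auto
    then show "al ys * (g (D - {x}) f ys * of_bool (x \<notin> set ys)) * (dg * H ys x) <=
     dg * (al ys * g (D - {x}) f ys * H ys x)" by (simp add: mult_ac)
   qed
   finally have two: "(\<Sum>y\<in>nb w x. w x y * ?R y) <=
     csum w x * (?h x + c0 + (\<Sum>ys\<in>\<Gamma>. al ys * g (D - {x}) f ys * H ys x))" by (simp add: csum_w)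
   show "(\<Sum>y\<in>nb w x. w x y * ?R y) <= csum w x * U x f"
    using one two x by (simp add: U_def min_def)
  qed
  also have "... <= fosum w D (%f. min 1 (hit w D v r + c0 + (\<Sum>ys\<in>\<Gamma>. al ys * g D f ys * H ys r)))"
  proof (rule W.fosum_mono)
   fix f
   have "g (D - {r}) (restrict f (D - {r})) ys <= g D f ys" for ys
    using spine_mono[of "D - {r}" "restrict f (D - {r})" v n ys D f] by (auto simp: g_def)
   then have "(\<Sum>ys\<in>\<Gamma>. al ys * g (D - {r}) (restrict f (D - {r})) ys * H ys r) <=
     (\<Sum>ys\<in>\<Gamma>. al ys * g D f ys * H ys r)"
    by (intro sum_mono mult_right_mono mult_left_mono al0 H0 r)
   then show "U r (restrict f (D - {r})) <= min 1 (hit w D v r + c0 + (\<Sum>ys\<in>\<Gamma>. al ys * g D f ys * H ys r))"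
    unfolding U_def using r by (auto simp: min_def)
  qed
  finally show ?thesis .
 qed
 have "b * fosum w D W = (\<Sum>r\<in>D. edeg D r * fosum w D W)" by (simp add: b_def sum_distrib_right)
 also have "... <= (\<Sum>r\<in>D. edeg D r * fosum w D (%f. min 1 (hit w D v r + c0 + (\<Sum>ys\<in>\<Gamma>. al ys * g D f ys * H ys r))))"
  by (intro sum_mono mult_left_mono stat edeg_nonneg D)
 also have "... = fosum w D (%f. \<Sum>r\<in>D. edeg D r * min 1 (hit w D v r + c0 + (\<Sum>ys\<in>\<Gamma>. al ys * g D f ys * H ys r)))"
  by (simp add: W.fosum_sum W.fosum_cmult)
 also have "... <= fosum w D (%f. b * M f)"
 proof (rule W.fosum_mono)
  fix f
  let ?X = "%r. hit w D v r + c0 + (\<Sum>ys\<in>\<Gamma>. al ys * g D f ys * H ys r)"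
  let ?L = "\<Sum>r\<in>D. edeg D r * min 1 (?X r)"
  have "?L <= (\<Sum>r\<in>D. edeg D r * 1)" by (intro sum_mono mult_left_mono edeg_nonneg D) auto
  then have 1: "?L <= b * 1" by (simp add: b_def)
  have "?L <= (\<Sum>r\<in>D. edeg D r * ?X r)" by (intro sum_mono mult_left_mono edeg_nonneg D) auto
  also have "... = (\<Sum>r\<in>D. edeg D r * hit w D v r) + b * c0 +
    (\<Sum>ys\<in>\<Gamma>. al ys * g D f ys * (\<Sum>r\<in>D. edeg D r * H ys r))"
   unfolding distrib_left sum.distrib sum_distrib_left sum_distrib_right b_def
    sum.swap[where A = D and B = \<Gamma>]
   by (simp only: mult_ac)
  also have "... <= dg + b * c0 + (\<Sum>ys\<in>\<Gamma>. al ys * g D f ys * (b - \<kappa> ys))"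
   using k al0 g01 unfolding b_def
   by (intro add_mono edeg_hit_sum D order_refl sum_mono mult_left_mono) auto
  also have "... = b * (dg / b + c0 + (\<Sum>ys\<in>\<Gamma>. al ys * (1 - \<kappa> ys / b) * g D f ys))"
   using b by (simp add: distrib_left sum_distrib_left) (auto intro!: sum.cong simp: field_simps)
  finally show "?L <= b * M f" using 1 b unfolding M_def by (simp add: min_def)
 qed
 also have "... = b * fosum w D M" by (rule W.fosum_cmult)
 finally have WM: "fosum w D W <= fosum w D M" using b by simp
 \<comment> \<open>Stationarity gives \<open>W\<close> \<le> \<open>M\<close> in mean; inserted in
   the averaged pointwise inequality, it leaves \<open>q\<close> times the claim.\<close>
 have "q * fosum w D \<psi> + (1 - q) * fosum w D M <= fosum w D W"
  using W.fosum_mono[of D "%f. q * \<psi> f + (1 - q) * M f" W, OF pt]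
  by (simp add: W.fosum_add W.fosum_cmult)
 moreover have "(1 - q) * fosum w D W <= (1 - q) * fosum w D M" using WM q by (intro mult_left_mono) auto
 ultimately have "q * fosum w D \<psi> <= q * fosum w D W" by (simp add: algebra_simps)
 then have "fosum w D \<psi> <= fosum w D W" using q by simp
 also have "... <= fosum w D (%f. c0 + (\<Sum>ys\<in>\<Gamma>. al ys * g D f ys))"
  by (rule W.fosum_mono) (auto simp: W_def)
 also have "... = c0 * partn w D + (\<Sum>ys\<in>\<Gamma>. al ys * fosum w D (%f. g D f ys))"
  by (simp add: W.fosum_add W.fosum_const W.fosum_sum W.fosum_cmult)
 finally show ?thesis by (simp add: \<psi>_def[abs_def] g_def c0_def al_def)
qed

end

lemma sum_plists_Suc:
 assumes D: "finite D"
 shows "(\<Sum>ys\<in>plists D (Suc n). F ys) = F [] + (\<Sum>y\<in>D. \<Sum>ys\<in>plists (D - {y}) n. F (y # ys))"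
proof -
 have eq: "plists D (Suc n) = insert [] ((%(y, ys). y # ys) ` (SIGMA y:D. plists (D - {y}) n))"
 proof (intro equalityI subsetI)
  fix zs assume zs: "zs \<in> plists D (Suc n)"
  show "zs \<in> insert [] ((%(y, ys). y # ys) ` (SIGMA y:D. plists (D - {y}) n))"
  proof (cases zs)
   case (Cons y ys)
   then show ?thesis using zs by (intro insertI2 image_eqI[of _ _ "(y, ys)"]) (auto simp: plists_def)
  qed simp
 qed (auto simp: plists_def)
 have fin: "finite (SIGMA y:D. plists (D - {y}) n)" using D by (intro finite_SigmaI finite_plists) auto
 have "(\<Sum>ys\<in>plists D (Suc n). F ys) = F [] + (\<Sum>ys\<in>(%(y, ys). y # ys) ` (SIGMA y:D. plists (D - {y}) n). F ys)"
  unfolding eq using fin by (subst sum.insert) auto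
 also have "(\<Sum>ys\<in>(%(y, ys). y # ys) ` (SIGMA y:D. plists (D - {y}) n). F ys) =
   (\<Sum>(y, ys)\<in>(SIGMA y:D. plists (D - {y}) n). F (y # ys))"
  by (subst sum.reindex) (auto simp: inj_on_def case_prod_unfold)
 also have "... = (\<Sum>y\<in>D. \<Sum>ys\<in>plists (D - {y}) n. F (y # ys))"
  using D by (intro sum.Sigma[symmetric]) (auto intro: finite_plists)
 finally show ?thesis .
qed

context tgraph
begin

section \<open>Energy and capacity of lines of descent\<close>

definition energy :: "'v list => real" where
 "energy ys = (\<Sum>u\<in>set ys. \<Sum>x\<in>set ys. gh u x)"

lemma gh_diag_pos: "0 < gh u u"
 using gh_self[of u] dg_pos gh_nonneg[of u u] by (cases "gh u u = 0") auto

lemma energy_pos: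
 assumes "ys ~= []"
 shows "0 < energy ys"
proof -
 have h: "hd ys \<in> set ys" using assms by simp
 have "0 < gh (hd ys) (hd ys)" by (rule gh_diag_pos)
 also have "... <= (\<Sum>x\<in>set ys. gh (hd ys) x)"
  by (rule member_le_sum[OF h]) (auto simp: gh_nonneg)
 also have "... <= energy ys"
  unfolding energy_def
  by (rule member_le_sum[OF h, of "%u. \<Sum>x\<in>set ys. gh u x"]) (auto intro: sum_nonneg gh_nonneg)
 finally show ?thesis .
qed

text \<open>Half of the points of \<open>ys\<close> have potential at most twice the average; \<open>H\<close> is one minus the
 normalized potential of these points.\<close>

lemma capacity_bound:
 assumes D: "finite D" "set ys \<subseteq> D" "distinct ys" "ys ~= []"
 shows "\<exists>H :: 'v => real. (\<forall>x\<in>D. 0 <= H x) &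
  (\<forall>x\<in>D. x \<notin> set ys --> (\<Sum>y\<in>D. w x y * H y) + edeg D x <= dg * H x) &
  (\<Sum>x\<in>D. edeg D x * H x) <= (\<Sum>x\<in>D. edeg D x) - (real (length ys))\<^sup>2 / (4 * energy ys)"
proof -
 define l where "l = real (length ys)"
 have l: "0 < l" using D by (simp add: l_def)
 have En: "0 < energy ys" by (rule energy_pos[OF D(4)])
 define K where "K = 2 * energy ys / l"
 have K: "0 < K" using l En by (simp add: K_def)
 define C where "C = {u \<in> set ys. (\<Sum>x\<in>set ys. gh u x) <= K}"
 have CD: "C \<subseteq> D" "finite C" using D by (auto simp: C_def)
 have "card (set ys - C) * K = (\<Sum>u\<in>set ys - C. K)" by simp
 also have "... <= (\<Sum>u\<in>set ys - C. \<Sum>x\<in>set ys. gh u x)" by (intro sum_mono) (auto simp: C_def)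
 also have "... <= energy ys" unfolding energy_def
  by (intro sum_mono2) (auto intro: sum_nonneg gh_nonneg)
 finally have "card (set ys - C) <= l / 2" using l En by (simp add: K_def field_simps)
 moreover have "real (card (set ys - C)) = l - card C"
 proof -
  have "card C <= card (set ys)" by (intro card_mono) (auto simp: C_def)
  then show ?thesis using D(3) CD by (subst card_Diff_subset) (auto simp: C_def l_def distinct_card of_nat_diff)
 qed
 ultimately have cC: "l / 2 <= card C" by simp
 define pot where "pot x = (\<Sum>u\<in>C. green w D x u)" for x
 have Lpot: "dg * pot x - (\<Sum>y\<in>D. w x y * pot y) = of_bool (x \<in> C)" if x: "x \<in> D" for x
 proof -
  have "dg * pot x - (\<Sum>y\<in>D. w x y * pot y) =
    (\<Sum>u\<in>C. dg * green w D x u - (\<Sum>y\<in>D. w x y * green w D y u))"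
   unfolding pot_def sum_subtractf sum_distrib_left by (subst (2) sum.swap) simp
  also have "... = (\<Sum>u\<in>C. of_bool (x = u))"
   using CD(1) by (intro sum.cong refl W.green_eq[OF D(1) _ x, unfolded csum_w]) auto
  also have "... = of_bool (x \<in> C)" using CD by (simp add: of_bool_def)
  finally show ?thesis .
 qed
 have potC: "pot x <= K" if x: "x \<in> C" for x
 proof -
  have "pot x <= (\<Sum>u\<in>C. gh x u)" unfolding pot_def by (intro sum_mono green_le_gh D)
  also have "... <= (\<Sum>u\<in>set ys. gh x u)" by (intro sum_mono2) (auto simp: C_def gh_nonneg)
  finally show ?thesis using x by (simp add: C_def)
 qed
 \<comment> \<open>On \<open>C\<close> the potential is at most \<open>K\<close>; off
   \<open>C\<close> it is harmonic, so the maximum principle carries the bound to all of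
   \<open>D\<close>.\<close>
 have pot: "0 <= K - pot x" if x: "x \<in> D" for x
 proof (cases "x \<in> C")
  case False
  show ?thesis
  proof (rule W.max_principle[of "D - C" "%x. K - pot x"])
   fix x assume x: "x \<in> D - C"
   have "(\<Sum>y\<in>D - C. w x y * (K - pot y)) <= (\<Sum>y\<in>D. w x y * (K - pot y))"
    using D potC by (intro sum_mono2) (auto simp: w_def)
   also have "... = (\<Sum>y\<in>D. w x y) * K - (\<Sum>y\<in>D. w x y * pot y)"
    by (simp add: algebra_simps sum_subtractf sum_distrib_left)
   also have "... <= dg * K - dg * pot x"
    using Lpot[of x] x sum_w_le[OF D(1), of x] K by (intro diff_mono mult_right_mono) auto
   finally show "(\<Sum>y\<in>D - C. w x y * (K - pot y)) <= csum w x * (K - pot x)"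
    by (simp add: csum_w algebra_simps)
  qed (use D False x in auto)
 qed (use potC in auto)
 define H where "H x = 1 - pot x / K" for x
 have "0 <= H x" if "x \<in> D" for x using pot[OF that] K by (simp add: H_def field_simps)
 moreover have "(\<Sum>y\<in>D. w x y * H y) + edeg D x <= dg * H x" if "x \<in> D" "x \<notin> set ys" for x
 proof -
  have "(\<Sum>y\<in>D. w x y * H y) = (\<Sum>y\<in>D. w x y) - (\<Sum>y\<in>D. w x y * pot y) / K"
   by (simp add: H_def algebra_simps sum_subtractf sum_divide_distrib)
  moreover have "(\<Sum>y\<in>D. w x y * pot y) = dg * pot x" using Lpot[OF that(1)] that(2) by (auto simp: C_def)
  ultimately show ?thesis by (simp add: H_def edeg_def algebra_simps)
 qed
 moreover have "(\<Sum>x\<in>D. edeg D x * H x) <= (\<Sum>x\<in>D. edeg D x) - l\<^sup>2 / (4 * energy ys)"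
 proof -
  \<comment> \<open>The boundary flux of the potential counts the points of \<open>C\<close>, at
    least half of the length. Divided by \<open>K\<close>, it is the rate at which walks are stopped
    by \<open>C\<close>.\<close>
  have "(\<Sum>x\<in>D. edeg D x * pot x) = (\<Sum>x\<in>D. of_bool (x \<in> C))"
   unfolding divergence[OF D(1), symmetric] by (intro sum.cong) (auto simp: Lpot)
  also have "... = card C" using CD D(1) by (simp add: of_bool_def sum.If_cases Int_absorb1)
  finally have c: "(\<Sum>x\<in>D. edeg D x * pot x) = card C" .
  have "l\<^sup>2 / (4 * energy ys) = (l / 2) / K" using l En by (simp add: K_def power2_eq_square)
  also have "... <= card C / K" using cC K by (intro divide_right_mono) auto
  finally show ?thesis
   by (simp add: H_def algebra_simps sum_subtractf c[symmetric] sum_divide_distrib)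
 qed
 ultimately show ?thesis unfolding l_def by (intro exI[of _ H] conjI ballI impI)
qed

lemma sum_pw_le':
 assumes "finite D" "v \<notin> D" "n <= N" "1 <= N"
 shows "(\<Sum>ys\<in>plists D n. pw w D v ys) <= CS * N"
proof -
 have "(\<Sum>ys\<in>plists D n. pw w D v ys) <= (\<Sum>ys\<in>plists D N. pw w D v ys)"
  using assms by (intro sum_mono2 finite_plists W.pw_nonneg) (auto simp: plists_def)
 then show ?thesis using sum_pw_le[of D v N] assms by simp
qed

lemma pw_Cons': "finite D ==> pw w D v (y # ys) = pw w D v [y] * pw w (D - {y}) y ys"
 using W.pw_append[of D v "[y]" ys] by simp

lemma mult_add_swap: "a * (p * k + k * s) = k * (a * (s + p))" for a p k s :: real
 by (simp add: algebra_simps)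

definition lastv :: "('v => real) => 'v list => real" where
 "lastv \<phi> ys = (if ys = [] then 0 else \<phi> (last ys))"

text \<open>Cut the path at the marked vertex \<open>u\<close>: the first part is a path ending at
  \<open>u\<close>, and the continuations sum to at most \<open>CS * N\<close> in the remaining
  domain. \<open>lastv\<close> vanishes on the empty path, which has no vertex to mark.\<close>

lemma sum_pw_points:
 fixes N :: nat
 assumes phi: "!!x. 0 <= \<phi> x" and N: "1 <= N"
 shows "finite D ==> v \<notin> D ==> n <= N ==>
  (\<Sum>ys\<in>plists D n. pw w D v ys * (\<Sum>u\<in>set ys. \<phi> u)) <=
  CS * N * (\<Sum>ys\<in>plists D n. pw w D v ys * lastv \<phi> ys)"
proof (induction n arbitrary: D v)
 case 0
 have "plists D 0 = {[]}" by (auto simp: plists_def)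
 then show ?case by (simp add: lastv_def)
next
 case (Suc n D v)
 have cs: "0 <= CS * N" using CS_ge by simp
 let ?p = "%y ys. pw w (D - {y}) y ys"
 have "(\<Sum>ys\<in>plists D (Suc n). pw w D v ys * (\<Sum>u\<in>set ys. \<phi> u)) =
   (\<Sum>y\<in>D. \<Sum>ys\<in>plists (D - {y}) n. pw w D v (y # ys) * (\<Sum>u\<in>set (y # ys). \<phi> u))"
  using Suc.prems by (subst sum_plists_Suc) auto
 also have "... = (\<Sum>y\<in>D. pw w D v [y] * (\<phi> y * (\<Sum>ys\<in>plists (D - {y}) n. ?p y ys) +
   (\<Sum>ys\<in>plists (D - {y}) n. ?p y ys * (\<Sum>u\<in>set ys. \<phi> u))))"
 proof (rule sum.cong[OF refl])
  fix y assume y: "y \<in> D"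
  have "(\<Sum>ys\<in>plists (D - {y}) n. pw w D v (y # ys) * (\<Sum>u\<in>set (y # ys). \<phi> u)) =
   (\<Sum>ys\<in>plists (D - {y}) n. pw w D v [y] * (?p y ys * \<phi> y + ?p y ys * (\<Sum>u\<in>set ys. \<phi> u)))"
  proof (rule sum.cong[OF refl])
   fix ys assume "ys \<in> plists (D - {y}) n"
   then have "y \<notin> set ys" by (auto simp: plists_def)
   then show "pw w D v (y # ys) * (\<Sum>u\<in>set (y # ys). \<phi> u) =
     pw w D v [y] * (?p y ys * \<phi> y + ?p y ys * (\<Sum>u\<in>set ys. \<phi> u))"
    using pw_Cons'[OF Suc.prems(1), of v y ys] by (simp add: algebra_simps)
  qed
  also have "... = pw w D v [y] * ((\<Sum>ys\<in>plists (D - {y}) n. ?p y ys * \<phi> y) +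
    (\<Sum>ys\<in>plists (D - {y}) n. ?p y ys * (\<Sum>u\<in>set ys. \<phi> u)))"
   by (simp only: sum_distrib_left[of "pw w D v [y]" _ "plists (D - {y}) n"] sum.distrib distrib_left)
  also have "(\<Sum>ys\<in>plists (D - {y}) n. ?p y ys * \<phi> y) = \<phi> y * (\<Sum>ys\<in>plists (D - {y}) n. ?p y ys)"
   by (subst sum_distrib_left) (simp only: mult.commute)
  finally show "(\<Sum>ys\<in>plists (D - {y}) n. pw w D v (y # ys) * (\<Sum>u\<in>set (y # ys). \<phi> u)) =
   pw w D v [y] * (\<phi> y * (\<Sum>ys\<in>plists (D - {y}) n. ?p y ys) +
   (\<Sum>ys\<in>plists (D - {y}) n. ?p y ys * (\<Sum>u\<in>set ys. \<phi> u)))" .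
 qed
 also have "... <= (\<Sum>y\<in>D. pw w D v [y] * (\<phi> y * (CS * N) +
   CS * N * (\<Sum>ys\<in>plists (D - {y}) n. ?p y ys * lastv \<phi> ys)))"
  using Suc.prems N by (intro sum_mono mult_left_mono add_mono sum_pw_le' phi W.pw_nonneg Suc.IH) auto
 also have "... = CS * N * (\<Sum>y\<in>D. pw w D v [y] * (\<Sum>ys\<in>plists (D - {y}) n. ?p y ys * \<phi> (last (y # ys))))"
  unfolding sum_distrib_left[of "CS * N" "%y. pw w D v [y] * (\<Sum>ys\<in>plists (D - {y}) n. ?p y ys * \<phi> (last (y # ys)))" D]
 proof (rule sum.cong[OF refl])
  fix y assume y: "y \<in> D"
  have "(\<Sum>ys\<in>plists (D - {y}) n. ?p y ys * \<phi> (last (y # ys))) =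
   (\<Sum>ys\<in>plists (D - {y}) n. ?p y ys * lastv \<phi> ys) + (\<Sum>ys\<in>plists (D - {y}) n. if ys = [] then \<phi> y else 0)"
   unfolding sum.distrib[symmetric] using Suc.prems by (intro sum.cong) (auto simp: lastv_def)
  also have "(\<Sum>ys\<in>plists (D - {y}) n. if ys = [] then \<phi> y else 0) = \<phi> y"
   using Suc.prems finite_plists[of "D - {y}" n] by (simp add: plists_def)
  finally have eq: "(\<Sum>ys\<in>plists (D - {y}) n. ?p y ys * \<phi> (last (y # ys))) =
   (\<Sum>ys\<in>plists (D - {y}) n. ?p y ys * lastv \<phi> ys) + \<phi> y" .
  show "pw w D v [y] * (\<phi> y * (CS * N) + CS * N * (\<Sum>ys\<in>plists (D - {y}) n. ?p y ys * lastv \<phi> ys)) =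
   CS * N * (pw w D v [y] * (\<Sum>ys\<in>plists (D - {y}) n. ?p y ys * \<phi> (last (y # ys))))"
   unfolding eq by (rule mult_add_swap)
 qed
 also have "(\<Sum>y\<in>D. pw w D v [y] * (\<Sum>ys\<in>plists (D - {y}) n. ?p y ys * \<phi> (last (y # ys)))) =
   (\<Sum>ys\<in>plists D (Suc n). pw w D v ys * lastv \<phi> ys)"
 proof -
  have "(\<Sum>ys\<in>plists (D - {y}) n. pw w D v (y # ys) * lastv \<phi> (y # ys)) =
   pw w D v [y] * (\<Sum>ys\<in>plists (D - {y}) n. ?p y ys * \<phi> (last (y # ys)))" for y
   unfolding sum_distrib_left
  proof (rule sum.cong[OF refl])
   fix ys
   show "pw w D v (y # ys) * lastv \<phi> (y # ys) = pw w D v [y] * (?p y ys * \<phi> (last (y # ys)))"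
    unfolding pw_Cons'[OF Suc.prems(1), of v y ys] by (simp add: lastv_def)
  qed
  then show ?thesis unfolding sum_plists_Suc[OF Suc.prems(1)] by (simp add: lastv_def)
 qed
 finally show ?case .
qed

lemma hit_le_gh:
 assumes D: "finite D" "v \<notin> D" "x \<in> D"
 shows "hit w D v x <= dg * gh x v"
proof -
 let ?D = "insert v D"
 have e: "?D - {v} = D" using D by auto
 have "hit w D v x * 1 <= hit w D v x * (dg * green w ?D v v)"
  using W.green_diag_ge[of ?D v] D by (intro mult_left_mono W.hit_nonneg) (auto simp: csum_w)
 also have "... = dg * green w ?D x v" using W.green_hit[of ?D v x] D e by simp
 also have "... <= dg * gh x v" using D by (intro mult_left_mono green_le_gh) auto
 finally show ?thesis by simp
qed

lemma sum_pw_lastv: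
 assumes D: "finite D" "v \<notin> D" and phi: "!!x. 0 <= \<phi> x"
 shows "(\<Sum>ys\<in>plists D n. pw w D v ys * lastv \<phi> ys) <= (\<Sum>x\<in>D. hit w D v x * \<phi> x)"
proof -
 let ?p = "%x. if x = v then 0 else \<phi> x"
 have "(\<Sum>ys\<in>plists D n. pw w D v ys * lastv \<phi> ys) = (\<Sum>ys\<in>plists D n. pw w D v ys * ?p (last (v # ys)))"
 proof (rule sum.cong[OF refl])
  fix ys assume ys: "ys \<in> plists D n"
  then have "last ys ~= v" if "ys ~= []" using last_in_set[OF that] D by (auto simp: plists_def)
  then show "pw w D v ys * lastv \<phi> ys = pw w D v ys * ?p (last (v # ys))" by (auto simp: lastv_def)
 qed
 also have "... <= ?p v + (\<Sum>x\<in>D. hit w D v x * ?p x)" by (rule W.sum_paths_le[OF D]) (simp add: phi)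
 also have "... = (\<Sum>x\<in>D. hit w D v x * \<phi> x)" using D by (auto intro!: sum.cong)
 finally show ?thesis .
qed

text \<open>By \<open>sum_pw_points\<close> the marked vertex becomes an endpoint. It is reached
  with probability \<open>hit\<close>, at most \<open>dg * gh\<close>, and the product with
  \<open>gh v\<close> is the bubble.\<close>

lemma sum_pw_head:
 fixes N :: nat
 assumes D: "finite D" "v \<notin> D" "n <= N" "1 <= N"
 shows "(\<Sum>ys\<in>plists D n. pw w D v ys * (\<Sum>u\<in>set ys. gh v u)) <= CS * N * (dg * B)"
proof -
 have "(\<Sum>ys\<in>plists D n. pw w D v ys * (\<Sum>u\<in>set ys. gh v u)) <=
  CS * N * (\<Sum>ys\<in>plists D n. pw w D v ys * lastv (gh v) ys)"
  by (rule sum_pw_points) (use D gh_nonneg in auto)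
 also have "... <= CS * N * (\<Sum>x\<in>D. hit w D v x * gh v x)"
  using CS_ge by (intro mult_left_mono sum_pw_lastv D gh_nonneg) auto
 also have "... <= CS * N * (\<Sum>x\<in>D. dg * (gh x v)\<^sup>2)"
 proof (intro mult_left_mono sum_mono)
  fix x assume "x \<in> D"
  then have "hit w D v x * gh v x <= dg * gh x v * gh v x"
   using D by (intro mult_right_mono hit_le_gh gh_nonneg)
  then show "hit w D v x * gh v x <= dg * (gh x v)\<^sup>2" using gh_sym[of v x] by (simp add: power2_eq_square mult.assoc)
 qed (use CS_ge in simp)
 also have "... <= CS * N * (dg * B)"
  using gh_bubble[OF D(1), of v] CS_ge by (simp add: sum_distrib_left[symmetric] mult_left_mono)
 finally show ?thesis .
qed

primrec offd :: "'v list => real" where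
 "offd [] = 0"
| "offd (y # ys) = (\<Sum>u\<in>set ys. gh y u) + offd ys"

text \<open>For a pair of path vertices take the earlier one as a new root and apply
  \<open>sum_pw_head\<close> to the rest of the path.\<close>

lemma sum_pw_offd:
 fixes N :: nat
 assumes N: "1 <= N"
 shows "finite D ==> v \<notin> D ==> n <= N ==>
  (\<Sum>ys\<in>plists D n. pw w D v ys * offd ys) <=
  CS * N * (dg * B) * (\<Sum>ys\<in>plists D n. pw w D v ys * of_bool (ys ~= []))"
proof (induction n arbitrary: D v)
 case 0
 have "plists D 0 = {[]}" by (auto simp: plists_def)
 then show ?case by simp
next
 case (Suc n D v)
 let ?p = "%y ys. pw w (D - {y}) y ys" and ?h = "CS * N * (dg * B)"
 have h: "0 <= ?h" using CS_ge B_pos by simp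
 have "(\<Sum>ys\<in>plists D (Suc n). pw w D v ys * offd ys) =
   (\<Sum>y\<in>D. \<Sum>ys\<in>plists (D - {y}) n. pw w D v [y] * (?p y ys * (\<Sum>u\<in>set ys. gh y u) + ?p y ys * offd ys))"
 proof -
  have "(\<Sum>ys\<in>plists (D - {y}) n. pw w D v (y # ys) * offd (y # ys)) =
   (\<Sum>ys\<in>plists (D - {y}) n. pw w D v [y] * (?p y ys * (\<Sum>u\<in>set ys. gh y u) + ?p y ys * offd ys))" for y
  proof (rule sum.cong[OF refl])
   fix ys
   show "pw w D v (y # ys) * offd (y # ys) =
    pw w D v [y] * (?p y ys * (\<Sum>u\<in>set ys. gh y u) + ?p y ys * offd ys)"
    unfolding pw_Cons'[OF Suc.prems(1), of v y ys] by (simp add: algebra_simps)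
  qed
  then show ?thesis unfolding sum_plists_Suc[OF Suc.prems(1)] by simp
 qed
 also have "... = (\<Sum>y\<in>D. pw w D v [y] * ((\<Sum>ys\<in>plists (D - {y}) n. ?p y ys * (\<Sum>u\<in>set ys. gh y u)) +
   (\<Sum>ys\<in>plists (D - {y}) n. ?p y ys * offd ys)))"
  by (simp only: sum_distrib_left sum.distrib distrib_left)
 also have "... <= (\<Sum>y\<in>D. pw w D v [y] * (?h + ?h * (\<Sum>ys\<in>plists (D - {y}) n. ?p y ys * of_bool (ys ~= []))))"
  using Suc.prems N by (intro sum_mono mult_left_mono add_mono sum_pw_head W.pw_nonneg Suc.IH) auto
 also have "... = ?h * (\<Sum>y\<in>D. pw w D v [y] * (\<Sum>ys\<in>plists (D - {y}) n. ?p y ys))"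
  unfolding sum_distrib_left[of ?h "%y. pw w D v [y] * (\<Sum>ys\<in>plists (D - {y}) n. ?p y ys)" D]
 proof (rule sum.cong[OF refl])
  fix y assume y: "y \<in> D"
  have "(\<Sum>ys\<in>plists (D - {y}) n. ?p y ys) =
   (\<Sum>ys\<in>plists (D - {y}) n. ?p y ys * of_bool (ys ~= [])) + (\<Sum>ys\<in>plists (D - {y}) n. if ys = [] then 1 else 0)"
   unfolding sum.distrib[symmetric] using Suc.prems by (intro sum.cong) auto
  also have "(\<Sum>ys\<in>plists (D - {y}) n. if ys = [] then 1 else 0) = (1::real)"
   using Suc.prems finite_plists[of "D - {y}" n] by (simp add: plists_def)
  finally have eq: "(\<Sum>ys\<in>plists (D - {y}) n. ?p y ys) =
   (\<Sum>ys\<in>plists (D - {y}) n. ?p y ys * of_bool (ys ~= [])) + 1" .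
  show "pw w D v [y] * (?h + ?h * (\<Sum>ys\<in>plists (D - {y}) n. ?p y ys * of_bool (ys ~= []))) =
   ?h * (pw w D v [y] * (\<Sum>ys\<in>plists (D - {y}) n. ?p y ys))"
   unfolding eq using mult_add_swap[of "pw w D v [y]" 1 ?h] by simp
 qed
 also have "(\<Sum>y\<in>D. pw w D v [y] * (\<Sum>ys\<in>plists (D - {y}) n. ?p y ys)) =
   (\<Sum>ys\<in>plists D (Suc n). pw w D v ys * of_bool (ys ~= []))"
 proof -
  have "(\<Sum>ys\<in>plists (D - {y}) n. pw w D v (y # ys) * of_bool (y # ys ~= [])) =
   pw w D v [y] * (\<Sum>ys\<in>plists (D - {y}) n. ?p y ys)" for y
   unfolding sum_distrib_left
  proof (rule sum.cong[OF refl])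
   fix ys
   show "pw w D v (y # ys) * of_bool (y # ys ~= []) = pw w D v [y] * ?p y ys"
    unfolding pw_Cons'[OF Suc.prems(1), of v y ys] by simp
  qed
  then show ?thesis unfolding sum_plists_Suc[OF Suc.prems(1)] by simp
 qed
 finally show ?case .
qed

lemma energy_eq: "distinct ys ==> energy ys = (\<Sum>u\<in>set ys. gh u u) + 2 * offd ys"
proof (induction ys)
 case (Cons y ys)
 have "energy (y # ys) = gh y y + (\<Sum>x\<in>set ys. gh y x) + (\<Sum>u\<in>set ys. gh u y) + energy ys"
  using Cons by (simp add: energy_def sum.distrib)
 also have "(\<Sum>u\<in>set ys. gh u y) = (\<Sum>u\<in>set ys. gh y u)" by (intro sum.cong refl gh_sym)
 finally show ?case using Cons by simp
qed (simp add: energy_def)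

lemma gh_diag_le: "gh u u <= 1 + B"
proof -
 have "gh u u <= 1 + (gh u u)\<^sup>2" using zero_le_power2[of "gh u u - 1"] gh_nonneg[of u u]
  by (simp add: power2_eq_square algebra_simps)
 also have "(gh u u)\<^sup>2 <= B" using gh_bubble[of "{u}" u] by simp
 finally show ?thesis by simp
qed

definition CE :: real where "CE = CS * (1 + B) + 2 * dg * B * CS\<^sup>2"

lemma CE_pos: "0 < CE" using CS_ge B_pos dg_pos by (simp add: CE_def add_pos_nonneg)

text \<open>Compared with the bound \<open>CS * N\<close> on the total weight of the paths, this
  allows an energy of order \<open>N\<close> per path, so that a path of length about
  \<open>N\<close> has capacity of the order of its length.\<close>

lemma sum_pw_energy:
 assumes D: "finite D" "v \<notin> D" "1 <= N"
 shows "(\<Sum>ys\<in>plists D N. pw w D v ys * energy ys) <= CE * (real N)\<^sup>2"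
proof -
 have "(\<Sum>ys\<in>plists D N. pw w D v ys * energy ys) <=
  (\<Sum>ys\<in>plists D N. pw w D v ys * (N * (1 + B)) + 2 * (pw w D v ys * offd ys))"
 proof (rule sum_mono)
  fix ys assume ys: "ys \<in> plists D N"
  have "(\<Sum>u\<in>set ys. gh u u) <= (\<Sum>u\<in>set ys. 1 + B)" by (intro sum_mono gh_diag_le)
  also have "... = card (set ys) * (1 + B)" by simp
  also have "... <= N * (1 + B)" using ys B_pos by (intro mult_right_mono) (auto simp: plists_def distinct_card)
  finally have "energy ys <= N * (1 + B) + 2 * offd ys" using ys by (simp add: energy_eq plists_def)
  from mult_left_mono[OF this W.pw_nonneg[OF D(1)]]
  show "pw w D v ys * energy ys <= pw w D v ys * (N * (1 + B)) + 2 * (pw w D v ys * offd ys)"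
   by (simp add: algebra_simps)
 qed
 also have "... = (\<Sum>ys\<in>plists D N. pw w D v ys) * (N * (1 + B)) + 2 * (\<Sum>ys\<in>plists D N. pw w D v ys * offd ys)"
  by (simp add: sum.distrib sum_distrib_left sum_distrib_right)
 also have "... <= (CS * N) * (N * (1 + B)) + 2 * (CS * N * (dg * B) * (CS * N))"
 proof (intro add_mono mult_right_mono mult_left_mono sum_pw_le D)
  have "(\<Sum>ys\<in>plists D N. pw w D v ys * offd ys) <=
    CS * N * (dg * B) * (\<Sum>ys\<in>plists D N. pw w D v ys * of_bool (ys ~= []))"
   using D by (intro sum_pw_offd) auto
  also have "... <= CS * N * (dg * B) * (\<Sum>ys\<in>plists D N. pw w D v ys)"
   using CS_ge B_pos by (intro mult_left_mono sum_mono) (auto simp: W.pw_nonneg D)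
  also have "... <= CS * N * (dg * B) * (CS * N)"
   using CS_ge B_pos D by (intro mult_left_mono sum_pw_le) auto
  finally show "(\<Sum>ys\<in>plists D N. pw w D v ys * offd ys) <= CS * N * (dg * B) * (CS * N)" .
 qed (use B_pos in auto)
 also have "... = CE * (real N)\<^sup>2" by (simp add: CE_def power2_eq_square algebra_simps)
 finally show ?thesis .
qed

end

section \<open>The tail of the height of the tree\<close>

lemma chain_take: "chain D f v ys ==> chain D f v (take m ys)"
 using chain_append[of D f v "take m ys" "drop m ys"] unfolding append_take_drop_id by blast

lemma chain_drop: "chain D f v ys ==> chain D f (last (v # take m ys)) (drop m ys)"
 using chain_append[of D f v "take m ys" "drop m ys"] unfolding append_take_drop_id by blast

context tgraph
begin

text \<open>Given the chain \<open>ys\<close>, the event below its end lives in a fresh forest of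
  \<open>D - set ys\<close> (\<open>fosum_chain\<close>), where the bound \<open>q\<close>, uniform
  in the domain, applies.\<close>

lemma spine_factor:
 assumes D: "finite D" "v \<notin> D" "set ys \<subseteq> D" "distinct ys" "ys ~= []"
  and q: "!!D v. finite D ==> v \<notin> D ==> fosum w D (%f. of_bool (P D f v)) <= q * partn w D"
  and imp: "!!f. Q f ==> chain D f v ys & P (D - set ys) (restrict f (D - set ys)) (last ys)"
 shows "fosum w D (%f. of_bool (Q f)) <= q * pw w D v ys * partn w D"
proof -
 have "fosum w D (%f. of_bool (Q f)) <=
   fosum w D (%f. of_bool (chain D f v ys) * of_bool (P (D - set ys) (restrict f (D - set ys)) (last ys)))"
  using imp by (intro W.fosum_mono) auto
 also have "... = pathc w v ys * fosum w (D - set ys) (%g. of_bool (P (D - set ys) g (last ys)))"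
  by (rule W.fosum_chain[OF D(1-4)])
 also have "... <= pathc w v ys * (q * partn w (D - set ys))"
  using D by (intro mult_left_mono q W.pathc_nonneg) auto
 also have "... = q * pw w D v ys * partn w D"
  using W.partn_pos[OF D(1)] by (simp add: pw_def)
 finally show ?thesis .
qed

lemma chain_rest:
 assumes v: "v \<notin> D" and c: "chain D f v ys" "chain D f (last (v # ys)) zs"
 shows "chain (D - set ys) (restrict f (D - set ys)) (last (v # ys)) zs"
proof -
 have ap: "chain D f v (ys @ zs)" using c by (simp add: chain_append)
 have "distinct (ys @ zs)" by (rule chain_distinct[OF v ap])
 then have s: "set zs \<subseteq> D - set ys" using chain_subset[OF ap] by auto
 then have "chain D f (last (v # ys)) zs =
   chain (D - set ys) (restrict f (D - set ys)) (last (v # ys)) zs"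
  by (intro chain_cong) auto
 then show ?thesis using c by simp
qed

lemma spine_rest:
 assumes "v \<notin> D" "spine D f v n ys" "ys ~= []"
 shows "chain D f v ys & tall (D - set ys) (restrict f (D - set ys)) (last ys) n"
 using assms chain_rest[OF assms(1), of f ys] by (auto simp: spine_def tall_def)

text \<open>A chain of length \<open>3 * n\<close> has \<open>n\<close> prefixes with length between \<open>n\<close> and \<open>2 * n\<close>.\<close>

lemma tall_prefixes:
 assumes D: "finite D" "v \<notin> D" and n: "1 <= n"
 shows "of_bool (tall D f v (3 * n)) <=
  min 1 (\<Sum>ys\<in>{ys \<in> plists D (2 * n). n < length ys}. (1 / real n) * of_bool (spine D f v n ys))"
proof (cases "tall D f v (3 * n)")
 case True
 let ?G = "{ys \<in> plists D (2 * n). n < length ys}"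
 obtain zs where zs: "chain D f v zs" "length zs = 3 * n" using True by (auto simp: tall_def)
 have sp: "take l zs \<in> {ys \<in> ?G. spine D f v n ys}" if l: "l \<in> {n<..2 * n}" for l
 proof -
  have c: "chain D f v (take l zs)" "chain D f (last (v # take l zs)) (drop l zs)"
   using chain_take[OF zs(1)] chain_drop[OF zs(1)] by blast+
  have "chain D f (last (v # take l zs)) (take n (drop l zs))" by (rule chain_take[OF c(2)])
  moreover have "length (take n (drop l zs)) = n" using zs l by auto
  ultimately have "tall D f (last (v # take l zs)) n" unfolding tall_def by blast
  then show ?thesis using c(1) chain_plists[OF D(2) c(1), of "2 * n"] zs l by (auto simp: spine_def)
 qed
 have inj: "inj_on (%l. take l zs) {n<..2 * n}"
 proof (rule inj_onI)
  fix a b assume "a \<in> {n<..2 * n}" "b \<in> {n<..2 * n}" and eq: "take a zs = take b zs"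
  then have "a <= length zs" "b <= length zs" using zs by auto
  then show "a = b" using arg_cong[OF eq, of length] by simp
 qed
 have fin: "finite ?G" using D by (simp add: finite_plists)
 have "real n = card ((%l. take l zs) ` {n<..2 * n})" using inj by (simp add: card_image)
 also have "... <= card {ys \<in> ?G. spine D f v n ys}"
 proof (intro of_nat_mono card_mono)
  show "finite {ys \<in> ?G. spine D f v n ys}" by (rule finite_subset[OF _ fin]) auto
  show "(%l. take l zs) ` {n<..2 * n} \<subseteq> {ys \<in> ?G. spine D f v n ys}" using sp by blast
 qed
 finally have "real n <= card {ys \<in> ?G. spine D f v n ys}" .
 then have "1 <= (1 / real n) * card {ys \<in> ?G. spine D f v n ys}" using n by (simp add: field_simps)
 also have "... = (\<Sum>ys\<in>{ys \<in> ?G. spine D f v n ys}. (1 / real n) * of_bool (spine D f v n ys))" by simp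
 also have "... = (\<Sum>ys\<in>?G. (1 / real n) * of_bool (spine D f v n ys))"
  using fin by (intro sum.mono_neutral_left) auto
 finally show ?thesis using True by simp
next
 case False
 then show ?thesis by (auto intro!: sum_nonneg)
qed

text \<open>Use \<open>excursion_bound\<close> with \<epsilon> = \<open>lam / n\<close> and weight
  \<open>1 / n\<close> on the prefixes longer than \<open>n\<close>. New branches cost
  \<open>dg * lam / n\<close>. A prefix is hit at rate at least
  \<open>n\<^sup>2 / (4 * energy ys)\<close>, and the mean energy turns this into the factor
  \<open>16 * CE / lam\<close> on the previous bound.\<close>

lemma tall_recursion:
 fixes lam q :: real
 assumes n: "1 <= n" and lam: "0 < lam" and q0: "0 <= q"
  and q: "!!D v. finite D ==> v \<notin> D ==> fosum w D (%f. of_bool (tall D f v n)) <= q * partn w D"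
  and D: "finite D" "v \<notin> D"
 shows "fosum w D (%f. of_bool (tall D f v (3 * n))) <= (dg * lam / n + 16 * CE / lam * q) * partn w D"
proof (cases "D = {}")
 case True
 have "\<not> tall D f v (3 * n)" for f
 proof
  assume "tall D f v (3 * n)"
  then obtain ys where "chain D f v ys" "length ys = 3 * n" by (auto simp: tall_def)
  then show False using chain_subset[of D f v ys] True n by auto
 qed
 then have "fosum w D (%f. of_bool (tall D f v (3 * n))) = 0" by (simp add: fosum_def)
 then show ?thesis using W.partn_pos[OF D(1)] lam q0 CE_pos by (simp add: less_imp_le)
next
 case ne: False
 define G where "G = {ys \<in> plists D (2 * n). n < length ys}"
 have G: "finite G" "!!ys. ys \<in> G ==> ys ~= []" using D by (auto simp: G_def finite_plists)
 have ys: "set ys \<subseteq> D" "distinct ys" "ys ~= []" "ys \<in> plists D (2 * n)" if "ys \<in> G" for ys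
  using that n by (auto simp: G_def plists_def)
 define ka where "ka ys = (real (length ys))\<^sup>2 / (4 * energy ys)" for ys
 have "\<forall>ys\<in>G. \<exists>H :: 'v => real. (\<forall>x\<in>D. 0 <= H x) &
  (\<forall>x\<in>D. x \<notin> set ys --> (\<Sum>y\<in>D. w x y * H y) + edeg D x <= dg * H x) &
  (\<Sum>x\<in>D. edeg D x * H x) <= (\<Sum>x\<in>D. edeg D x) - ka ys"
  unfolding ka_def using capacity_bound[OF D(1)] ys by blast
 from bchoice[OF this] obtain H :: "'v list => 'v => real" where H: "\<forall>ys\<in>G. (\<forall>x\<in>D. 0 <= H ys x) &
  (\<forall>x\<in>D. x \<notin> set ys --> (\<Sum>y\<in>D. w x y * H ys y) + edeg D x <= dg * H ys x) &
  (\<Sum>x\<in>D. edeg D x * H ys x) <= (\<Sum>x\<in>D. edeg D x) - ka ys" by blast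
 let ?e = "lam / n"
 have en: "0 < energy ys" if "ys \<in> G" for ys using energy_pos ys[OF that] by simp
 have ka0: "0 < ka ys" if "ys \<in> G" for ys using en[OF that] ys[OF that] by (simp add: ka_def)
 have Z: "0 < partn w D" by (rule W.partn_pos[OF D(1)])
 have "fosum w D (%f. of_bool (tall D f v (3 * n))) <=
  fosum w D (%f. min 1 (\<Sum>ys\<in>G. (1 / real n) * of_bool (spine D f v n ys)))"
  unfolding G_def by (intro W.fosum_mono tall_prefixes D n)
 also have "... <= dg * ?e * partn w D +
   (\<Sum>ys\<in>G. (1 / real n) / (1 + ?e * ka ys) * fosum w D (%f. of_bool (spine D f v n ys)))"
  by (rule excursion_bound[where H = H]) (use D G H ne lam ka0 n in \<open>auto intro: less_imp_le\<close>)
 also have "(\<Sum>ys\<in>G. (1 / real n) / (1 + ?e * ka ys) * fosum w D (%f. of_bool (spine D f v n ys))) <=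
   (\<Sum>ys\<in>G. (4 / (lam * (real n)\<^sup>2) * q * partn w D) * (pw w D v ys * energy ys))"
 proof (rule sum_mono)
  fix ys assume yG: "ys \<in> G"
  have l: "real n <= real (length ys)" using yG by (simp add: G_def)
  have "(real n)\<^sup>2 / (4 * energy ys) <= ka ys"
   unfolding ka_def using l en[OF yG] by (intro divide_right_mono power_mono) auto
  then have "?e * ((real n)\<^sup>2 / (4 * energy ys)) <= ?e * ka ys"
   using lam by (intro mult_left_mono) auto
  moreover have "?e * ((real n)\<^sup>2 / (4 * energy ys)) = lam * n / (4 * energy ys)"
   using n by (simp add: power2_eq_square)
  ultimately have k: "lam * n / (4 * energy ys) <= 1 + ?e * ka ys" by simp
  have p: "0 < lam * n / (4 * energy ys)" using lam n en[OF yG] by simp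
  have "(1 / real n) / (1 + ?e * ka ys) <= (1 / real n) / (lam * n / (4 * energy ys))"
   using k p n by (intro divide_left_mono mult_pos_pos) auto
  also have "... = 4 / (lam * (real n)\<^sup>2) * energy ys" using en[OF yG] by (simp add: power2_eq_square)
  finally have 1: "(1 / real n) / (1 + ?e * ka ys) <= 4 / (lam * (real n)\<^sup>2) * energy ys" .
  have 2: "fosum w D (%f. of_bool (spine D f v n ys)) <= q * pw w D v ys * partn w D"
   by (rule spine_factor[where P = "%D f v. tall D f v n"])
    (use D q ys[OF yG] spine_rest[OF D(2)] in auto)
  have "(1 / real n) / (1 + ?e * ka ys) * fosum w D (%f. of_bool (spine D f v n ys)) <=
   (4 / (lam * (real n)\<^sup>2) * energy ys) * (q * pw w D v ys * partn w D)"
   using lam en[OF yG] by (intro mult_mono 1 2 W.fosum_nonneg) auto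
  then show "(1 / real n) / (1 + ?e * ka ys) * fosum w D (%f. of_bool (spine D f v n ys)) <=
   (4 / (lam * (real n)\<^sup>2) * q * partn w D) * (pw w D v ys * energy ys)" by (simp only: mult_ac)
 qed
 also have "... = (4 / (lam * (real n)\<^sup>2) * q * partn w D) * (\<Sum>ys\<in>G. pw w D v ys * energy ys)"
  by (rule sum_distrib_left[symmetric])
 also have "... <= (4 / (lam * (real n)\<^sup>2) * q * partn w D) * (CE * (real (2 * n))\<^sup>2)"
 proof (intro mult_left_mono)
  have "(\<Sum>ys\<in>G. pw w D v ys * energy ys) <= (\<Sum>ys\<in>plists D (2 * n). pw w D v ys * energy ys)"
   using D by (intro sum_mono2 finite_plists)
    (auto simp: G_def energy_def intro!: mult_nonneg_nonneg W.pw_nonneg sum_nonneg gh_nonneg)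
  then show "(\<Sum>ys\<in>G. pw w D v ys * energy ys) <= CE * (real (2 * n))\<^sup>2"
   using sum_pw_energy[OF D, of "2 * n"] n by simp
 qed (use lam q0 Z in auto)
 also have "... = 16 * CE / lam * q * partn w D"
  using n lam by (simp add: power2_eq_square field_simps)
 finally show ?thesis by (simp add: algebra_simps)
qed

text \<open>Solves the recursion with \<open>lam = 96 * CE\<close>, where
  \<open>16 * CE / lam\<close> is 1/6. The two terms add up to CA/30 + CA/6 = CA/5, which suffices
  because n \<le> 5 m for m = n div 3 \<ge> 1. The summand 3 covers n < 3.\<close>

definition CA :: real where "CA = 30 * dg * (96 * CE) + 3"

lemma CA_ge: "3 <= CA" using CE_pos by (simp add: CA_def)

lemma tall_bound:
 "1 <= n ==> finite D ==> v \<notin> D ==> fosum w D (%f. of_bool (tall D f v n)) <= CA / n * partn w D"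
proof (induction n arbitrary: D v rule: less_induct)
 case (less n)
 have Z: "0 < partn w D" using less by (intro W.partn_pos)
 show ?case
 proof (cases "n < 3")
  case True
  have "fosum w D (%f. of_bool (tall D f v n)) <= 1 * partn w D"
   unfolding partn_def mult_1 by (intro W.fosum_mono) auto
  also have "... <= CA / n * partn w D"
   using True CA_ge less Z by (intro mult_right_mono) (auto simp: field_simps)
  finally show ?thesis .
 next
  case False
  define m where "m = n div 3"
  have m: "1 <= m" "3 * m <= n" "n <= 5 * m" "m < n"
  proof -
   have "n = 3 * m + n mod 3" "n mod 3 < 3" by (simp_all add: m_def)
   then have "1 <= m" "n = 3 * m + n mod 3" "n mod 3 < 3" using False by linarith+
   then show "1 <= m" "3 * m <= n" "n <= 5 * m" "m < n" by linarith+
  qed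
  have q: "fosum w D (%f. of_bool (tall D f v m)) <= CA / m * partn w D" if "finite D" "v \<notin> D" for D v
   using less.IH[of m D v] m that by auto
  have "fosum w D (%f. of_bool (tall D f v n)) <= fosum w D (%f. of_bool (tall D f v (3 * m)))"
   using tall_mono[OF _ m(2)] by (intro W.fosum_mono) (auto simp: of_bool_def)
  also have "... <= (dg * (96 * CE) / m + 16 * CE / (96 * CE) * (CA / m)) * partn w D"
  proof (rule tall_recursion[OF m(1)])
   show "fosum w D (%f. of_bool (tall D f v m)) <= CA / m * partn w D" if "finite D" "v \<notin> D" for D v
    by (rule q[OF that])
  qed (use CE_pos CA_ge less.prems in auto)
  also have "... <= CA / n * partn w D"
  proof (intro mult_right_mono)
   have "dg * (96 * CE) / m + 16 * CE / (96 * CE) * (CA / m) = (dg * (96 * CE) + CA / 6) / m"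
    using CE_pos m by (simp add: field_simps)
   also have "... <= (CA / 30 + CA / 6) / m"
    by (intro divide_right_mono) (auto simp: CA_def)
   also have "... = CA / (5 * m)" using m by (simp add: field_simps)
   also have "... <= CA / n" using m CA_ge by (intro divide_left_mono) auto
   finally show "dg * (96 * CE) / m + 16 * CE / (96 * CE) * (CA / m) <= CA / n" .
  qed (use Z in simp)
  finally show ?thesis .
 qed
qed

end

section \<open>Extrinsic radius and volume of the component of the root\<close>

text \<open>\<open>dd\<close> is distance-like and at most the graph distance.
  \<open>exp_fun\<close> supplies functions above \<open>exp (\<theta> * dd v x)\<close> whose
  growth rate is quadratic in \<theta>, which encodes diffusive scaling.\<close>

locale egraph = tgraph E dg gh B
 for E :: "'v => 'v => bool" and dg :: nat and gh :: "'v => 'v => real" and B :: real +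
 fixes dd :: "'v => 'v => real" and Ke Kt :: real
 assumes dd_self: "dd v v = 0"
  and dd_triangle: "dd x z <= dd x y + dd y z"
  and dd_step: "E x y ==> dd x y <= 1"
  and Ke_pos: "0 < Ke" and Kt_pos: "0 < Kt"
  and exp_fun: "0 <= \<theta> ==> \<theta> <= 1 ==> \<exists>e. (\<forall>x. exp (\<theta> * dd v x) <= e x) & e v <= Ke &
    (\<forall>x. (\<Sum>y\<in>{y. E x y}. e y) <= (dg + Kt * \<theta>\<^sup>2) * e x)"
begin

section \<open>Displacement of lines of descent\<close>

definition reach :: "'v set => ('v => 'v) => 'v => nat => real => bool" where
 "reach D f v k s \<longleftrightarrow> (\<exists>ys. chain D f v ys & length ys <= k & s <= dd v (last (v # ys)))"

lemma exp_ge_power: "0 <= x ==> x ^ m / fact m <= exp (x::real)"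
proof -
 assume x: "0 <= x"
 have "x ^ m / fact m = (\<Sum>n\<in>{m}. x ^ n /\<^sub>R fact n)" by (simp add: field_simps)
 also have "... <= (\<Sum>n. x ^ n /\<^sub>R fact n)"
  using x by (intro sum_le_suminf summable_exp_generic) auto
 finally show ?thesis by (simp add: exp_def)
qed

text \<open>Exponential moment at \<theta> = c / sqrt n, small enough for its growth rate to stay
  below half of the killing rate \<open>kr n\<close>. The exponential is then bounded below by one
  term of its series, since a large power is all that the recursion needs.\<close>

lemma far_tail:
 "\<exists>C\<ge>0. \<forall>D v n s. finite D --> v \<notin> D --> 1 <= n --> 0 < s -->
  (\<Sum>ys\<in>{ys \<in> plists D n. s <= dd v (last (v # ys))}. pw w D v ys) <= C * n * (n / s\<^sup>2) ^ j"
proof -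
 define c where "c = min 1 (sqrt (1 / (4 * dg * B * Kt)))"
 have c: "0 < c" "c <= 1" using B_pos dg_pos Kt_pos by (auto simp: c_def)
 have c2: "c\<^sup>2 <= 1 / (4 * dg * B * Kt)"
 proof -
  have "c\<^sup>2 <= (sqrt (1 / (4 * dg * B * Kt)))\<^sup>2" using c by (intro power_mono) (auto simp: c_def)
  then show ?thesis using B_pos dg_pos Kt_pos by simp
 qed
 define C where "C = CS * Ke * fact (2 * j) / c ^ (2 * j)"
 show ?thesis
 proof (intro exI[of _ C] conjI allI impI)
  show "0 <= C" using CS_ge Ke_pos c by (simp add: C_def)
  fix D :: "'v set" and v and n :: nat and s :: real
  assume D: "finite D" "v \<notin> D" and n: "1 <= n" and s: "0 < s"
  let ?th = "c / sqrt n"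
  have th: "0 <= ?th" "?th <= 1"
  proof -
   have "1 <= sqrt n" using n by simp
   then show "0 <= ?th" "?th <= 1" using c by (auto simp: divide_le_eq_1 intro: order_trans[of c 1])
  qed
  obtain e where e: "\<forall>x. exp (?th * dd v x) <= e x" "e v <= Ke"
   "\<forall>x. (\<Sum>y\<in>{y. E x y}. e y) <= (dg + Kt * ?th\<^sup>2) * e x" using exp_fun[OF th, of v] by blast
  have e0: "0 <= e x" for x using e(1) order_trans[of 0 "exp (?th * dd v x)" "e x"] by simp
  have "Kt * ?th\<^sup>2 = Kt * c\<^sup>2 / n" using n by (simp add: power_divide)
  also have "... <= Kt * (1 / (4 * dg * B * Kt)) / n"
   using c2 Kt_pos by (intro divide_right_mono mult_left_mono) auto
  also have "... = kr n / 2" using Kt_pos by (simp add: kr_def)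
  finally have kt: "Kt * ?th\<^sup>2 <= kr n / 2" .
  have S: "(\<Sum>ys\<in>plists D n. pw w D v ys * e (last (v # ys))) <= CS * n * Ke"
  proof -
   have "(\<Sum>ys\<in>plists D n. pw w D v ys * e (last (v # ys))) <= CS * n * e v"
    by (rule sum_pw_weighted[OF D n _ kt e0]) (use e(3) Kt_pos in auto)
   also have "... <= CS * n * Ke" using e(2) CS_ge by (intro mult_left_mono) auto
   finally show ?thesis .
  qed
  let ?F = "{ys \<in> plists D n. s <= dd v (last (v # ys))}"
  define a where "a = (?th * s) ^ (2 * j) / fact (2 * j)"
  have a: "0 < a" using c n s by (simp add: a_def)
  have "a * (\<Sum>ys\<in>?F. pw w D v ys) <= (\<Sum>ys\<in>?F. pw w D v ys * e (last (v # ys)))"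
   unfolding sum_distrib_left
  proof (rule sum_mono)
   fix ys assume ys: "ys \<in> ?F"
   have "a <= exp (?th * s)" unfolding a_def using s by (intro exp_ge_power mult_nonneg_nonneg[OF th(1)]) simp
   also have "... <= exp (?th * dd v (last (v # ys)))"
   proof -
    have "?th * s <= ?th * dd v (last (v # ys))" using ys th by (intro mult_left_mono) auto
    then show ?thesis by simp
   qed
   also have "... <= e (last (v # ys))" using e(1) by blast
   finally have "a <= e (last (v # ys))" .
   then show "a * pw w D v ys <= pw w D v ys * e (last (v # ys))"
    using W.pw_nonneg[OF D(1), of v ys] by (metis mult.commute mult_right_mono)
  qed
  also have "... <= (\<Sum>ys\<in>plists D n. pw w D v ys * e (last (v # ys)))"
   using D e0 by (intro sum_mono2 finite_plists) (auto intro!: mult_nonneg_nonneg W.pw_nonneg)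
  also note S
  finally have "(\<Sum>ys\<in>?F. pw w D v ys) <= CS * n * Ke / a" using a by (simp add: field_simps)
  also have "... = C * n * (n / s\<^sup>2) ^ j"
  proof -
   have "(?th * s) ^ (2 * j) = (c\<^sup>2 * s\<^sup>2 / n) ^ j"
    using n by (simp add: power_mult power_mult_distrib power_divide)
   then have "a = c ^ (2 * j) * (s\<^sup>2 / n) ^ j / fact (2 * j)"
    by (simp add: a_def power_mult power_mult_distrib power_divide)
   moreover have "(n / s\<^sup>2) ^ j = 1 / (s\<^sup>2 / n) ^ j" by (simp add: power_divide)
   ultimately show ?thesis by (simp add: C_def)
  qed
  finally show "(\<Sum>ys\<in>?F. pw w D v ys) <= C * n * (n / s\<^sup>2) ^ j" .
 qed
qed

lemma dd_chain:
 assumes "f \<in> wforests w D"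
 shows "chain D f v ys ==> dd v (last (v # ys)) <= length ys"
proof (induction ys arbitrary: v)
 case Nil
 then show ?case by (simp add: dd_self)
next
 case (Cons y ys)
 have "f y \<in> nb w y" using Cons.prems assms by (auto simp: wforests_def dest: forests_arc)
 then have "E v y" using Cons.prems E_sym by (auto simp: nb_w)
 then have 1: "dd v y <= 1" by (rule dd_step)
 have "dd y (last (y # ys)) <= length ys" using Cons.prems by (intro Cons.IH) auto
 then show ?case using dd_triangle[of v "last (y # ys)" y] 1 by (simp split: if_splits)
qed

text \<open>A chain that needs more than k/2 generations has at least k/16 prefixes of length in
  (k/8, k/4]. For each of them, either the prefix moves s/32 away and k/4 generations remain, or the
  remainder, of length at most 7k/8, covers 31s/32. Averaging over these prefixes gives the factor
  16/k.\<close>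

lemma reach_split:
 assumes D: "finite D" "v \<notin> D" and k: "16 <= k" and s: "0 < s"
 shows "of_bool (reach D f v k s) <= of_bool (reach D f v (k div 2) s) +
  (\<Sum>ys\<in>{ys \<in> plists D k. ys ~= []}. (16 / real k) *
   (of_bool (s / 32 <= dd v (last (v # ys))) * of_bool (spine D f v (k div 4) ys) +
    of_bool (chain D f v ys & reach (D - set ys) (restrict f (D - set ys)) (last ys) (7 * k div 8) (31 * s / 32))))"
  (is "_ <= _ + (\<Sum>ys\<in>?G. ?c * (?P ys + ?Q ys))")
proof (cases "reach D f v k s & \<not> reach D f v (k div 2) s")
 case True
 then obtain zs where zs: "chain D f v zs" "length zs <= k" "s <= dd v (last (v # zs))"
  by (auto simp: reach_def)
 have len: "k div 2 < length zs" using True zs by (force simp: reach_def not_less)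
 let ?L = "{k div 8<..k div 4}"
 have good: "take l zs \<in> ?G & 1 <= ?P (take l zs) + ?Q (take l zs)" if l: "l \<in> ?L" for l
 proof -
  define as where "as = take l zs"
  define bs where "bs = drop l zs"
  have l1: "0 < l" "l < length zs" using l len by auto
  have lb: "k div 4 <= length bs" "length bs <= 7 * k div 8" using l len zs(2) by (auto simp: bs_def)
  have ne: "as ~= []" using l1 by (auto simp: as_def)
  have zs_eq: "zs = as @ bs" by (simp add: as_def bs_def)
  have ca: "chain D f v as" "chain D f (last (v # as)) bs"
   using chain_take[OF zs(1)] chain_drop[OF zs(1)] by (auto simp only: as_def bs_def)
  have lenas: "length as <= k" using zs by (simp add: as_def)
  have asG: "as \<in> ?G" using chain_plists[OF D(2) ca(1) lenas] ne by simp
  have tl: "spine D f v (k div 4) as"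
  proof -
   have "tall D f (last (v # as)) (length bs)" using ca(2) unfolding tall_def by blast
   then have "tall D f (last (v # as)) (k div 4)" using lb(1) by (rule tall_mono)
   then show ?thesis using ca(1) unfolding spine_def by blast
  qed
  have cr: "chain (D - set as) (restrict f (D - set as)) (last as) bs"
   using chain_rest[OF D(2) ca] ne by simp
  have "s / 32 <= dd v (last as) \<or> 31 * s / 32 <= dd (last as) (last (last as # bs))"
  proof (rule ccontr)
   assume "\<not> ?thesis"
   moreover have "last (v # zs) = last (last as # bs)" using ne zs_eq by simp
   ultimately show False using zs(3) dd_triangle[of v "last (last as # bs)" "last as"] by simp
  qed
  then have "1 <= ?P as + ?Q as"
  proof
   assume "s / 32 <= dd v (last as)"
   then show ?thesis using tl ne by simp
  next
   assume "31 * s / 32 <= dd (last as) (last (last as # bs))"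
   then have "reach (D - set as) (restrict f (D - set as)) (last as) (7 * k div 8) (31 * s / 32)"
    using cr lb(2) unfolding reach_def by blast
   then show ?thesis using ca(1) by simp
  qed
  then show ?thesis using asG by (simp add: as_def)
 qed
 have inj: "inj_on (%l. take l zs) ?L"
 proof (rule inj_onI)
  fix a b assume "a \<in> ?L" "b \<in> ?L" and eq: "take a zs = take b zs"
  then have "a <= length zs" "b <= length zs" using len by auto
  then show "a = b" using arg_cong[OF eq, of length] by simp
 qed
 have fin: "finite ?G" using D by (simp add: finite_plists)
 have "real k / 16 <= card ?L"
 proof -
  have "k <= 16 * (k div 4 - k div 8)" using k by linarith
  then show ?thesis by simp
 qed
 then have "1 <= ?c * card ?L" using k by (simp add: field_simps)
 also have "?c * card ?L = (\<Sum>ys\<in>(%l. take l zs) ` ?L. ?c)" using card_image[OF inj] by simp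
 finally have a1: "1 <= (\<Sum>ys\<in>(%l. take l zs) ` ?L. ?c)" .
 have a2: "(\<Sum>ys\<in>(%l. take l zs) ` ?L. ?c) <= (\<Sum>ys\<in>(%l. take l zs) ` ?L. ?c * (?P ys + ?Q ys))"
 proof (rule sum_mono)
  fix ys assume "ys \<in> (%l. take l zs) ` ?L"
  then obtain l where l: "l \<in> ?L" "ys = take l zs" by (rule imageE)
  have "1 <= ?P ys + ?Q ys" unfolding l(2) by (rule conjunct2[OF good[OF l(1)]])
  from mult_left_mono[OF this, of ?c] show "?c <= ?c * (?P ys + ?Q ys)" by simp
 qed
 have nn: "0 <= ?c * (?P ys + ?Q ys)" for ys
  by (intro mult_nonneg_nonneg add_nonneg_nonneg zero_less_eq_of_bool) simp
 have a3: "(\<Sum>ys\<in>(%l. take l zs) ` ?L. ?c * (?P ys + ?Q ys)) <= (\<Sum>ys\<in>?G. ?c * (?P ys + ?Q ys))"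
 proof (rule sum_mono2[OF fin])
  show "(%l. take l zs) ` ?L \<subseteq> ?G" by (rule image_subsetI) (rule conjunct1[OF good])
 qed (rule nn)
 have a4: "1 <= (\<Sum>ys\<in>?G. ?c * (?P ys + ?Q ys))"
  by (rule order_trans[OF a1 order_trans[OF a2 a3]])
 have "of_bool (reach D f v k s) <= (1 :: real)" by simp
 from order_trans[OF this a4] show ?thesis by (rule add_increasing[rotated]) simp
next
 case False
 have "of_bool (reach D f v k s) <= (of_bool (reach D f v (k div 2) s) :: real)" using False by auto
 moreover have "0 <= (\<Sum>ys\<in>?G. ?c * (?P ys + ?Q ys))"
  by (intro sum_nonneg mult_nonneg_nonneg add_nonneg_nonneg zero_less_eq_of_bool) simp
 ultimately show ?thesis by (rule add_increasing2[rotated])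
qed

text \<open>Far prefixes are rare by the bound \<open>T\<close> and are charged with the height
  bound. The remainders are charged with the assumed bound, and the weights of the prefixes sum to
  at most \<open>CS * k\<close>.\<close>

lemma reach_recursion:
 assumes D: "finite D" "v \<notin> D" and k: "16 <= k" and s: "0 < s"
  and r1: "fosum w D (%f. of_bool (reach D f v (k div 2) s)) <= \<rho>1 * partn w D"
  and r2: "!!D v. finite D ==> v \<notin> D ==>
    fosum w D (%f. of_bool (reach D f v (7 * k div 8) (31 * s / 32))) <= \<rho>2 * partn w D"
  and r20: "0 <= \<rho>2"
  and C: "(\<Sum>ys\<in>{ys \<in> plists D k. s / 32 <= dd v (last (v # ys))}. pw w D v ys) <= T"
 shows "fosum w D (%f. of_bool (reach D f v k s)) <=
  (\<rho>1 + 128 * CA * T / (real k)\<^sup>2 + 16 * CS * \<rho>2) * partn w D"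
proof -
 let ?G = "{ys \<in> plists D k. ys ~= []}" and ?c = "16 / real k"
 let ?P = "%f ys. of_bool (s / 32 <= dd v (last (v # ys))) * of_bool (spine D f v (k div 4) ys) :: real"
 let ?Q = "%f ys. of_bool (chain D f v ys & reach (D - set ys) (restrict f (D - set ys)) (last ys) (7 * k div 8) (31 * s / 32)) :: real"
 have Z: "0 < partn w D" by (rule W.partn_pos[OF D(1)])
 have k4: "1 <= k div 4" "real k <= 8 * real (k div 4)" using k by linarith+
 have "fosum w D (%f. of_bool (reach D f v k s)) <= fosum w D (%f. of_bool (reach D f v (k div 2) s) +
   (\<Sum>ys\<in>?G. ?c * (?P f ys + ?Q f ys)))"
  by (intro W.fosum_mono reach_split D k s)
 also have "... = fosum w D (%f. of_bool (reach D f v (k div 2) s)) +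
   (\<Sum>ys\<in>?G. ?c * (of_bool (s / 32 <= dd v (last (v # ys))) * fosum w D (%f. of_bool (spine D f v (k div 4) ys)) +
    fosum w D (%f. ?Q f ys)))"
  by (simp only: W.fosum_add W.fosum_sum W.fosum_cmult)
 also have "... <= \<rho>1 * partn w D + (\<Sum>ys\<in>?G. ?c * (of_bool (s / 32 <= dd v (last (v # ys))) *
   (CA / (k div 4) * pw w D v ys * partn w D) + \<rho>2 * pw w D v ys * partn w D))"
 proof (intro add_mono r1 sum_mono mult_left_mono)
  fix ys assume ys: "ys \<in> ?G"
  then have ys': "set ys \<subseteq> D" "distinct ys" "ys ~= []" by (auto simp: plists_def)
  show "fosum w D (%f. of_bool (spine D f v (k div 4) ys)) <= CA / real (k div 4) * pw w D v ys * partn w D"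
   by (rule spine_factor[where P = "%D f v. tall D f v (k div 4)"])
    (use D ys' tall_bound[OF k4(1)] spine_rest[OF D(2)] in auto)
  show "fosum w D (%f. ?Q f ys) <= \<rho>2 * pw w D v ys * partn w D"
   by (rule spine_factor[where P = "%D f v. reach D f v (7 * k div 8) (31 * s / 32)"])
    (use D ys' r2 in auto)
 qed auto
 also have "(\<Sum>ys\<in>?G. ?c * (of_bool (s / 32 <= dd v (last (v # ys))) *
   (CA / (k div 4) * pw w D v ys * partn w D) + \<rho>2 * pw w D v ys * partn w D)) =
   ?c * (CA / (k div 4) * partn w D * (\<Sum>ys\<in>?G. of_bool (s / 32 <= dd v (last (v # ys))) * pw w D v ys) +
    \<rho>2 * partn w D * (\<Sum>ys\<in>?G. pw w D v ys))"
  unfolding sum_distrib_left sum.distrib[symmetric] by (intro sum.cong refl) (simp add: algebra_simps)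
 also have "... <= ?c * (CA / (k div 4) * partn w D * T + \<rho>2 * partn w D * (CS * k))"
 proof (intro mult_left_mono add_mono)
  have fin: "finite (plists D k)" by (rule finite_plists[OF D(1)])
  have "(\<Sum>ys\<in>?G. of_bool (s / 32 <= dd v (last (v # ys))) * pw w D v ys) <=
   (\<Sum>ys\<in>plists D k. of_bool (s / 32 <= dd v (last (v # ys))) * pw w D v ys)"
   using fin D by (intro sum_mono2) (auto intro: W.pw_nonneg)
  also have "... = (\<Sum>ys\<in>{ys \<in> plists D k. s / 32 <= dd v (last (v # ys))}. pw w D v ys)"
   using fin by (intro sum.mono_neutral_cong_right) auto
  finally show "(\<Sum>ys\<in>?G. of_bool (s / 32 <= dd v (last (v # ys))) * pw w D v ys) <= T" using C by simp
  have "(\<Sum>ys\<in>?G. pw w D v ys) <= (\<Sum>ys\<in>plists D k. pw w D v ys)"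
   using fin D by (intro sum_mono2) (auto intro: W.pw_nonneg)
  then show "(\<Sum>ys\<in>?G. pw w D v ys) <= CS * k" using sum_pw_le[OF D, of k] k by simp
 qed (use CA_ge CS_ge Z r20 in auto)
 also have "... = (16 / real k * (CA / (k div 4) * T) + 16 * CS * \<rho>2) * partn w D"
  using k by (simp add: field_simps)
 also have "... <= (128 * CA * T / (real k)\<^sup>2 + 16 * CS * \<rho>2) * partn w D"
 proof -
  have T0: "0 <= T" using C D by (intro order_trans[OF _ C] sum_nonneg W.pw_nonneg)
  have "CA / (k div 4) * T <= CA / (real k / 8) * T"
   using k4 k CA_ge T0 by (intro mult_right_mono divide_left_mono) auto
  then have "16 / real k * (CA / (k div 4) * T) <= 16 / real k * (CA / (real k / 8) * T)"
   by (intro mult_left_mono) auto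
  also have "... = 128 * CA * T / (real k)\<^sup>2" by (simp add: power2_eq_square)
  finally show ?thesis using Z by (intro mult_right_mono) auto
 qed
 finally show ?thesis by (simp add: algebra_simps)
qed

text \<open>The ansatz k^p / s^(2p + 2) reproduces itself. It is the order of the term with far
  prefixes; halving k contracts by 2^(-p); and the last term contracts for large p, since (7/8)
  (32/31)^2 = 7168/7688 < 1 beats the fixed factor \<open>16 * CS\<close>. At k = s^2 the ansatz is
  of the desired order 1/s^2.\<close>

lemma reach_short:
 "\<exists>K\<ge>0. \<exists>p\<ge>1. \<forall>k D v s. finite D --> v \<notin> D --> 0 < s -->
  fosum w D (%f. of_bool (reach D f v k s)) <= K * real k ^ p / s ^ (2 * p + 2) * partn w D"
proof -
 have "(%p. 16 * CS * (32 / 31)\<^sup>2 * (7168 / 7688 :: real) ^ p) \<longlonglongrightarrow> 16 * CS * (32 / 31)\<^sup>2 * 0"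
  by (intro tendsto_intros LIMSEQ_power_zero) auto
 then have "\<forall>\<^sub>F p in sequentially. 16 * CS * (32 / 31)\<^sup>2 * (7168 / 7688 :: real) ^ p < 1 / 4"
  by (rule order_tendstoD) simp
 then obtain p0 where p0: "!!p. p0 <= p ==> 16 * CS * (32 / 31)\<^sup>2 * (7168 / 7688 :: real) ^ p < 1 / 4"
  by (auto simp: eventually_sequentially)
 define p where "p = p0 + 2"
 have p: "2 <= p" "16 * CS * (32 / 31)\<^sup>2 * (7168 / 7688 :: real) ^ p <= 1 / 4"
  using p0[of p] by (auto simp: p_def)
 have half: "(1 / 2 :: real) ^ p <= 1 / 4"
  using power_decreasing[OF p(1), of "1 / 2 :: real"] by (simp add: power2_eq_square)
 obtain C where C0: "0 <= C" and C: "!!D v n s. finite D ==> v \<notin> D ==> 1 <= n ==> 0 < s ==>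
  (\<Sum>ys\<in>{ys \<in> plists D n. s <= dd v (last (v # ys))}. pw w D v ys) <= C * n * (n / s\<^sup>2) ^ (p + 1)"
  using far_tail[of "p + 1"] by blast
 define C2 where "C2 = 128 * CA * C * 1024 ^ (p + 1)"
 define K where "K = 2 * C2 + 16 ^ (2 * p + 2)"
 have C20: "0 <= C2" using C0 CA_ge by (simp add: C2_def)
 have K: "0 <= K" "2 * C2 <= K" "16 ^ (2 * p + 2) <= K" using C20 by (auto simp: K_def)
 have main: "finite D ==> v \<notin> D ==> 0 < s ==>
  fosum w D (%f. of_bool (reach D f v k s)) <= K * real k ^ p / s ^ (2 * p + 2) * partn w D" for k D v s
 proof (induction k arbitrary: D v s rule: less_induct)
  case (less k)
  note D = less.prems(1,2) and s = less.prems(3)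
  have Z: "0 < partn w D" by (rule W.partn_pos[OF D(1)])
  show ?case
  proof (cases "16 <= k")
   case False
   show ?thesis
   proof (cases "s <= k")
    case True
    have "fosum w D (%f. of_bool (reach D f v k s)) <= 1 * partn w D"
     unfolding partn_def mult_1 by (intro W.fosum_mono) auto
    also have "... <= K * real k ^ p / s ^ (2 * p + 2) * partn w D"
    proof (intro mult_right_mono)
     have k1: "1 <= real k" using True s by (cases k) auto
     have "s ^ (2 * p + 2) <= 16 ^ (2 * p + 2)" using True False s by (intro power_mono) auto
     also have "... <= K * 1" using K by simp
     also have "... <= K * real k ^ p" using K k1 by (intro mult_left_mono one_le_power) auto
     finally show "1 <= K * real k ^ p / s ^ (2 * p + 2)" using s by (simp add: field_simps)
    qed (use Z in simp)
    finally show ?thesis .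
   next
    case False
    have "\<not> reach D f v k s" if "f \<in> wforests w D" for f
     using dd_chain[OF that, of v] False by (force simp: reach_def)
    then have "fosum w D (%f. of_bool (reach D f v k s)) = fosum w D (%_. 0)"
     by (intro W.fosum_cong) auto
    also have "... <= K * real k ^ p / s ^ (2 * p + 2) * partn w D"
     using K Z s by (simp add: fosum_def)
    finally show ?thesis .
   qed
  next
   case True
   let ?X = "real k ^ p / s ^ (2 * p + 2)"
   have X: "0 <= ?X" using s by simp
   let ?r1 = "K * real (k div 2) ^ p / s ^ (2 * p + 2)"
   let ?r2 = "K * real (7 * k div 8) ^ p / (31 * s / 32) ^ (2 * p + 2)"
   let ?T = "C * k * (k / (s / 32)\<^sup>2) ^ (p + 1)"
   have "fosum w D (%f. of_bool (reach D f v k s)) <=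
    (?r1 + 128 * CA * ?T / (real k)\<^sup>2 + 16 * CS * ?r2) * partn w D"
   proof (rule reach_recursion[OF D True s])
    show "fosum w D (%f. of_bool (reach D f v (k div 2) s)) <= ?r1 * partn w D"
     using True D s by (intro less.IH) auto
    show "fosum w D (%f. of_bool (reach D f v (7 * k div 8) (31 * s / 32))) <= ?r2 * partn w D"
     if "finite D" "v \<notin> D" for D v
     using True that s by (intro less.IH) auto
    show "0 <= ?r2" using K s by simp
    show "(\<Sum>ys\<in>{ys \<in> plists D k. s / 32 <= dd v (last (v # ys))}. pw w D v ys) <= ?T"
     using True D s by (intro C) auto
   qed
   also have "... <= (K * ?X) * partn w D"
   proof (intro mult_right_mono)
    have "real (k div 2) ^ p <= (real k / 2) ^ p" by (intro power_mono) (use of_nat_div_le_of_nat[of k 2, where ?'a = real] in auto)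
    also have "... = real k ^ p * (1 / 2) ^ p" by (simp add: power_mult_distrib power_divide)
    also have "... <= real k ^ p * (1 / 4)" by (intro mult_left_mono half) auto
    finally have "K * real (k div 2) ^ p / s ^ (2 * p + 2) <= K * (real k ^ p * (1 / 4)) / s ^ (2 * p + 2)"
     using K s by (intro divide_right_mono mult_left_mono) auto
    then have 1: "?r1 <= K * ?X * (1 / 4)" by simp
    have "?T / (real k)\<^sup>2 = C * 1024 ^ (p + 1) * ?X"
     using True s by (simp add: power_divide power_mult_distrib power2_eq_square power_mult field_simps power_add)
    then have "128 * CA * (?T / (real k)\<^sup>2) = C2 * ?X" by (simp only: C2_def mult.assoc)
    then have "128 * CA * ?T / (real k)\<^sup>2 = C2 * ?X" by (simp only: times_divide_eq_right)
    also have "... <= (K / 2) * ?X" using K X by (intro mult_right_mono) auto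
    finally have 2: "128 * CA * ?T / (real k)\<^sup>2 <= K * ?X * (1 / 2)" by simp
    have "real (7 * k div 8) ^ p <= (7 * real k / 8) ^ p"
     using of_nat_div_le_of_nat[of "7 * k" 8, where ?'a = real] by (intro power_mono) auto
    then have "?r2 <= K * (7 * real k / 8) ^ p / (31 * s / 32) ^ (2 * p + 2)"
     using K s by (intro divide_right_mono mult_left_mono) auto
    also have "... = K * ?X * ((32 / 31)\<^sup>2 * ((7 / 8) ^ p * ((32 / 31)\<^sup>2) ^ p))"
    proof -
     have 1: "(7 * real k / 8) ^ p = real k ^ p * (7 / 8) ^ p"
      unfolding power_mult_distrib[symmetric] by (simp add: mult.commute)
     have 2: "1 / (31 * s / 32) ^ (2 * p + 2) = (32 / 31) ^ (2 * p + 2) / s ^ (2 * p + 2)"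
     proof -
      have "1 / (31 * s / 32) ^ (2 * p + 2) = (1 / (31 * s / 32)) ^ (2 * p + 2)" by (rule power_one_over[symmetric])
      also have "1 / (31 * s / 32) = (32 / 31) / s" by simp
      finally show ?thesis by (simp only: power_divide)
     qed
     have 3: "(32 / 31 :: real) ^ (2 * p + 2) = (32 / 31)\<^sup>2 * ((32 / 31)\<^sup>2) ^ p"
      by (subst power_add) (subst power_mult, simp only: mult.commute)
     have "K * (7 * real k / 8) ^ p / (31 * s / 32) ^ (2 * p + 2) =
       K * (7 * real k / 8) ^ p * (1 / (31 * s / 32) ^ (2 * p + 2))" by simp
     also have "... = K * (real k ^ p * (7 / 8) ^ p) * ((32 / 31)\<^sup>2 * ((32 / 31)\<^sup>2) ^ p / s ^ (2 * p + 2))"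
      unfolding 1 2 unfolding 3 ..
     finally show ?thesis by (simp only: times_divide_eq_right times_divide_eq_left mult_ac)
    qed
    also have "(7 / 8) ^ p * ((32 / 31)\<^sup>2) ^ p = (7168 / 7688 :: real) ^ p"
     unfolding power_mult_distrib[symmetric] by (simp add: power2_eq_square)
    finally have "16 * CS * ?r2 <= 16 * CS * (K * ?X * ((32 / 31)\<^sup>2 * (7168 / 7688) ^ p))"
     using CS_ge by (intro mult_left_mono) auto
    also have "... = K * ?X * (16 * CS * (32 / 31)\<^sup>2 * (7168 / 7688) ^ p)" by simp
    also have "... <= K * ?X * (1 / 4)" using K X p by (intro mult_left_mono mult_nonneg_nonneg) auto
    finally have 3: "16 * CS * ?r2 <= K * ?X * (1 / 4)" .
    show "?r1 + 128 * CA * ?T / (real k)\<^sup>2 + 16 * CS * ?r2 <= K * ?X"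
     using add_mono[OF add_mono[OF 1 2] 3] by (simp only: distrib_left[symmetric]) simp
   qed (use Z in simp)
   finally show ?thesis by simp
  qed
 qed
 show ?thesis using K(1) p(1) main by (intro exI[of _ K] conjI exI[of _ p]) auto
qed

definition far :: "'v set => ('v => 'v) => 'v => real => bool" where
 "far D f v s \<longleftrightarrow> (\<exists>x. leads D f x v & s <= dd v x)"

text \<open>Let k be s^2 rounded up. Vertices within k generations are covered by
  \<open>reach_short\<close>, and a height of k has probability at most
  \<open>CA / k\<close>.\<close>

lemma far_bound:
 "\<exists>C>0. \<forall>D v s. finite D --> v \<notin> D --> 0 < s -->
  fosum w D (%f. of_bool (far D f v s)) <= C / s\<^sup>2 * partn w D"
proof -
 obtain K p where K: "0 <= K" "1 <= p" "!!k D v s. finite D ==> v \<notin> D ==> 0 < s ==>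
  fosum w D (%f. of_bool (reach D f v k s)) <= K * real k ^ p / s ^ (2 * p + 2) * partn w D"
  using reach_short by blast
 define C where "C = K * 2 ^ p + CA + 1"
 have C: "0 < C" "1 <= C" using K CA_ge by (auto simp: C_def add_nonneg_pos)
 show ?thesis
 proof (intro exI[of _ C] conjI allI impI C)
  fix D :: "'v set" and v and s :: real
  assume D: "finite D" "v \<notin> D" and s: "0 < s"
  have Z: "0 < partn w D" by (rule W.partn_pos[OF D(1)])
  show "fosum w D (%f. of_bool (far D f v s)) <= C / s\<^sup>2 * partn w D"
  proof (cases "s < 1")
   case True
   have "fosum w D (%f. of_bool (far D f v s)) <= 1 * partn w D"
    unfolding partn_def mult_1 by (intro W.fosum_mono) auto
   also have "... <= C / s\<^sup>2 * partn w D"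
   proof (intro mult_right_mono)
    have "s\<^sup>2 <= 1" using True s by (simp add: power_le_one)
    then show "1 <= C / s\<^sup>2" using C s by (simp add: field_simps)
   qed (use Z in simp)
   finally show ?thesis .
  next
   case False
   define k where "k = nat \<lceil>s\<^sup>2\<rceil>"
   have s2: "1 <= s\<^sup>2" using False by simp
   have k: "s\<^sup>2 <= real k" "real k <= 2 * s\<^sup>2" "1 <= k" using s2 unfolding k_def by linarith+
   have "fosum w D (%f. of_bool (far D f v s)) <=
     fosum w D (%f. of_bool (reach D f v k s) + of_bool (tall D f v k))"
   proof (rule W.fosum_mono)
    fix f
    have "reach D f v k s \<or> tall D f v k" if "far D f v s"
    proof -
     obtain x where "leads D f x v" "s <= dd v x" using \<open>far D f v s\<close> by (auto simp: far_def)
     then obtain ys where ys: "chain D f v ys" "s <= dd v (last (v # ys))" using leads_chain by metis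
     show ?thesis
     proof (cases "length ys <= k")
      case True
      then show ?thesis using ys unfolding reach_def by blast
     next
      case False
      have "tall D f v (length ys)" using ys(1) unfolding tall_def by blast
      then show ?thesis using tall_mono[of D f v "length ys" k] False by simp
     qed
    qed
    then show "of_bool (far D f v s) <= (of_bool (reach D f v k s) + of_bool (tall D f v k) :: real)" by auto
   qed
   also have "... <= K * real k ^ p / s ^ (2 * p + 2) * partn w D + CA / k * partn w D"
    unfolding W.fosum_add by (intro add_mono K(3) tall_bound D s k)
   also have "... = (K * real k ^ p / s ^ (2 * p + 2) + CA / k) * partn w D" by (simp add: algebra_simps)
   also have "... <= (C / s\<^sup>2) * partn w D"
   proof (intro mult_right_mono)
    have "K * real k ^ p / s ^ (2 * p + 2) <= K * (2 * s\<^sup>2) ^ p / s ^ (2 * p + 2)"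
     using K k s by (intro divide_right_mono mult_left_mono power_mono) auto
    also have "... = K * 2 ^ p / s\<^sup>2"
     using s by (simp add: power_mult_distrib power_add power_mult power2_eq_square)
    finally have 1: "K * real k ^ p / s ^ (2 * p + 2) <= K * 2 ^ p / s\<^sup>2" .
    have "CA / k <= CA / s\<^sup>2" using k s2 CA_ge by (intro divide_left_mono mult_pos_pos) auto
    then have "K * real k ^ p / s ^ (2 * p + 2) + CA / k <= (K * 2 ^ p + CA) / s\<^sup>2"
     using 1 by (simp add: add_divide_distrib)
    also have "... <= C / s\<^sup>2" using s by (intro divide_right_mono) (auto simp: C_def)
    finally show "K * real k ^ p / s ^ (2 * p + 2) + CA / k <= C / s\<^sup>2" .
   qed (use Z in simp)
   finally show ?thesis .
  qed
 qed
qed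

end

section \<open>Size of the tree and its truncated mean\<close>

definition tree :: "'v set => ('v => 'v) => 'v => 'v set" where
 "tree D f v = {x \<in> D. leads D f x v}"

lemma tree_cong: "(!!y. y \<in> D ==> f y = g y) ==> tree D f v = tree D g v"
 unfolding tree_def using leads_cong_iff[of D f g] by blast

context tgraph
begin

text \<open>By \<open>chain_inj\<close> this counts the vertices within \<open>n\<close> generations
  below \<open>v\<close>, with \<open>v\<close> included.\<close>

definition nchains :: "'v set => 'v => nat => ('v => 'v) => real" where
 "nchains D v n f = (\<Sum>ys\<in>plists D n. of_bool (chain D f v ys))"

lemma nchains_nonneg: "0 <= nchains D v n f"
 by (simp add: nchains_def sum_nonneg)

lemma fosum_nchains:
 assumes "finite D" "v \<notin> D" "1 <= n"
 shows "fosum w D (nchains D v n) <= CS * n * partn w D"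
proof -
 have "fosum w D (nchains D v n) = (\<Sum>ys\<in>plists D n. fosum w D (%f. of_bool (chain D f v ys)))"
  unfolding nchains_def[abs_def] by (rule W.fosum_sum)
 also have "... = (\<Sum>ys\<in>plists D n. pw w D v ys * partn w D)"
  using assms by (intro sum.cong W.fosum_chain_pw) (auto simp: plists_def)
 also have "... = (\<Sum>ys\<in>plists D n. pw w D v ys) * partn w D" by (rule sum_distrib_right[symmetric])
 also have "... <= CS * n * partn w D"
  using assms W.partn_pos[of D] by (intro mult_right_mono sum_pw_le) auto
 finally show ?thesis .
qed

lemma card_tree_le:
 assumes "finite D" "v \<notin> D"
 shows "min (real n) (card (tree D f v)) <= real n * of_bool (tall D f v m) + nchains D v m f"
proof (cases "tall D f v m")
 case True
 then show ?thesis using nchains_nonneg[of D v m f] by simp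
next
 case False
 let ?S = "{ys \<in> plists D m. chain D f v ys}"
 have "tree D f v \<subseteq> (%ys. last (v # ys)) ` ?S"
 proof
  fix x assume "x \<in> tree D f v"
  then obtain ys where ys: "chain D f v ys" "last (v # ys) = x"
   using leads_chain[of D f x v] by (auto simp: tree_def)
  have "tall D f v (length ys)" using ys(1) unfolding tall_def by blast
  then have "length ys <= m" using False tall_mono[of D f v "length ys" m] by (cases "length ys <= m") auto
  then have "ys \<in> ?S" using chain_plists[OF assms(2) ys(1)] ys(1) by simp
  then show "x \<in> (%ys. last (v # ys)) ` ?S" using ys(2) by blast
 qed
 moreover have fin: "finite ?S" by (rule finite_subset[OF _ finite_plists[OF assms(1), of m]]) auto
 ultimately have "card (tree D f v) <= card ?S" by (rule surj_card_le[rotated])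
 also have "real (card ?S) = (\<Sum>ys\<in>?S. of_bool (chain D f v ys))" by simp
 also have "... = nchains D v m f" unfolding nchains_def
  by (rule sum.mono_neutral_left[OF finite_plists[OF assms(1)]]) auto
 finally show ?thesis using False by (simp add: min_def)
qed

text \<open>With m of order sqrt n both terms of \<open>card_tree_le\<close> are of order sqrt n: n
  times the probability of height m, and the mean number of vertices up to height m.\<close>

lemma tree_size_bound:
 assumes D: "finite D" "v \<notin> D" and n: "1 <= n"
 shows "fosum w D (%f. min (real n) (card (tree D f v))) <= (CA + 2 * CS) * sqrt n * partn w D"
proof -
 define m where "m = nat \<lceil>sqrt n\<rceil>"
 have s1: "1 <= sqrt n" using n by simp
 have m: "sqrt n <= real m" "real m <= 2 * sqrt n" "1 <= m" using s1 unfolding m_def by linarith+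
 have Z: "0 < partn w D" by (rule W.partn_pos[OF D(1)])
 have "fosum w D (%f. min (real n) (card (tree D f v))) <=
  fosum w D (%f. real n * of_bool (tall D f v m) + nchains D v m f)"
  by (rule W.fosum_mono) (rule card_tree_le[OF D])
 also have "... = real n * fosum w D (%f. of_bool (tall D f v m)) + fosum w D (nchains D v m)"
  by (simp only: W.fosum_add W.fosum_cmult)
 also have "... <= real n * (CA / m * partn w D) + CS * m * partn w D"
  by (intro add_mono mult_left_mono tall_bound fosum_nchains D m) simp
 also have "... = (real n * CA / m + CS * m) * partn w D" by (simp add: algebra_simps)
 also have "... <= ((CA + 2 * CS) * sqrt n) * partn w D"
 proof (intro mult_right_mono)
  have "real n * CA / m <= real n * CA / sqrt n"
  proof (rule divide_left_mono)
   have "0 < sqrt n" "0 < real m" using s1 m by linarith+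
   then show "0 < real m * sqrt n" by (rule mult_pos_pos[rotated])
  qed (use m CA_ge in auto)
  also have "... = CA * (real n / sqrt n)" by simp
  also have "real n / sqrt n = sqrt n" by (rule real_div_sqrt) simp
  finally have "real n * CA / m <= CA * sqrt n" .
  moreover have "CS * m <= CS * (2 * sqrt n)" using m CS_ge by (intro mult_left_mono) auto
  ultimately show "real n * CA / m + CS * m <= (CA + 2 * CS) * sqrt n" by (simp add: algebra_simps)
 qed (use Z in simp)
 finally show ?thesis by simp
qed

section \<open>Second moments\<close>

text \<open>Cut \<open>zs\<close> at its last vertex on \<open>ys\<close>: the rest is a chain from
  a vertex of \<open>ys\<close>, or from \<open>v\<close>, that avoids \<open>ys\<close>.\<close>

lemma chain_branch:
 assumes D: "v \<notin> D" and z: "chain D f v zs" "length zs <= n"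
 shows "\<exists>u\<in>insert v (set ys). \<exists>bs\<in>plists (D - set ys) n.
  chain (D - set ys) (restrict f (D - set ys)) u bs & last (u # bs) = last (v # zs)"
proof -
 have *: "chain (D - set ys) (restrict f (D - set ys)) u bs" if "chain D f u bs" "set bs \<inter> set ys = {}" for u bs
 proof -
  have "set bs \<subseteq> D - set ys" using chain_subset[OF that(1)] that(2) by auto
  then have "chain D f u bs = chain (D - set ys) (restrict f (D - set ys)) u bs"
   by (intro chain_cong) auto
  then show ?thesis using that(1) by simp
 qed
 have d: "distinct zs" by (rule chain_distinct[OF D z(1)])
 have s: "set zs \<subseteq> D" by (rule chain_subset[OF z(1)])
 show ?thesis
 proof (cases "\<exists>x\<in>set zs. x \<in> set ys")
  case True
  then obtain as u bs where zs: "zs = as @ u # bs" "u \<in> set ys" "\<forall>b\<in>set bs. b \<notin> set ys"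
   by (rule split_list_last_propE)
  have "chain D f u bs" using z(1) zs by (simp add: chain_append)
  then have c: "chain (D - set ys) (restrict f (D - set ys)) u bs" using zs(3) by (intro *) auto
  moreover have "bs \<in> plists (D - set ys) n" using chain_subset[OF c] d zs z(2) by (auto simp: plists_def)
  ultimately show ?thesis using zs by (intro bexI[of _ u] bexI[of _ bs]) auto
 next
  case False
  then have c: "chain (D - set ys) (restrict f (D - set ys)) v zs" using z(1) by (intro *) auto
  moreover have "zs \<in> plists (D - set ys) n" using chain_subset[OF c] d z(2) by (auto simp: plists_def)
  ultimately show ?thesis by (intro bexI[of _ v] bexI[of _ zs]) auto
 qed
qed

lemma nchains_branch:
 assumes D: "finite D" "v \<notin> D"
 shows "nchains D v n f <= (\<Sum>u\<in>insert v (set ys). nchains (D - set ys) u n (restrict f (D - set ys)))"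
proof -
 let ?D = "D - set ys" and ?f = "restrict f (D - set ys)"
 let ?Z = "{zs \<in> plists D n. chain D f v zs}"
 let ?T = "SIGMA u:insert v (set ys). {bs \<in> plists ?D n. chain ?D ?f u bs}"
 have finT: "finite ?T"
 proof (rule finite_SigmaI)
  show "finite {bs \<in> plists ?D n. chain ?D ?f u bs}" for u
   by (rule finite_subset[OF _ finite_plists[of ?D n]]) (use D in auto)
 qed simp
 have "(%zs. last (v # zs)) ` ?Z \<subseteq> (%(u, bs). last (u # bs)) ` ?T"
 proof (rule image_subsetI)
  fix zs assume "zs \<in> ?Z"
  then have "chain D f v zs" "length zs <= n" by (auto simp: plists_def)
  from chain_branch[OF D(2) this, of ys] obtain u bs where
   "u \<in> insert v (set ys)" "bs \<in> plists ?D n" "chain ?D ?f u bs" "last (u # bs) = last (v # zs)" by blast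
  then show "last (v # zs) \<in> (%(u, bs). last (u # bs)) ` ?T"
   by (intro image_eqI[of _ _ "(u, bs)"]) auto
 qed
 then have "card ((%zs. last (v # zs)) ` ?Z) <= card ((%(u, bs). last (u # bs)) ` ?T)"
  using finT by (intro card_mono) auto
 also have "... <= card ?T" by (rule card_image_le[OF finT])
 also have "card ((%zs. last (v # zs)) ` ?Z) = card ?Z"
  by (rule card_image) (rule inj_onI, rule chain_inj[OF D(2)], auto)
 finally have le: "card ?Z <= card ?T" .
 have n: "nchains D' u n f' = card {bs \<in> plists D' n. chain D' f' u bs}" if "finite D'" for D' u f'
 proof -
  have "nchains D' u n f' = (\<Sum>bs\<in>{bs \<in> plists D' n. chain D' f' u bs}. 1)"
   unfolding nchains_def using finite_plists[OF that] by (intro sum.mono_neutral_cong_right) auto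
  then show ?thesis by simp
 qed
 have "card ?T = (\<Sum>u\<in>insert v (set ys). card {bs \<in> plists ?D n. chain ?D ?f u bs})"
  by (rule card_SigmaI) (use D in \<open>auto intro: finite_subset[OF _ finite_plists[of ?D n]]\<close>)
 then show ?thesis using le n[OF D(1)] n[of ?D] D
  by (simp only: of_nat_sum[symmetric] of_nat_le_iff finite_Diff)
qed

text \<open>Given a first chain, any other one branches off at one of at most n + 1 vertices, and
  the fresh forest there contributes \<open>CS * n\<close>. The sum over the first chain gives the
  third factor of order n.\<close>

lemma second_moment:
 assumes D: "finite D" "v \<notin> D" and n: "1 <= n"
 shows "fosum w D (%f. (nchains D v n f)\<^sup>2) <= 2 * CS\<^sup>2 * real n ^ 3 * partn w D"
proof -
 have Z: "0 < partn w D" by (rule W.partn_pos[OF D(1)])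
 have "fosum w D (%f. (nchains D v n f)\<^sup>2) =
  fosum w D (%f. \<Sum>ys\<in>plists D n. of_bool (chain D f v ys) * nchains D v n f)"
  by (rule W.fosum_cong) (simp add: power2_eq_square nchains_def sum_distrib_right)
 also have "... = (\<Sum>ys\<in>plists D n. fosum w D (%f. of_bool (chain D f v ys) * nchains D v n f))"
  by (rule W.fosum_sum)
 also have "... <= (\<Sum>ys\<in>plists D n. pw w D v ys * ((n + 1) * (CS * n)) * partn w D)"
 proof (rule sum_mono)
  fix ys assume "ys \<in> plists D n"
  then have ys: "set ys \<subseteq> D" "distinct ys" "length ys <= n" by (auto simp: plists_def)
  let ?D = "D - set ys"
  let ?Y = "%g. \<Sum>u\<in>insert v (set ys). nchains ?D u n g"
  have Z': "0 < partn w ?D" by (rule W.partn_pos) (use D in simp)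
  have "fosum w D (%f. of_bool (chain D f v ys) * nchains D v n f) <=
   fosum w D (%f. of_bool (chain D f v ys) * ?Y (restrict f ?D))"
   by (rule W.fosum_mono) (rule mult_left_mono[OF nchains_branch[OF D]], simp)
  also have "... = pathc w v ys * fosum w ?D ?Y" by (rule W.fosum_chain[OF D ys(1,2)])
  also have "fosum w ?D ?Y = (\<Sum>u\<in>insert v (set ys). fosum w ?D (nchains ?D u n))" by (rule W.fosum_sum)
  also have "pathc w v ys * ... <= pathc w v ys * ((n + 1) * (CS * n * partn w ?D))"
  proof (rule mult_left_mono[OF _ W.pathc_nonneg])
   have "(\<Sum>u\<in>insert v (set ys). fosum w ?D (nchains ?D u n)) <=
     (\<Sum>u\<in>insert v (set ys). CS * n * partn w ?D)"
    using D n by (intro sum_mono fosum_nchains) auto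
   also have "... = card (insert v (set ys)) * (CS * n * partn w ?D)" by simp
   also have "... <= (n + 1) * (CS * n * partn w ?D)"
   proof (rule mult_right_mono)
    have "card (insert v (set ys)) <= Suc (card (set ys))" by (rule card_insert_le_m1) auto
    also have "... <= n + 1" using ys card_length[of ys] by simp
    finally show "real (card (insert v (set ys))) <= real (n + 1)" by simp
   qed (use CS_ge Z' in simp)
   finally show "(\<Sum>u\<in>insert v (set ys). fosum w ?D (nchains ?D u n)) <= (n + 1) * (CS * n * partn w ?D)" .
  qed
  also have "... = pw w D v ys * ((n + 1) * (CS * n)) * partn w D" using Z by (simp add: pw_def)
  finally show "fosum w D (%f. of_bool (chain D f v ys) * nchains D v n f) <=
   pw w D v ys * ((n + 1) * (CS * n)) * partn w D" .
 qed
 also have "... = (\<Sum>ys\<in>plists D n. pw w D v ys) * ((n + 1) * (CS * n) * partn w D)"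
  by (simp only: sum_distrib_right mult.assoc)
 also have "... <= (CS * n) * ((n + 1) * (CS * n) * partn w D)"
  using CS_ge Z n by (intro mult_right_mono sum_pw_le D) auto
 also have "... <= (CS * n) * ((2 * n) * (CS * n) * partn w D)"
  using CS_ge Z n by (intro mult_left_mono mult_right_mono) auto
 also have "... = 2 * CS\<^sup>2 * real n ^ 3 * partn w D" by (simp add: power2_eq_square power3_eq_cube)
 finally show ?thesis .
qed

section \<open>Lower bounds averaged over the position of the root\<close>

text \<open>A forest of \<open>D\<close> is a forest of \<open>D - {v}\<close> with an arc at
  \<open>v\<close> that closes no cycle; dropping the condition on this arc costs at most the
  degree.\<close>

lemma fosum_remove_le:
 assumes D: "finite D" "v \<in> D" and Y: "!!g. 0 <= Y g"
 shows "fosum w D (%f. Y (restrict f (D - {v}))) <= dg * fosum w (D - {v}) Y"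
proof -
 have "fosum w D (%f. Y (restrict f (D - {v}))) =
   fosum w D (%f. \<Sum>y\<in>nb w v. of_bool (f v = y) * Y (restrict f (D - {v})))"
 proof (rule W.fosum_cong)
  fix f assume "f \<in> wforests w D"
  then have "f v \<in> nb w v" using D by (auto simp: wforests_def dest: forests_arc)
  then have "(\<Sum>y\<in>nb w v. of_bool (f v = y) :: real) = 1" using W.finite_nb[of v] by (simp add: of_bool_def)
  then show "Y (restrict f (D - {v})) = (\<Sum>y\<in>nb w v. of_bool (f v = y) * Y (restrict f (D - {v})))"
   by (simp only: sum_distrib_right[symmetric] mult_1)
 qed
 also have "... = (\<Sum>y\<in>nb w v. w v y * fosum w (D - {v}) (%g. of_bool (\<not> leads (D - {v}) g y v) *
   Y (restrict (g(v := y)) (D - {v}))))"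
  unfolding W.fosum_sum by (intro sum.cong refl W.fosum_arc[OF D])
 also have "... <= (\<Sum>y\<in>nb w v. w v y * fosum w (D - {v}) Y)"
 proof (intro sum_mono mult_left_mono W.fosum_mono)
  fix y g assume g: "g \<in> wforests w (D - {v})"
  have "restrict (g(v := y)) (D - {v}) = g"
   using g by (auto simp: wforests_def forests_def restrict_def fun_eq_iff PiE_def extensional_def)
  then show "of_bool (\<not> leads (D - {v}) g y v) * Y (restrict (g(v := y)) (D - {v})) <= Y g"
   using Y[of g] by simp
 qed (simp add: w_def)
 also have "... = dg * fosum w (D - {v}) Y"
  using csum_w[of v] by (simp add: csum_def sum_distrib_right[symmetric])
 finally show ?thesis .
qed

text \<open>The cost of treating an interior vertex as a root: \<open>dg\<close> for its arc and
  \<open>1 + B\<close> for the ratio of partition functions.\<close>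

definition Cr :: real where "Cr = dg * (1 + B)"

lemma Cr_pos: "0 < Cr" using B_pos dg_pos by (simp add: Cr_def)

lemma fosum_past_le:
 assumes D: "finite D" "v \<in> D" and Y: "!!g. 0 <= Y g" and b: "fosum w (D - {v}) Y <= b * partn w (D - {v})"
  and b0: "0 <= b"
 shows "fosum w D (%f. Y (restrict f (D - {v}))) <= Cr * b * partn w D"
proof -
 have Z: "0 < partn w D" by (rule W.partn_pos[OF D(1)])
 have "partn w (D - {v}) / partn w D <= 1 + B"
  using green_le_gh[OF D(1), of v v] gh_diag_le[of v] W.green_diag[OF D] by simp
 then have p: "partn w (D - {v}) <= (1 + B) * partn w D" using Z by (simp add: field_simps)
 have "fosum w D (%f. Y (restrict f (D - {v}))) <= dg * fosum w (D - {v}) Y"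
  by (rule fosum_remove_le[OF D Y])
 also have "... <= dg * (b * partn w (D - {v}))" by (intro mult_left_mono b) simp
 also have "... <= dg * (b * ((1 + B) * partn w D))" by (intro mult_left_mono p b0) simp
 finally show ?thesis by (simp add: Cr_def mult_ac)
qed

end

context egraph
begin

text \<open>Descendants of the interior vertex \<open>v\<close> in generations k + 1 to 2k, counted
  through their lines of descent; \<open>P\<close> will separate near from far ones.\<close>

definition npast :: "('v => 'v list => bool) => 'v set => nat => 'v => ('v => 'v) => real" where
 "npast P D k v f = (\<Sum>ys\<in>{ys \<in> plists (D - {v}) (2 * k). k < length ys & P v ys}. of_bool (chain (D - {v}) f v ys))"

text \<open>Mass transport: every vertex has exactly one ancestor in every generation.\<close>

lemma npast_sum:
 assumes D: "finite D" and I: "I \<subseteq> X" "X \<subseteq> D"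
  and near: "!!x y. x \<in> I ==> dd y x <= 2 * real k ==> y \<in> X"
  and f: "f \<in> wforests w D"
 shows "real k * card I <= (\<Sum>v\<in>X. npast (%_ _. True) D k v f)"
proof -
 let ?S = "SIGMA v:X. {ys \<in> plists (D - {v}) (2 * k). k < length ys & chain (D - {v}) f v ys}"
 have finX: "finite X" using D I by (meson finite_subset)
 have finp: "finite {ys \<in> plists (D - {v}) (2 * k). k < length ys & chain (D - {v}) f v ys}" for v
  by (rule finite_subset[OF _ finite_plists[of "D - {v}" "2 * k"]]) (use D in auto)
 have finS: "finite ?S" by (rule finite_SigmaI[OF finX finp])
 have "I \<times> {k<..2 * k} \<subseteq> (%(v, ys). (last ys, length ys)) ` ?S"
 proof (rule subsetI)
  fix p assume "p \<in> I \<times> {k<..2 * k}"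
  then obtain x l where p: "p = (x, l)" "x \<in> I" "k < l" "l <= 2 * k" by auto
  obtain r where "leads D f x r" using forests_leads f unfolding wforests_def by metis
  then obtain zs where zs: "chain D f r zs" "last (r # zs) = x" and r: "r \<notin> D"
   using leads_chain leads_notin by metis
  \<comment> \<open>A root within 2k generations of \<open>x\<close> would be within distance 2k,
    hence in \<open>X\<close> and in \<open>D\<close>. So all ancestors of \<open>x\<close> up to
    generation 2k are interior vertices.\<close>
  have long: "2 * k < length zs"
  proof (rule ccontr)
   assume "\<not> ?thesis"
   then have "dd r x <= 2 * real k" using dd_chain[OF f zs(1)] zs(2) by simp
   then show False using near[OF p(2)] I r by blast
  qed
  define as where "as = take (length zs - l) zs"
  define bs where "bs = drop (length zs - l) zs"
  define v where "v = last (r # as)"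
  have lb: "length bs = l" using long p by (simp add: bs_def)
  have ne: "as ~= []" using long p by (auto simp: as_def)
  have bne: "bs ~= []" using lb p by auto
  have z: "zs = as @ bs" by (simp add: as_def bs_def)
  have cb: "chain D f v bs" using chain_drop[OF zs(1), of "length zs - l"] by (simp only: v_def as_def bs_def)
  have d: "distinct zs" by (rule chain_distinct[OF r zs(1)])
  have va: "v \<in> set as" using ne by (simp add: v_def)
  then have vb: "v \<notin> set bs" using d z by auto
  have "set bs \<subseteq> D - {v}" using chain_subset[OF cb] vb by auto
  then have cb': "chain (D - {v}) f v bs" using cb chain_cong[of bs D "D - {v}" f f v] by auto
  have lx: "last bs = x" using zs(2) z bne by simp
  have "dd v x <= l" using dd_chain[OF f cb] lb lx bne by simp
  then have "v \<in> X" using near[OF p(2)] p(4) by simp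
  moreover have "bs \<in> plists (D - {v}) (2 * k)"
   using \<open>set bs \<subseteq> D - {v}\<close> d z lb p by (auto simp: plists_def)
  ultimately have "(v, bs) \<in> ?S" using lb p cb' by simp
  then show "p \<in> (%(v, ys). (last ys, length ys)) ` ?S"
   using lx lb p by (intro image_eqI[of _ _ "(v, bs)"]) auto
 qed
 then have "card (I \<times> {k<..2 * k}) <= card ?S"
  using finS by (intro surj_card_le)
 also have "card (I \<times> {k<..2 * k}) = k * card I" by (simp add: card_cartesian_product)
 also have "card ?S = (\<Sum>v\<in>X. card {ys \<in> plists (D - {v}) (2 * k). k < length ys & chain (D - {v}) f v ys})"
  using finX finp by (intro card_SigmaI) auto
 finally have "real (k * card I) <= real (\<Sum>v\<in>X. card {ys \<in> plists (D - {v}) (2 * k). k < length ys & chain (D - {v}) f v ys})"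
  by (rule of_nat_mono)
 also have "... = (\<Sum>v\<in>X. npast (%_ _. True) D k v f)"
  unfolding of_nat_sum
 proof (rule sum.cong[OF refl])
  fix v
  have "npast (%_ _. True) D k v f =
   (\<Sum>ys\<in>{ys \<in> plists (D - {v}) (2 * k). k < length ys & chain (D - {v}) f v ys}. 1)"
   unfolding npast_def using finite_plists[of "D - {v}" "2 * k"] D
   by (intro sum.mono_neutral_cong_right) auto
  then show "real (card {ys \<in> plists (D - {v}) (2 * k). k < length ys & chain (D - {v}) f v ys}) =
   npast (%_ _. True) D k v f" by simp
 qed
 finally show ?thesis by simp
qed

lemma npast_restrict:
 "npast P D k v f = npast P D k v (restrict f (D - {v}))"
 unfolding npast_def
proof (intro sum.cong refl arg_cong[where f = of_bool])
 fix ys assume "ys \<in> {ys \<in> plists (D - {v}) (2 * k). k < length ys & P v ys}"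
 then show "chain (D - {v}) f v ys = chain (D - {v}) (restrict f (D - {v})) v ys"
  by (intro chain_cong) (auto simp: plists_def)
qed

lemma npast_nonneg: "0 <= npast P D k v f"
 by (simp add: npast_def sum_nonneg)

lemma npast_le: "finite D ==> npast P D k v f <= nchains (D - {v}) v (2 * k) f"
 unfolding npast_def nchains_def by (intro sum_mono2 finite_plists) auto

lemma npast_sq:
 assumes D: "finite D" "v \<in> D" and k: "1 <= k"
 shows "fosum w D (%f. (npast P D k v f)\<^sup>2) <= Cr * (16 * CS\<^sup>2 * real k ^ 3) * partn w D"
proof -
 have "fosum w (D - {v}) (%f. (npast P D k v f)\<^sup>2) <= fosum w (D - {v}) (%f. (nchains (D - {v}) v (2 * k) f)\<^sup>2)"
  by (intro W.fosum_mono power_mono npast_le D npast_nonneg)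
 also have "... <= 2 * CS\<^sup>2 * real (2 * k) ^ 3 * partn w (D - {v})"
  using D k by (intro second_moment) auto
 finally have "fosum w (D - {v}) (%f. (npast P D k v f)\<^sup>2) <= (16 * CS\<^sup>2 * real k ^ 3) * partn w (D - {v})"
  by (simp add: power_mult_distrib)
 then have "fosum w D (%f. (npast P D k v (restrict f (D - {v})))\<^sup>2) <= Cr * (16 * CS\<^sup>2 * real k ^ 3) * partn w D"
  by (intro fosum_past_le[OF D, of "%g. (npast P D k v g)\<^sup>2"]) auto
 then show ?thesis by (simp only: npast_restrict[symmetric])
qed

text \<open>A Paley--Zygmund argument, with \<open>N 1[S] <= s 1[S] / 2 + N\<^sup>2 / (2 s)\<close> for \<open>s\<close> of order \<open>k\<^sup>2\<close>.\<close>

lemma paley_zygmund: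
 assumes D: "finite D" and X: "X \<subseteq> D" and k: "1 <= k"
  and m: "real k / 8 * card X * partn w D <= (\<Sum>v\<in>X. fosum w D (%f. npast P D k v f * of_bool (S v f)))"
 shows "card X / (2048 * Cr * CS\<^sup>2 * k) * partn w D <= (\<Sum>v\<in>X. fosum w D (%f. of_bool (S v f)))"
proof -
 \<comment> \<open>Chosen so that the second moment term equals k/16 per vertex, half of the first
   moment k/8 in the hypothesis \<open>m\<close>.\<close>
 define s where "s = 128 * Cr * CS\<^sup>2 * (real k)\<^sup>2"
 have s: "0 < s" using Cr_pos CS_ge k by (simp add: s_def)
 have "(\<Sum>v\<in>X. fosum w D (%f. npast P D k v f * of_bool (S v f))) <=
  (\<Sum>v\<in>X. fosum w D (%f. (s / 2) * of_bool (S v f) + (1 / (2 * s)) * (npast P D k v f)\<^sup>2))"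
 proof (intro sum_mono W.fosum_mono)
  fix v f
  have "2 * npast P D k v f * s <= s\<^sup>2 + (npast P D k v f)\<^sup>2"
   using zero_le_power2[of "s - npast P D k v f"] by (simp add: power2_diff algebra_simps)
  then have "npast P D k v f <= s / 2 + (1 / (2 * s)) * (npast P D k v f)\<^sup>2"
   using s by (simp add: field_simps power2_eq_square)
  then show "npast P D k v f * of_bool (S v f) <= (s / 2) * of_bool (S v f) + (1 / (2 * s)) * (npast P D k v f)\<^sup>2"
   using s by (cases "S v f") auto
 qed
 also have "... = (s / 2) * (\<Sum>v\<in>X. fosum w D (%f. of_bool (S v f))) +
   (1 / (2 * s)) * (\<Sum>v\<in>X. fosum w D (%f. (npast P D k v f)\<^sup>2))"
  by (simp only: W.fosum_add W.fosum_cmult sum.distrib sum_distrib_left)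
 also have "... <= (s / 2) * (\<Sum>v\<in>X. fosum w D (%f. of_bool (S v f))) +
   (1 / (2 * s)) * (\<Sum>v\<in>X. Cr * (16 * CS\<^sup>2 * real k ^ 3) * partn w D)"
  using s X k by (intro add_left_mono mult_left_mono sum_mono npast_sq D) auto
 also have "(1 / (2 * s)) * (\<Sum>v\<in>X. Cr * (16 * CS\<^sup>2 * real k ^ 3) * partn w D) =
   real k / 16 * card X * partn w D"
  using Cr_pos CS_ge k by (simp add: s_def power2_eq_square power3_eq_cube)
 finally have "real k / 16 * card X * partn w D <= (s / 2) * (\<Sum>v\<in>X. fosum w D (%f. of_bool (S v f)))"
  using m by (simp add: algebra_simps)
 then have "real k / 16 * card X * partn w D / (s / 2) <= (\<Sum>v\<in>X. fosum w D (%f. of_bool (S v f)))"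
  using s by (simp add: field_simps)
 moreover have "real k / 16 * card X * partn w D / (s / 2) = card X / (1024 * Cr * CS\<^sup>2 * k) * partn w D"
  using k by (simp add: s_def power2_eq_square)
 moreover have "card X / (2048 * Cr * CS\<^sup>2 * k) * partn w D <= card X / (1024 * Cr * CS\<^sup>2 * k) * partn w D"
  using Cr_pos CS_ge k W.partn_pos[OF D] by (intro mult_right_mono divide_left_mono) auto
 ultimately show ?thesis by linarith
qed

lemma npast_mean:
 assumes D: "finite D" and I: "I \<subseteq> X" "X \<subseteq> D" "card X <= 2 * card I"
  and near: "!!x y. x \<in> I ==> dd y x <= 2 * real k ==> y \<in> X"
 shows "real k / 2 * card X * partn w D <= (\<Sum>v\<in>X. fosum w D (%f. npast (%_ _. True) D k v f))"
proof -
 have "real (card X) <= 2 * real (card I)" using I(3) by linarith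
 then have "real k / 2 * card X <= real k / 2 * (2 * real (card I))" by (intro mult_left_mono) auto
 then have "real k / 2 * card X <= real k * card I" by simp
 then have "real k / 2 * card X * partn w D <= (real k * card I) * partn w D"
  using W.partn_pos[OF D] by (intro mult_right_mono) auto
 also have "... = fosum w D (%f. real k * card I)" by (rule W.fosum_const[symmetric])
 also have "... <= fosum w D (%f. \<Sum>v\<in>X. npast (%_ _. True) D k v f)"
  by (rule W.fosum_mono) (rule npast_sum[OF D I(1,2) near])
 also have "... = (\<Sum>v\<in>X. fosum w D (%f. npast (%_ _. True) D k v f))" by (rule W.fosum_sum)
 finally show ?thesis .
qed

lemma npast_pos_tree:
 assumes D: "finite D" and pos: "0 < npast P D k v f"
 shows "\<exists>ys. k < length ys & P v ys & chain (D - {v}) f v ys"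
proof (rule ccontr)
 assume "\<not> ?thesis"
 then have "npast P D k v f = 0" unfolding npast_def by (intro sum.neutral) auto
 then show False using pos by simp
qed

text \<open>Look at generations of order K r^2. The mean number of descendants closer than r is at
  most a multiple of r^2, hence at most k/4 for this \<open>K\<close>, so at least k/4 of the
  transported mean k/2 stays with far descendants. \<open>paley_zygmund\<close> then yields a
  probability of order 1/k, that is 1/r^2.\<close>

lemma lower_far:
 assumes near_fun: "!!D v r. finite D ==> v \<notin> D ==> 1 <= r ==>
   (\<Sum>x\<in>{x \<in> D. dd v x < r}. hit w D v x) <= Cq * r\<^sup>2"
  and Cq: "0 < Cq"
 shows "\<exists>c>0. \<forall>r\<ge>1. \<exists>k. \<forall>D X I. finite D --> I \<subseteq> X --> X \<subseteq> D --> card X <= 2 * card I -->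
  (\<forall>x\<in>I. \<forall>y. dd y x <= 2 * real k --> y \<in> X) -->
  c / r\<^sup>2 * card X * partn w D <= (\<Sum>v\<in>X. fosum w D (%f. of_bool (\<exists>x\<in>tree (D - {v}) f v. r <= dd v x)))"
proof -
 define K where "K = 4 * Cr * Cq + 1"
 have K: "1 <= K" using Cr_pos Cq by (simp add: K_def)
 define c where "c = 1 / (2048 * Cr * CS\<^sup>2 * (2 * K))"
 have c: "0 < c" using Cr_pos CS_ge K by (simp add: c_def)
 show ?thesis
 proof (intro exI[of _ c] conjI c allI impI)
  fix r :: real assume r: "1 <= r"
  define k where "k = nat \<lceil>K * r\<^sup>2\<rceil>"
  have kr: "1 <= K * r\<^sup>2" using K r mult_mono[of 1 K 1 "r\<^sup>2"] by simp
  have k: "K * r\<^sup>2 <= k" "k <= 2 * (K * r\<^sup>2)" "1 <= k" using kr unfolding k_def by linarith+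
  show "\<exists>k. \<forall>D X I. finite D --> I \<subseteq> X --> X \<subseteq> D --> card X <= 2 * card I -->
   (\<forall>x\<in>I. \<forall>y. dd y x <= 2 * real k --> y \<in> X) -->
   c / r\<^sup>2 * card X * partn w D <= (\<Sum>v\<in>X. fosum w D (%f. of_bool (\<exists>x\<in>tree (D - {v}) f v. r <= dd v x)))"
  proof (intro exI[of _ k] allI impI)
   fix D X I
   assume D: "finite D" and I: "I \<subseteq> X" "X \<subseteq> D" "card X <= 2 * card I"
    and near: "\<forall>x\<in>I. \<forall>y. dd y x <= 2 * real k --> y \<in> X"
   have Z: "0 < partn w D" by (rule W.partn_pos[OF D])
   let ?P = "%v ys. r <= dd v (last (v # ys))"
   let ?N = "%v ys. \<not> ?P v ys"
   have split: "npast (%_ _. True) D k v f = npast ?P D k v f + npast ?N D k v f" for v f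
   proof -
    let ?A = "{ys \<in> plists (D - {v}) (2 * k). k < length ys & True}"
    have fin: "finite (plists (D - {v}) (2 * k))" using D by (intro finite_plists) simp
    have "{ys \<in> plists (D - {v}) (2 * k). k < length ys & True} =
     {ys \<in> plists (D - {v}) (2 * k). k < length ys & ?P v ys} \<union>
     {ys \<in> plists (D - {v}) (2 * k). k < length ys & ?N v ys}" by blast
    then show ?thesis unfolding npast_def
     by (simp only:) (rule sum.union_disjoint, use fin in auto)
   qed
   have nearb: "fosum w D (%f. npast ?N D k v f) <= real k / 4 * partn w D" if v: "v \<in> X" for v
   proof -
    let ?D = "D - {v}"
    have vD: "v \<in> D" using v I by auto
    have "fosum w ?D (%f. npast ?N D k v f) = (\<Sum>ys\<in>{ys \<in> plists ?D (2 * k). k < length ys & ?N v ys}.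
      fosum w ?D (%f. of_bool (chain ?D f v ys)))"
     unfolding npast_def by (rule W.fosum_sum)
    also have "... = (\<Sum>ys\<in>{ys \<in> plists ?D (2 * k). k < length ys & ?N v ys}. pw w ?D v ys * partn w ?D)"
     using D by (intro sum.cong W.fosum_chain_pw) (auto simp: plists_def)
    also have "... = (\<Sum>ys\<in>{ys \<in> plists ?D (2 * k). k < length ys & ?N v ys}. pw w ?D v ys) * partn w ?D"
     by (rule sum_distrib_right[symmetric])
    also have "... <= (Cq * r\<^sup>2) * partn w ?D"
    proof (rule mult_right_mono)
     let ?phi = "%x. of_bool (dd v x < r) :: real"
     have "(\<Sum>ys\<in>{ys \<in> plists ?D (2 * k). k < length ys & ?N v ys}. pw w ?D v ys) <=
       (\<Sum>ys\<in>{ys \<in> plists ?D (2 * k). k < length ys & ?N v ys}. pw w ?D v ys * lastv ?phi ys)"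
      by (intro sum_mono) (auto simp: lastv_def)
     also have "... <= (\<Sum>ys\<in>plists ?D (2 * k). pw w ?D v ys * lastv ?phi ys)"
      using D by (intro sum_mono2 finite_plists) (auto simp: lastv_def intro!: W.pw_nonneg)
     also have "... <= (\<Sum>x\<in>?D. hit w ?D v x * ?phi x)"
      using D by (intro sum_pw_lastv) auto
     also have "... = (\<Sum>x\<in>{x \<in> ?D. dd v x < r}. hit w ?D v x)"
      using D by (intro sum.mono_neutral_cong_right) auto
     also have "... <= Cq * r\<^sup>2" using D r by (intro near_fun) auto
     finally show "(\<Sum>ys\<in>{ys \<in> plists ?D (2 * k). k < length ys & ?N v ys}. pw w ?D v ys) <= Cq * r\<^sup>2" .
     show "0 <= partn w ?D" using W.partn_pos[of ?D] D by simp
    qed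
    finally have "fosum w D (%f. npast ?N D k v (restrict f ?D)) <= Cr * (Cq * r\<^sup>2) * partn w D"
     using Cq by (intro fosum_past_le[OF D vD]) (auto simp: npast_nonneg)
    also have "... <= real k / 4 * partn w D"
    proof (rule mult_right_mono)
     have "4 * (Cr * (Cq * r\<^sup>2)) <= K * r\<^sup>2" by (simp add: K_def algebra_simps)
     then show "Cr * (Cq * r\<^sup>2) <= real k / 4" using k by simp
    qed (use Z in simp)
    finally show ?thesis by (simp only: npast_restrict[symmetric])
   qed
   have "real k / 2 * card X * partn w D <= (\<Sum>v\<in>X. fosum w D (%f. npast (%_ _. True) D k v f))"
    using near by (intro npast_mean[OF D I]) auto
   also have "... = (\<Sum>v\<in>X. fosum w D (%f. npast ?P D k v f)) + (\<Sum>v\<in>X. fosum w D (%f. npast ?N D k v f))"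
    unfolding split W.fosum_add by (rule sum.distrib)
   also have "(\<Sum>v\<in>X. fosum w D (%f. npast ?N D k v f)) <= (\<Sum>v\<in>X. real k / 4 * partn w D)"
    by (rule sum_mono[OF nearb])
   finally have m1: "real k / 4 * card X * partn w D <= (\<Sum>v\<in>X. fosum w D (%f. npast ?P D k v f))"
    by (simp add: algebra_simps)
   have m2: "real k / 8 * card X * partn w D <= real k / 4 * card X * partn w D"
    using Z by (intro mult_right_mono) auto
   have m3: "(\<Sum>v\<in>X. fosum w D (%f. npast ?P D k v f)) =
    (\<Sum>v\<in>X. fosum w D (%f. npast ?P D k v f * of_bool (0 < npast ?P D k v f)))"
   proof (intro sum.cong refl W.fosum_cong)
    fix v f
    show "npast ?P D k v f = npast ?P D k v f * of_bool (0 < npast ?P D k v f)"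
     using npast_nonneg[of ?P D k v f] by (cases "0 < npast ?P D k v f") auto
   qed
   have "card X / (2048 * Cr * CS\<^sup>2 * k) * partn w D <=
     (\<Sum>v\<in>X. fosum w D (%f. of_bool (0 < npast ?P D k v f)))"
    by (rule paley_zygmund[OF D I(2) k(3) order_trans[OF m2 order_trans[OF m1 eq_refl[OF m3]]]])
   also have "... <= (\<Sum>v\<in>X. fosum w D (%f. of_bool (\<exists>x\<in>tree (D - {v}) f v. r <= dd v x)))"
   proof (intro sum_mono W.fosum_mono)
    fix v f
    have "\<exists>x\<in>tree (D - {v}) f v. r <= dd v x" if pos: "0 < npast ?P D k v f"
    proof -
     obtain ys where ys: "k < length ys" "r <= dd v (last (v # ys))" "chain (D - {v}) f v ys"
      using npast_pos_tree[OF D pos] by blast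
     have "leads (D - {v}) f (last (v # ys)) v" using chain_leads[OF _ ys(3)] by simp
     moreover have "last (v # ys) \<in> D - {v}"
     proof -
      have "ys ~= []" using ys by auto
      then show ?thesis using subsetD[OF chain_subset[OF ys(3)] last_in_set[of ys]] by simp
     qed
     ultimately show ?thesis using ys(2) unfolding tree_def by blast
    qed
    then show "of_bool (0 < npast ?P D k v f) <= (of_bool (\<exists>x\<in>tree (D - {v}) f v. r <= dd v x) :: real)"
     by auto
   qed
   finally have fA: "card X / (2048 * Cr * CS\<^sup>2 * k) * partn w D <=
    (\<Sum>v\<in>X. fosum w D (%f. of_bool (\<exists>x\<in>tree (D - {v}) f v. r <= dd v x)))" .
   have fB: "c / r\<^sup>2 * card X <= card X / (2048 * Cr * CS\<^sup>2 * k)"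
   proof -
    have "c / r\<^sup>2 * card X = card X / (2048 * Cr * CS\<^sup>2 * (2 * (K * r\<^sup>2)))" by (simp add: c_def)
    also have "... <= card X / (2048 * Cr * CS\<^sup>2 * k)"
     using k Cr_pos CS_ge K r by (intro divide_left_mono mult_left_mono mult_pos_pos) auto
    finally show ?thesis .
   qed
   show "c / r\<^sup>2 * card X * partn w D <=
    (\<Sum>v\<in>X. fosum w D (%f. of_bool (\<exists>x\<in>tree (D - {v}) f v. r <= dd v x)))"
    by (rule order_trans[OF mult_right_mono[OF fB less_imp_le[OF Z]] fA])
  qed
 qed
qed

lemma npast_le_card_tree:
 assumes D: "finite D"
 shows "npast P D k v f <= card (tree (D - {v}) f v)"
proof -
 let ?S = "{ys \<in> plists (D - {v}) (2 * k). k < length ys & P v ys & chain (D - {v}) f v ys}"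
 have fin: "finite (plists (D - {v}) (2 * k))" using D by (intro finite_plists) simp
 have "npast P D k v f = (\<Sum>ys\<in>?S. 1)"
  unfolding npast_def using fin by (intro sum.mono_neutral_cong_right) auto
 also have "... = card ((%ys. last (v # ys)) ` ?S)"
  by (subst card_image) (auto intro!: inj_onI chain_inj[of v "D - {v}" f])
 also have "... <= card (tree (D - {v}) f v)"
 proof (intro of_nat_mono card_mono image_subsetI)
  fix ys assume ys: "ys \<in> ?S"
  then have ne: "ys ~= []" by auto
  have "set ys \<subseteq> D - {v}" using ys chain_subset[of "D - {v}" f v ys] by blast
  from subsetD[OF this last_in_set[OF ne]] have "last (v # ys) \<in> D - {v}" using ne by simp
  then show "last (v # ys) \<in> tree (D - {v}) f v"
   using chain_leads[of v "D - {v}" f ys] ys by (simp add: tree_def)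
 qed (simp add: tree_def D)
 finally show ?thesis .
qed

text \<open>Values of \<open>npast\<close> below \<epsilon> k^2 contribute at most \<epsilon> k^2
  times the probability of height k, which is at most k/4 for this \<epsilon>. The remaining mean
  sits on trees with at least \<epsilon> k^2 \<ge> n vertices, where k is of order sqrt n.\<close>

lemma lower_size:
 "\<exists>c>0. \<forall>n\<ge>1. \<exists>k. \<forall>D X I. finite D --> I \<subseteq> X --> X \<subseteq> D --> card X <= 2 * card I -->
  (\<forall>x\<in>I. \<forall>y. dd y x <= 2 * real k --> y \<in> X) -->
  c / sqrt (real n) * card X * partn w D <= (\<Sum>v\<in>X. fosum w D (%f. of_bool (n <= card (tree (D - {v}) f v))))"
proof -
 define \<epsilon> where "\<epsilon> = 1 / (4 * Cr * CA + 4)"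
 have eps: "0 < \<epsilon>" "\<epsilon> <= 1" "\<epsilon> * Cr * CA <= 1 / 4"
 proof -
  have p: "0 < Cr * CA" using Cr_pos CA_ge by simp
  then show "0 < \<epsilon>" "\<epsilon> <= 1" by (auto simp: \<epsilon>_def)
  have "\<epsilon> * Cr * CA = Cr * CA / (4 * (Cr * CA) + 4)" by (simp add: \<epsilon>_def)
  also have "... <= Cr * CA / (4 * (Cr * CA))" using p by (intro divide_left_mono) auto
  also have "... = 1 / 4" using p Cr_pos CA_ge by simp
  finally show "\<epsilon> * Cr * CA <= 1 / 4" .
 qed
 define c where "c = sqrt \<epsilon> / (2048 * Cr * CS\<^sup>2 * 2)"
 have c: "0 < c" using Cr_pos CS_ge eps by (simp add: c_def)
 show ?thesis
 proof (intro exI[of _ c] conjI c allI impI)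
  fix n :: nat assume n: "1 <= n"
  define k where "k = nat \<lceil>sqrt (n / \<epsilon>)\<rceil>"
  have "\<epsilon> <= n" using n eps by linarith
  then have s1: "1 <= sqrt (n / \<epsilon>)" using eps by simp
  have k: "sqrt (n / \<epsilon>) <= k" "k <= 2 * sqrt (n / \<epsilon>)" "1 <= k" using s1 unfolding k_def by linarith+
  have nk: "real n <= \<epsilon> * (real k)\<^sup>2"
  proof -
   have "n / \<epsilon> = (sqrt (n / \<epsilon>))\<^sup>2" using eps by simp
   also have "... <= (real k)\<^sup>2" using k s1 by (intro power_mono) auto
   finally show ?thesis using eps by (simp add: field_simps)
  qed
  show "\<exists>k. \<forall>D X I. finite D --> I \<subseteq> X --> X \<subseteq> D --> card X <= 2 * card I -->
   (\<forall>x\<in>I. \<forall>y. dd y x <= 2 * real k --> y \<in> X) -->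
   c / sqrt (real n) * card X * partn w D <= (\<Sum>v\<in>X. fosum w D (%f. of_bool (n <= card (tree (D - {v}) f v))))"
  proof (intro exI[of _ k] allI impI)
   fix D X I
   assume D: "finite D" and I: "I \<subseteq> X" "X \<subseteq> D" "card X <= 2 * card I"
    and near: "\<forall>x\<in>I. \<forall>y. dd y x <= 2 * real k --> y \<in> X"
   have Z: "0 < partn w D" by (rule W.partn_pos[OF D])
   let ?N = "npast (%_ _. True) D k"
   let ?S = "%v f. \<epsilon> * (real k)\<^sup>2 <= ?N v f"
   have small: "fosum w D (%f. ?N v f * of_bool (\<not> ?S v f)) <= real k / 4 * partn w D" if v: "v \<in> X" for v
   proof -
    let ?D = "D - {v}"
    have vD: "v \<in> D" using v I by auto
    have "fosum w D (%f. ?N v f * of_bool (\<not> ?S v f)) <=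
      fosum w D (%f. \<epsilon> * (real k)\<^sup>2 * of_bool (tall ?D (restrict f ?D) v k))"
    proof (rule W.fosum_mono)
     fix f
     show "?N v f * of_bool (\<not> ?S v f) <= \<epsilon> * (real k)\<^sup>2 * of_bool (tall ?D (restrict f ?D) v k)"
     proof (cases "0 < ?N v f")
      case True
      then have "0 < ?N v (restrict f ?D)" by (simp only: npast_restrict[symmetric])
      from npast_pos_tree[OF D this] obtain ys where "k < length ys" "chain ?D (restrict f ?D) v ys" by blast
      then have "tall ?D (restrict f ?D) v (length ys)" unfolding tall_def by blast
      then have "tall ?D (restrict f ?D) v k" using \<open>k < length ys\<close> tall_mono[of ?D "restrict f ?D" v "length ys" k] by simp
      then show ?thesis using eps by (cases "?S v f") auto
     next
      case False
      then have "?N v f = 0" using npast_nonneg[of "%_ _. True" D k v f] by simp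
      then show ?thesis using eps by simp
     qed
    qed
    also have "... = \<epsilon> * (real k)\<^sup>2 * fosum w D (%f. of_bool (tall ?D (restrict f ?D) v k))"
     by (rule W.fosum_cmult)
    also have "... <= \<epsilon> * (real k)\<^sup>2 * (Cr * (CA / k) * partn w D)"
    proof (rule mult_left_mono)
     show "fosum w D (%f. of_bool (tall ?D (restrict f ?D) v k)) <= Cr * (CA / k) * partn w D"
      using D k CA_ge by (intro fosum_past_le[OF D vD, of "%g. of_bool (tall ?D g v k)"] tall_bound) auto
    qed (use eps in simp)
    also have "... = (\<epsilon> * Cr * CA) * k * partn w D" using k by (simp add: power2_eq_square)
    also have "... <= (1 / 4) * k * partn w D" using eps Z by (intro mult_right_mono) auto
    finally show ?thesis by simp
   qed
   have "real k / 2 * card X * partn w D <= (\<Sum>v\<in>X. fosum w D (%f. ?N v f))"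
    using near by (intro npast_mean[OF D I]) auto
   also have "... = (\<Sum>v\<in>X. fosum w D (%f. ?N v f * of_bool (?S v f)) + fosum w D (%f. ?N v f * of_bool (\<not> ?S v f)))"
    unfolding W.fosum_add[symmetric] by (intro sum.cong refl W.fosum_cong) auto
   also have "... = (\<Sum>v\<in>X. fosum w D (%f. ?N v f * of_bool (?S v f))) + (\<Sum>v\<in>X. fosum w D (%f. ?N v f * of_bool (\<not> ?S v f)))"
    by (rule sum.distrib)
   also have "(\<Sum>v\<in>X. fosum w D (%f. ?N v f * of_bool (\<not> ?S v f))) <= (\<Sum>v\<in>X. real k / 4 * partn w D)"
    by (rule sum_mono[OF small])
   finally have m1: "real k / 4 * card X * partn w D <= (\<Sum>v\<in>X. fosum w D (%f. ?N v f * of_bool (?S v f)))"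
    by (simp add: algebra_simps)
   have m2: "real k / 8 * card X * partn w D <= real k / 4 * card X * partn w D"
    using Z by (intro mult_right_mono) auto
   have "card X / (2048 * Cr * CS\<^sup>2 * k) * partn w D <= (\<Sum>v\<in>X. fosum w D (%f. of_bool (?S v f)))"
    by (rule paley_zygmund[OF D I(2) k(3) order_trans[OF m2 m1]])
   also have "... <= (\<Sum>v\<in>X. fosum w D (%f. of_bool (n <= card (tree (D - {v}) f v))))"
   proof (intro sum_mono W.fosum_mono)
    fix v f
    have "n <= card (tree (D - {v}) f v)" if "?S v f"
    proof -
     have "real n <= real (card (tree (D - {v}) f v))"
      using nk that npast_le_card_tree[OF D, of "%_ _. True" k v f] by linarith
     then show ?thesis by simp
    qed
    then show "of_bool (?S v f) <= (of_bool (n <= card (tree (D - {v}) f v)) :: real)" by auto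
   qed
   finally have fA: "card X / (2048 * Cr * CS\<^sup>2 * k) * partn w D <=
    (\<Sum>v\<in>X. fosum w D (%f. of_bool (n <= card (tree (D - {v}) f v))))" .
   have fB: "c / sqrt n * card X <= card X / (2048 * Cr * CS\<^sup>2 * k)"
   proof -
    have "c / sqrt n * card X = card X / (2048 * Cr * CS\<^sup>2 * (2 * sqrt (n / \<epsilon>)))"
     using eps n by (simp add: c_def real_sqrt_divide mult_ac)
    also have "... <= card X / (2048 * Cr * CS\<^sup>2 * k)"
    proof (rule divide_left_mono)
     have k0: "0 < real k" using k(1) s1 by linarith
     show "2048 * Cr * CS\<^sup>2 * k <= 2048 * Cr * CS\<^sup>2 * (2 * sqrt (n / \<epsilon>))"
      using k(2) Cr_pos by (intro mult_left_mono) auto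
     show "0 < 2048 * Cr * CS\<^sup>2 * (2 * sqrt (n / \<epsilon>)) * (2048 * Cr * CS\<^sup>2 * k)"
      using k0 Cr_pos CS_ge s1 by (intro mult_pos_pos) auto
    qed simp
    finally show ?thesis .
   qed
   show "c / sqrt n * card X * partn w D <=
    (\<Sum>v\<in>X. fosum w D (%f. of_bool (n <= card (tree (D - {v}) f v))))"
    by (rule order_trans[OF mult_right_mono[OF fB less_imp_le[OF Z]] fA])
  qed
 qed
qed

end

section \<open>Toppling and stabilization\<close>

lemma legal_append:
 "legal E K \<eta> (xs @ ys) \<longleftrightarrow> legal E K \<eta> xs & legal E K (fold (topple E K) xs \<eta>) ys"
 by (induction xs arbitrary: \<eta>) auto

lemma legal_subset: "legal E K \<eta> xs ==> set xs \<subseteq> K"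
 by (induction xs arbitrary: \<eta>) auto

lemma fold_topple_out: "legal E K \<eta> xs ==> y \<notin> K ==> fold (topple E K) xs \<eta> y = \<eta> y"
 by (induction xs arbitrary: \<eta>) (auto simp: topple_def)

context tgraph
begin

lemma deg_E: "deg E x = dg"
 by (simp add: deg_def E_card)

definition nin :: "'v set => 'v => nat" where
 "nin P x = card {y \<in> P. E x y}"

lemma finite_nin: "finite {y \<in> P. E x y}"
 by (rule finite_subset[OF _ finite_E[of x]]) auto

lemma nin_mono: "P \<subseteq> Q ==> nin P x <= nin Q x"
 unfolding nin_def by (intro card_mono finite_nin) auto

lemma nin_UNIV: "nin UNIV x = dg"
 by (simp add: nin_def E_card)

lemma nin_le: "nin P x <= dg"
 using nin_mono[of P UNIV x] by (simp add: nin_UNIV)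

lemma nin_Un: "P \<inter> Q = {} ==> nin (P \<union> Q) x = nin P x + nin Q x"
proof -
 assume d: "P \<inter> Q = {}"
 have "{y \<in> P \<union> Q. E x y} = {y \<in> P. E x y} \<union> {y \<in> Q. E x y}" by auto
 then show ?thesis unfolding nin_def using d by (simp add: card_Un_disjoint[OF finite_nin finite_nin] disjoint_iff)
qed

text \<open>The toppling matrix of \<open>K\<close> applied to \<open>m\<close>. Integer values
  permit differences of toppling numbers, on which the uniqueness arguments rest.\<close>

definition lap :: "'v set => ('v => int) => 'v => int" where
 "lap K m x = int dg * m x - (\<Sum>y\<in>{y \<in> K. E x y}. m y)"

lemma lap_add: "lap K (%z. m z + m' z) x = lap K m x + lap K m' x"
 by (simp add: lap_def sum.distrib algebra_simps)

lemma lap_diff: "lap K (%z. m z - m' z) x = lap K m x - lap K m' x"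
 by (simp add: lap_def sum_subtractf algebra_simps)

lemma lap_uminus: "lap K (%z. - m z) x = - lap K m x"
 by (simp add: lap_def sum_negf)

lemma lap_cong: "x \<in> K ==> (!!z. z \<in> K ==> m z = m' z) ==> lap K m x = lap K m' x"
 by (auto simp: lap_def intro!: sum.cong)

lemma lap_indicator: "lap K (%z. of_bool (z \<in> A)) x = int dg * of_bool (x \<in> A) - int (nin (K \<inter> A) x)"
proof -
 have "(\<Sum>y\<in>{y \<in> K. E x y}. of_bool (y \<in> A) :: int) = (\<Sum>y\<in>{y \<in> K \<inter> A. E x y}. 1)"
  by (rule sum.mono_neutral_cong_right[OF finite_nin]) auto
 then show ?thesis by (simp add: lap_def nin_def)
qed

lemma nin_singleton: "nin (K \<inter> {a}) x = of_bool (a \<in> K & E x a)"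
proof -
 have "{y \<in> K \<inter> {a}. E x y} = (if a \<in> K & E x a then {a} else {})" by auto
 then show ?thesis by (simp add: nin_def)
qed

lemma topple_int:
 assumes "a \<in> K" "dg <= \<eta> a" "y \<in> K"
 shows "int (topple E K a \<eta> y) = int (\<eta> y) - lap K (%z. of_bool (z \<in> {a})) y"
 unfolding lap_indicator nin_singleton topple_def deg_E
 using assms E_irrefl E_sym by (auto simp: of_nat_diff)

lemma fold_topple_int:
 "legal E K \<eta> xs ==> y \<in> K ==>
  int (fold (topple E K) xs \<eta> y) = int (\<eta> y) - lap K (%z. int (count_list xs z)) y"
proof (induction xs arbitrary: \<eta>)
 case Nil
 then show ?case by (simp add: lap_def)
next
 case (Cons a xs)
 have a: "a \<in> K" "dg <= \<eta> a" "legal E K (topple E K a \<eta>) xs" using Cons.prems by (auto simp: deg_E)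
 have "int (fold (topple E K) (a # xs) \<eta> y) = int (topple E K a \<eta> y) - lap K (%z. int (count_list xs z)) y"
  using Cons.IH[OF a(3) Cons.prems(2)] by simp
 also have "... = int (\<eta> y) - (lap K (%z. of_bool (z \<in> {a})) y + lap K (%z. int (count_list xs z)) y)"
  using topple_int[where a = a and K = K and \<eta> = \<eta> and y = y, OF a(1,2) Cons.prems(2)] by simp
 also have "lap K (%z. of_bool (z \<in> {a})) y + lap K (%z. int (count_list xs z)) y =
   lap K (%z. int (count_list (a # xs) z)) y"
  unfolding lap_add[symmetric] by (rule lap_cong[OF Cons.prems(2)]) auto
 finally show ?case .
qed

text \<open>The least action principle.\<close>

lemma count_le_stabilizing:
 assumes m: "!!x. x \<in> K ==> int (\<eta> x) - lap K (%z. int (m z)) x < int dg"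
 shows "legal E K \<eta> xs ==> count_list xs z <= m z"
proof (induction xs arbitrary: z rule: rev_induct)
 case (snoc a xs)
 have l: "legal E K \<eta> xs" "a \<in> K" "dg <= fold (topple E K) xs \<eta> a"
  using snoc.prems by (auto simp: legal_append deg_E)
 have le: "count_list xs y <= m y" for y by (rule snoc.IH[OF l(1)])
 have "count_list xs a ~= m a"
 proof
  assume eq: "count_list xs a = m a"
  have "(\<Sum>y\<in>{y \<in> K. E a y}. int (count_list xs y)) <= (\<Sum>y\<in>{y \<in> K. E a y}. int (m y))"
   using le by (intro sum_mono) simp
  then have "lap K (%z. int (m z)) a <= lap K (%z. int (count_list xs z)) a" using eq by (simp add: lap_def)
  then show False using fold_topple_int[OF l(1,2)] m[OF l(2)] l(3) by linarith
 qed
 then have "count_list xs a < m a" using le[of a] by simp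
 then show ?case using le[of z] by auto
qed simp

text \<open>\<open>t\<close> is an expected exit time up to the factor \<open>dg\<close>: its
  Laplacian is 1 on \<open>K\<close>, so each toppling lowers the weighted mass by exactly 1. The
  weights do not depend on the configuration, which makes the bound uniform in
  \<open>local_lists\<close>.\<close>

lemma length_legal_le:
 assumes K: "finite K"
 shows "\<exists>t. (\<forall>x. 0 <= (t x :: real)) & (\<forall>\<eta> xs. legal E K \<eta> xs --> real (length xs) <= (\<Sum>x\<in>K. t x * real (\<eta> x)))"
proof -
 define t where "t x = (\<Sum>u\<in>K. green w K x u)" for x
 have t0: "0 <= t x" for x unfolding t_def by (intro sum_nonneg W.green_nonneg K)
 have Lt: "dg * t x - (\<Sum>y\<in>K. w x y * t y) = 1" if x: "x \<in> K" for x
 proof -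
  have "dg * t x - (\<Sum>y\<in>K. w x y * t y) = (\<Sum>u\<in>K. dg * green w K x u - (\<Sum>y\<in>K. w x y * green w K y u))"
   unfolding t_def sum_subtractf sum_distrib_left by (subst (2) sum.swap) simp
  also have "... = (\<Sum>u\<in>K. of_bool (x = u))"
   by (intro sum.cong refl W.green_eq[OF K _ x, unfolded csum_w])
  also have "... = 1" using x K by (simp add: of_bool_def)
  finally show ?thesis .
 qed
 have main: "real (length xs) <= (\<Sum>x\<in>K. t x * real (\<eta> x))" if l: "legal E K \<eta> xs" for \<eta> xs
 proof -
  let ?c = "%z. real (count_list xs z)"
  have lapr: "real_of_int (lap K (%z. int (count_list xs z)) x) = csum w x * ?c x - (\<Sum>y\<in>K. w x y * ?c y)" for x
  proof -
   have "(\<Sum>y\<in>K. w x y * ?c y) = (\<Sum>y\<in>{y \<in> K. E x y}. ?c y)"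
    using K by (intro sum.mono_neutral_cong_right) (auto simp: w_def)
   then show ?thesis by (simp add: lap_def csum_w)
  qed
  have "0 <= (\<Sum>x\<in>K. t x * real (fold (topple E K) xs \<eta> x))"
   by (intro sum_nonneg mult_nonneg_nonneg t0) simp
  also have "... = (\<Sum>x\<in>K. t x * real (\<eta> x) - t x * (csum w x * ?c x - (\<Sum>y\<in>K. w x y * ?c y)))"
  proof (rule sum.cong[OF refl])
   fix x assume x: "x \<in> K"
   have "real (fold (topple E K) xs \<eta> x) = real_of_int (int (\<eta> x) - lap K (%z. int (count_list xs z)) x)"
    unfolding fold_topple_int[OF l x, symmetric] by simp
   then show "t x * real (fold (topple E K) xs \<eta> x) =
    t x * real (\<eta> x) - t x * (csum w x * ?c x - (\<Sum>y\<in>K. w x y * ?c y))"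
    by (simp only: of_int_diff lapr right_diff_distrib of_int_of_nat_eq)
  qed
  also have "... = (\<Sum>x\<in>K. t x * real (\<eta> x)) - (\<Sum>x\<in>K. t x * (csum w x * ?c x - (\<Sum>y\<in>K. w x y * ?c y)))"
   by (rule sum_subtractf)
  also have "(\<Sum>x\<in>K. t x * (csum w x * ?c x - (\<Sum>y\<in>K. w x y * ?c y))) =
    (\<Sum>x\<in>K. (csum w x * t x - (\<Sum>y\<in>K. w x y * t y)) * ?c x)"
   by (rule W.laplace_sym[OF K w_sym])
  also have "... = (\<Sum>x\<in>K. ?c x)" using Lt by (intro sum.cong) (auto simp: csum_w)
  also have "... = real (length xs)"
  proof -
   have "(\<Sum>x\<in>K. count_list xs x) = (\<Sum>x\<in>set xs. count_list xs x)"
    using legal_subset[OF l] K by (intro sum.mono_neutral_right) auto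
   then show ?thesis using sum_count_set[of xs "set xs"] by (simp flip: of_nat_sum)
  qed
  finally show ?thesis by simp
 qed
 show ?thesis using t0 main by blast
qed

definition stabilizing :: "'v set => ('v => nat) => 'v list => bool" where
 "stabilizing K \<eta> xs \<longleftrightarrow> legal E K \<eta> xs & stable E K (fold (topple E K) xs \<eta>)"

lemma stabilizing_exists:
 assumes K: "finite K"
 shows "\<exists>xs. stabilizing K \<eta> xs"
proof -
 obtain t where t: "!!\<eta> xs. legal E K \<eta> xs ==> real (length xs) <= (\<Sum>x\<in>K. t x * real (\<eta> x))"
  using length_legal_le[OF K] by blast
 obtain b :: nat where "(\<Sum>x\<in>K. t x * real (\<eta> x)) <= b" using real_arch_simple by blast
 then have "\<forall>xs. legal E K \<eta> xs --> length xs < Suc b" using t[of \<eta>] by (meson less_Suc_eq_le of_nat_le_iff order_trans)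
 from ex_has_greatest_nat[OF _ this, of "[]"] obtain xs where
  xs: "legal E K \<eta> xs" "!!ys. legal E K \<eta> ys ==> length ys <= length xs" by auto
 have "stable E K (fold (topple E K) xs \<eta>)"
  unfolding stable_def
 proof (intro ballI, rule ccontr)
  fix x assume "x \<in> K" "\<not> fold (topple E K) xs \<eta> x < deg E x"
  then have "legal E K \<eta> (xs @ [x])" using xs(1) by (simp add: legal_append)
  from xs(2)[OF this] show False by simp
 qed
 then show ?thesis using xs(1) unfolding stabilizing_def by blast
qed

text \<open>The choice of the list does not matter by \<open>stabilizing_count\<close>.\<close>

definition odo :: "'v set => ('v => nat) => 'v => nat" where
 "odo K \<eta> = count_list (SOME xs. stabilizing K \<eta> xs)"

lemma stabilizing_int:
 assumes "stabilizing K \<eta> xs" "x \<in> K"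
 shows "int (\<eta> x) - lap K (%z. int (count_list xs z)) x < int dg"
proof -
 have l: "legal E K \<eta> xs" and s: "stable E K (fold (topple E K) xs \<eta>)"
  using assms by (auto simp: stabilizing_def)
 have "fold (topple E K) xs \<eta> x < dg" using s assms(2) by (simp add: stable_def deg_E)
 then show ?thesis using fold_topple_int[OF l assms(2)] by simp
qed

lemma stabilizing_count:
 assumes "stabilizing K \<eta> xs" "stabilizing K \<eta> ys"
 shows "count_list xs = count_list ys"
proof (rule ext, rule antisym)
 fix z
 have lx: "legal E K \<eta> xs" and ly: "legal E K \<eta> ys" using assms by (auto simp: stabilizing_def)
 show "count_list xs z <= count_list ys z"
  using count_le_stabilizing[OF stabilizing_int[OF assms(2)] lx] .
 show "count_list ys z <= count_list xs z"
  using count_le_stabilizing[OF stabilizing_int[OF assms(1)] ly] .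
qed

lemma stabilizing_fold:
 assumes "stabilizing K \<eta> xs" "stabilizing K \<eta> ys"
 shows "fold (topple E K) xs \<eta> = fold (topple E K) ys \<eta>"
proof
 fix x
 have lx: "legal E K \<eta> xs" and ly: "legal E K \<eta> ys" using assms by (auto simp: stabilizing_def)
 show "fold (topple E K) xs \<eta> x = fold (topple E K) ys \<eta> x"
 proof (cases "x \<in> K")
  case True
  have "int (fold (topple E K) xs \<eta> x) = int (fold (topple E K) ys \<eta> x)"
   unfolding fold_topple_int[OF lx True] fold_topple_int[OF ly True] stabilizing_count[OF assms] ..
  then show ?thesis by simp
 next
  case False
  then show ?thesis using fold_topple_out[OF lx] fold_topple_out[OF ly] by simp
 qed
qed

lemma stabilize_eq:
 assumes "stabilizing K \<eta> xs"
 shows "stabilize E K \<eta> = fold (topple E K) xs \<eta>"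
 unfolding stabilize_def
proof (rule the_equality)
 show "stable E K (fold (topple E K) xs \<eta>) &
   (\<exists>ys. legal E K \<eta> ys & fold (topple E K) xs \<eta> = fold (topple E K) ys \<eta>)"
  using assms unfolding stabilizing_def by blast
 fix \<xi> assume a: "stable E K \<xi> & (\<exists>ys. legal E K \<eta> ys & \<xi> = fold (topple E K) ys \<eta>)"
 then obtain ys where "legal E K \<eta> ys" "\<xi> = fold (topple E K) ys \<eta>" by blast
 then have "stabilizing K \<eta> ys" using a by (simp add: stabilizing_def)
 from stabilizing_fold[OF this assms] show "\<xi> = fold (topple E K) xs \<eta>" using \<open>\<xi> = _\<close> by simp
qed

lemma odo_list:
 assumes "finite K"
 shows "\<exists>xs. stabilizing K \<eta> xs & count_list xs = odo K \<eta> & fold (topple E K) xs \<eta> = stabilize E K \<eta>"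
proof -
 have s: "stabilizing K \<eta> (SOME xs. stabilizing K \<eta> xs)" by (rule someI_ex[OF stabilizing_exists[OF assms]])
 then show ?thesis using stabilize_eq[OF s] unfolding odo_def by metis
qed

lemma stable_stabilize: "finite K ==> stable E K (stabilize E K \<eta>)"
 using odo_list[of K \<eta>] by (auto simp: stabilizing_def)

lemma stabilize_int:
 "finite K ==> x \<in> K ==> int (stabilize E K \<eta> x) = int (\<eta> x) - lap K (%z. int (odo K \<eta> z)) x"
proof -
 assume K: "finite K" and x: "x \<in> K"
 obtain xs where xs: "stabilizing K \<eta> xs" "count_list xs = odo K \<eta>" "fold (topple E K) xs \<eta> = stabilize E K \<eta>"
  using odo_list[OF K] by blast
 then have "legal E K \<eta> xs" by (simp add: stabilizing_def)
 then show ?thesis unfolding xs(2,3)[symmetric] by (rule fold_topple_int[OF _ x])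
qed

lemma stabilize_out: "finite K ==> x \<notin> K ==> stabilize E K \<eta> x = \<eta> x"
proof -
 assume K: "finite K" and x: "x \<notin> K"
 obtain xs where xs: "stabilizing K \<eta> xs" "fold (topple E K) xs \<eta> = stabilize E K \<eta>"
  using odo_list[OF K] by blast
 then have "legal E K \<eta> xs" by (simp add: stabilizing_def)
 then show ?thesis unfolding xs(2)[symmetric] by (rule fold_topple_out[OF _ x])
qed

lemma odo_out: "finite K ==> x \<notin> K ==> odo K \<eta> x = 0"
 using odo_list[of K \<eta>] legal_subset[of E K \<eta>] by (metis count_list_0_iff stabilizing_def subsetD)

lemma odo_ge: "finite K ==> legal E K \<eta> xs ==> count_list xs x <= odo K \<eta> x"
 using odo_list[of K \<eta>] count_le_stabilizing[of K \<eta> "odo K \<eta>" xs x] stabilizing_int[of K \<eta>] by metis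

lemma odo_le:
 assumes "finite K" "!!x. x \<in> K ==> int (\<eta> x) - lap K (%z. int (m z)) x < int dg"
 shows "odo K \<eta> x <= m x"
proof -
 obtain xs where xs: "stabilizing K \<eta> xs" "count_list xs = odo K \<eta>"
  using odo_list[OF assms(1)] by blast
 then have "legal E K \<eta> xs" by (simp add: stabilizing_def)
 then show ?thesis unfolding xs(2)[symmetric] by (rule count_le_stabilizing[rotated]) (rule assms(2))
qed

lemma stabilize_stable: "stable E K \<eta> ==> stabilize E K \<eta> = \<eta>"
 using stabilize_eq[of K \<eta> "[]"] by (simp add: stabilizing_def)

section \<open>Recurrent configurations\<close>

text \<open>Absence of forbidden subconfigurations, the burning criterion;
  \<open>recurrent_eq\<close> identifies it with recurrence.\<close>

definition allowed :: "'v set => ('v => nat) => bool" where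
 "allowed K \<eta> \<longleftrightarrow> (\<forall>P. P \<subseteq> K --> P ~= {} --> (\<exists>x\<in>P. nin P x <= \<eta> x))"

lemma allowed_mono: "allowed K \<eta> ==> (!!x. x \<in> K ==> \<eta> x <= \<xi> x) ==> allowed K \<xi>"
 unfolding allowed_def by (meson le_trans subsetD)

lemma allowed_subset: "allowed K \<eta> ==> L \<subseteq> K ==> allowed L \<eta>"
 unfolding allowed_def by (meson subset_trans)

lemma allowed_cong: "(!!x. x \<in> K ==> \<eta> x = \<xi> x) ==> allowed K \<eta> \<longleftrightarrow> allowed K \<xi>"
 using allowed_mono[of K \<eta> \<xi>] allowed_mono[of K \<xi> \<eta>] by auto

lemma nin_remove: "x \<in> P ==> nin P y = nin (P - {x}) y + of_bool (E y x)"
proof -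
 assume x: "x \<in> P"
 have "nin P y = nin ((P - {x}) \<union> (P \<inter> {x})) y" using x by (intro arg_cong2[where f = nin]) auto
 also have "... = nin (P - {x}) y + nin (P \<inter> {x}) y" by (rule nin_Un) auto
 finally show ?thesis unfolding nin_singleton using x by simp
qed

text \<open>A set containing the toppled vertex \<open>a\<close> is tested without \<open>a\<close>:
  each neighbour of \<open>a\<close> gains the grain that compensates for putting \<open>a\<close>
  back.\<close>

lemma allowed_topple:
 assumes al: "allowed K \<eta>" and a: "a \<in> K" "dg <= \<eta> a"
 shows "allowed K (topple E K a \<eta>)"
 unfolding allowed_def
proof (intro allI impI)
 fix P assume P: "P \<subseteq> K" "P ~= {}"
 show "\<exists>x\<in>P. nin P x <= topple E K a \<eta> x"
 proof (cases "a \<in> P")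
  case False
  obtain x where x: "x \<in> P" "nin P x <= \<eta> x" using al P unfolding allowed_def by blast
  then show ?thesis using False P by (intro bexI[of _ x]) (auto simp: topple_def)
 next
  case True
  show ?thesis
  proof (cases "P = {a}")
   case True
   have "nin P a = 0" using True E_irrefl by (auto simp: nin_def)
   then show ?thesis using True by auto
  next
   case False
   then have "P - {a} \<subseteq> K" "P - {a} ~= {}" using P True by auto
   then obtain x where x: "x \<in> P - {a}" "nin (P - {a}) x <= \<eta> x" using al unfolding allowed_def by blast
   have "nin P x <= topple E K a \<eta> x"
    using x P nin_remove[OF True, of x] E_sym by (auto simp: topple_def)
   then show ?thesis using x by blast
  qed
 qed
qed

lemma allowed_fold: "allowed K \<eta> ==> legal E K \<eta> xs ==> allowed K (fold (topple E K) xs \<eta>)"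
 by (induction xs arbitrary: \<eta>) (auto simp: deg_E intro: allowed_topple)

lemma allowed_stabilize: "finite K ==> allowed K \<eta> ==> allowed K (stabilize E K \<eta>)"
 using odo_list[of K \<eta>] allowed_fold[of K \<eta>] unfolding stabilizing_def by metis

text \<open>The set where the difference of the toppling numbers is maximal is a forbidden subconfiguration.\<close>

lemma lap_allowed_nonpos:
 assumes K: "finite K" and st: "stable E K \<eta>" and al: "allowed K \<xi>"
  and eq: "!!x. x \<in> K ==> int (\<xi> x) = int (\<eta> x) - lap K m x" and x: "x \<in> K"
 shows "m x <= 0"
proof (rule ccontr)
 assume pos: "\<not> m x <= 0"
 define M where "M = Max (m ` K)"
 have M: "m y <= M" if "y \<in> K" for y unfolding M_def using K that by simp
 have M0: "0 < M" using M[OF x] pos by simp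
 define P where "P = {y \<in> K. m y = M}"
 have "M \<in> m ` K" unfolding M_def using K x by (intro Max_in) auto
 then have "P ~= {}" "P \<subseteq> K" by (auto simp: P_def)
 then obtain y where y: "y \<in> P" "nin P y <= \<xi> y" using al unfolding allowed_def by blast
 have yK: "y \<in> K" "m y = M" using y by (auto simp: P_def)
 have "(\<Sum>z\<in>{z \<in> K. E y z}. m z) <= (\<Sum>z\<in>{z \<in> K. E y z}. (M - 1) + of_bool (z \<in> P))"
 proof (rule sum_mono)
  fix z assume "z \<in> {z \<in> K. E y z}"
  then show "m z <= (M - 1) + of_bool (z \<in> P)" using M[of z] by (auto simp: P_def)
 qed
 also have "... = int (nin K y) * (M - 1) + int (nin (K \<inter> P) y)"
  using lap_indicator[of K P y] by (simp add: sum.distrib nin_def lap_def)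
 also have "... <= int dg * (M - 1) + int (nin P y)"
  using nin_le[of K y] nin_mono[of "K \<inter> P" P y] M0 by (intro add_mono mult_right_mono) auto
 finally have "lap K m y \<ge> int dg - int (nin P y)" using yK by (simp add: lap_def algebra_simps)
 moreover have "int (\<eta> y) < int dg" using st yK by (simp add: stable_def deg_E)
 ultimately show False using eq[OF yK(1)] y(2) by linarith
qed

definition rec_set :: "'v set => ('v => nat) set" where
 "rec_set K = {\<eta> \<in> stable_sandpiles E K. allowed K \<eta>}"

lemma rec_setD: "\<eta> \<in> rec_set K ==> stable E K \<eta> & allowed K \<eta> & (\<forall>x. x \<notin> K --> \<eta> x = 0)"
 by (auto simp: rec_set_def stable_sandpiles_def sandpiles_def)

lemma rec_setI: "stable E K \<eta> ==> allowed K \<eta> ==> (!!x. x \<notin> K ==> \<eta> x = 0) ==> \<eta> \<in> rec_set K"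
 by (auto simp: rec_set_def stable_sandpiles_def sandpiles_def)

text \<open>Apply \<open>lap_allowed_nonpos\<close> to \<open>m\<close> and to its negative: each
  class modulo the image of the Laplacian contains at most one recurrent configuration.\<close>

lemma rec_unique:
 assumes K: "finite K" and r: "\<eta> \<in> rec_set K" "\<xi> \<in> rec_set K"
  and eq: "!!x. x \<in> K ==> int (\<xi> x) = int (\<eta> x) - lap K m x"
 shows "\<xi> = \<eta> & (\<forall>x\<in>K. m x = 0)"
proof -
 have 1: "m x <= 0" if "x \<in> K" for x
  using rec_setD[OF r(1)] rec_setD[OF r(2)] by (intro lap_allowed_nonpos[OF K _ _ eq that]) auto
 have eq': "int (\<eta> x) = int (\<xi> x) - lap K (%z. - m z) x" if "x \<in> K" for x
  using eq[OF that] by (simp add: lap_uminus)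
 have 2: "- m x <= 0" if "x \<in> K" for x
  using rec_setD[OF r(1)] rec_setD[OF r(2)] by (intro lap_allowed_nonpos[OF K _ _ eq' that]) auto
 have z: "m x = 0" if "x \<in> K" for x using 1[OF that] 2[OF that] by simp
 have "\<xi> x = \<eta> x" for x
 proof (cases "x \<in> K")
  case True
  have "lap K m x = lap K (%_. 0) x" using z True by (intro lap_cong) auto
  then show ?thesis using eq[OF True] by (simp add: lap_def)
 next
  case False
  then show ?thesis using rec_setD[OF r(1)] rec_setD[OF r(2)] by simp
 qed
 then show ?thesis using z by auto
qed

section \<open>Addition operators and communication of recurrent configurations\<close>

definition gadd :: "'v set => 'v => ('v => nat) => 'v => nat" where
 "gadd K v \<eta> = stabilize E K (add_grain v \<eta>)"

lemma gadd_rec: "finite K ==> v \<in> K ==> \<eta> \<in> rec_set K ==> gadd K v \<eta> \<in> rec_set K"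
 unfolding gadd_def
proof (rule rec_setI)
 assume K: "finite K" "v \<in> K" "\<eta> \<in> rec_set K"
 show "stable E K (stabilize E K (add_grain v \<eta>))" by (rule stable_stabilize[OF K(1)])
 have "allowed K (add_grain v \<eta>)"
  using rec_setD[OF K(3)] allowed_mono[of K \<eta> "add_grain v \<eta>"] by (auto simp: add_grain_def)
 then show "allowed K (stabilize E K (add_grain v \<eta>))" by (rule allowed_stabilize[OF K(1)])
 show "stabilize E K (add_grain v \<eta>) x = 0" if "x \<notin> K" for x
  using that K rec_setD[OF K(3)] stabilize_out[OF K(1) that] by (auto simp: add_grain_def)
qed

lemma gadd_inj: "finite K ==> inj_on (gadd K v) (rec_set K)"
proof (rule inj_onI)
 fix \<eta> \<xi> assume K: "finite K" and r: "\<eta> \<in> rec_set K" "\<xi> \<in> rec_set K" and eq: "gadd K v \<eta> = gadd K v \<xi>"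
 have "int (\<xi> x) = int (\<eta> x) - lap K (%z. int (odo K (add_grain v \<eta>) z) - int (odo K (add_grain v \<xi>) z)) x"
  if "x \<in> K" for x
 proof -
  have "int (stabilize E K (add_grain v \<eta>) x) = int (stabilize E K (add_grain v \<xi>) x)"
   using eq by (simp add: gadd_def)
  then show ?thesis unfolding stabilize_int[OF K that] lap_diff by (auto simp: add_grain_def split: if_splits)
 qed
 from rec_unique[OF K r this] show "\<eta> = \<xi>" by simp
qed

lemma finite_stable: "finite K ==> finite (stable_sandpiles E K)"
proof -
 assume K: "finite K"
 have "finite {f. \<forall>x. (x \<in> K --> f x \<in> {..<dg}) & (x \<notin> K --> f x = 0)}"
  by (rule finite_set_of_finite_funs) (use K in auto)
 then show ?thesis
  by (rule finite_subset[rotated]) (auto simp: stable_sandpiles_def sandpiles_def stable_def deg_E)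
qed

lemma finite_rec: "finite K ==> finite (rec_set K)"
 using finite_stable[of K] by (simp add: rec_set_def)

definition full :: "'v set => 'v => nat" where
 "full K x = (if x \<in> K then dg - 1 else 0)"

lemma full_rec: "finite K ==> full K \<in> rec_set K"
proof (rule rec_setI)
 assume K: "finite K"
 show "stable E K (full K)" using dg_pos by (simp add: stable_def deg_E full_def)
 show "allowed K (full K)"
  unfolding allowed_def
 proof (intro allI impI)
  fix P assume P: "P \<subseteq> K" "P ~= {}"
  obtain x y where xy: "x \<in> P" "y \<notin> P" "E x y" using E_escape[of P] P K finite_subset by blast
  have "nin (insert y P) x = nin P x + 1" using nin_remove[of y "insert y P" x] xy by simp
  then have "nin P x <= dg - 1" using nin_le[of "insert y P" x] by simp
  then show "\<exists>x\<in>P. nin P x <= full K x" using xy P by (intro bexI[of _ x]) (auto simp: full_def)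
 qed
qed (simp add: full_def)

lemma step_set:
 assumes "finite K" "K ~= {}"
 shows "set_pmf (sandpile_step E K \<eta>) = (%v. gadd K v \<eta>) ` K"
 unfolding sandpile_step_def gadd_def using assms by simp

lemma reachable_step: "finite K ==> v \<in> K ==> reachable E K \<eta> (gadd K v \<eta>)"
 unfolding reachable_def by (rule r_into_rtranclp) (subst step_set, auto)

lemma reachable_trans: "reachable E K \<eta> \<xi> ==> reachable E K \<xi> \<zeta> ==> reachable E K \<eta> \<zeta>"
 unfolding reachable_def by (rule rtranclp_trans)

lemma reachable_rec:
 assumes K: "finite K" "K ~= {}"
 shows "reachable E K \<eta> \<xi> ==> \<eta> \<in> rec_set K ==> \<xi> \<in> rec_set K"
 unfolding reachable_def
 by (induction rule: rtranclp_induct) (auto simp: step_set[OF K] intro: gadd_rec[OF K(1)])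

lemma reachable_full:
 assumes K: "finite K"
 shows "\<eta> \<in> stable_sandpiles E K ==> reachable E K \<eta> (full K)"
proof (induction "\<Sum>x\<in>K. dg - \<eta> x" arbitrary: \<eta> rule: less_induct)
 case less
 show ?case
 proof (cases "\<eta> = full K")
  case True
  then show ?thesis by (simp add: reachable_def)
 next
  case False
  then obtain v where v: "\<eta> v ~= full K v" by auto
  have st: "\<eta> x < dg" if "x \<in> K" for x using less.prems that by (auto simp: stable_sandpiles_def stable_def deg_E)
  have out: "\<eta> x = 0" if "x \<notin> K" for x using less.prems that by (auto simp: stable_sandpiles_def sandpiles_def)
  have vK: "v \<in> K" using v out by (auto simp: full_def split: if_splits)
  then have lt: "\<eta> v + 1 < dg" using v st[OF vK] by (simp add: full_def)
  have s: "stable E K (add_grain v \<eta>)" using st lt by (auto simp: stable_def deg_E add_grain_def)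
  then have g: "gadd K v \<eta> = add_grain v \<eta>" unfolding gadd_def by (rule stabilize_stable)
  have "add_grain v \<eta> \<in> stable_sandpiles E K"
   using s out vK by (auto simp: stable_sandpiles_def sandpiles_def add_grain_def)
  moreover have "(\<Sum>x\<in>K. dg - add_grain v \<eta> x) < (\<Sum>x\<in>K. dg - \<eta> x)"
   using lt by (intro sum_strict_mono_ex1 K bexI[of _ v] vK) (auto simp: add_grain_def)
  ultimately have "reachable E K (add_grain v \<eta>) (full K)" by (intro less.hyps)
  then show ?thesis using reachable_trans reachable_step[OF K vK, of \<eta>] g by metis
 qed
qed

text \<open>Addition at \<open>v\<close> is an injective self-map of the finite set of recurrent
  configurations reachable from \<open>gadd K v \<eta>\<close>, hence onto; so \<eta> itself lies in
  this set.\<close>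

lemma reachable_sym:
 assumes K: "finite K" "K ~= {}"
 shows "reachable E K \<eta> \<xi> ==> \<eta> \<in> rec_set K ==> reachable E K \<xi> \<eta>"
proof -
 have one: "reachable E K (gadd K v \<eta>) \<eta>" if r: "\<eta> \<in> rec_set K" and v: "v \<in> K" for v \<eta>
 proof -
  define S where "S = {\<zeta> \<in> rec_set K. reachable E K (gadd K v \<eta>) \<zeta>}"
  have fin: "finite S" using finite_rec[OF K(1)] by (simp add: S_def)
  have sub: "gadd K v ` S \<subseteq> S"
   using gadd_rec[OF K(1) v] reachable_trans[OF _ reachable_step[OF K(1) v]] by (auto simp: S_def)
  have "inj_on (gadd K v) S" using gadd_inj[OF K(1)] by (rule inj_on_subset) (auto simp: S_def)
  from endo_inj_surj[OF fin sub this] have surj: "gadd K v ` S = S" .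
  have "gadd K v \<eta> \<in> S" using gadd_rec[OF K(1) v r] by (simp add: S_def reachable_def)
  then obtain \<zeta> where z: "\<zeta> \<in> S" "gadd K v \<zeta> = gadd K v \<eta>" using surj by (metis imageE)
  then have "\<zeta> = \<eta>" using inj_onD[OF gadd_inj[OF K(1)], of v \<zeta> \<eta>] r by (auto simp: S_def)
  then show ?thesis using z by (simp add: S_def)
 qed
 show "reachable E K \<eta> \<xi> ==> \<eta> \<in> rec_set K ==> reachable E K \<xi> \<eta>"
  unfolding reachable_def
 proof (induction rule: rtranclp_induct)
  case base
  then show ?case by simp
 next
  case (step \<xi> \<zeta>)
  have r: "\<xi> \<in> rec_set K" using reachable_rec[OF K, of \<eta> \<xi>] step by (simp add: reachable_def)
  obtain v where "v \<in> K" "\<zeta> = gadd K v \<xi>" using step.hyps(2) step_set[OF K] by auto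
  then have "reachable E K \<zeta> \<xi>" using one[OF r] by simp
  then show ?case using step.IH[OF step.prems] unfolding reachable_def by (rule rtranclp_trans)
 qed
qed

text \<open>Every stable configuration leads to \<open>full K\<close>, so each closed class contains
  it, and exactly the allowed stable configurations are reachable from it.\<close>

lemma recurrent_eq:
 assumes K: "finite K" "K ~= {}"
 shows "recurrent E K = rec_set K"
proof -
 have reach: "{\<xi>. reachable E K \<eta> \<xi>} = rec_set K" if r: "\<eta> \<in> rec_set K" for \<eta>
 proof (intro equalityI subsetI CollectI)
  show "\<xi> \<in> rec_set K" if "\<xi> \<in> {\<xi>. reachable E K \<eta> \<xi>}" for \<xi>
   using that reachable_rec[OF K _ r] by simp
  fix \<xi> assume x: "\<xi> \<in> rec_set K"
  have "reachable E K \<eta> (full K)" using r by (intro reachable_full K) (simp add: rec_set_def)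
  moreover have "reachable E K (full K) \<xi>"
   using x by (intro reachable_sym[OF K reachable_full[OF K(1)]]) (auto simp: rec_set_def)
  ultimately show "reachable E K \<eta> \<xi>" by (rule reachable_trans)
 qed
 have cl: "closed_communicating_class E K (rec_set K)"
  unfolding closed_communicating_class_def using reach full_rec[OF K(1)] by (auto simp: rec_set_def)
 have "C = rec_set K" if C: "closed_communicating_class E K C" for C
 proof -
  obtain \<eta> where e: "\<eta> \<in> C" using C unfolding closed_communicating_class_def by blast
  then have "\<eta> \<in> stable_sandpiles E K" using C unfolding closed_communicating_class_def by blast
  then have "full K \<in> C" using reachable_full[OF K(1)] C e unfolding closed_communicating_class_def by blast
  then have "{\<xi>. reachable E K (full K) \<xi>} = C" using C unfolding closed_communicating_class_def by blast
  then show ?thesis using reach[OF full_rec[OF K(1)]] by simp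
 qed
 then have "{C. closed_communicating_class E K C} = {rec_set K}" using cl by blast
 then show ?thesis by (simp add: recurrent_def)
qed

end

section \<open>Counting recurrent configurations\<close>

lemma card_glue:
 assumes L: "L \<subseteq> K" and A: "A \<subseteq> extensional L" and B: "B \<subseteq> extensional (K - L)" and S: "S \<subseteq> extensional K"
  and iff: "!!z. z \<in> extensional K ==> z \<in> S \<longleftrightarrow> restrict z L \<in> A & restrict z (K - L) \<in> B"
 shows "card S = card A * card B"
proof -
 have "bij_betw (%z. (restrict z L, restrict z (K - L))) S (A \<times> B)"
 proof (rule bij_betw_byWitness[where f' = "%(a, b) x. if x \<in> L then a x else b x"])
  show "\<forall>z\<in>S. (case (restrict z L, restrict z (K - L)) of (a, b) => %x. if x \<in> L then a x else b x) = z"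
   using S by (auto simp: fun_eq_iff extensional_def subset_iff)
  have g: "restrict (%x. if x \<in> L then a x else b x) L = a &
    restrict (%x. if x \<in> L then a x else b x) (K - L) = b &
    (%x. if x \<in> L then a x else b x) \<in> extensional K" if "a \<in> A" "b \<in> B" for a b
  proof -
   have "!!x. x \<notin> L ==> a x = undefined" "!!x. x \<notin> K - L ==> b x = undefined"
    using that A B by (auto simp: extensional_def)
   then show ?thesis using L by (auto simp: fun_eq_iff extensional_def restrict_def)
  qed
  show "\<forall>p\<in>A \<times> B. (restrict (case p of (a, b) => %x. if x \<in> L then a x else b x) L,
    restrict (case p of (a, b) => %x. if x \<in> L then a x else b x) (K - L)) = p"
   using g by auto
  show "(%z. (restrict z L, restrict z (K - L))) ` S \<subseteq> A \<times> B" using iff S by blast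
  show "(%(a, b) x. if x \<in> L then a x else b x) ` (A \<times> B) \<subseteq> S"
  proof (rule image_subsetI)
   fix p assume "p \<in> A \<times> B"
   then obtain a b where p: "p = (a, b)" "a \<in> A" "b \<in> B" by auto
   show "(case p of (a, b) => %x. if x \<in> L then a x else b x) \<in> S"
    unfolding p(1) prod.case
   proof (rule iffD2[OF iff])
    note h = g[OF p(2,3)]
    show "(%x. if x \<in> L then a x else b x) \<in> extensional K" by (rule h[THEN conjunct2, THEN conjunct2])
    show "restrict (%x. if x \<in> L then a x else b x) L \<in> A &
      restrict (%x. if x \<in> L then a x else b x) (K - L) \<in> B"
     unfolding h[THEN conjunct1] h[THEN conjunct2, THEN conjunct1] using p(2,3) by (rule conjI)
   qed
  qed
 qed
 then have "card S = card (A \<times> B)" by (rule bij_betw_same_card)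
 then show ?thesis by (simp add: card_cartesian_product)
qed

lemma leads_range: "leads D f x r ==> x \<in> D ==> (!!y. y \<in> D ==> f y \<in> T) ==> r \<in> T"
proof (induction rule: leads.induct)
 case (step x r)
 show ?case
 proof (cases "f x \<in> D")
  case True
  then show ?thesis using step by blast
 next
  case False
  then have "r = f x" using step.hyps(2) by (simp add: leads_out)
  then show ?thesis using step by blast
 qed
qed simp

lemma leads_last: "leads D f x r ==> x \<in> D ==> \<exists>y\<in>D. f y \<notin> D"
proof (induction rule: leads.induct)
 case (step x r)
 then show ?case by (cases "f x \<in> D") auto
qed simp

lemma forests_restrict_gen:
 assumes lead: "!!x. x \<in> L ==> \<exists>r. leads K f x r" and L: "L \<subseteq> K"
  and val: "!!x. x \<in> L ==> f x \<in> N x"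
 shows "restrict f L \<in> forests N L"
proof -
 have "\<exists>r. leads L (restrict f L) x r" if x: "x \<in> L" for x
 proof -
  obtain r where "leads K f x r" using lead[OF x] by blast
  then obtain b where "leads (K - (K - L)) f x b" using leads_mid by metis
  moreover have "K - (K - L) = L" using L by auto
  ultimately show ?thesis using leads_cong[of L f x b "restrict f L"] by auto
 qed
 then show ?thesis using val by (auto simp: forests_def)
qed

lemma sum_by_value:
 assumes "finite X" "finite I" "!!x. x \<in> X ==> g x \<in> I"
 shows "(\<Sum>x\<in>X. F (g x)) = (\<Sum>i\<in>I. real (card {x \<in> X. g x = i}) * (F i :: real))"
proof -
 have "(\<Sum>x\<in>X. F (g x)) = (\<Sum>i\<in>I. \<Sum>x\<in>{x \<in> X. g x = i}. F (g x))"
  using assms by (intro sum.group[symmetric]) auto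
 also have "... = (\<Sum>i\<in>I. \<Sum>x\<in>{x \<in> X. g x = i}. F i)" by (intro sum.cong) auto
 finally show ?thesis by simp
qed

context tgraph
begin

text \<open>Allowed stable configurations on \<open>K\<close> with sink \<open>S\<close>, where only
  edges inside \<open>K \<union> S\<close> count. The sink is a parameter because the burning
  recursion moves it.\<close>

definition conf :: "'v set => 'v set => ('v => nat) set" where
 "conf K S = {z \<in> PiE K (%x. {..<nin (K \<union> S) x}). allowed K z}"

definition forr :: "'v set => 'v set => ('v => 'v) set" where
 "forr K S = forests (%x. {y \<in> K \<union> S. E x y}) K"

lemma conf_ext: "conf K S \<subseteq> extensional K" by (auto simp: conf_def PiE_def)
lemma forr_ext: "forr K S \<subseteq> extensional K" by (auto simp: forr_def forests_def PiE_def)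

lemma finite_conf: "finite K ==> finite (conf K S)"
 by (rule finite_subset[of _ "PiE K (%x. {..<nin (K \<union> S) x})"]) (auto simp: conf_def intro: finite_PiE)

lemma finite_forr: "finite K ==> finite (forr K S)"
 unfolding forr_def by (intro finite_forests finite_nin)

text \<open>\<open>L\<close> is the layer that burns first. A vertex of \<open>L\<close> has
  \<open>nin S x\<close> admissible values, one for each edge to the sink, and the rest is a
  configuration for which \<open>L\<close> has become the sink.\<close>

lemma conf_layer:
 assumes d: "K \<inter> S = {}" and L: "L \<subseteq> K" and K: "finite K"
 shows "card {z \<in> conf K S. {x \<in> K. nin K x <= z x} = L} = (\<Prod>x\<in>L. nin S x) * card (conf (K - L) L)"
proof -
 let ?A = "PiE L (%x. {nin K x..<nin (K \<union> S) x})"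
 have KL: "(K - L) \<union> L = K" using L by auto
 have "card {z \<in> conf K S. {x \<in> K. nin K x <= z x} = L} = card ?A * card (conf (K - L) L)"
 proof (rule card_glue[OF L])
  show "?A \<subseteq> extensional L" by (auto simp: PiE_def)
  show "conf (K - L) L \<subseteq> extensional (K - L)" by (rule conf_ext)
  show "{z \<in> conf K S. {x \<in> K. nin K x <= z x} = L} \<subseteq> extensional K" using conf_ext by blast
  fix z :: "'v => nat" assume z: "z \<in> extensional K"
  show "z \<in> {z \<in> conf K S. {x \<in> K. nin K x <= z x} = L} \<longleftrightarrow>
   restrict z L \<in> ?A & restrict z (K - L) \<in> conf (K - L) L"
  proof
   assume "z \<in> {z \<in> conf K S. {x \<in> K. nin K x <= z x} = L}"
   then have zc: "!!x. x \<in> K ==> z x < nin (K \<union> S) x" "allowed K z"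
    and ly: "!!x. x \<in> K ==> nin K x <= z x \<longleftrightarrow> x \<in> L" by (auto simp: conf_def)
   have "restrict z L \<in> ?A" using zc ly L by auto
   moreover have "allowed (K - L) (restrict z (K - L))"
    using allowed_subset[OF zc(2), of "K - L"] allowed_cong[of "K - L" z "restrict z (K - L)"] by auto
   then have "restrict z (K - L) \<in> conf (K - L) L"
    unfolding conf_def KL using ly by (auto simp: not_le[symmetric])
   ultimately show "restrict z L \<in> ?A & restrict z (K - L) \<in> conf (K - L) L" by blast
  next
   assume a: "restrict z L \<in> ?A & restrict z (K - L) \<in> conf (K - L) L"
   have zL: "nin K x <= z x" "z x < nin (K \<union> S) x" if "x \<in> L" for x
    using PiE_mem[OF conjunct1[OF a] that] that by auto
   have zK: "z x < nin K x" if "x \<in> K - L" for x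
    using a that unfolding conf_def KL by (auto simp: PiE_iff)
   have al: "allowed (K - L) z"
    using a allowed_cong[of "K - L" z "restrict z (K - L)"] by (auto simp: conf_def)
   have "allowed K z"
    unfolding allowed_def
   proof (intro allI impI)
    fix P assume P: "P \<subseteq> K" "P ~= {}"
    show "\<exists>x\<in>P. nin P x <= z x"
    proof (cases "P \<inter> L = {}")
     case True
     then have "P \<subseteq> K - L" using P by auto
     then show ?thesis using al P unfolding allowed_def by blast
    next
     case False
     then obtain x where "x \<in> P" "x \<in> L" by auto
     then show ?thesis using zL(1)[of x] nin_mono[OF P(1), of x] by (intro bexI[of _ x]) auto
    qed
   qed
   moreover have "z x < nin (K \<union> S) x" if "x \<in> K" for x
    using that zL(2)[of x] zK[of x] nin_mono[of K "K \<union> S" x] by (cases "x \<in> L") auto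
   moreover have "{x \<in> K. nin K x <= z x} = L"
    using zL(1) zK L by (auto simp: not_le[symmetric])
   ultimately show "z \<in> {z \<in> conf K S. {x \<in> K. nin K x <= z x} = L}"
    using z by (auto simp: conf_def PiE_iff)
  qed
 qed
 also have "card ?A = (\<Prod>x\<in>L. nin S x)"
  using finite_subset[OF L K] by (simp add: card_PiE nin_Un[OF d])
 finally show ?thesis .
qed

lemma forr_layer:
 assumes d: "K \<inter> S = {}" and L: "L \<subseteq> K" and K: "finite K"
 shows "card {f \<in> forr K S. {x \<in> K. f x \<in> S} = L} = (\<Prod>x\<in>L. nin S x) * card (forr (K - L) L)"
proof -
 let ?A = "PiE L (%x. {y \<in> S. E x y})"
 have KL: "(K - L) \<union> L = K" using L by auto
 have "card {f \<in> forr K S. {x \<in> K. f x \<in> S} = L} = card ?A * card (forr (K - L) L)"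
 proof (rule card_glue[OF L])
  show "?A \<subseteq> extensional L" by (auto simp: PiE_def)
  show "forr (K - L) L \<subseteq> extensional (K - L)" by (rule forr_ext)
  show "{f \<in> forr K S. {x \<in> K. f x \<in> S} = L} \<subseteq> extensional K" using forr_ext by blast
  fix f :: "'v => 'v" assume f: "f \<in> extensional K"
  show "f \<in> {f \<in> forr K S. {x \<in> K. f x \<in> S} = L} \<longleftrightarrow>
   restrict f L \<in> ?A & restrict f (K - L) \<in> forr (K - L) L"
  proof
   assume "f \<in> {f \<in> forr K S. {x \<in> K. f x \<in> S} = L}"
   then have fF: "f \<in> forr K S" and ly: "!!x. x \<in> K ==> f x \<in> S \<longleftrightarrow> x \<in> L" by auto
   have v: "f x \<in> K \<union> S" "E x (f x)" if "x \<in> K" for x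
    using fF that by (auto simp: forr_def dest: forests_arc)
   have "restrict f L \<in> ?A" using v ly L by auto
   moreover have "restrict f (K - L) \<in> forr (K - L) L"
    unfolding forr_def KL
    by (rule forests_restrict_gen[of _ K]) (use v ly fF in \<open>auto simp: forr_def forests_def\<close>)
   ultimately show "restrict f L \<in> ?A & restrict f (K - L) \<in> forr (K - L) L" by blast
  next
   assume a: "restrict f L \<in> ?A & restrict f (K - L) \<in> forr (K - L) L"
   have fL: "f x \<in> S" "E x (f x)" if "x \<in> L" for x using PiE_mem[OF conjunct1[OF a] that] that by auto
   have b: "restrict f (K - L) \<in> forests (%x. {y \<in> K. E x y}) (K - L)"
    using a unfolding forr_def KL by blast
   have fK: "f x \<in> K" "E x (f x)" if "x \<in> K - L" for x using forests_arc[OF b that] that by auto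
   have lead: "\<exists>r. leads K f x r" if x: "x \<in> K" for x
   proof -
    obtain r where "leads (K - L) (restrict f (K - L)) x r" using forests_leads[OF b] by blast
    then have r: "leads (K - L) f x r" using leads_cong_iff[of "K - L" f "restrict f (K - L)"] by auto
    have "r \<in> L"
    proof (cases "x \<in> L")
     case True
     then show ?thesis using r by (simp add: leads_out)
    next
     case False
     then have "r \<in> K" using leads_range[OF r, of K] x fK by auto
     then show ?thesis using leads_notin[OF r] by auto
    qed
    then have "leads K f r (f r)"
     using leads.step[of r K f "f r"] leads.stop[of "f r" K f] L fL(1)[of r] d by auto
    then show ?thesis using leads_trans[OF r, of K "f r"] by auto
   qed
   have "f \<in> forr K S"
    unfolding forr_def forests_def using f lead fL fK L by (auto simp: PiE_iff) (metis DiffI)+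
   moreover have "{x \<in> K. f x \<in> S} = L" using fL(1) fK(1) L d by auto
   ultimately show "f \<in> {f \<in> forr K S. {x \<in> K. f x \<in> S} = L}" by blast
  qed
 qed
 also have "card ?A = (\<Prod>x\<in>L. nin S x)"
  using finite_subset[OF L K] by (simp add: card_PiE nin_def)
 finally show ?thesis .
qed

text \<open>Both sides satisfy the same recursion: peel off the vertices that burn in the first step,
 respectively the vertices pointing directly into \<open>S\<close>.\<close>

lemma card_conf:
 "finite K ==> K \<inter> S = {} ==> card (conf K S) = card (forr K S)"
proof (induction "card K" arbitrary: K S rule: less_induct)
 case less
 show ?case
 proof (cases "K = {}")
  case True
  have "conf {} S = {%_. undefined}" by (auto simp: conf_def allowed_def)
  moreover have "forr {} S = {%_. undefined}" by (auto simp: forr_def forests_def)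
  ultimately show ?thesis using True by simp
 next
  case False
  let ?I = "Pow K - {{}}"
  have finI: "finite ?I" using less.prems by simp
  have 1: "real (card (conf K S)) = (\<Sum>L\<in>?I. real (card {z \<in> conf K S. {x \<in> K. nin K x <= z x} = L}) * 1)"
  proof -
   have "{x \<in> K. nin K x <= z x} \<in> ?I" if "z \<in> conf K S" for z
    using that False unfolding conf_def allowed_def by blast
   from sum_by_value[OF finite_conf[OF less.prems(1)] finI this, where F = "%_. 1"] show ?thesis by simp
  qed
  have 2: "real (card (forr K S)) = (\<Sum>L\<in>?I. real (card {f \<in> forr K S. {x \<in> K. f x \<in> S} = L}) * 1)"
  proof -
   have "{x \<in> K. f x \<in> S} \<in> ?I" if f: "f \<in> forr K S" for f
   proof -
    obtain x where x: "x \<in> K" using False by blast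
    obtain r where "leads K f x r" using f forests_leads unfolding forr_def by metis
    then obtain y where y: "y \<in> K" "f y \<notin> K" using leads_last x by metis
    have "f y \<in> K \<union> S" using f y(1) by (auto simp: forr_def dest: forests_arc)
    then show ?thesis using y by auto
   qed
   from sum_by_value[OF finite_forr[OF less.prems(1)] finI this, where F = "%_. 1"] show ?thesis by simp
  qed
  have "real (card (conf K S)) = real (card (forr K S))"
   unfolding 1 2
  proof (intro sum.cong refl arg_cong2[where f="(*)"] arg_cong[where f=real])
   fix L assume L: "L \<in> ?I"
   then have "card (K - L) < card K" using less.prems(1) by (intro psubset_card_mono) auto
   then have "card (conf (K - L) L) = card (forr (K - L) L)" using less.prems(1) by (intro less.hyps) auto
   then show "card {z \<in> conf K S. {x \<in> K. nin K x <= z x} = L} = card {f \<in> forr K S. {x \<in> K. f x \<in> S} = L}"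
    using L less.prems by (simp add: conf_layer forr_layer)
  qed
  then show ?thesis by simp
 qed
qed

lemma wforests_forr: "wforests w K = forr K (- K)"
proof -
 have "nb w = (%x. {y. E x y})" by (rule ext) (simp add: nb_w)
 then show ?thesis by (simp add: wforests_def forr_def)
qed

lemma fosum_w: "fosum w K Y = (\<Sum>f\<in>wforests w K. Y f)"
 unfolding fosum_def
proof (rule sum.cong[OF refl])
 fix f assume "f \<in> wforests w K"
 then have "wt w K f = 1"
  unfolding wt_def by (intro prod.neutral) (auto simp: wforests_def nb_w w_def dest: forests_arc)
 then show "wt w K f * Y f = Y f" by simp
qed

lemma bij_rec_conf: "bij_betw (%\<eta>. restrict \<eta> K) (rec_set K) (conf K (- K))"
proof (rule bij_betw_byWitness[where f' = "%z x. if x \<in> K then z x else 0"])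
 show "\<forall>\<eta>\<in>rec_set K. (%x. if x \<in> K then restrict \<eta> K x else 0) = \<eta>"
  using rec_setD by (fastforce simp: fun_eq_iff)
 show "\<forall>z\<in>conf K (- K). restrict (%x. if x \<in> K then z x else 0) K = z"
  using conf_ext[of K "- K"] by (auto simp: fun_eq_iff extensional_def subset_iff)
 show "(%\<eta>. restrict \<eta> K) ` rec_set K \<subseteq> conf K (- K)"
 proof (rule image_subsetI)
  fix \<eta> assume "\<eta> \<in> rec_set K"
  then show "restrict \<eta> K \<in> conf K (- K)"
   using rec_setD[of \<eta> K] allowed_cong[of K \<eta> "restrict \<eta> K"]
   by (auto simp: conf_def nin_UNIV stable_def deg_E)
 qed
 show "(%z x. if x \<in> K then z x else 0) ` conf K (- K) \<subseteq> rec_set K"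
 proof (rule image_subsetI)
  fix z assume "z \<in> conf K (- K)"
  then show "(%x. if x \<in> K then z x else 0) \<in> rec_set K"
   using allowed_cong[of K z "%x. if x \<in> K then z x else 0"]
   by (intro rec_setI) (auto simp: conf_def nin_UNIV stable_def deg_E PiE_iff)
 qed
qed

lemma card_rec:
 assumes "finite K"
 shows "real (card (rec_set K)) = partn w K"
proof -
 have "card (rec_set K) = card (forr K (- K))"
  using bij_betw_same_card[OF bij_rec_conf[of K]] card_conf[OF assms, of "- K"] by simp
 then show ?thesis by (simp add: partn_def fosum_w wforests_forr)
qed

section \<open>Waves\<close>

definition wclosed :: "'v set => 'v => ('v => nat) => 'v set => bool" where
 "wclosed D v \<xi> Y \<longleftrightarrow> (\<forall>x\<in>D. dg <= \<xi> x + nin (insert v Y) x --> x \<in> Y)"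

text \<open>The set of vertices of \<open>D\<close> that topple, each of them once, when \<open>v\<close> is toppled once.\<close>

definition wave :: "'v set => 'v => ('v => nat) => 'v set" where
 "wave D v \<xi> = \<Inter> {Y. Y \<subseteq> D & wclosed D v \<xi> Y}"

lemma wave_subset: "wave D v \<xi> \<subseteq> D"
 unfolding wave_def by (rule Inter_lower) (simp add: wclosed_def)

lemma wave_closed: "wclosed D v \<xi> (wave D v \<xi>)"
 unfolding wclosed_def
proof (intro ballI impI)
 fix x assume x: "x \<in> D" "dg <= \<xi> x + nin (insert v (wave D v \<xi>)) x"
 show "x \<in> wave D v \<xi>"
  unfolding wave_def
 proof (rule InterI)
  fix Y assume Y: "Y \<in> {Y. Y \<subseteq> D & wclosed D v \<xi> Y}"
  then have "wave D v \<xi> \<subseteq> Y" unfolding wave_def by blast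
  then have "nin (insert v (wave D v \<xi>)) x <= nin (insert v Y) x" by (intro nin_mono) auto
  then have "dg <= \<xi> x + nin (insert v Y) x" using x by linarith
  then show "x \<in> Y" using Y x unfolding wclosed_def by blast
 qed
qed

lemma wave_least: "Y \<subseteq> D ==> wclosed D v \<xi> Y ==> wave D v \<xi> \<subseteq> Y"
 unfolding wave_def by blast

lemma wave_min:
 assumes P: "P \<subseteq> wave D v \<xi>" "P ~= {}"
 shows "\<exists>x\<in>P. dg <= \<xi> x + nin (insert v (wave D v \<xi> - P)) x"
proof (rule ccontr)
 assume n: "\<not> ?thesis"
 have "wclosed D v \<xi> (wave D v \<xi> - P)"
  unfolding wclosed_def
 proof (intro ballI impI)
  fix x assume x: "x \<in> D" "dg <= \<xi> x + nin (insert v (wave D v \<xi> - P)) x"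
  have "nin (insert v (wave D v \<xi> - P)) x <= nin (insert v (wave D v \<xi>)) x" by (rule nin_mono) auto
  then have "x \<in> wave D v \<xi>" using x wave_closed[of D v \<xi>] unfolding wclosed_def by force
  then show "x \<in> wave D v \<xi> - P" using n x by blast
 qed
 then have "wave D v \<xi> \<subseteq> wave D v \<xi> - P" using wave_subset by (intro wave_least) auto
 then show False using P by blast
qed

lemma wave_char:
 assumes "U \<subseteq> D"
 shows "wave D v \<xi> = U \<longleftrightarrow> wclosed D v \<xi> U &
  (\<forall>P. P \<subseteq> U --> P ~= {} --> (\<exists>x\<in>P. dg <= \<xi> x + nin (insert v (U - P)) x))"
proof
 assume "wave D v \<xi> = U"
 then show "wclosed D v \<xi> U & (\<forall>P. P \<subseteq> U --> P ~= {} --> (\<exists>x\<in>P. dg <= \<xi> x + nin (insert v (U - P)) x))"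
  using wave_closed[of D v \<xi>] wave_min[of _ D v \<xi>] by blast
next
 assume a: "wclosed D v \<xi> U & (\<forall>P. P \<subseteq> U --> P ~= {} --> (\<exists>x\<in>P. dg <= \<xi> x + nin (insert v (U - P)) x))"
 have sub: "wave D v \<xi> \<subseteq> U" using a assms by (intro wave_least) auto
 have "U - wave D v \<xi> = {}"
 proof (rule ccontr)
  assume "U - wave D v \<xi> ~= {}"
  then obtain x where x: "x \<in> U - wave D v \<xi>" "dg <= \<xi> x + nin (insert v (U - (U - wave D v \<xi>))) x"
   using a by blast
  have "U - (U - wave D v \<xi>) = wave D v \<xi>" using sub by auto
  then have "x \<in> wave D v \<xi>" using x wave_closed[of D v \<xi>] assms unfolding wclosed_def by auto
  then show False using x by blast
 qed
 then show "wave D v \<xi> = U" using sub by blast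
qed

lemma wave_cong: "(!!x. x \<in> D ==> \<xi> x = \<zeta> x) ==> wave D v \<xi> = wave D v \<zeta>"
 unfolding wave_def wclosed_def by simp

text \<open>Off \<open>U\<close> the values stay below the number of neighbours outside
  \<open>insert v U\<close>, which is stability with respect to the far sink. On \<open>U\<close>,
  subtracting the number of these outer neighbours turns the order of toppling into an order of
  burning from the sink \<open>v\<close>.\<close>

lemma card_wave_conf:
 assumes D: "finite D" "v \<notin> D" and U: "U \<subseteq> D"
 shows "card {z \<in> conf D (- D). wave D v z = U} = card (conf U {v}) * card (conf (D - U) (- insert v D))"
proof -
 let ?A = "{a \<in> PiE U (%_. {..<dg}). \<forall>P. P \<subseteq> U --> P ~= {} --> (\<exists>x\<in>P. dg <= a x + nin (insert v (U - P)) x)}"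
 let ?B = "conf (D - U) (- insert v D)"
 have vU: "v \<notin> U" using D U by auto
 have ninB: "nin ((D - U) \<union> - insert v D) x + nin (insert v U) x = dg" for x
 proof -
  have "nin (((D - U) \<union> - insert v D) \<union> insert v U) x = nin ((D - U) \<union> - insert v D) x + nin (insert v U) x"
   by (rule nin_Un) (use D U in auto)
  moreover have "((D - U) \<union> - insert v D) \<union> insert v U = UNIV" using U by auto
  ultimately show ?thesis by (simp add: nin_UNIV)
 qed
 have ninP: "nin (insert v U) x = nin P x + nin (insert v (U - P)) x" if "P \<subseteq> U" for P x
 proof -
  have "nin (P \<union> insert v (U - P)) x = nin P x + nin (insert v (U - P)) x"
   by (rule nin_Un) (use that vU in auto)
  moreover have "P \<union> insert v (U - P) = insert v U" using that by auto
  ultimately show ?thesis by simp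
 qed
 have "card {z \<in> conf D (- D). wave D v z = U} = card ?A * card ?B"
 proof (rule card_glue[OF U])
  show "?A \<subseteq> extensional U" by (auto simp: PiE_def)
  show "?B \<subseteq> extensional (D - U)" by (rule conf_ext)
  show "{z \<in> conf D (- D). wave D v z = U} \<subseteq> extensional D" using conf_ext by blast
  fix z :: "'v => nat" assume z: "z \<in> extensional D"
  have Pcong: "(\<exists>x\<in>P. dg <= restrict z U x + nin (insert v (U - P)) x) \<longleftrightarrow>
   (\<exists>x\<in>P. dg <= z x + nin (insert v (U - P)) x)" if "P \<subseteq> U" for P
   using that by (intro bex_cong) auto
  show "z \<in> {z \<in> conf D (- D). wave D v z = U} \<longleftrightarrow> restrict z U \<in> ?A & restrict z (D - U) \<in> ?B"
  proof
   assume "z \<in> {z \<in> conf D (- D). wave D v z = U}"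
   then have zd: "!!x. x \<in> D ==> z x < dg" and al: "allowed D z" and wv: "wave D v z = U"
    by (auto simp: conf_def nin_UNIV)
   have cl: "wclosed D v z U" and mn: "!!P. P \<subseteq> U ==> P ~= {} ==> \<exists>x\<in>P. dg <= z x + nin (insert v (U - P)) x"
    using wv wave_char[OF U] by auto
   have "restrict z U \<in> ?A" using zd U mn Pcong by auto
   moreover have "allowed (D - U) (restrict z (D - U))"
    using allowed_subset[OF al, of "D - U"] allowed_cong[of "D - U" z "restrict z (D - U)"] by auto
   moreover have "z x < nin ((D - U) \<union> - insert v D) x" if "x \<in> D - U" for x
    using cl that ninB[of x] unfolding wclosed_def by force
   ultimately show "restrict z U \<in> ?A & restrict z (D - U) \<in> ?B" by (auto simp: conf_def)
  next
   assume a: "restrict z U \<in> ?A & restrict z (D - U) \<in> ?B"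
   have zU: "z x < dg" if "x \<in> U" for x using a that by (auto simp: PiE_iff)
   have mn: "\<exists>x\<in>P. dg <= z x + nin (insert v (U - P)) x" if "P \<subseteq> U" "P ~= {}" for P
    using a Pcong that by blast
   have zD: "z x < nin ((D - U) \<union> - insert v D) x" if "x \<in> D - U" for x
    using a that by (auto simp: conf_def PiE_iff)
   have al: "allowed (D - U) z"
    using a allowed_cong[of "D - U" z "restrict z (D - U)"] by (auto simp: conf_def)
   have "wclosed D v z U"
    unfolding wclosed_def using zD ninB by (metis DiffI add.commute add_less_cancel_right leD)
   then have wv: "wave D v z = U" using mn wave_char[OF U] by blast
   have "allowed D z"
    unfolding allowed_def
   proof (intro allI impI)
    fix P assume P: "P \<subseteq> D" "P ~= {}"
    show "\<exists>x\<in>P. nin P x <= z x"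
    proof (cases "P \<inter> U = {}")
     case True
     then have "P \<subseteq> D - U" using P by auto
     then show ?thesis using al P unfolding allowed_def by blast
    next
     case False
     then obtain x where x: "x \<in> P \<inter> U" "dg <= z x + nin (insert v (U - (P \<inter> U))) x"
      using mn[of "P \<inter> U"] by blast
     have "nin (P \<union> insert v (U - (P \<inter> U))) x = nin P x + nin (insert v (U - (P \<inter> U))) x"
      by (rule nin_Un) (use P D in auto)
     then have "nin P x <= z x" using x(2) nin_le[of "P \<union> insert v (U - (P \<inter> U))" x] by linarith
     then show ?thesis using x by blast
    qed
   qed
   moreover have "z x < dg" if "x \<in> D" for x
    using that zU[of x] zD[of x] ninB[of x] by (cases "x \<in> U") auto
   ultimately show "z \<in> {z \<in> conf D (- D). wave D v z = U}"
    using z wv by (auto simp: conf_def nin_UNIV PiE_iff)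
  qed
 qed
 also have "card ?A = card (conf U {v})"
 proof -
  let ?s = "%x. dg - nin (insert v U) x"
  have key: "nin P x <= b \<longleftrightarrow> dg <= b + ?s x + nin (insert v (U - P)) x" if "P \<subseteq> U" for P x b
   using ninP[OF that, of x] nin_le[of "insert v U" x] by linarith
  have "bij_betw (%z. restrict (%x. z x + ?s x) U) (conf U {v}) ?A"
  proof (rule bij_betw_byWitness[where f' = "%a. restrict (%x. a x - ?s x) U"])
   have big: "?s x <= a x" if a: "a \<in> ?A" and x: "x \<in> U" for a x
   proof -
    have "{x} \<subseteq> U" "{x} ~= {}" using x by auto
    then have "dg <= a x + nin (insert v (U - {x})) x" using a by blast
    also have "nin (insert v (U - {x})) x <= nin (insert v U) x" by (rule nin_mono) auto
    finally show ?thesis by simp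
   qed
   show "\<forall>z\<in>conf U {v}. restrict (%x. restrict (%x. z x + ?s x) U x - ?s x) U = z"
    using conf_ext[of U "{v}"] by (auto simp: fun_eq_iff extensional_def subset_iff)
   show "\<forall>a\<in>?A. restrict (%x. restrict (%x. a x - ?s x) U x + ?s x) U = a"
   proof
    fix a assume a: "a \<in> ?A"
    then have "a \<in> extensional U" by (auto simp: PiE_def)
    then show "restrict (%x. restrict (%x. a x - ?s x) U x + ?s x) U = a"
     using big[OF a] by (auto simp: fun_eq_iff extensional_def)
   qed
   show "(%z. restrict (%x. z x + ?s x) U) ` conf U {v} \<subseteq> ?A"
   proof (rule image_subsetI)
    fix z assume z: "z \<in> conf U {v}"
    have "z x + ?s x < dg" if "x \<in> U" for x
    proof -
     have "z x < nin (insert v U) x" using z that by (auto simp: conf_def PiE_iff)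
     then show ?thesis using nin_le[of "insert v U" x] by linarith
    qed
    moreover have "\<exists>x\<in>P. dg <= restrict (%x. z x + ?s x) U x + nin (insert v (U - P)) x"
     if P: "P \<subseteq> U" "P ~= {}" for P
    proof -
     have "allowed U z" using z by (simp add: conf_def)
     then obtain x where x: "x \<in> P" "nin P x <= z x" using P unfolding allowed_def by blast
     then have "dg <= z x + ?s x + nin (insert v (U - P)) x" using key[OF P(1)] by simp
     then show ?thesis using x P by (intro bexI[of _ x]) auto
    qed
    ultimately show "restrict (%x. z x + ?s x) U \<in> ?A" by auto
   qed
   show "(%a. restrict (%x. a x - ?s x) U) ` ?A \<subseteq> conf U {v}"
   proof (rule image_subsetI)
    fix a assume a: "a \<in> ?A"
    have "a x - ?s x < nin (U \<union> {v}) x" if x: "x \<in> U" for x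
    proof -
     have "a x < dg" using a x by (auto simp: PiE_iff)
     then show ?thesis using big[OF a x] by simp
    qed
    moreover have "allowed U (restrict (%x. a x - ?s x) U)"
     unfolding allowed_def
    proof (intro allI impI)
     fix P assume P: "P \<subseteq> U" "P ~= {}"
     then obtain x where x: "x \<in> P" "dg <= a x + nin (insert v (U - P)) x" using a by blast
     then have xU: "x \<in> U" using P by auto
     have "nin P x <= a x - ?s x" using key[OF P(1), of x "a x - ?s x"] big[OF a xU] x(2) by simp
     then show "\<exists>x\<in>P. nin P x <= restrict (%x. a x - ?s x) U x" using x xU by (intro bexI[of _ x]) auto
    qed
    ultimately show "restrict (%x. a x - ?s x) U \<in> conf U {v}" by (auto simp: conf_def)
   qed
  qed
  then show ?thesis by (rule bij_betw_same_card[symmetric])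
 qed
 finally show ?thesis .
qed

text \<open>Arcs never cross between the tree of \<open>v\<close> and its complement, so the two
  parts are chosen independently.\<close>

lemma card_tree_forr:
 assumes D: "finite D" "v \<notin> D" and U: "U \<subseteq> D"
 shows "card {f \<in> forr D (- D). tree D f v = U} = card (forr U {v}) * card (forr (D - U) (- insert v D))"
proof (rule card_glue[OF U])
 show "forr U {v} \<subseteq> extensional U" by (rule forr_ext)
 show "forr (D - U) (- insert v D) \<subseteq> extensional (D - U)" by (rule forr_ext)
 show "{f \<in> forr D (- D). tree D f v = U} \<subseteq> extensional D" using forr_ext by blast
 fix f :: "'v => 'v" assume f: "f \<in> extensional D"
 show "f \<in> {f \<in> forr D (- D). tree D f v = U} \<longleftrightarrow>
  restrict f U \<in> forr U {v} & restrict f (D - U) \<in> forr (D - U) (- insert v D)"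
 proof
  assume "f \<in> {f \<in> forr D (- D). tree D f v = U}"
  then have fF: "f \<in> forests (%x. {y. E x y}) D" and t: "tree D f v = U" by (auto simp: forr_def)
  have arc: "E x (f x)" if "x \<in> D" for x using forests_arc[OF fF that] by simp
  have lead: "\<exists>r. leads D f x r" for x by (rule forests_leads[OF fF])
  have step: "x \<in> U \<longleftrightarrow> leads D f (f x) v" if "x \<in> D" for x
   using that t leads_in[OF that] by (auto simp: tree_def)
  have fU: "f x \<in> U \<union> {v}" if "x \<in> U" for x
  proof -
   have l: "leads D f (f x) v" using step[of x] that U by auto
   then show ?thesis using t by (cases "f x \<in> D") (auto simp: tree_def leads_out)
  qed
  have fD: "f x \<in> (D - U) \<union> - insert v D" if "x \<in> D - U" for x
  proof -
   have l: "\<not> leads D f (f x) v" using step[of x] that by auto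
   have "f x ~= v" using l leads.stop[OF D(2), of f] by auto
   moreover have "f x \<notin> U" using l t by (auto simp: tree_def)
   ultimately show ?thesis by auto
  qed
  have "restrict f U \<in> forr U {v}"
   unfolding forr_def by (rule forests_restrict_gen[of _ D]) (use lead U arc fU in auto)
  moreover have "restrict f (D - U) \<in> forr (D - U) (- insert v D)"
   unfolding forr_def by (rule forests_restrict_gen[of _ D]) (use lead U arc fD in auto)
  ultimately show "restrict f U \<in> forr U {v} & restrict f (D - U) \<in> forr (D - U) (- insert v D)" by blast
 next
  assume a: "restrict f U \<in> forr U {v} & restrict f (D - U) \<in> forr (D - U) (- insert v D)"
  have aU: "restrict f U \<in> forests (%x. {y \<in> U \<union> {v}. E x y}) U"
   and aD: "restrict f (D - U) \<in> forests (%x. {y \<in> (D - U) \<union> - insert v D. E x y}) (D - U)"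
   using a unfolding forr_def by blast+
  have fU: "f x \<in> U \<union> {v}" "E x (f x)" if "x \<in> U" for x using forests_arc[OF aU that] that by auto
  have fD: "f x \<in> (D - U) \<union> - insert v D" "E x (f x)" if "x \<in> D - U" for x
   using forests_arc[OF aD that] that by auto
  have lU: "leads D f x v" if x: "x \<in> U" for x
  proof -
   obtain r where "leads U (restrict f U) x r" using forests_leads[OF aU] by blast
   then have r: "leads U f x r" using leads_cong_iff[of U f "restrict f U"] by auto
   have "r \<in> U \<union> {v}" by (rule leads_range[OF r x fU(1)])
   then have "r = v" using leads_notin[OF r] by auto
   then show ?thesis using leads_trans[OF r U] leads.stop[OF D(2), of f] by simp
  qed
  have lD: "\<exists>r. r ~= v & leads D f x r" if x: "x \<in> D - U" for x
  proof -
   obtain r where "leads (D - U) (restrict f (D - U)) x r" using forests_leads[OF aD] by blast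
   then have r: "leads (D - U) f x r" using leads_cong_iff[of "D - U" f "restrict f (D - U)"] by auto
   have "r \<in> (D - U) \<union> - insert v D" by (rule leads_range[OF r x fD(1)])
   then have "r \<notin> D" "r ~= v" using leads_notin[OF r] by auto
   then show ?thesis using leads_trans[OF r Diff_subset] leads.stop[of r D f] by blast
  qed
  have "E x (f x) & (\<exists>r. leads D f x r)" if "x \<in> D" for x
   using that fU(2)[of x] fD(2)[of x] lU[of x] lD[of x] by (cases "x \<in> U") auto
  then have "f \<in> forr D (- D)" unfolding forr_def forests_def using f by (auto simp: PiE_iff)
  moreover have "tree D f v = U"
  proof
   show "U \<subseteq> tree D f v" using lU U by (auto simp: tree_def)
   show "tree D f v \<subseteq> U"
   proof
    fix x assume x: "x \<in> tree D f v"
    show "x \<in> U"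
    proof (rule ccontr)
     assume "x \<notin> U"
     then obtain r where "r ~= v" "leads D f x r" using lD[of x] x by (auto simp: tree_def)
     then show False using x leads_unique[of D f x r v] by (auto simp: tree_def)
    qed
   qed
  qed
  ultimately show "f \<in> {f \<in> forr D (- D). tree D f v = U}" by blast
 qed
qed

text \<open>Both counts factor over \<open>U\<close> in the same way and \<open>card_conf\<close>
  matches the factors. Hence the wave of a uniform recurrent configuration on \<open>D\<close> and
  the tree of \<open>v\<close> in a uniform forest have the same law.\<close>

lemma wave_sum:
 assumes D: "finite D" "v \<notin> D"
 shows "(\<Sum>\<xi>\<in>rec_set D. F (wave D v \<xi>)) = fosum w D (%f. F (tree D f v))"
proof -
 have "(\<Sum>\<xi>\<in>rec_set D. F (wave D v \<xi>)) = (\<Sum>\<xi>\<in>rec_set D. F (wave D v (restrict \<xi> D)))"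
  by (intro sum.cong refl arg_cong[where f = F] wave_cong) auto
 also have "... = (\<Sum>z\<in>conf D (- D). F (wave D v z))"
  by (rule sum.reindex_bij_betw[OF bij_rec_conf])
 also have "... = (\<Sum>U\<in>Pow D. real (card {z \<in> conf D (- D). wave D v z = U}) * F U)"
  using D wave_subset by (intro sum_by_value finite_conf) auto
 also have "... = (\<Sum>U\<in>Pow D. real (card {f \<in> forr D (- D). tree D f v = U}) * F U)"
 proof (intro sum.cong refl arg_cong2[where f="(*)"] arg_cong[where f=real])
  fix U assume "U \<in> Pow D"
  then have U: "U \<subseteq> D" "finite U" using D finite_subset by auto
  have "card (conf U {v}) = card (forr U {v})" by (rule card_conf) (use U D in auto)
  moreover have "card (conf (D - U) (- insert v D)) = card (forr (D - U) (- insert v D))"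
   by (rule card_conf) (use U D in auto)
  ultimately show "card {z \<in> conf D (- D). wave D v z = U} = card {f \<in> forr D (- D). tree D f v = U}"
   using card_wave_conf[OF D U(1)] card_tree_forr[OF D U(1)] by simp
 qed
 also have "... = (\<Sum>f\<in>forr D (- D). F (tree D f v))"
  using D by (intro sum_by_value[symmetric] finite_forr) (auto simp: tree_def)
 finally show ?thesis by (simp add: fosum_w wforests_forr)
qed

end

section \<open>Waves and avalanches\<close>

context tgraph
begin

lemma lap_remove: "m v = 0 ==> lap (K - {v}) m x = lap K m x"
 unfolding lap_def using finite_nin[of K x]
 by (intro arg_cong2[where f = "(-)"] refl sum.mono_neutral_left) auto

lemma nin_insert: "v \<notin> P ==> nin (insert v P) x = nin P x + of_bool (E x v)"
 using nin_remove[of v "insert v P" x] by simp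

lemma nin_full: "nin P v = dg ==> {y. E v y} \<subseteq> P"
proof -
 assume n: "nin P v = dg"
 have "{y \<in> P. E v y} = {y. E v y}"
  by (rule card_subset_eq[OF finite_E]) (use n E_card in \<open>auto simp: nin_def\<close>)
 then show ?thesis by blast
qed

lemma nin_full': "{y. E v y} \<subseteq> P ==> nin P v = dg"
proof -
 assume "{y. E v y} \<subseteq> P"
 then have "{y \<in> P. E v y} = {y. E v y}" by blast
 then show ?thesis by (simp add: nin_def E_card)
qed

definition nextw :: "'v set => 'v => ('v => nat) => 'v => nat" where
 "nextw D v \<xi> x = (if x \<in> D then \<xi> x + nin (insert v (wave D v \<xi>)) x - dg * of_bool (x \<in> wave D v \<xi>) else 0)"

lemma wave_ge: "x \<in> wave D v \<xi> ==> dg <= \<xi> x + nin (insert v (wave D v \<xi>)) x"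
proof -
 assume x: "x \<in> wave D v \<xi>"
 then have "dg <= \<xi> x + nin (insert v (wave D v \<xi> - {x})) x" using wave_min[of "{x}" D v \<xi>] by blast
 also have "nin (insert v (wave D v \<xi> - {x})) x <= nin (insert v (wave D v \<xi>)) x" by (rule nin_mono) auto
 finally show ?thesis by simp
qed

lemma nextw_int:
 assumes x: "x \<in> D" and K: "insert v D \<subseteq> K" "v \<notin> D"
 shows "int (nextw D v \<xi> x) = int (\<xi> x) - lap K (%z. of_bool (z \<in> insert v (wave D v \<xi>))) x"
proof -
 have "K \<inter> insert v (wave D v \<xi>) = insert v (wave D v \<xi>)" using K wave_subset[of D v \<xi>] by auto
 moreover have "x ~= v" using x K by auto
 ultimately show ?thesis
  unfolding lap_indicator using x wave_ge[of x D v \<xi>] by (auto simp: nextw_def of_nat_diff)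
qed

lemma nextw_lt: "x \<in> D ==> \<xi> x < dg ==> nextw D v \<xi> x < dg"
proof -
 assume x: "x \<in> D" "\<xi> x < dg"
 show ?thesis
 proof (cases "x \<in> wave D v \<xi>")
  case True
  then show ?thesis using x wave_ge[OF True] nin_le[of "insert v (wave D v \<xi>)" x] by (simp add: nextw_def)
 next
  case False
  then have "\<not> dg <= \<xi> x + nin (insert v (wave D v \<xi>)) x"
   using wave_closed[of D v \<xi>] x unfolding wclosed_def by blast
  then show ?thesis using x False by (simp add: nextw_def)
 qed
qed

text \<open>The configuration on \<open>insert v D\<close> just after the wave, with the grains received by \<open>v\<close>.\<close>

definition post :: "'v set => 'v => ('v => nat) => 'v => nat" where
 "post D v \<xi> = (nextw D v \<xi>)(v := nin (wave D v \<xi>) v)"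

text \<open>If \<open>P\<close> leaves the wave, its outer part was allowed before and receives a
  grain along each edge to the wave or to \<open>v\<close>. If \<open>P\<close> lies in the wave,
  its first vertex to topple keeps the grains that the rest of \<open>P\<close> sends later.
  \<open>v\<close> collects one grain from each toppled neighbour.\<close>

lemma post_allowed:
 assumes v: "v \<notin> D" and al: "allowed D \<xi>"
 shows "allowed (insert v D) (post D v \<xi>)"
 unfolding allowed_def
proof (intro allI impI)
 fix P assume P: "P \<subseteq> insert v D" "P ~= {}"
 let ?W = "wave D v \<xi>"
 have vW: "v \<notin> ?W" using v wave_subset[of D v \<xi>] by auto
 show "\<exists>x\<in>P. nin P x <= post D v \<xi> x"
 proof (cases "P - insert v ?W = {}")
  case False
  moreover have "P - insert v ?W \<subseteq> D" using P by auto
  ultimately obtain x where x: "x \<in> P - insert v ?W" "nin (P - insert v ?W) x <= \<xi> x"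
   using al unfolding allowed_def by blast
  have "nin P x <= nin ((P - insert v ?W) \<union> insert v ?W) x" by (rule nin_mono) auto
  also have "... = nin (P - insert v ?W) x + nin (insert v ?W) x" by (rule nin_Un) auto
  finally have "nin P x <= post D v \<xi> x" using x P by (auto simp: post_def nextw_def)
  then show ?thesis using x by blast
 next
  case True
  show ?thesis
  proof (cases "v \<in> P")
   case vP: True
   have "nin P v <= nin (insert v ?W) v" using True by (intro nin_mono) auto
   then have "nin P v <= post D v \<xi> v" using nin_insert[OF vW, of v] E_irrefl by (simp add: post_def)
   then show ?thesis using vP by blast
  next
   case False
   then have PW: "P \<subseteq> ?W" using True by auto
   then obtain x where x: "x \<in> P" "dg <= \<xi> x + nin (insert v (?W - P)) x" using wave_min P by metis
   have "insert v ?W = P \<union> insert v (?W - P)" using PW by auto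
   then have "nin (insert v ?W) x = nin P x + nin (insert v (?W - P)) x"
    using vW PW by (simp only:) (rule nin_Un, auto)
   moreover have "x \<in> ?W" "x \<in> D" "x ~= v" using x PW wave_subset[of D v \<xi>] vW by auto
   ultimately have "nin P x <= post D v \<xi> x" using x by (simp add: post_def nextw_def)
   then show ?thesis using x by blast
  qed
 qed
qed

lemma nextw_rec:
 assumes v: "v \<notin> D" and r: "\<xi> \<in> rec_set D"
 shows "nextw D v \<xi> \<in> rec_set D"
proof (rule rec_setI)
 have "allowed (insert v D) (post D v \<xi>)" using post_allowed[OF v] rec_setD[OF r] by blast
 then have "allowed D (post D v \<xi>)" by (rule allowed_subset) auto
 moreover have "post D v \<xi> x = nextw D v \<xi> x" if "x \<in> D" for x using that v by (auto simp: post_def)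
 ultimately show "allowed D (nextw D v \<xi>)" using allowed_cong[of D] by blast
 show "stable E D (nextw D v \<xi>)"
  using rec_setD[OF r] nextw_lt by (auto simp: stable_def deg_E)
qed (simp add: nextw_def)

text \<open>A wave that misses a neighbour of \<open>v\<close> returns fewer than \<open>dg\<close>
  grains to \<open>v\<close>, so \<open>v\<close> is stable after it.\<close>

lemma post_rec:
 assumes v: "v \<notin> D" and r: "\<xi> \<in> rec_set D" and n: "\<not> {y. E v y} \<subseteq> wave D v \<xi>"
 shows "post D v \<xi> \<in> rec_set (insert v D)"
proof (rule rec_setI)
 show "allowed (insert v D) (post D v \<xi>)" using post_allowed[OF v] rec_setD[OF r] by blast
 have "nin (wave D v \<xi>) v ~= dg" using n nin_full by blast
 then have "nin (wave D v \<xi>) v < dg" using nin_le[of "wave D v \<xi>" v] by simp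
 then show "stable E (insert v D) (post D v \<xi>)"
  using rec_setD[OF r] nextw_lt[of _ D \<xi> v] by (auto simp: stable_def deg_E post_def)
qed (auto simp: post_def nextw_def)

lemma post_inj:
 assumes D: "finite D" "v \<notin> D"
 shows "inj_on (post D v) (rec_set D)"
proof (rule inj_onI)
 fix \<xi> \<zeta> assume r: "\<xi> \<in> rec_set D" "\<zeta> \<in> rec_set D" and eq: "post D v \<xi> = post D v \<zeta>"
 let ?m = "%z. of_bool (z \<in> insert v (wave D v \<xi>)) - of_bool (z \<in> insert v (wave D v \<zeta>)) :: int"
 have "int (\<zeta> x) = int (\<xi> x) - lap D ?m x" if x: "x \<in> D" for x
 proof -
  have "nextw D v \<xi> x = nextw D v \<zeta> x" using fun_cong[OF eq, of x] x D by (auto simp: post_def split: if_splits)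
  then have "int (\<zeta> x) = int (\<xi> x) - lap (insert v D) ?m x"
   using nextw_int[OF x order_refl D(2), of \<xi>] nextw_int[OF x order_refl D(2), of \<zeta>] by (simp add: lap_diff)
  moreover have "lap (insert v D) ?m x = lap D ?m x"
   using lap_remove[of ?m v "insert v D" x] D by simp
  ultimately show ?thesis by simp
 qed
 from rec_unique[OF D(1) r this] show "\<xi> = \<zeta>" by simp
qed

text \<open>Let \<open>Y\<close> be the vertices of the wave or \<open>v\<close> that do not topple.
  As \<eta> is allowed, some \<open>y\<close> in \<open>Y\<close> starts with at least
  \<open>nin Y y\<close> grains and also receives one from each toppled neighbour in the wave, so it
  ends too high for \<open>post\<close>. Strictness comes from the added grain at \<open>v\<close>
  and from stability of \<xi> elsewhere.\<close>

lemma post_odo: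
 assumes D: "finite D" "v \<notin> D" and eta: "\<eta> \<in> rec_set (insert v D)"
  and eq: "gadd (insert v D) v \<eta> = post D v \<xi>" and r: "\<xi> \<in> rec_set D" and x: "x \<in> insert v (wave D v \<xi>)"
 shows "1 <= odo (insert v D) (add_grain v \<eta>) x"
proof (rule ccontr)
 let ?W = "wave D v \<xi>" and ?K = "insert v D"
 define m where "m = odo ?K (add_grain v \<eta>)"
 define Y where "Y = {x \<in> insert v ?W. m x = 0}"
 assume "\<not> ?thesis"
 then have "x \<in> Y" using x by (simp add: Y_def m_def)
 moreover have "Y \<subseteq> ?K" using wave_subset[of D v \<xi>] by (auto simp: Y_def)
 ultimately obtain y where y: "y \<in> Y" "nin Y y <= \<eta> y"
  using rec_setD[OF eta] unfolding allowed_def by blast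
 have vW: "v \<notin> ?W" using D wave_subset[of D v \<xi>] by auto
 have yK: "y \<in> ?K" "m y = 0" using y \<open>Y \<subseteq> ?K\<close> by (auto simp: Y_def)
 have "int (post D v \<xi> y) = int (add_grain v \<eta> y) + (\<Sum>z\<in>{z \<in> ?K. E y z}. int (m z))"
  using stabilize_int[of ?K y "add_grain v \<eta>"] D yK eq by (simp add: gadd_def lap_def m_def)
 moreover have "int (nin (insert v ?W - Y) y) <= (\<Sum>z\<in>{z \<in> ?K. E y z}. int (m z))"
 proof -
  have "int (nin (insert v ?W - Y) y) = (\<Sum>z\<in>{z \<in> insert v ?W - Y. E y z}. 1)" by (simp add: nin_def)
  also have "... <= (\<Sum>z\<in>{z \<in> insert v ?W - Y. E y z}. int (m z))" by (rule sum_mono) (auto simp: Y_def)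
  also have "... <= (\<Sum>z\<in>{z \<in> ?K. E y z}. int (m z))"
   by (rule sum_mono2[OF finite_nin]) (use wave_subset[of D v \<xi>] in auto)
  finally show ?thesis .
 qed
 ultimately have ge: "add_grain v \<eta> y + nin (insert v ?W - Y) y <= post D v \<xi> y" by linarith
 have "nin (Y \<union> (insert v ?W - Y)) y = nin Y y + nin (insert v ?W - Y) y" by (rule nin_Un) auto
 moreover have "Y \<union> (insert v ?W - Y) = insert v ?W" by (auto simp: Y_def)
 ultimately have sp: "nin (insert v ?W) y = nin Y y + nin (insert v ?W - Y) y" by simp
 show False
 proof (cases "y = v")
  case True
  have "post D v \<xi> v = nin (insert v ?W) v" using nin_insert[OF vW, of v] E_irrefl by (simp add: post_def)
  then show False using ge sp y(2) True by (simp add: add_grain_def)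
 next
  case False
  then have yW: "y \<in> ?W" "y \<in> D" using y wave_subset[of D v \<xi>] by (auto simp: Y_def)
  have "\<xi> y < dg" using rec_setD[OF r] yW by (auto simp: stable_def deg_E)
  then show False using ge sp y(2) False yW wave_ge[OF yW(1)] by (simp add: add_grain_def post_def nextw_def)
 qed
qed

text \<open>The parent of \<open>v\<close> in a forest of \<open>L\<close> is not a descendant of
  \<open>v\<close>, so the tree misses a neighbour of \<open>v\<close> and corresponds to a wave
  with stable outcome. Such outcomes are recurrent on \<open>L\<close>, hence results of additions
  at \<open>v\<close>, and different waves have different outcomes.\<close>

lemma lower_count:
 assumes L: "finite L" "v \<in> L"
 shows "fosum w L (%f. of_bool (\<Psi> (tree (L - {v}) f v))) <=
  dg * real (card {\<eta> \<in> rec_set L. \<exists>U. \<Psi> U & U \<subseteq> L & insert v U \<subseteq> {x. 1 <= odo L (add_grain v \<eta>) x}})"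
  (is "_ <= dg * real (card ?T)")
proof -
 let ?D = "L - {v}"
 let ?F = "%U. of_bool (\<Psi> U & \<not> {y. E v y} \<subseteq> U) :: real"
 have D: "finite ?D" "v \<notin> ?D" and ins: "insert v ?D = L" using L by auto
 have "fosum w L (%f. of_bool (\<Psi> (tree ?D f v))) <= fosum w L (%f. ?F (tree ?D (restrict f ?D) v))"
 proof (rule W.fosum_mono)
  fix f assume "f \<in> wforests w L"
  then have f: "f \<in> forests (nb w) L" by (simp add: wforests_def)
  have t: "tree ?D (restrict f ?D) v = tree ?D f v" by (rule tree_cong) auto
  obtain r where "leads L f v r" using forests_leads[OF f] by blast
  then have "\<not> leads ?D f (f v) v" using L by (intro leads_no_cycle) auto
  then have "f v \<notin> tree ?D f v" by (simp add: tree_def)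
  moreover have "E v (f v)" using forests_arc[OF f L(2)] by (simp add: nb_w)
  ultimately show "of_bool (\<Psi> (tree ?D f v)) <= ?F (tree ?D (restrict f ?D) v)" unfolding t by auto
 qed
 also have "... <= dg * fosum w ?D (%f. ?F (tree ?D f v))"
  by (rule fosum_remove_le[OF L]) simp
 also have "fosum w ?D (%f. ?F (tree ?D f v)) = (\<Sum>\<xi>\<in>rec_set ?D. ?F (wave ?D v \<xi>))"
  by (rule wave_sum[OF D, symmetric])
 also have "... = real (card {\<xi> \<in> rec_set ?D. \<Psi> (wave ?D v \<xi>) & \<not> {y. E v y} \<subseteq> wave ?D v \<xi>})" (is "_ = real (card ?S)")
  using finite_rec[OF D(1)] by (simp add: of_bool_def sum.If_cases Int_def)
 also have "card ?S <= card ?T"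
 proof -
  have "card ?S = card (post ?D v ` ?S)"
   by (rule card_image[symmetric, OF inj_on_subset[OF post_inj[OF D]]]) auto
  also have "... <= card (gadd L v ` ?T)"
  proof (rule card_mono)
   show "finite (gadd L v ` ?T)" using finite_rec[OF L(1)] by simp
   show "post ?D v ` ?S \<subseteq> gadd L v ` ?T"
   proof (rule image_subsetI)
    fix \<xi> assume xi: "\<xi> \<in> ?S"
    have "gadd L v ` rec_set L = rec_set L"
     by (rule endo_inj_surj[OF finite_rec[OF L(1)] _ gadd_inj[OF L(1)]]) (use gadd_rec[OF L] in auto)
    moreover have "post ?D v \<xi> \<in> rec_set L" using post_rec[OF D(2), of \<xi>] xi unfolding ins by blast
    ultimately obtain \<eta> where e: "\<eta> \<in> rec_set L" "post ?D v \<xi> = gadd L v \<eta>" by blast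
    have r: "\<xi> \<in> rec_set ?D" using xi by simp
    have "1 <= odo L (add_grain v \<eta>) x" if "x \<in> insert v (wave ?D v \<xi>)" for x
     using post_odo[OF D, unfolded ins, OF e(1) e(2)[symmetric] r that] .
    then have "insert v (wave ?D v \<xi>) \<subseteq> {x. 1 <= odo L (add_grain v \<eta>) x}" by blast
    moreover have "wave ?D v \<xi> \<subseteq> L" using wave_subset[of ?D v \<xi>] by blast
    ultimately have "\<eta> \<in> ?T" using xi e(1) by blast
    then show "post ?D v \<xi> \<in> gadd L v ` ?T" using e(2) by blast
   qed
  qed
  also have "... <= card ?T" by (rule card_image_le) (use finite_rec[OF L(1)] in simp)
  finally show ?thesis .
 qed
 finally show ?thesis by (simp add: mult_left_mono)
qed

text \<open>Waves are iterated without asking whether \<open>v\<close> is unstable;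
  \<open>avalanche_waves\<close> decides how many of them are used.\<close>

definition ws :: "'v set => 'v => ('v => nat) => nat => 'v => nat" where
 "ws D v \<eta> i = (nextw D v ^^ i) (%x. if x \<in> D then \<eta> x else 0)"

definition mw :: "'v set => 'v => ('v => nat) => nat => 'v => nat" where
 "mw D v \<eta> k z = (\<Sum>i<k. of_bool (z \<in> insert v (wave D v (ws D v \<eta> i))))"

lemma ws_rec:
 assumes "v \<notin> D" "\<eta> \<in> rec_set (insert v D)"
 shows "ws D v \<eta> i \<in> rec_set D"
proof (induction i)
 case 0
 have "allowed D \<eta>" using rec_setD[OF assms(2)] allowed_subset[of "insert v D" \<eta> D] by auto
 then have "allowed D (%x. if x \<in> D then \<eta> x else 0)"
  using allowed_cong[of D \<eta> "%x. if x \<in> D then \<eta> x else 0"] by auto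
 then show ?case using rec_setD[OF assms(2)] by (auto simp: ws_def stable_def intro!: rec_setI)
next
 case (Suc i)
 then show ?case using nextw_rec[OF assms(1)] by (simp add: ws_def)
qed

lemma ws_int:
 assumes "v \<notin> D" "x \<in> D"
 shows "int (ws D v \<eta> k x) = int (\<eta> x) - lap (insert v D) (%z. int (mw D v \<eta> k z)) x"
proof (induction k)
 case 0
 then show ?case using assms by (simp add: ws_def mw_def lap_def)
next
 case (Suc k)
 have "int (ws D v \<eta> (Suc k) x) = int (ws D v \<eta> k x) -
   lap (insert v D) (%z. of_bool (z \<in> insert v (wave D v (ws D v \<eta> k)))) x"
  using nextw_int[OF assms(2) order_refl assms(1), of "ws D v \<eta> k"] by (simp add: ws_def)
 then show ?case unfolding Suc mw_def by (simp add: lap_add del: insert_iff)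
qed

lemma mw_v: "mw D v \<eta> k v = k"
 by (simp add: mw_def)

lemma lap_mw_v:
 assumes "v \<notin> D"
 shows "lap (insert v D) (%z. int (mw D v \<eta> k z)) v = int dg * int k - (\<Sum>i<k. int (nin (wave D v (ws D v \<eta> i)) v))"
proof (induction k)
 case 0
 then show ?case by (simp add: mw_def lap_def)
next
 case (Suc k)
 let ?W = "wave D v (ws D v \<eta> k)"
 have W: "v \<notin> ?W" "insert v D \<inter> insert v ?W = insert v ?W" using wave_subset[of D v "ws D v \<eta> k"] assms by auto
 have "lap (insert v D) (%z. int (mw D v \<eta> (Suc k) z)) v =
  lap (insert v D) (%z. int (mw D v \<eta> k z)) v + lap (insert v D) (%z. of_bool (z \<in> insert v ?W)) v"
  unfolding mw_def by (simp add: lap_add del: insert_iff)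
 also have "lap (insert v D) (%z. of_bool (z \<in> insert v ?W)) v = int dg - int (nin ?W v)"
  unfolding lap_indicator W(2) using nin_insert[OF W(1), of v] E_irrefl by simp
 finally show ?case unfolding Suc by (simp add: algebra_simps)
qed

text \<open>Each such wave takes \<open>dg\<close> grains from \<open>v\<close> and returns one from
  every neighbour.\<close>

lemma lap_mw_full:
 assumes "v \<notin> D" "!!i. i < k ==> {y. E v y} \<subseteq> wave D v (ws D v \<eta> i)"
 shows "lap (insert v D) (%z. int (mw D v \<eta> k z)) v = 0"
proof -
 have "(\<Sum>i<k. int (nin (wave D v (ws D v \<eta> i)) v)) = (\<Sum>i<k. int dg)"
  by (rule sum.cong) (use assms(2) nin_full' in auto)
 then show ?thesis by (simp add: lap_mw_v[OF assms(1)])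
qed

text \<open>When all earlier waves return \<open>v\<close> to its height and the heights at
  \<open>v\<close> agree, the starting configurations differ by a Laplacian on all of
  \<open>insert v D\<close>. Then \<open>rec_unique\<close> identifies them and also the toppling
  numbers at \<open>v\<close>, which are \<open>i\<close> and \<open>j\<close>.\<close>

lemma ws_inj:
 assumes D: "finite D" "v \<notin> D" and r: "\<eta> \<in> rec_set (insert v D)" "\<zeta> \<in> rec_set (insert v D)"
  and fi: "!!l. l < i ==> {y. E v y} \<subseteq> wave D v (ws D v \<eta> l)"
  and fj: "!!l. l < j ==> {y. E v y} \<subseteq> wave D v (ws D v \<zeta> l)"
  and vv: "\<eta> v = \<zeta> v" and eq: "ws D v \<eta> i = ws D v \<zeta> j"
 shows "\<zeta> = \<eta> & i = j"
proof -
 let ?m = "%z. int (mw D v \<eta> i z) - int (mw D v \<zeta> j z)"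
 have "int (\<zeta> x) = int (\<eta> x) - lap (insert v D) ?m x" if x: "x \<in> insert v D" for x
 proof (cases "x = v")
  case True
  then show ?thesis
   unfolding lap_diff using lap_mw_full[OF D(2) fi] lap_mw_full[OF D(2) fj] vv by simp
 next
  case False
  then have "x \<in> D" using x by simp
  then show ?thesis
   unfolding lap_diff using ws_int[OF D(2), of x \<eta> i] ws_int[OF D(2), of x \<zeta> j] eq by simp
 qed
 from rec_unique[OF _ r this] have "\<zeta> = \<eta>" "?m v = 0" using D by auto
 then show ?thesis by (simp add: mw_v)
qed

text \<open>Topplings occur only if \<eta> has \<open>dg - 1\<close> grains at \<open>v\<close>;
  waves are then taken up to the first one that misses a neighbour of \<open>v\<close>. One exists,
  since otherwise there would be infinitely many distinct recurrent configurations. By least action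
  these waves dominate the odometer, and \<open>ws_inj\<close> makes the families of different
  \<eta> disjoint.\<close>

lemma avalanche_waves:
 assumes L: "finite L" "v \<in> L"
 shows "\<exists>Xi. (\<forall>\<eta>\<in>rec_set L. Xi \<eta> \<subseteq> rec_set (L - {v}) &
   (\<forall>x. odo L (add_grain v \<eta>) x <= (\<Sum>\<xi>\<in>Xi \<eta>. of_bool (x \<in> insert v (wave (L - {v}) v \<xi>))))) &
  disjoint_family_on Xi (rec_set L)"
proof -
 let ?D = "L - {v}"
 have D: "finite ?D" "v \<notin> ?D" and ins: "insert v ?D = L" using L by auto
 let ?full = "%\<eta> i. {y. E v y} \<subseteq> wave ?D v (ws ?D v \<eta> i)"
 have ex: "\<exists>i. \<not> ?full \<eta> i" if r: "\<eta> \<in> rec_set L" for \<eta>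
 proof (rule ccontr)
  assume f: "\<nexists>i. \<not> ?full \<eta> i"
  have "inj (ws ?D v \<eta>)"
   using ws_inj[OF D, unfolded ins, OF r r] f by (intro injI) blast
  moreover have "finite (range (ws ?D v \<eta>))"
   by (rule finite_subset[OF _ finite_rec[OF D(1)]]) (use ws_rec[OF D(2), unfolded ins, OF r] in auto)
  ultimately show False using finite_imageD infinite_UNIV_nat by blast
 qed
 define k where "k \<eta> = (if \<eta> v + 1 = dg then Suc (LEAST i. \<not> ?full \<eta> i) else 0)" for \<eta>
 have kf: "?full \<eta> i" if "Suc i < k \<eta>" for \<eta> i
  using that not_less_Least[of i "%i. \<not> ?full \<eta> i"] by (auto simp: k_def split: if_splits)
 have kv: "\<eta> v + 1 = dg" if "i < k \<eta>" for \<eta> i using that by (auto simp: k_def split: if_splits)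
 have inj: "\<eta> = \<zeta> & i = j"
  if "\<eta> \<in> rec_set L" "\<zeta> \<in> rec_set L" "i < k \<eta>" "j < k \<zeta>" "ws ?D v \<eta> i = ws ?D v \<zeta> j" for \<eta> \<zeta> i j
 proof -
  have "?full \<eta> l" if "l < i" for l by (rule kf) (use that \<open>i < k \<eta>\<close> in simp)
  moreover have "?full \<zeta> l" if "l < j" for l by (rule kf) (use that \<open>j < k \<zeta>\<close> in simp)
  moreover have "\<eta> v = \<zeta> v" using kv[OF that(3)] kv[OF that(4)] by simp
  ultimately have "\<zeta> = \<eta> & i = j"
   using ws_inj[OF D, unfolded ins, OF that(1,2), of i j] that(5) by blast
  then show ?thesis by simp
 qed
 have odo: "odo L (add_grain v \<eta>) x <= mw ?D v \<eta> (k \<eta>) x" if r: "\<eta> \<in> rec_set L" for \<eta> x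
 proof (rule odo_le[OF L(1)])
  fix x assume x: "x \<in> L"
  have st: "\<eta> y < dg" if "y \<in> L" for y using rec_setD[OF r] that by (auto simp: stable_def deg_E)
  show "int (add_grain v \<eta> x) - lap L (%z. int (mw ?D v \<eta> (k \<eta>) z)) x < int dg"
  proof (cases "\<eta> v + 1 = dg")
   case False
   then have "add_grain v \<eta> x < dg" using st[OF x] st[OF L(2)] by (auto simp: add_grain_def)
   then show ?thesis using False by (simp add: k_def mw_def lap_def)
  next
   case True
   define i where "i = (LEAST i. \<not> ?full \<eta> i)"
   have k: "k \<eta> = Suc i" using True by (simp add: k_def i_def)
   show ?thesis
   proof (cases "x = v")
    case False
    then have xD: "x \<in> ?D" using x by simp
    have "ws ?D v \<eta> (k \<eta>) x < dg"
     using rec_setD[OF ws_rec[OF D(2), unfolded ins, OF r, of "k \<eta>"]] xD by (auto simp: stable_def deg_E)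
    then show ?thesis using ws_int[OF D(2) xD, unfolded ins, of \<eta> "k \<eta>"] False by (simp add: add_grain_def)
   next
    case xv: True
    have "\<not> ?full \<eta> i" unfolding i_def by (rule LeastI_ex[OF ex[OF r]])
    then have "nin (wave ?D v (ws ?D v \<eta> i)) v ~= dg" using nin_full by blast
    then have lt: "nin (wave ?D v (ws ?D v \<eta> i)) v < dg" using nin_le[of "wave ?D v (ws ?D v \<eta> i)" v] by simp
    have "lap L (%z. int (mw ?D v \<eta> i z)) v = 0"
     by (rule lap_mw_full[OF D(2), unfolded ins]) (rule kf, simp add: k)
    then have "lap L (%z. int (mw ?D v \<eta> (Suc i) z)) v = int dg - int (nin (wave ?D v (ws ?D v \<eta> i)) v)"
     using lap_mw_v[OF D(2), unfolded ins, of \<eta> i] lap_mw_v[OF D(2), unfolded ins, of \<eta> "Suc i"]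
     by (simp add: algebra_simps)
    then show ?thesis using lt True xv k by (simp add: add_grain_def)
   qed
  qed
 qed
 define Xi where "Xi \<eta> = ws ?D v \<eta> ` {..<k \<eta>}" for \<eta>
 show ?thesis
 proof (intro exI[of _ Xi] conjI ballI allI)
  fix \<eta> assume r: "\<eta> \<in> rec_set L"
  show "Xi \<eta> \<subseteq> rec_set ?D" using ws_rec[OF D(2), unfolded ins, OF r] by (auto simp: Xi_def)
  fix x
  have "inj_on (ws ?D v \<eta>) {..<k \<eta>}" using inj[OF r r] by (intro inj_onI) blast
  from sum.reindex[OF this] have "mw ?D v \<eta> (k \<eta>) x = (\<Sum>\<xi>\<in>Xi \<eta>. of_bool (x \<in> insert v (wave ?D v \<xi>)))"
   unfolding Xi_def mw_def comp_def by (rule sym)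
  then show "odo L (add_grain v \<eta>) x <= (\<Sum>\<xi>\<in>Xi \<eta>. of_bool (x \<in> insert v (wave ?D v \<xi>)))"
   using odo[OF r, of x] by simp
 next
  show "disjoint_family_on Xi (rec_set L)"
   unfolding disjoint_family_on_def
  proof (intro ballI impI)
   fix \<eta> \<zeta> assume a: "\<eta> \<in> rec_set L" "\<zeta> \<in> rec_set L" "\<eta> ~= \<zeta>"
   show "Xi \<eta> \<inter> Xi \<zeta> = {}"
   proof (rule ccontr)
    assume "Xi \<eta> \<inter> Xi \<zeta> ~= {}"
    then obtain i j where "i < k \<eta>" "j < k \<zeta>" "ws ?D v \<eta> i = ws ?D v \<zeta> j" unfolding Xi_def by blast
    then show False using inj[OF a(1,2)] a(3) by blast
   qed
  qed
 qed
qed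

text \<open>The waves of all avalanches together use each recurrent configuration on
  \<open>L - {v}\<close> at most once, and \<open>wave_sum\<close> turns a sum over these into a sum
  over forests.\<close>

lemma upper_count:
 assumes L: "finite L" "v \<in> L" and F: "!!U. 0 <= F U"
  and A: "!!\<eta> Xi. finite Xi ==> (!!x. odo L (add_grain v \<eta>) x <= (\<Sum>\<xi>\<in>Xi. of_bool (x \<in> insert v (wave (L - {v}) v \<xi>)))) ==>
   A \<eta> <= (\<Sum>\<xi>\<in>Xi. F (wave (L - {v}) v \<xi>))"
 shows "(\<Sum>\<eta>\<in>rec_set L. A \<eta>) <= fosum w (L - {v}) (%f. F (tree (L - {v}) f v))"
proof -
 let ?D = "L - {v}"
 have D: "finite ?D" "v \<notin> ?D" using L by auto
 obtain Xi where Xi: "!!\<eta>. \<eta> \<in> rec_set L ==> Xi \<eta> \<subseteq> rec_set ?D"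
  "!!\<eta> x. \<eta> \<in> rec_set L ==> odo L (add_grain v \<eta>) x <= (\<Sum>\<xi>\<in>Xi \<eta>. of_bool (x \<in> insert v (wave ?D v \<xi>)))"
  and dis: "disjoint_family_on Xi (rec_set L)" using avalanche_waves[OF L] by blast
 have fin: "finite (Xi \<eta>)" if "\<eta> \<in> rec_set L" for \<eta>
  using Xi(1)[OF that] finite_rec[OF D(1)] finite_subset by blast
 have "(\<Sum>\<eta>\<in>rec_set L. A \<eta>) <= (\<Sum>\<eta>\<in>rec_set L. \<Sum>\<xi>\<in>Xi \<eta>. F (wave ?D v \<xi>))"
  using A Xi(2) fin by (intro sum_mono) blast
 also have "... = (\<Sum>\<xi>\<in>(\<Union>\<eta>\<in>rec_set L. Xi \<eta>). F (wave ?D v \<xi>))"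
  by (rule sum.UNION_disjoint[symmetric]) (use finite_rec[OF L(1)] fin dis in \<open>auto simp: disjoint_family_on_def\<close>)
 also have "... <= (\<Sum>\<xi>\<in>rec_set ?D. F (wave ?D v \<xi>))"
  by (rule sum_mono2[OF finite_rec[OF D(1)]]) (use Xi(1) F in auto)
 finally show ?thesis unfolding wave_sum[OF D] .
qed

section \<open>Upper bounds in finite volume\<close>

lemma partn_remove_le:
 assumes D: "finite D" "v \<in> D"
 shows "partn w (D - {v}) <= (1 + B) * partn w D"
proof -
 have Z: "0 < partn w D" by (rule W.partn_pos[OF D(1)])
 have "partn w (D - {v}) / partn w D <= 1 + B"
  using green_le_gh[OF D(1), of v v] gh_diag_le[of v] W.green_diag[OF D] by simp
 then show ?thesis using Z by (simp add: field_simps)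
qed

lemma one_B_nonneg: "0 <= 1 + B"
 using gh_nonneg gh_diag_le order_trans by blast

lemma card_of_bool: "finite S ==> real (card {x \<in> S. P x}) = (\<Sum>x\<in>S. of_bool (P x))"
 by (simp add: of_bool_def sum.If_cases Int_def)

text \<open>If an avalanche has at least n topplings, then n is at most the sum over its waves of
  min(n, size) + 1, the 1 being the toppling of \<open>v\<close>; this holds whether one wave is
  large or all are small. So the truncated mean of the tree size suffices although the number of
  waves is not controlled.\<close>

lemma size_upper:
 assumes L: "finite L" "v \<in> L" and n: "1 <= n"
 shows "real (card {\<eta> \<in> rec_set L. n <= (\<Sum>x\<in>L. odo L (add_grain v \<eta>) x)}) <=
  (CA + 2 * CS + 1) * (1 + B) / sqrt n * real (card (rec_set L))"
proof -
 let ?D = "L - {v}"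
 have D: "finite ?D" "v \<notin> ?D" using L by auto
 have nr: "1 <= sqrt n" using n by simp
 have "(\<Sum>\<eta>\<in>rec_set L. real n * of_bool (n <= (\<Sum>x\<in>L. odo L (add_grain v \<eta>) x)))
   <= fosum w ?D (%f. min (real n) (card (tree ?D f v)) + 1)"
 proof (rule upper_count[OF L])
  fix \<eta> and Xi :: "('v => nat) set"
  assume fin: "finite Xi" and le: "!!x. odo L (add_grain v \<eta>) x <= (\<Sum>\<xi>\<in>Xi. of_bool (x \<in> insert v (wave ?D v \<xi>)))"
  let ?G = "%\<xi>. min (real n) (real (card (wave ?D v \<xi>))) + 1"
  show "real n * of_bool (n <= (\<Sum>x\<in>L. odo L (add_grain v \<eta>) x)) <= (\<Sum>\<xi>\<in>Xi. ?G \<xi>)"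
  proof (cases "n <= (\<Sum>x\<in>L. odo L (add_grain v \<eta>) x)")
   case True
   have "(\<Sum>x\<in>L. odo L (add_grain v \<eta>) x) <= (\<Sum>x\<in>L. \<Sum>\<xi>\<in>Xi. of_bool (x \<in> insert v (wave ?D v \<xi>)))"
    by (rule sum_mono) (rule le)
   also have "... = (\<Sum>\<xi>\<in>Xi. \<Sum>x\<in>L. of_bool (x \<in> insert v (wave ?D v \<xi>)))" by (rule sum.swap)
   also have "... = (\<Sum>\<xi>\<in>Xi. card (wave ?D v \<xi>) + 1)"
   proof (rule sum.cong[OF refl])
    fix \<xi>
    have "L \<inter> {x. x \<in> insert v (wave ?D v \<xi>)} = insert v (wave ?D v \<xi>)"
     using wave_subset[of ?D v \<xi>] L by auto
    moreover have "finite (wave ?D v \<xi>)" "v \<notin> wave ?D v \<xi>"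
     using wave_subset[of ?D v \<xi>] D finite_subset by auto
    ultimately show "(\<Sum>x\<in>L. of_bool (x \<in> insert v (wave ?D v \<xi>))) = card (wave ?D v \<xi>) + 1"
     using L(1) by (simp only: of_bool_def sum.If_cases) simp
   qed
   finally have "n <= (\<Sum>\<xi>\<in>Xi. card (wave ?D v \<xi>) + 1)" by (rule order_trans[OF True])
   then have "real n <= real (\<Sum>\<xi>\<in>Xi. card (wave ?D v \<xi>) + 1)" by (simp only: of_nat_le_iff)
   then have tot: "real n <= (\<Sum>\<xi>\<in>Xi. real (card (wave ?D v \<xi>)) + 1)" by (simp only: of_nat_sum of_nat_add of_nat_1)
   show ?thesis
   proof (cases "\<exists>\<xi>\<in>Xi. n <= card (wave ?D v \<xi>)")
    case True
    then obtain \<xi> where xi: "\<xi> \<in> Xi" "n <= card (wave ?D v \<xi>)" by blast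
    have "real n <= ?G \<xi>" using xi(2) by simp
    also have "... <= (\<Sum>\<xi>\<in>Xi. ?G \<xi>)" by (rule member_le_sum[OF xi(1) _ fin]) simp
    finally show ?thesis by (simp add: of_bool_def)
   next
    case False
    then have "(\<Sum>\<xi>\<in>Xi. real (card (wave ?D v \<xi>)) + 1) = (\<Sum>\<xi>\<in>Xi. ?G \<xi>)"
     by (intro sum.cong) auto
    then show ?thesis using tot by (simp add: of_bool_def)
   qed
  qed (auto intro!: sum_nonneg)
 qed simp
 also have "... = fosum w ?D (%f. min (real n) (card (tree ?D f v))) + 1 * partn w ?D"
  by (simp only: W.fosum_add W.fosum_const)
 also have "... <= (CA + 2 * CS) * sqrt n * partn w ?D + sqrt n * partn w ?D"
  using W.partn_pos[OF D(1)] nr by (intro add_mono tree_size_bound[OF D n] mult_right_mono) auto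
 also have "... = (CA + 2 * CS + 1) * sqrt n * partn w ?D" by (simp add: algebra_simps)
 also have "... <= (CA + 2 * CS + 1) * sqrt n * ((1 + B) * partn w L)"
  using CA_ge CS_ge by (intro mult_left_mono partn_remove_le[OF L]) auto
 finally have "real n * real (card {\<eta> \<in> rec_set L. n <= (\<Sum>x\<in>L. odo L (add_grain v \<eta>) x)}) <=
   (CA + 2 * CS + 1) * sqrt n * ((1 + B) * partn w L)"
  unfolding sum_distrib_left[symmetric] card_of_bool[OF finite_rec[OF L(1)], symmetric] .
 then have "sqrt n * (sqrt n * real (card {\<eta> \<in> rec_set L. n <= (\<Sum>x\<in>L. odo L (add_grain v \<eta>) x)})) <=
   sqrt n * ((CA + 2 * CS + 1) * (1 + B) * partn w L)"
  by (simp add: mult.assoc[symmetric]) (simp add: mult_ac)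
 then have "sqrt n * real (card {\<eta> \<in> rec_set L. n <= (\<Sum>x\<in>L. odo L (add_grain v \<eta>) x)}) <=
   (CA + 2 * CS + 1) * (1 + B) * partn w L" using nr by (subst (asm) mult_le_cancel_left_pos) auto
 then show ?thesis unfolding card_rec[OF L(1)] using nr by (simp add: field_simps)
qed

end

context egraph
begin

text \<open>A distant toppled vertex belongs to some wave, so a first moment over waves is
  enough.\<close>

lemma far_upper:
 "\<exists>C>0. \<forall>L v s. finite L --> v \<in> L --> 0 < s -->
  real (card {\<eta> \<in> rec_set L. \<exists>x. 1 <= odo L (add_grain v \<eta>) x & s <= dd v x}) <= C / s\<^sup>2 * real (card (rec_set L))"
proof -
 obtain C where C: "0 < C" "!!D v s. finite D ==> v \<notin> D ==> 0 < s ==>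
  fosum w D (%f. of_bool (far D f v s)) <= C / s\<^sup>2 * partn w D" using far_bound by blast
 show ?thesis
 proof (intro exI[of _ "C * (1 + B) + 1"] conjI allI impI)
  show "0 < C * (1 + B) + 1" using C(1) one_B_nonneg by (simp add: add_nonneg_pos)
  fix L :: "'v set" and v and s :: real assume L: "finite L" "v \<in> L" and s: "0 < s"
  let ?D = "L - {v}"
  have D: "finite ?D" "v \<notin> ?D" using L by auto
  have "real (card {\<eta> \<in> rec_set L. \<exists>x. 1 <= odo L (add_grain v \<eta>) x & s <= dd v x})
   = (\<Sum>\<eta>\<in>rec_set L. of_bool (\<exists>x. 1 <= odo L (add_grain v \<eta>) x & s <= dd v x))"
   by (rule card_of_bool[OF finite_rec[OF L(1)]])
  also have "... <= fosum w ?D (%f. of_bool (\<exists>x\<in>tree ?D f v. s <= dd v x))"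
  proof (rule upper_count[OF L])
   fix \<eta> and Xi :: "('v => nat) set"
   assume fin: "finite Xi" and le: "!!x. odo L (add_grain v \<eta>) x <= (\<Sum>\<xi>\<in>Xi. of_bool (x \<in> insert v (wave ?D v \<xi>)))"
   let ?G = "%\<xi>. of_bool (\<exists>x\<in>wave ?D v \<xi>. s <= dd v x) :: real"
   show "of_bool (\<exists>x. 1 <= odo L (add_grain v \<eta>) x & s <= dd v x) <= (\<Sum>\<xi>\<in>Xi. ?G \<xi>)"
   proof (cases "\<exists>x. 1 <= odo L (add_grain v \<eta>) x & s <= dd v x")
    case True
    then obtain x where x: "1 <= odo L (add_grain v \<eta>) x" "s <= dd v x" by blast
    have xv: "x ~= v" using x s dd_self[of v] by auto
    have "(\<Sum>\<xi>\<in>Xi. of_bool (x \<in> insert v (wave ?D v \<xi>))) ~= (0::nat)" using le[of x] x(1) by linarith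
    then obtain \<xi> where xi: "\<xi> \<in> Xi" "x \<in> insert v (wave ?D v \<xi>)" by (rule sum.not_neutral_contains_not_neutral) simp
    have "1 <= ?G \<xi>" using xi xv x(2) by auto
    also have "... <= (\<Sum>\<xi>\<in>Xi. ?G \<xi>)" by (rule member_le_sum[OF xi(1) _ fin]) simp
    finally show ?thesis using True by simp
   qed (auto intro!: sum_nonneg)
  qed simp
  also have "... <= fosum w ?D (%f. of_bool (far ?D f v s))"
   by (rule W.fosum_mono) (auto simp: far_def tree_def)
  also have "... <= C / s\<^sup>2 * partn w ?D" by (rule C(2)[OF D s])
  also have "... <= C / s\<^sup>2 * ((1 + B) * partn w L)"
   using C(1) by (intro mult_left_mono partn_remove_le[OF L]) simp
  also have "... <= (C * (1 + B) + 1) / s\<^sup>2 * partn w L"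
   using W.partn_pos[OF L(1)] s by (simp add: field_simps)
  finally show "real (card {\<eta> \<in> rec_set L. \<exists>x. 1 <= odo L (add_grain v \<eta>) x & s <= dd v x}) <=
   (C * (1 + B) + 1) / s\<^sup>2 * real (card (rec_set L))" unfolding card_rec[OF L(1)] .
 qed
qed

end

context tgraph
begin

text \<open>By \<open>green_dual\<close> the value \<open>q v\<close> dominates the sum of the Green
  function over \<open>S\<close>, and \<open>hit\<close> is at most \<open>dg\<close> times the
  Green function.\<close>

lemma near_hit:
 fixes q :: "'v => real"
 assumes q: "!!x. 0 <= q x" "!!x. (\<Sum>y\<in>{y. E x y}. q y) + of_bool (x \<in> S) <= dg * q x"
  and D: "finite D" "v \<notin> D"
 shows "(\<Sum>x\<in>D \<inter> S. hit w D v x) <= dg * q v"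
proof -
 let ?D = "insert v D"
 have fD: "finite ?D" "v \<in> ?D" "?D - {v} = D" using D by auto
 have sym: "!!x y. x \<in> ?D ==> y \<in> ?D ==> w x y = w y x" by (rule w_sym)
 have "(\<Sum>x\<in>D \<inter> S. hit w D v x) <= (\<Sum>x\<in>D \<inter> S. dg * green w ?D x v)"
 proof (rule sum_mono)
  fix x
  have "hit w D v x * 1 <= hit w D v x * (dg * green w ?D v v)"
   using W.green_diag_ge[of ?D v] fD D by (intro mult_left_mono W.hit_nonneg) (auto simp: csum_w)
  then show "hit w D v x <= dg * green w ?D x v" using W.green_hit[of ?D v x] fD by (simp add: mult_ac)
 qed
 also have "... = (\<Sum>x\<in>D \<inter> S. dg * green w ?D x v * of_bool (x \<in> S))" by (rule sum.cong) auto
 also have "... <= (\<Sum>x\<in>?D. dg * green w ?D x v * of_bool (x \<in> S))"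
  by (rule sum_mono2) (use fD W.green_nonneg[OF fD(1)] in auto)
 also have "... <= (\<Sum>x\<in>?D. dg * green w ?D x v * (csum w x * q x - (\<Sum>y\<in>?D. w x y * q y)))"
 proof (intro sum_mono mult_left_mono)
  fix x assume "x \<in> ?D"
  have "(\<Sum>y\<in>?D. w x y * q y) = (\<Sum>y\<in>?D \<inter> {y. E x y}. q y)"
   using fD by (intro sum.mono_neutral_cong_right) (auto simp: w_def)
  also have "... <= (\<Sum>y\<in>{y. E x y}. q y)" by (intro sum_mono2) (auto simp: finite_E q)
  finally show "of_bool (x \<in> S) <= csum w x * q x - (\<Sum>y\<in>?D. w x y * q y)"
   using q(2)[of x] by (simp add: csum_w)
 qed (use W.green_nonneg[OF fD(1)] in auto)
 also have "... = dg * (\<Sum>x\<in>?D. green w ?D x v * (csum w x * q x - (\<Sum>y\<in>?D. w x y * q y)))"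
  by (simp only: sum_distrib_left mult.assoc)
 also have "... = dg * q v" by (simp only: W.green_dual[OF fD(1,2) sym])
 finally show ?thesis .
qed

end

section \<open>The hypercubic lattice\<close>

text \<open>Expand to fourth order at t and at -t; the odd terms cancel, and the remainder is
  bounded through 1 + s \<ge> 1/2.\<close>

lemma powr_second_order:
 fixes p t :: real
 assumes p: "0 <= p" and t: "\<bar>t\<bar> <= 1 / 2"
 shows "(1 + t) powr (- p) + (1 - t) powr (- p) <=
  2 + p * (p + 1) * t\<^sup>2 + p * (p + 1) * (p + 2) * (p + 3) * 2 powr (p + 4) * t ^ 4"
proof -
 define C where "C = p * (p + 1) * (p + 2) * (p + 3)"
 have C: "0 <= C" using p by (simp add: C_def)
 define diff where "diff = (%m::nat. %s::real. (\<Prod>i<m. - p - real i) * (1 + s) powr (- p - real m))"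
 have key: "(1 + t) powr (- p) <= 1 - p * t + p * (p + 1) / 2 * t\<^sup>2 - p * (p + 1) * (p + 2) / 6 * t ^ 3 +
   C * 2 powr (p + 4) / 24 * t ^ 4" if t: "\<bar>t\<bar> <= 1 / 2" for t :: real
 proof -
  have der: "DERIV (diff m) s :> diff (Suc m) s" if "\<bar>s\<bar> <= \<bar>t\<bar>" for m and s :: real
  proof -
   have "0 < 1 + s" using that t by linarith
   then have "((%s. (1 + s) powr (- p - real m)) has_real_derivative
     (- p - real m) * (1 + s) powr (- p - real m - 1)) (at s)"
    by (auto intro!: derivative_eq_intros)
   from DERIV_cmult[OF this, of "\<Prod>i<m. - p - real i"] show ?thesis
    unfolding diff_def by (simp add: algebra_simps)
  qed
  obtain s where s: "\<bar>s\<bar> <= \<bar>t\<bar>"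
   "diff 0 t = (\<Sum>m<4. diff m 0 / fact m * t ^ m) + diff 4 s / fact 4 * t ^ 4"
   using Maclaurin_bi_le[of diff "diff 0" 4 t] der by blast
  have e: "(\<Prod>i<4. - p - real i) = C"
   by (simp add: C_def eval_nat_numeral) (simp add: algebra_simps)
  have s1: "1 / 2 <= 1 + s" using s t by linarith
  have "(1 + s) powr (- p - 4) <= (1 / 2) powr (- p - 4)" using s1 p by (intro powr_mono2') auto
  also have "... = 2 powr (p + 4)" by (simp add: powr_divide powr_minus_divide[symmetric] add.commute)
  finally have le: "diff 4 s / fact 4 * t ^ 4 <= C * 2 powr (p + 4) / 24 * t ^ 4"
   unfolding diff_def e using C by (intro mult_right_mono) (auto simp: fact_numeral intro!: mult_left_mono divide_right_mono)
  have "(\<Sum>m<4. diff m 0 / fact m * t ^ m) =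
    1 - p * t + p * (p + 1) / 2 * t\<^sup>2 - p * (p + 1) * (p + 2) / 6 * t ^ 3"
   by (simp add: diff_def eval_nat_numeral) (simp add: field_simps)
  then show ?thesis using s(2) le by (simp add: diff_def)
 qed
 have "(1 + t) powr (- p) + (1 - t) powr (- p) <= 2 + p * (p + 1) * t\<^sup>2 + C * 2 powr (p + 4) / 12 * t ^ 4"
  using key[of t] key[of "- t"] t by (simp add: power2_eq_square power3_eq_cube eval_nat_numeral)
 also have "C * 2 powr (p + 4) / 12 * t ^ 4 <= C * 2 powr (p + 4) * t ^ 4"
  using C by (intro mult_right_mono) auto
 finally show ?thesis by (simp add: C_def)
qed

lemma powr_first_order:
 fixes p s :: real
 assumes "0 <= p" "0 <= s" "s < 1"
 shows "1 + p * s <= (1 - s) powr (- p)"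
proof -
 have "ln (1 - s) <= - s" using ln_le_minus_one[of "1 - s"] assms by simp
 then have "p * s <= - p * ln (1 - s)" using mult_left_mono[of "ln (1 - s)" "- s" p] assms by simp
 then have "1 + p * s <= exp (- p * ln (1 - s))" using exp_ge_add_one_self[of "- p * ln (1 - s)"] by linarith
 then show ?thesis using assms by (simp add: powr_def)
qed

section \<open>Norms and neighbours on the lattice\<close>

definition nrm2 :: "int ^ 'd => real" where
 "nrm2 x = (\<Sum>i\<in>UNIV. (real_of_int (x $ i))\<^sup>2)"

definition nrm1 :: "int ^ 'd => int" where
 "nrm1 x = (\<Sum>i\<in>UNIV. \<bar>x $ i\<bar>)"

lemma nrm2_nonneg: "0 <= nrm2 x"
 by (simp add: nrm2_def sum_nonneg)

lemma nrm1_nonneg: "0 <= nrm1 x"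
 by (simp add: nrm1_def sum_nonneg)

lemma nrm1_triangle: "nrm1 (x + y) <= nrm1 x + nrm1 y"
 unfolding nrm1_def sum.distrib[symmetric] by (intro sum_mono) simp

lemma nrm1_minus: "nrm1 (x - y) = nrm1 (y - x)"
 unfolding nrm1_def by (intro sum.cong) auto

lemma nrm2_le_nrm1: "nrm2 x <= (real_of_int (nrm1 x))\<^sup>2"
proof -
 have "(\<Sum>i\<in>UNIV. (real_of_int \<bar>x $ i\<bar>)\<^sup>2) <= (\<Sum>i\<in>UNIV. real_of_int \<bar>x $ i\<bar> * real_of_int (nrm1 x))"
  unfolding power2_eq_square nrm1_def of_int_sum
  by (intro sum_mono mult_left_mono member_le_sum) auto
 also have "... = (real_of_int (nrm1 x))\<^sup>2"
  by (simp add: sum_distrib_right[symmetric] nrm1_def power2_eq_square)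
 finally show ?thesis by (simp add: nrm2_def)
qed

lemma lattice_adj_nrm1: "lattice_adj x y \<longleftrightarrow> nrm1 (x - y) = 1"
 by (simp add: lattice_adj_def nrm1_def)

lemma nrm1_axis: "nrm1 (axis i s :: int ^ 'd) = \<bar>s\<bar>"
 by (simp add: nrm1_def axis_def if_distrib cong: if_cong)

lemma lattice_adj_axis: "\<bar>s\<bar> = 1 ==> lattice_adj x (x + axis i s)"
 unfolding lattice_adj_nrm1 nrm1_minus[of x "x + axis i s"] by (simp add: nrm1_axis)

lemma lattice_nbrs:
 "{y. lattice_adj x y} = (%(i, s). x + axis i s) ` (UNIV \<times> {1, -1 :: int})" (is "?L = ?R")
proof
 show "?R \<subseteq> ?L" by (auto simp: lattice_adj_nrm1 nrm1_minus[of x] nrm1_axis)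
 show "?L \<subseteq> ?R"
 proof
  fix y assume "y \<in> ?L"
  then have "nrm1 (y - x) = 1" by (simp add: lattice_adj_nrm1 nrm1_minus[of x y])
  then have 1: "(\<Sum>i\<in>UNIV. \<bar>(y - x) $ i\<bar>) = 1" by (simp only: nrm1_def)
  then obtain i where i: "(y - x) $ i ~= 0" by (metis abs_zero sum.neutral zero_neq_one)
  have s: "\<bar>(y - x) $ i\<bar> + (\<Sum>j\<in>UNIV - {i}. \<bar>(y - x) $ j\<bar>) = 1"
   using 1 sum.remove[of UNIV i "%j. \<bar>(y - x) $ j\<bar>"] by simp
  have nn: "0 <= (\<Sum>j\<in>UNIV - {i}. \<bar>(y - x) $ j\<bar>)" by (rule sum_nonneg) simp
  have i1: "\<bar>(y - x) $ i\<bar> = 1" using s nn i by linarith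
  then have "(\<Sum>j\<in>UNIV - {i}. \<bar>(y - x) $ j\<bar>) = 0" using s by linarith
  then have z: "(y - x) $ j = 0" if "j ~= i" for j
   using that by (subst (asm) sum_nonneg_eq_0_iff) auto
  have "y = x + axis i ((y - x) $ i)"
   by (rule vec_eq_iff[THEN iffD2]) (use z in \<open>auto simp: axis_def\<close>)
  moreover have "(y - x) $ i = 1 \<or> (y - x) $ i = -1" using i1 by linarith
  ultimately show "y \<in> ?R" by (metis (no_types, lifting) SigmaI UNIV_I case_prod_conv image_eqI insertCI)
 qed
qed

lemma inj_axis: "inj_on (%(i, s). x + axis i s) (UNIV \<times> {1, -1 :: int})"
proof (rule inj_onI, clarify)
 fix i j :: 'a and s t :: int assume st: "s \<in> {1, -1}" "t \<in> {1, -1}" and eq: "x + axis i s = x + axis j t"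
 then have "axis i s $ i = axis j t $ i" by (metis add_left_cancel)
 then have "s = (if i = j then t else 0)" by (auto simp: axis_def)
 then show "i = j & s = t" using st by (auto split: if_splits)
qed

lemma sum_lattice_nbrs:
 "(\<Sum>y\<in>{y. lattice_adj x y}. u y) = (\<Sum>i\<in>UNIV. u (x + axis i 1) + u (x + axis i (-1)) :: real)"
proof -
 have "(\<Sum>y\<in>{y. lattice_adj x y}. u y) = (\<Sum>p\<in>UNIV \<times> {1, -1}. u (case p of (i, s) => x + axis i s))"
  unfolding lattice_nbrs by (simp only: sum.reindex[OF inj_axis] comp_def)
 also have "... = (\<Sum>(i, s)\<in>UNIV \<times> {1, -1}. u (x + axis i s))" by (rule sum.cong) auto
 also have "... = (\<Sum>i\<in>UNIV. \<Sum>s\<in>{1, -1}. u (x + axis i s))" by (rule sum.cartesian_product[symmetric])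
 finally show ?thesis by simp
qed

lemma card_lattice_nbrs: "card {y :: int ^ 'd. lattice_adj x y} = 2 * CARD('d)"
 unfolding lattice_nbrs by (subst card_image[OF inj_axis]) (simp add: card_cartesian_product)

lemma nrm2_axis: "nrm2 (x + axis i s) = nrm2 x + 2 * real_of_int s * real_of_int (x $ i) + (real_of_int s)\<^sup>2"
proof -
 have "nrm2 (x + axis i s) = (\<Sum>j\<in>UNIV. (real_of_int (x $ j))\<^sup>2 + (if j = i then 2 * real_of_int s * real_of_int (x $ i) + (real_of_int s)\<^sup>2 else 0))"
  unfolding nrm2_def by (rule sum.cong) (auto simp: axis_def power2_eq_square algebra_simps)
 then show ?thesis by (simp add: sum.distrib nrm2_def)
qed

text \<open>A smoothed Newton potential |x|^(2 - d). With A = a + |x|^2 + 1, neighbouring values are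
  powers of A(1 + t) and A(1 - t), and the centre is a power of A(1 - 1/A). The terms of order 1/A
  cancel because 2(p + 1) = d. The shift \<open>a\<close> leaves a gain of order a/A^2, which beats
  the fourth-order error once a \<ge> C.\<close>

lemma superharmonic:
 fixes a p :: real and x :: "int ^ 'd"
 defines "p \<equiv> (real CARD('d) - 2) / 2"
 defines "C \<equiv> 16 * (p * (p + 1) * (p + 2) * (p + 3) * 2 powr (p + 4))"
 assumes d: "5 <= CARD('d)" and a: "3 <= a" "C <= a"
 shows "(\<Sum>y\<in>{y. lattice_adj x y}. (a + nrm2 y) powr (- p)) + a * (a + nrm2 x + 1) powr (- p - 2)
  <= real (2 * CARD('d)) * (a + nrm2 x) powr (- p)"
proof -
 let ?d = "real CARD('d)"
 define A where "A = a + nrm2 x + 1"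
 define C1 where "C1 = p * (p + 1) * (p + 2) * (p + 3) * 2 powr (p + 4)"
 define t where "t i = 2 * real_of_int (x $ i) / A" for i
 have p: "3 / 2 <= p" "2 * (p + 1) = ?d" using d by (auto simp: p_def field_simps)
 have A: "4 <= A" "nrm2 x <= A" using a nrm2_nonneg[of x] by (auto simp: A_def)
 have C1: "0 <= C1" using p by (simp add: C1_def)
 have xi: "(real_of_int (x $ i))\<^sup>2 <= nrm2 x" for i unfolding nrm2_def by (intro member_le_sum) auto
 have t2: "\<bar>t i\<bar> <= 1 / 2" for i
 proof -
  have "0 <= (\<bar>real_of_int (x $ i)\<bar> - 2)\<^sup>2" by simp
  then have "4 * \<bar>real_of_int (x $ i)\<bar> <= (real_of_int (x $ i))\<^sup>2 + 4" by (simp add: power2_diff)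
  also have "... <= A" using xi[of i] a by (simp add: A_def)
  finally show ?thesis using A by (simp add: t_def field_simps)
 qed
 have nbr: "(a + nrm2 (x + axis i 1)) powr (- p) + (a + nrm2 (x + axis i (-1))) powr (- p) <=
   A powr (- p) * (2 + p * (p + 1) * (t i)\<^sup>2 + C1 * (t i) ^ 4)" for i
 proof -
  have e: "a + nrm2 (x + axis i 1) = A * (1 + t i)" "a + nrm2 (x + axis i (-1)) = A * (1 - t i)"
   using A by (auto simp: nrm2_axis A_def t_def field_simps)
  have nn: "0 <= 1 + t i" "0 <= 1 - t i" using t2[of i] by linarith+
  have "(A * (1 + t i)) powr (- p) = A powr (- p) * (1 + t i) powr (- p)"
   "(A * (1 - t i)) powr (- p) = A powr (- p) * (1 - t i) powr (- p)"
   using A nn by (intro powr_mult; simp)+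
  then have "(a + nrm2 (x + axis i 1)) powr (- p) + (a + nrm2 (x + axis i (-1))) powr (- p) =
    A powr (- p) * ((1 + t i) powr (- p) + (1 - t i) powr (- p))"
   by (simp only: e distrib_left)
  also have "... <= A powr (- p) * (2 + p * (p + 1) * (t i)\<^sup>2 + C1 * (t i) ^ 4)"
   using powr_second_order[of p "t i"] p t2[of i] by (intro mult_left_mono) (auto simp: C1_def)
  finally show ?thesis .
 qed
 have s2: "(\<Sum>i\<in>UNIV. (t i)\<^sup>2) = 4 * nrm2 x / A\<^sup>2"
  by (simp add: t_def nrm2_def power_divide power_mult_distrib sum_divide_distrib sum_distrib_left)
 have s4: "(\<Sum>i\<in>UNIV. (t i) ^ 4) <= 16 / A\<^sup>2"
 proof -
  have "(\<Sum>i\<in>UNIV. (t i) ^ 4) <= (\<Sum>i\<in>UNIV. (t i)\<^sup>2 * (4 / A))"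
  proof (rule sum_mono)
   fix i
   have "(t i)\<^sup>2 = 4 * (real_of_int (x $ i))\<^sup>2 / A\<^sup>2" by (simp add: t_def power_divide power_mult_distrib)
   also have "... <= 4 * A / A\<^sup>2" using xi[of i] A by (intro divide_right_mono) auto
   also have "... = 4 / A" using A by (simp add: power2_eq_square)
   finally have "(t i)\<^sup>2 * (t i)\<^sup>2 <= (t i)\<^sup>2 * (4 / A)" by (intro mult_left_mono) auto
   then show "(t i) ^ 4 <= (t i)\<^sup>2 * (4 / A)" by (simp add: eval_nat_numeral mult.assoc)
  qed
  also have "... = 4 * nrm2 x / A\<^sup>2 * (4 / A)" by (simp only: sum_distrib_right[symmetric] s2)
  also have "... <= 4 * A / A\<^sup>2 * (4 / A)" using A by (intro mult_right_mono divide_right_mono) auto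
  also have "... = 16 / A\<^sup>2" using A by (simp add: power2_eq_square)
  finally show ?thesis .
 qed
 have "(\<Sum>y\<in>{y. lattice_adj x y}. (a + nrm2 y) powr (- p)) <=
   (\<Sum>i\<in>UNIV. A powr (- p) * (2 + p * (p + 1) * (t i)\<^sup>2 + C1 * (t i) ^ 4))"
  unfolding sum_lattice_nbrs by (rule sum_mono) (rule nbr)
 also have "... = A powr (- p) * (2 * ?d + p * (p + 1) * (\<Sum>i\<in>UNIV. (t i)\<^sup>2) + C1 * (\<Sum>i\<in>UNIV. (t i) ^ 4))"
  by (simp only: sum_distrib_left[symmetric] sum.distrib) (simp add: algebra_simps)
 also have "... <= A powr (- p) * (2 * ?d + p * (p + 1) * (4 * nrm2 x / A\<^sup>2) + C1 * (16 / A\<^sup>2))"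
  using s4 C1 unfolding s2 by (intro mult_left_mono add_left_mono) auto
 also have "... = A powr (- p) * (2 * ?d + 2 * ?d * p / A - (2 * ?d * p * (a + 1) - 16 * C1) / A\<^sup>2)"
 proof -
  have "p * (p + 1) * (4 * nrm2 x / A\<^sup>2) = 2 * ?d * p * (A - a - 1) / A\<^sup>2"
   unfolding p(2)[symmetric] by (simp add: A_def algebra_simps)
  also have "... = 2 * ?d * p / A - 2 * ?d * p * (a + 1) / A\<^sup>2"
   using A by (simp add: field_simps power2_eq_square)
  finally have "2 * ?d + p * (p + 1) * (4 * nrm2 x / A\<^sup>2) + C1 * (16 / A\<^sup>2) =
    2 * ?d + 2 * ?d * p / A - (2 * ?d * p * (a + 1) - 16 * C1) / A\<^sup>2"
   by (simp add: diff_divide_distrib)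
  then show ?thesis by (rule arg_cong)
 qed
 also have "... <= A powr (- p) * (2 * ?d + 2 * ?d * p / A - a / A\<^sup>2)"
 proof -
  have "1 * 1 <= ?d * p" using d p by (intro mult_mono) auto
  then have "2 * a <= 2 * ?d * p * (a + 1) " using a mult_mono[of 2 "2 * (?d * p)" a "a + 1"] by (simp add: mult.assoc)
  moreover have "16 * C1 <= a" using a by (simp add: C_def C1_def)
  ultimately have "a <= 2 * ?d * p * (a + 1) - 16 * C1" by linarith
  then show ?thesis by (intro mult_left_mono diff_left_mono divide_right_mono) auto
 qed
 also have "... = 2 * ?d * (A powr (- p) * (1 + p * (1 / A))) - a * (A powr (- p) / A\<^sup>2)"
  by (simp add: algebra_simps)
 also have "... <= 2 * ?d * (A powr (- p) * (1 - 1 / A) powr (- p)) - a * (A powr (- p) / A\<^sup>2)"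
  using p A by (intro diff_right_mono mult_left_mono powr_first_order) auto
 also have "A powr (- p) * (1 - 1 / A) powr (- p) = (a + nrm2 x) powr (- p)"
 proof -
  have "A * (1 - 1 / A) = A - 1" using A by (simp add: right_diff_distrib)
  then have "A * (1 - 1 / A) = a + nrm2 x" by (simp add: A_def)
  then show ?thesis using A by (simp add: powr_mult[symmetric])
 qed
 also have "A powr (- p) / A\<^sup>2 = A powr (- p - 2)"
  using A by (simp add: powr_diff powr_numeral)
 finally show ?thesis by (simp add: A_def)
qed

lemma sum_nbrs_shift:
 "(\<Sum>y\<in>{y. lattice_adj x y}. u (y - v)) = (\<Sum>y\<in>{y. lattice_adj (x - v) y}. u y :: real)"
proof -
 have "x + axis i s - v = (x - v) + axis i s" for i s by simp
 then show ?thesis unfolding sum_lattice_nbrs by (simp only:)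
qed

lemma summable_square_powr:
 fixes q :: real
 assumes q: "3 / 5 <= q"
 shows "summable (%n::nat. (1 + (real n)\<^sup>2) powr (- q))"
proof (rule summable_comparison_test'[where N = 1])
 show "summable (%n::nat. real n powr (- 6 / 5))" by (simp add: summable_real_powr_iff)
 fix n :: nat assume n: "1 <= n"
 have "(1 + (real n)\<^sup>2) powr (- q) <= ((real n)\<^sup>2) powr (- q)" using n q by (intro powr_mono2') auto
 also have "(real n)\<^sup>2 = real n powr 2" using n by (simp add: powr_numeral)
 also have "(real n powr 2) powr (- q) = real n powr (2 * - q)" by (rule powr_powr)
 also have "... <= real n powr (- 6 / 5)" using n q by (intro powr_mono) auto
 finally show "norm ((1 + (real n)\<^sup>2) powr (- q)) <= real n powr (- 6 / 5)" by simp
qed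

lemma int_sum_bounded:
 fixes q :: real
 assumes q: "3 / 5 <= q"
 shows "\<exists>S. \<forall>J::int set. finite J --> (\<Sum>j\<in>J. (1 + (real_of_int j)\<^sup>2) powr (- q)) <= S"
proof -
 let ?g = "%n::nat. (1 + (real n)\<^sup>2) powr (- q)"
 let ?h = "%j::int. (1 + (real_of_int j)\<^sup>2) powr (- q)"
 have half: "sum ?h J <= suminf ?g" if "finite J" "inj_on (%j. nat \<bar>j\<bar>) J" for J
 proof -
  have "sum ?h J = sum (?g \<circ> (%j. nat \<bar>j\<bar>)) J" by (rule sum.cong) auto
  also have "... = sum ?g ((%j. nat \<bar>j\<bar>) ` J)" by (rule sum.reindex[OF that(2), symmetric])
  also have "... <= suminf ?g"
   by (rule sum_le_suminf[OF summable_square_powr[OF q]]) (use that in auto)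
  finally show ?thesis .
 qed
 have "sum ?h J <= suminf ?g + suminf ?g" if J: "finite J" for J
 proof -
  have "sum ?h J = sum ?h (J \<inter> {0..}) + sum ?h (J - {0..})" by (rule sum.Int_Diff[OF J])
  also have "... <= suminf ?g + suminf ?g"
   by (intro add_mono half) (use J in \<open>auto simp: inj_on_def\<close>)
  finally show ?thesis .
 qed
 then show ?thesis by blast
qed

text \<open>The square is (a + |z|^2)^(2 - d), split into d equal powers with exponent q = (d -
  2)/d, each bounded by a function of one coordinate. The one-dimensional sums converge if 2q > 1,
  that is d > 4; d \<ge> 5 gives q \<ge> 3/5.\<close>

lemma lattice_bubble:
 fixes a :: real
 assumes d: "5 <= CARD('d)" and a: "1 <= a"
 shows "\<exists>B. \<forall>D (v :: int ^ 'd). finite D -->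
  (\<Sum>x\<in>D. ((a + nrm2 (x - v)) powr (- ((real CARD('d) - 2) / 2)))\<^sup>2) <= B"
proof -
 let ?d = "real CARD('d)"
 let ?p = "(?d - 2) / 2"
 define q where "q = (?d - 2) / ?d"
 have q: "3 / 5 <= q" using d by (simp add: q_def field_simps)
 let ?h = "%j::int. (1 + (real_of_int j)\<^sup>2) powr (- q)"
 obtain S where S: "!!J. finite J ==> sum ?h J <= S" using int_sum_bounded[OF q] by blast
 have pt: "((a + nrm2 z) powr (- ?p))\<^sup>2 <= (\<Prod>i\<in>UNIV. ?h (z $ i))" for z :: "int ^ 'd"
 proof -
  have pos: "0 < a + nrm2 z" using a nrm2_nonneg[of z] by linarith
  have "((a + nrm2 z) powr (- ?p))\<^sup>2 = ((a + nrm2 z) powr (- ?p)) powr 2"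
   using pos by (subst powr_numeral) auto
  also have "... = (a + nrm2 z) powr (- ?p * 2)" by (rule powr_powr)
  also have "- ?p * 2 = - q * ?d" using d by (simp add: q_def field_simps)
  also have "(a + nrm2 z) powr (- q * ?d) = ((a + nrm2 z) powr (- q)) ^ CARD('d)"
   using pos by (simp only: powr_powr[symmetric]) (simp add: powr_realpow)
  also have "... = (\<Prod>i\<in>(UNIV :: 'd set). (a + nrm2 z) powr (- q))" by simp
  also have "... <= (\<Prod>i\<in>UNIV. ?h (z $ i))"
  proof (intro prod_mono conjI powr_mono2')
   fix i
   have "(real_of_int (z $ i))\<^sup>2 <= nrm2 z" unfolding nrm2_def by (intro member_le_sum) auto
   then show "1 + (real_of_int (z $ i))\<^sup>2 <= a + nrm2 z" using a by linarith
  qed (use q in \<open>auto intro: add_pos_nonneg\<close>)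
  finally show ?thesis .
 qed
 show ?thesis
 proof (intro exI[of _ "S ^ CARD('d)"] allI impI)
  fix D :: "(int ^ 'd) set" and v assume D: "finite D"
  define J where "J = (\<Union>x\<in>D. range (%i. (x - v) $ i))"
  have J: "finite J" using D by (simp add: J_def)
  let ?c = "%x i. (x - v) $ i"
  have inj: "inj_on ?c D"
  proof (rule inj_onI)
   fix x y assume e: "?c x = ?c y"
   have "x $ i = y $ i" for i using fun_cong[OF e, of i] by simp
   then show "x = y" by (simp add: vec_eq_iff)
  qed
  have "(\<Sum>x\<in>D. ((a + nrm2 (x - v)) powr (- ?p))\<^sup>2) <= (\<Sum>x\<in>D. \<Prod>i\<in>UNIV. ?h (?c x i))"
   by (intro sum_mono pt)
  also have "... = (\<Sum>g\<in>?c ` D. \<Prod>i\<in>UNIV. ?h (g i))"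
   by (simp only: sum.reindex[OF inj] comp_def)
  also have "... <= (\<Sum>g\<in>PiE (UNIV :: 'd set) (%_. J). \<Prod>i\<in>UNIV. ?h (g i))"
   by (rule sum_mono2) (use J in \<open>auto simp: J_def intro!: finite_PiE prod_nonneg\<close>)
  also have "... = (\<Prod>i\<in>(UNIV :: 'd set). sum ?h J)"
   by (rule prod_sum_PiE[symmetric]) (use J in auto)
  also have "... = (sum ?h J) ^ CARD('d)" by simp
  also have "... <= S ^ CARD('d)" using S[OF J] by (intro power_mono) (auto intro: sum_nonneg)
  finally show "(\<Sum>x\<in>D. ((a + nrm2 (x - v)) powr (- ?p))\<^sup>2) <= S ^ CARD('d)" .
 qed
qed

lemma cosh_bound:
 fixes \<theta> :: real
 assumes "0 <= \<theta>" "\<theta> <= 1"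
 shows "exp \<theta> + exp (- \<theta>) <= 2 + 2 * \<theta>\<^sup>2"
proof -
 have "exp (- \<theta>) <= 1 / (1 + \<theta>)"
  using exp_ge_add_one_self[of \<theta>] assms by (simp add: exp_minus inverse_eq_divide frac_le)
 also have "... <= 1 - \<theta> + \<theta>\<^sup>2"
 proof -
  have "1 <= (1 - \<theta> + \<theta>\<^sup>2) * (1 + \<theta>)" using assms by (simp add: algebra_simps power2_eq_square)
  then show ?thesis using assms by (simp add: divide_le_eq)
 qed
 finally show ?thesis using exp_bound[of \<theta>] assms by linarith
qed

text \<open>A product of hyperbolic cosines of \<theta> times the coordinates is an exact
  eigenfunction of the adjacency operator, and \<open>cosh_bound\<close> estimates the
  eigenvalue.\<close>

lemma exp_nrm1:
 fixes v :: "int ^ 'd" and \<theta> :: real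
 assumes th: "0 <= \<theta>" "\<theta> <= 1"
 shows "\<exists>e. (\<forall>x. exp (\<theta> * real_of_int (nrm1 (v - x))) <= e x) & e v <= 2 ^ CARD('d) &
  (\<forall>x. (\<Sum>y\<in>{y. lattice_adj x y}. e y) <= (real (2 * CARD('d)) + real (2 * CARD('d)) * \<theta>\<^sup>2) * e x)"
proof -
 define c where "c j = exp (\<theta> * real_of_int j) + exp (- (\<theta> * real_of_int j))" for j
 define e where "e x = (\<Prod>i\<in>UNIV. c ((x - v) $ i))" for x :: "int ^ 'd"
 have c0: "0 <= c j" for j by (simp add: c_def add_nonneg_nonneg)
 have c1: "c (j + 1) + c (j + (- 1)) = (exp \<theta> + exp (- \<theta>)) * c j" for j
  by (simp add: c_def distrib_left distrib_right exp_add[symmetric] algebra_simps)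
 have e0: "0 <= e x" for x unfolding e_def by (intro prod_nonneg) (simp add: c0)
 have es: "e (x + axis i s) = c ((x - v) $ i + s) * (\<Prod>j\<in>UNIV - {i}. c ((x - v) $ j))" for x i s
 proof -
  have "e (x + axis i s) = c ((x + axis i s - v) $ i) * (\<Prod>j\<in>UNIV - {i}. c ((x + axis i s - v) $ j))"
   unfolding e_def by (rule prod.remove) auto
  also have "(\<Prod>j\<in>UNIV - {i}. c ((x + axis i s - v) $ j)) = (\<Prod>j\<in>UNIV - {i}. c ((x - v) $ j))"
   by (rule prod.cong) (auto simp: axis_def)
  also have "(x + axis i s - v) $ i = (x - v) $ i + s" by (simp add: axis_def)
  finally show ?thesis .
 qed
 have e1: "e x = c ((x - v) $ i) * (\<Prod>j\<in>UNIV - {i}. c ((x - v) $ j))" for x i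
  unfolding e_def by (rule prod.remove) auto
 have 1: "exp (\<theta> * real_of_int (nrm1 (v - x))) <= e x" for x
 proof -
  have "exp (\<theta> * real_of_int (nrm1 (v - x))) = (\<Prod>i\<in>UNIV. exp (\<theta> * real_of_int \<bar>(x - v) $ i\<bar>))"
   unfolding nrm1_def by (simp add: sum_distrib_left exp_sum abs_minus_commute)
  also have "... <= e x"
   unfolding e_def
  proof (intro prod_mono conjI)
   fix i
   show "exp (\<theta> * real_of_int \<bar>(x - v) $ i\<bar>) <= c ((x - v) $ i)"
    by (cases "0 <= (x - v) $ i") (simp_all add: c_def abs_if algebra_simps)
  qed simp
  finally show ?thesis .
 qed
 have 2: "e v <= 2 ^ CARD('d)" by (simp add: e_def c_def)
 have 3: "(\<Sum>y\<in>{y. lattice_adj x y}. e y) <= (real (2 * CARD('d)) + real (2 * CARD('d)) * \<theta>\<^sup>2) * e x" for x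
 proof -
  have "(\<Sum>y\<in>{y. lattice_adj x y}. e y) = (\<Sum>i\<in>(UNIV :: 'd set). (exp \<theta> + exp (- \<theta>)) * e x)"
   unfolding sum_lattice_nbrs
  proof (rule sum.cong[OF refl])
   fix i :: 'd
   have "e (x + axis i 1) + e (x + axis i (- 1)) =
    (c ((x - v) $ i + 1) + c ((x - v) $ i + (- 1))) * (\<Prod>j\<in>UNIV - {i}. c ((x - v) $ j))"
    unfolding es by (rule distrib_right[symmetric])
   also have "... = (exp \<theta> + exp (- \<theta>)) * e x" unfolding c1 e1[of x i] by (rule mult.assoc)
   finally show "e (x + axis i 1) + e (x + axis i (- 1)) = (exp \<theta> + exp (- \<theta>)) * e x" .
  qed
  also have "... = CARD('d) * ((exp \<theta> + exp (- \<theta>)) * e x)" by simp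
  also have "... <= CARD('d) * ((2 + 2 * \<theta>\<^sup>2) * e x)"
   using cosh_bound[OF th] e0 by (intro mult_left_mono mult_right_mono) auto
  finally show ?thesis by (simp add: algebra_simps)
 qed
 show ?thesis using 1 2 3 by blast
qed

section \<open>The lattice as an instance of the abstract setting\<close>

lemma lattice_escape:
 fixes P :: "(int ^ 'd) set"
 assumes "finite P" "P ~= {}"
 shows "\<exists>x\<in>P. \<exists>y. y \<notin> P & lattice_adj x y"
proof -
 fix i :: 'd
 have "Max ((%x. x $ i) ` P) \<in> (%x. x $ i) ` P" using assms by (intro Max_in) auto
 then obtain x where x: "x \<in> P" "x $ i = Max ((%x. x $ i) ` P)" by auto
 have "x + axis i 1 \<notin> P"
 proof
  assume "x + axis i 1 \<in> P"
  from Max_ge[OF finite_imageI[OF assms(1)] imageI[OF this, of "%x. x $ i"]]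
  have "(x + axis i 1) $ i <= x $ i" unfolding x(2) .
  then show False by (simp add: axis_def)
 qed
 moreover have "lattice_adj x (x + axis i 1)" by (rule lattice_adj_axis) simp
 ultimately show ?thesis using x(1) by blast
qed

lemma infinite_lattice: "infinite (UNIV :: (int ^ 'd) set)"
proof
 fix i :: 'd
 assume "finite (UNIV :: (int ^ 'd) set)"
 then have "finite (range (%s. axis i s :: int ^ 'd))" by (rule finite_subset[rotated]) simp
 moreover have "inj (%s. axis i s :: int ^ 'd)" by (rule injI) (metis axis_nth)
 ultimately show False using finite_imageD infinite_UNIV_int by blast
qed

lemma lattice_potential:
 assumes d: "5 <= CARD('d)"
 obtains a0 :: real where "3 <= a0"
  "!!a (x :: int ^ 'd) v. a0 <= a ==>
   (\<Sum>y\<in>{y. lattice_adj x y}. (a + nrm2 (y - v)) powr (- ((real CARD('d) - 2) / 2))) +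
    a * (a + nrm2 (x - v) + 1) powr (- ((real CARD('d) - 2) / 2) - 2)
   <= real (2 * CARD('d)) * (a + nrm2 (x - v)) powr (- ((real CARD('d) - 2) / 2))"
proof -
 let ?p = "(real CARD('d) - 2) / 2"
 let ?C = "16 * (?p * (?p + 1) * (?p + 2) * (?p + 3) * 2 powr (?p + 4))"
 show ?thesis
 proof (rule that[of "max 3 ?C"])
  show "3 <= max 3 ?C" by (rule max.cobounded1)
  fix a and x v :: "int ^ 'd" assume a: "max 3 ?C <= a"
  then have a': "3 <= a" "?C <= a" by (simp_all only: max.bounded_iff)
  show "(\<Sum>y\<in>{y. lattice_adj x y}. (a + nrm2 (y - v)) powr (- ?p)) +
    a * (a + nrm2 (x - v) + 1) powr (- ?p - 2) <= real (2 * CARD('d)) * (a + nrm2 (x - v)) powr (- ?p)"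
   using superharmonic[OF d a', of "x - v"]
   unfolding sum_nbrs_shift[of "%z. (a + nrm2 z) powr (- ?p)" v x] .
 qed
qed

lemma lattice_egraph:
 assumes d: "5 <= CARD('d)"
 shows "\<exists>gh B Ke Kt. egraph (lattice_adj :: int ^ 'd => _) (2 * CARD('d)) gh B
  (%x y. real_of_int (nrm1 (x - y))) Ke Kt"
proof -
 let ?p = "(real CARD('d) - 2) / 2"
 obtain a :: real where a: "3 <= a" and pot: "!!(x :: int ^ 'd) v.
   (\<Sum>y\<in>{y. lattice_adj x y}. (a + nrm2 (y - v)) powr (- ?p)) + a * (a + nrm2 (x - v) + 1) powr (- ?p - 2)
   <= real (2 * CARD('d)) * (a + nrm2 (x - v)) powr (- ?p)"
  using lattice_potential[OF d] by (metis order_refl)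
 obtain B where B: "!!D (v :: int ^ 'd). finite D ==> (\<Sum>x\<in>D. ((a + nrm2 (x - v)) powr (- ?p))\<^sup>2) <= B"
  using lattice_bubble[OF d, of a] a by auto
 \<comment> \<open>Normalization: at \<open>x = v\<close> the gain from the potential becomes
   exactly 1, as \<open>gh_super\<close> demands.\<close>
 define \<kappa> where "\<kappa> = (a + 1) powr (?p + 2) / a"
 have \<kappa>: "0 < \<kappa>" "\<kappa> * (a * (a + 1) powr (- ?p - 2)) = 1"
 proof -
  show "0 < \<kappa>" using a by (simp add: \<kappa>_def)
  have "(a + 1) powr (?p + 2) * (a + 1) powr (- ?p - 2) = 1"
   using a by (simp add: powr_add[symmetric])
  then show "\<kappa> * (a * (a + 1) powr (- ?p - 2)) = 1" using a by (simp add: \<kappa>_def)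
 qed
 define gh where "gh x y = \<kappa> * (a + nrm2 (x - y)) powr (- ?p)" for x y :: "int ^ 'd"
 have nrm2_minus: "nrm2 (x - y) = nrm2 (y - x)" for x y :: "int ^ 'd"
  unfolding nrm2_def by (intro sum.cong) (auto simp: power2_commute)
 have "egraph (lattice_adj :: int ^ 'd => _) (2 * CARD('d)) gh (\<kappa>\<^sup>2 * B)
  (%x y. real_of_int (nrm1 (x - y))) (2 ^ CARD('d)) (real (2 * CARD('d)))"
 proof
  show "lattice_adj x y ==> lattice_adj y x" for x y :: "int ^ 'd"
   by (simp add: lattice_adj_nrm1 nrm1_minus[of x y])
  show "\<not> lattice_adj x x" for x :: "int ^ 'd" by (simp add: lattice_adj_def)
  show "card {y. lattice_adj x y} = 2 * CARD('d)" for x :: "int ^ 'd" by (rule card_lattice_nbrs)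
  show "infinite (UNIV :: (int ^ 'd) set)" by (rule infinite_lattice)
  show "finite P ==> P ~= {} ==> \<exists>x\<in>P. \<exists>y. y \<notin> P & lattice_adj x y" for P :: "(int ^ 'd) set"
   by (rule lattice_escape)
  show "0 <= gh x y" for x y using \<kappa> by (simp add: gh_def)
  show "gh x y = gh y x" for x y by (simp add: gh_def nrm2_minus[of x y])
  show "(\<Sum>y\<in>{y. lattice_adj x y}. gh y v) + of_bool (x = v) <= real (2 * CARD('d)) * gh x v" for x v
  proof -
   have "of_bool (x = v) <= \<kappa> * (a * (a + nrm2 (x - v) + 1) powr (- ?p - 2))"
    using \<kappa> a by (cases "x = v") (auto simp: nrm2_def)
   then have "(\<Sum>y\<in>{y. lattice_adj x y}. gh y v) + of_bool (x = v) <=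
    \<kappa> * ((\<Sum>y\<in>{y. lattice_adj x y}. (a + nrm2 (y - v)) powr (- ?p)) + a * (a + nrm2 (x - v) + 1) powr (- ?p - 2))"
    by (simp add: gh_def distrib_left sum_distrib_left)
   also have "... <= \<kappa> * (real (2 * CARD('d)) * (a + nrm2 (x - v)) powr (- ?p))"
    using \<kappa> by (intro mult_left_mono pot) auto
   finally show ?thesis by (simp only: gh_def mult_ac)
  qed
  show "(\<Sum>x\<in>D. (gh x v)\<^sup>2) <= \<kappa>\<^sup>2 * B" if "finite D" for D v
   unfolding gh_def power_mult_distrib sum_distrib_left[symmetric] using B[OF that] by (intro mult_left_mono) auto
  show "real_of_int (nrm1 (v - v)) = 0" for v :: "int ^ 'd" by (simp add: nrm1_def)
  show "real_of_int (nrm1 (x - z)) <= real_of_int (nrm1 (x - y)) + real_of_int (nrm1 (y - z))" for x y z :: "int ^ 'd"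
   using nrm1_triangle[of "x - y" "y - z"] by simp
  show "lattice_adj x y ==> real_of_int (nrm1 (x - y)) <= 1" for x y :: "int ^ 'd"
   by (simp add: lattice_adj_nrm1)
  show "\<exists>e. (\<forall>x. exp (\<theta> * real_of_int (nrm1 (v - x))) <= e x) & e v <= 2 ^ CARD('d) &
    (\<forall>x. (\<Sum>y\<in>{y. lattice_adj x y}. e y) <= (real (2 * CARD('d)) + real (2 * CARD('d)) * \<theta>\<^sup>2) * e x)"
   if "0 <= \<theta>" "\<theta> <= 1" for \<theta> and v :: "int ^ 'd" by (rule exp_nrm1[OF that])
 qed auto
 then show ?thesis by blast
qed

text \<open>The potential smoothed at scale r: with \<open>a\<close> a multiple of r^2 the gain is
  comparable at all points of the ball of radius r, and when it is scaled to be at least 1 there,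
  the value at the centre is of order r^2.\<close>

lemma lattice_near:
 assumes d: "5 <= CARD('d)"
 shows "\<exists>Cq>0. \<forall>(v :: int ^ 'd) r. 1 <= r --> (\<exists>q. (\<forall>x. 0 <= q x) &
  (\<forall>x. (\<Sum>y\<in>{y. lattice_adj x y}. q y) + of_bool (real_of_int (nrm1 (v - x)) < r) <= real (2 * CARD('d)) * q x) &
  real (2 * CARD('d)) * q v <= Cq * (r :: real)\<^sup>2)"
proof -
 let ?p = "(real CARD('d) - 2) / 2"
 obtain a0 :: real where a0: "3 <= a0" and pot: "!!a (x :: int ^ 'd) v. a0 <= a ==>
   (\<Sum>y\<in>{y. lattice_adj x y}. (a + nrm2 (y - v)) powr (- ?p)) + a * (a + nrm2 (x - v) + 1) powr (- ?p - 2)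
   <= real (2 * CARD('d)) * (a + nrm2 (x - v)) powr (- ?p)"
  using lattice_potential[OF d] by metis
 have p: "0 <= ?p" using d by simp
 define K where "K = (a0 + 2) powr (?p + 2) * a0 powr (- ?p) / a0"
 have K: "0 < K" using a0 by (simp add: K_def)
 show ?thesis
 proof (intro exI[of _ "real (2 * CARD('d)) * K"] conjI allI impI)
  show "0 < real (2 * CARD('d)) * K" using K d by simp
  fix v :: "int ^ 'd" and r :: real assume r: "1 <= r"
  define R where "R = r\<^sup>2"
  have R: "1 <= R" using r by (simp add: R_def)
  define \<kappa> where "\<kappa> = ((a0 + 2) * R) powr (?p + 2) / (a0 * R)"
  have \<kappa>: "0 < \<kappa>" using a0 R by (simp add: \<kappa>_def)
  define q where "q x = \<kappa> * (a0 * R + nrm2 (x - v)) powr (- ?p)" for x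
  have aR: "a0 <= a0 * R" using a0 R by (simp add: mult_le_cancel_left1)
  have "(\<Sum>y\<in>{y. lattice_adj x y}. q y) + of_bool (real_of_int (nrm1 (v - x)) < r) <= real (2 * CARD('d)) * q x" for x
  proof -
   have "of_bool (real_of_int (nrm1 (v - x)) < r) <= \<kappa> * (a0 * R * (a0 * R + nrm2 (x - v) + 1) powr (- ?p - 2))"
   proof (cases "real_of_int (nrm1 (v - x)) < r")
    case True
    have "nrm2 (x - v) <= (real_of_int (nrm1 (v - x)))\<^sup>2" using nrm2_le_nrm1[of "x - v"] nrm1_minus[of x v] by simp
    also have "... <= R" unfolding R_def using True nrm1_nonneg[of "v - x"] by (intro power_mono) auto
    finally have le: "a0 * R + nrm2 (x - v) + 1 <= (a0 + 2) * R" using R by (simp add: algebra_simps)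
    have "((a0 + 2) * R) powr (- ?p - 2) <= (a0 * R + nrm2 (x - v) + 1) powr (- ?p - 2)"
    proof (rule powr_mono2'[OF _ _ le])
     show "- ?p - 2 <= 0" using p by linarith
     show "0 < a0 * R + nrm2 (x - v) + 1" using a0 R nrm2_nonneg[of "x - v"] by (intro add_nonneg_pos) auto
    qed
    then have "\<kappa> * (a0 * R * ((a0 + 2) * R) powr (- ?p - 2)) <=
      \<kappa> * (a0 * R * (a0 * R + nrm2 (x - v) + 1) powr (- ?p - 2))"
     using \<kappa> a0 R by (intro mult_left_mono) auto
    moreover have "\<kappa> * (a0 * R * ((a0 + 2) * R) powr (- ?p - 2)) = 1"
    proof -
     have pos: "0 < (a0 + 2) * R" using a0 R by simp
     have "((a0 + 2) * R) powr (?p + 2) * ((a0 + 2) * R) powr (- ?p - 2) = ((a0 + 2) * R) powr ((?p + 2) + (- ?p - 2))"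
      by (rule powr_add[symmetric])
     also have "... = 1" using a0 R by simp
     finally show ?thesis using a0 R by (simp add: \<kappa>_def)
    qed
    ultimately show ?thesis using True by simp
   qed (use \<kappa> a0 R in simp)
   then have "(\<Sum>y\<in>{y. lattice_adj x y}. q y) + of_bool (real_of_int (nrm1 (v - x)) < r) <=
    \<kappa> * ((\<Sum>y\<in>{y. lattice_adj x y}. (a0 * R + nrm2 (y - v)) powr (- ?p)) +
     a0 * R * (a0 * R + nrm2 (x - v) + 1) powr (- ?p - 2))"
    by (simp add: q_def distrib_left sum_distrib_left)
   also have "... <= \<kappa> * (real (2 * CARD('d)) * (a0 * R + nrm2 (x - v)) powr (- ?p))"
    using \<kappa> by (intro mult_left_mono pot aR) auto
   finally show ?thesis by (simp only: q_def mult_ac)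
  qed
  moreover have "0 <= q x" for x using \<kappa> by (simp add: q_def)
  moreover have "real (2 * CARD('d)) * q v <= real (2 * CARD('d)) * K * r\<^sup>2"
  proof -
   have "q v = \<kappa> * (a0 * R) powr (- ?p)" by (simp add: q_def nrm2_def)
   also have "... = K * (R powr (?p + 2) * R powr (- ?p) / R)"
   proof -
    have "((a0 + 2) * R) powr (?p + 2) = (a0 + 2) powr (?p + 2) * R powr (?p + 2)"
     "(a0 * R) powr (- ?p) = a0 powr (- ?p) * R powr (- ?p)"
     using a0 R by (intro powr_mult; simp)+
    then show ?thesis by (simp add: \<kappa>_def K_def)
   qed
   also have "R powr (?p + 2) * R powr (- ?p) = R powr ((?p + 2) + (- ?p))" by (rule powr_add[symmetric])
   also have "... = R\<^sup>2" using R by (simp add: powr_numeral)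
   finally show ?thesis using R by (simp add: power2_eq_square R_def)
  qed
  ultimately show "\<exists>q. (\<forall>x. 0 <= q x) &
   (\<forall>x. (\<Sum>y\<in>{y. lattice_adj x y}. q y) + of_bool (real_of_int (nrm1 (v - x)) < r) <= real (2 * CARD('d)) * q x) &
   real (2 * CARD('d)) * q v <= real (2 * CARD('d)) * K * r\<^sup>2" by blast
 qed
qed

section \<open>Graph distance on the lattice\<close>

lemma relpowp_nrm1: "(lattice_adj ^^ n) x y ==> nrm1 (x - y) <= int n"
proof (induction n arbitrary: y)
 case 0
 then show ?case by (simp add: nrm1_def)
next
 case (Suc n)
 then obtain z where z: "(lattice_adj ^^ n) x z" "lattice_adj z y" by (elim relpowp_Suc_E)
 then show ?case using Suc.IH[OF z(1)] nrm1_triangle[of "x - z" "z - y"] by (simp add: lattice_adj_nrm1)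
qed

lemma nrm1_relpowp: "nrm1 (x - y) = int n ==> (lattice_adj ^^ n) x y"
proof (induction n arbitrary: x)
 case 0
 have "x $ i - y $ i = 0" for i
  using 0 unfolding nrm1_def by (subst (asm) of_nat_0, subst (asm) sum_nonneg_eq_0_iff) auto
 then have "x = y" by (simp add: vec_eq_iff)
 then show ?case by simp
next
 case (Suc n)
 have "\<exists>i. (x - y) $ i ~= 0"
 proof (rule ccontr)
  assume "\<not> ?thesis"
  then have "nrm1 (x - y) = 0" by (simp add: nrm1_def)
  then show False using Suc.prems by simp
 qed
 then obtain i where i: "(x - y) $ i ~= 0" by blast
 define s where "s = - sgn ((x - y) $ i)"
 let ?x = "x + axis i s"
 have "nrm1 (?x - y) = (\<Sum>j\<in>UNIV. \<bar>(x - y) $ j\<bar> - (if j = i then 1 else 0))"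
  unfolding nrm1_def
 proof (rule sum.cong[OF refl])
  fix j
  show "\<bar>(?x - y) $ j\<bar> = \<bar>(x - y) $ j\<bar> - (if j = i then 1 else 0)"
   using i by (auto simp: axis_def s_def sgn_if)
 qed
 also have "... = nrm1 (x - y) - 1" by (simp add: sum_subtractf nrm1_def)
 finally have "(lattice_adj ^^ n) ?x y" using Suc.prems by (intro Suc.IH) simp
 moreover have "lattice_adj x ?x" using i by (intro lattice_adj_axis) (simp add: s_def sgn_if)
 ultimately show ?case by (rule relpowp_Suc_I2[rotated])
qed

lemma graph_dist_lattice: "graph_dist lattice_adj x y = enat (nat (nrm1 (x - y)))"
 unfolding graph_dist_def
proof (rule antisym)
 show "(INF n\<in>{n. (lattice_adj ^^ n) x y}. enat n) <= enat (nat (nrm1 (x - y)))"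
  by (rule INF_lower) (simp add: nrm1_relpowp nrm1_nonneg)
 show "enat (nat (nrm1 (x - y))) <= (INF n\<in>{n. (lattice_adj ^^ n) x y}. enat n)"
  by (rule INF_greatest) (use relpowp_nrm1 in fastforce)
qed

section \<open>Passage to infinite volume\<close>

text \<open>Grains arriving off the list never influence whether its topplings are legal, so
  legality does not see the domain beyond the entries.\<close>

lemma legal_cong:
 "set xs \<subseteq> K \<inter> K' ==> (!!x. x \<in> set xs ==> \<eta> x = \<xi> x) ==> legal E K \<eta> xs \<longleftrightarrow> legal E K' \<xi> xs"
proof (induction xs arbitrary: \<eta> \<xi>)
 case (Cons a xs)
 have "legal E K (topple E K a \<eta>) xs \<longleftrightarrow> legal E K' (topple E K' a \<xi>) xs"
  by (rule Cons.IH) (use Cons.prems in \<open>auto simp: topple_def\<close>)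
 then show ?case using Cons.prems by auto
qed simp

definition cylinder :: "('v => nat) set => bool" where
 "cylinder C \<longleftrightarrow> (\<exists>F. finite F & (\<forall>\<eta> \<xi>. (\<forall>x\<in>F. \<eta> x = \<xi> x) --> (\<eta> \<in> C \<longleftrightarrow> \<xi> \<in> C)))"

lemma cylinder_open:
 assumes "cylinder C"
 shows "open C"
proof -
 obtain F where F: "finite F" "!!\<eta> \<xi>. (\<forall>x\<in>F. \<eta> x = \<xi> x) ==> \<eta> \<in> C \<longleftrightarrow> \<xi> \<in> C"
  using assms unfolding cylinder_def by blast
 have "\<exists>T. open T & \<eta> \<in> T & T \<subseteq> C" if "\<eta> \<in> C" for \<eta>
 proof (intro exI[of _ "\<Inter>x\<in>F. (%\<xi>. \<xi> x) -` {\<eta> x}"] conjI)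
  show "open (\<Inter>x\<in>F. (%\<xi>. \<xi> x) -` {\<eta> x})"
  proof (intro open_INT ballI F(1))
   fix x
   have "open {\<eta> x}" by (rule discrete_topology_class.open_discrete)
   then show "open ((%\<xi>. \<xi> x) -` {\<eta> x})" by (rule open_vimage[OF _ continuous_on_product_coordinates])
  qed
  show "(\<Inter>x\<in>F. (%\<xi>. \<xi> x) -` {\<eta> x}) \<subseteq> C"
  proof
   fix \<xi> assume "\<xi> \<in> (\<Inter>x\<in>F. (%\<xi>. \<xi> x) -` {\<eta> x})"
   then have "\<forall>x\<in>F. \<eta> x = \<xi> x" by auto
   then show "\<xi> \<in> C" using F(2) that by blast
  qed
 qed auto
 then show ?thesis by (subst open_subopen) blast
qed

lemma cylinder_Compl: "cylinder C ==> cylinder (- C)"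
 unfolding cylinder_def by (metis Compl_iff)

lemma cylinder_Un: "cylinder C ==> cylinder D ==> cylinder (C \<union> D)"
proof -
 assume "cylinder C" "cylinder D"
 then obtain F G where FG: "finite F" "!!\<eta> \<xi>. (\<forall>x\<in>F. \<eta> x = \<xi> x) ==> \<eta> \<in> C \<longleftrightarrow> \<xi> \<in> C"
  "finite G" "!!\<eta> \<xi>. (\<forall>x\<in>G. \<eta> x = \<xi> x) ==> \<eta> \<in> D \<longleftrightarrow> \<xi> \<in> D"
  unfolding cylinder_def by blast
 show ?thesis
  unfolding cylinder_def
 proof (intro exI[of _ "F \<union> G"] conjI allI impI)
  show "finite (F \<union> G)" using FG by simp
  fix \<eta> \<xi> :: "'a => nat" assume a: "\<forall>x\<in>F \<union> G. \<eta> x = \<xi> x"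
  have "\<eta> \<in> C \<longleftrightarrow> \<xi> \<in> C" by (rule FG(2)) (use a in blast)
  moreover have "\<eta> \<in> D \<longleftrightarrow> \<xi> \<in> D" by (rule FG(4)) (use a in blast)
  ultimately show "\<eta> \<in> C \<union> D \<longleftrightarrow> \<xi> \<in> C \<union> D" by blast
 qed
qed

lemma cylinder_UN: "finite I ==> (!!i. i \<in> I ==> cylinder (C i)) ==> cylinder (\<Union>i\<in>I. C i)"
proof (induction rule: finite_induct)
 case empty
 show ?case unfolding cylinder_def by (intro exI[of _ "{}"]) simp
next
 case (insert i I)
 then show ?case using cylinder_Un[of "C i" "\<Union>i\<in>I. C i"] by simp
qed

lemma cylinder_INT: "finite I ==> (!!i. i \<in> I ==> cylinder (C i)) ==> cylinder (\<Inter>i\<in>I. C i)"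
proof -
 assume "finite I" "!!i. i \<in> I ==> cylinder (C i)"
 then have "cylinder (- (\<Union>i\<in>I. - C i))" by (intro cylinder_Compl cylinder_UN)
 moreover have "- (\<Union>i\<in>I. - C i) = (\<Inter>i\<in>I. C i)" by blast
 ultimately show ?thesis by simp
qed

text \<open>A finite family of legal lists witnesses a lower bound on the avalanche; the events of
  the theorem are unions of such sets.\<close>

definition legals :: "('v => 'v => bool) => 'v => 'v list set => ('v => nat) set" where
 "legals E v X = {\<eta>. \<forall>xs\<in>X. legal E UNIV (add_grain v \<eta>) xs}"

lemma cylinder_legals:
 assumes "finite X"
 shows "cylinder (legals E v X)"
proof -
 have "cylinder {\<eta>. legal E UNIV (add_grain v \<eta>) xs}" for xs
  unfolding cylinder_def
 proof (intro exI[of _ "set xs"] conjI allI impI)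
  fix \<eta> \<xi> :: "'a => nat" assume "\<forall>x\<in>set xs. \<eta> x = \<xi> x"
  then have "legal E UNIV (add_grain v \<eta>) xs \<longleftrightarrow> legal E UNIV (add_grain v \<xi>) xs"
   by (intro legal_cong) (auto simp: add_grain_def)
  then show "\<eta> \<in> {\<eta>. legal E UNIV (add_grain v \<eta>) xs} \<longleftrightarrow> \<xi> \<in> {\<eta>. legal E UNIV (add_grain v \<eta>) xs}" by simp
 qed simp
 from cylinder_INT[OF assms this] have "cylinder (\<Inter>xs\<in>X. {\<eta>. legal E UNIV (add_grain v \<eta>) xs})" .
 moreover have "(\<Inter>xs\<in>X. {\<eta>. legal E UNIV (add_grain v \<eta>) xs}) = legals E v X" by (auto simp: legals_def)
 ultimately show ?thesis by simp
qed

lemma continuous_indicator_cylinder: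
 assumes "cylinder C"
 shows "continuous_on UNIV (indicat_real C)"
proof (subst continuous_on_open_vimage[OF open_UNIV], intro allI impI)
 fix S :: "real set"
 have "indicat_real C -` S = (if 1 \<in> S then (if 0 \<in> S then UNIV else C) else if 0 \<in> S then - C else {})"
  by (rule set_eqI) (simp add: indicator_def)
 then show "open (indicat_real C -` S \<inter> UNIV)"
  using cylinder_open[OF assms] cylinder_open[OF cylinder_Compl[OF assms]] by simp
qed

lemma (in finite_measure) measure_UN_le:
 assumes I: "countable I" and A: "!!i. i \<in> I ==> A i \<in> sets M" and b: "0 <= b"
  and le: "!!J. finite J ==> J \<subseteq> I ==> measure M (\<Union>i\<in>J. A i) <= b"
 shows "measure M (\<Union>i\<in>I. A i) <= b"
proof (cases "I = {}")
 case False
 define J where "J n = from_nat_into I ` {..<n}" for n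
 have J: "finite (J n)" "J n \<subseteq> I" for n using from_nat_into[OF False] by (auto simp: J_def)
 let ?B = "%n. \<Union>i\<in>J n. A i"
 have "(%n. measure M (?B n)) \<longlonglongrightarrow> measure M (\<Union>n. ?B n)"
 proof (rule finite_Lim_measure_incseq)
  show "range ?B \<subseteq> sets M" using A J by (auto intro!: sets.finite_UN)
  show "incseq ?B" by (rule incseq_SucI, rule UN_mono) (auto simp: J_def)
 qed
 moreover have "(\<Union>n. ?B n) = (\<Union>i\<in>I. A i)"
 proof
  show "(\<Union>n. ?B n) \<subseteq> (\<Union>i\<in>I. A i)" using J(2) by blast
  show "(\<Union>i\<in>I. A i) \<subseteq> (\<Union>n. ?B n)"
  proof
   fix z assume "z \<in> (\<Union>i\<in>I. A i)"
   then obtain i where i: "i \<in> I" "z \<in> A i" by blast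
   then obtain n where "from_nat_into I n = i" using from_nat_into_surj[OF I] by blast
   then have "i \<in> J (Suc n)" unfolding J_def by blast
   then show "z \<in> (\<Union>n. ?B n)" using i(2) by blast
  qed
 qed
 ultimately have lim: "(%n. measure M (?B n)) \<longlonglongrightarrow> measure M (\<Union>i\<in>I. A i)" by simp
 show ?thesis by (rule LIMSEQ_le_const2[OF lim]) (use le J in blast)
qed (use b in simp)

lemma exhaustion_covers:
 assumes "exhaustion V" "finite F"
 shows "\<forall>\<^sub>F n in sequentially. F \<subseteq> V n"
proof -
 have mono: "incseq V" and un: "(\<Union>n. V n) = UNIV" using assms by (auto simp: exhaustion_def)
 have "\<forall>\<^sub>F n in sequentially. x \<in> V n" for x
 proof -
  obtain n where "x \<in> V n" using un by blast
  then have "x \<in> V m" if "n <= m" for m using incseqD[OF mono that] by blast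
  then show ?thesis unfolding eventually_sequentially by blast
 qed
 then have "\<forall>\<^sub>F n in sequentially. \<forall>x\<in>F. x \<in> V n" using assms(2) by (intro eventually_ball_finite) auto
 then show ?thesis by (rule eventually_mono) blast
qed

lemma exhaustion_exists:
 assumes "countable (UNIV :: 'v set)"
 shows "\<exists>V :: nat => 'v set. exhaustion V"
proof -
 define V :: "nat => 'v set" where "V n = from_nat_into UNIV ` {..<n}" for n
 have "x \<in> (\<Union>n. V n)" for x
 proof -
  obtain n where "from_nat_into (UNIV :: 'v set) n = x" using from_nat_into_surj[OF assms] by blast
  then have "x \<in> V (Suc n)" unfolding V_def by blast
  then show ?thesis by blast
 qed
 moreover have "incseq V" by (rule incseq_SucI) (auto simp: V_def)
 moreover have "finite (V n)" for n by (simp add: V_def)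
 ultimately have "exhaustion V" unfolding exhaustion_def by blast
 then show ?thesis by blast
qed

context tgraph
begin

text \<open>Indicators of cylinder sets are continuous for the product topology, so weak convergence
  applies to them.\<close>

lemma law_limit:
 assumes M: "uniform_recurrent_law E M" and V: "exhaustion V" and C: "cylinder C"
 shows "(%n. real (card (rec_set (V n) \<inter> C)) / real (card (rec_set (V n)))) \<longlonglongrightarrow> measure M C"
proof -
 let ?f = "indicat_real C"
 have cont: "continuous_on UNIV ?f" by (rule continuous_indicator_cylinder[OF C])
 have bdd: "bounded (range ?f)" by (rule boundedI[of _ 1]) (auto simp: indicator_def)
 have Cb: "C \<in> sets borel" using cylinder_open[OF C] by (rule borel_open)
 have sM: "sets M = sets borel" using M by (simp add: uniform_recurrent_law_def)
 have "weakly_converges (%n. uniform_recurrent_on E (V n)) M"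
  using M V by (simp add: uniform_recurrent_law_def)
 then have lim: "(%n. \<integral>\<eta>. ?f \<eta> \<partial>uniform_recurrent_on E (V n)) \<longlonglongrightarrow> (\<integral>\<eta>. ?f \<eta> \<partial>M)"
  unfolding weakly_converges_def using cont bdd by blast
 have "space M = UNIV" using sets_eq_imp_space_eq[OF sM] by simp
 then have r: "(\<integral>\<eta>. ?f \<eta> \<partial>M) = measure M C" by simp
 have l: "(\<integral>\<eta>. ?f \<eta> \<partial>uniform_recurrent_on E (V n)) =
   real (card (rec_set (V n) \<inter> C)) / real (card (rec_set (V n)))" if "V n ~= {}" for n
 proof -
  have fin: "finite (V n)" using V by (simp add: exhaustion_def)
  have R: "finite (rec_set (V n))" "rec_set (V n) ~= {}" using finite_rec[OF fin] full_rec[OF fin] by auto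
  have "(\<integral>\<eta>. ?f \<eta> \<partial>uniform_recurrent_on E (V n)) = (\<integral>\<eta>. ?f \<eta> \<partial>measure_pmf (pmf_of_set (rec_set (V n))))"
   unfolding uniform_recurrent_on_def recurrent_eq[OF fin that]
   by (rule integral_distr) (use Cb in auto)
  also have "... = measure (measure_pmf (pmf_of_set (rec_set (V n)))) C" by simp
  finally show ?thesis by (simp add: measure_pmf_of_set[OF R(2,1)])
 qed
 obtain x :: 'v where True by simp
 have "\<forall>\<^sub>F n in sequentially. {x} \<subseteq> V n" by (rule exhaustion_covers[OF V]) simp
 then have "\<forall>\<^sub>F n in sequentially. (\<integral>\<eta>. ?f \<eta> \<partial>uniform_recurrent_on E (V n)) =
   real (card (rec_set (V n) \<inter> C)) / real (card (rec_set (V n)))"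
  by (rule eventually_mono) (rule l, blast)
 from Lim_transform_eventually[OF lim this] show ?thesis unfolding r .
qed

lemma card_rec_pos: "finite K ==> 0 < real (card (rec_set K))"
 using full_rec[of K] finite_rec[of K] by (auto simp: card_gt_0_iff)

text \<open>For an upper bound it is enough to treat finite subunions of the covering. Each of them
  is a cylinder event, and its lists are legal in \<open>V n\<close> as soon as their entries lie in
  \<open>V n\<close>.\<close>

lemma upper_transfer:
 assumes M: "uniform_recurrent_law E M" and cnt: "countable (UNIV :: 'v set)" and b: "0 <= b"
  and W: "!!X. X \<in> W ==> finite X" and A: "A \<subseteq> (\<Union>X\<in>W. legals E v X)"
  and le: "!!L. finite L ==> v \<in> L ==>
   real (card {\<eta> \<in> rec_set L. \<exists>X\<in>W. \<forall>xs\<in>X. legal E L (add_grain v \<eta>) xs}) <= b * real (card (rec_set L))"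
 shows "measure M A <= b"
proof -
 interpret M: prob_space M using M by (simp add: uniform_recurrent_law_def)
 have sM: "sets M = sets borel" using M by (simp add: uniform_recurrent_law_def)
 have ms: "legals E v X \<in> sets M" if "X \<in> W" for X
  unfolding sM by (rule borel_open) (rule cylinder_open[OF cylinder_legals[OF W[OF that]]])
 have "countable (lists (UNIV :: 'v set))" using cnt by (rule countable_lists)
 then have cW: "countable W"
  by (intro countable_subset[OF _ countable_Collect_finite_subset[of "UNIV :: 'v list set"]]) (use W in auto)
 have UM: "(\<Union>X\<in>W. legals E v X) \<in> sets M" using cW ms by (rule sets.countable_UN'')
 have "measure M A <= measure M (\<Union>X\<in>W. legals E v X)" by (rule M.finite_measure_mono[OF A UM])
 also have "... <= b"
 proof (rule M.measure_UN_le[OF cW ms b])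
  fix J assume J: "finite J" "J \<subseteq> W"
  let ?C = "\<Union>X\<in>J. legals E v X"
  have cyl: "cylinder ?C" using J W by (intro cylinder_UN cylinder_legals) auto
  obtain V :: "nat => 'v set" where V: "exhaustion V" using exhaustion_exists[OF cnt] by blast
  let ?F = "insert v (\<Union>X\<in>J. \<Union>xs\<in>X. set xs)"
  have "finite ?F" using J W by auto
  from exhaustion_covers[OF V this]
  have "\<forall>\<^sub>F n in sequentially. real (card (rec_set (V n) \<inter> ?C)) / real (card (rec_set (V n))) <= b"
  proof (rule eventually_mono)
   fix n assume F: "?F \<subseteq> V n"
   have fin: "finite (V n)" using V by (simp add: exhaustion_def)
   have "card (rec_set (V n) \<inter> ?C) <= card {\<eta> \<in> rec_set (V n). \<exists>X\<in>W. \<forall>xs\<in>X. legal E (V n) (add_grain v \<eta>) xs}"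
   proof (rule card_mono)
    show "rec_set (V n) \<inter> ?C \<subseteq> {\<eta> \<in> rec_set (V n). \<exists>X\<in>W. \<forall>xs\<in>X. legal E (V n) (add_grain v \<eta>) xs}"
    proof
     fix \<eta> assume "\<eta> \<in> rec_set (V n) \<inter> ?C"
     then obtain X where X: "\<eta> \<in> rec_set (V n)" "X \<in> J" "\<eta> \<in> legals E v X" by blast
     have "legal E (V n) (add_grain v \<eta>) xs" if xs: "xs \<in> X" for xs
     proof -
      have "set xs \<subseteq> UNIV \<inter> V n" using F X(2) xs by blast
      from legal_cong[OF this, of "add_grain v \<eta>" "add_grain v \<eta>" E] show ?thesis
       using X(3) xs by (simp add: legals_def)
     qed
     then show "\<eta> \<in> {\<eta> \<in> rec_set (V n). \<exists>X\<in>W. \<forall>xs\<in>X. legal E (V n) (add_grain v \<eta>) xs}"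
      using X J by blast
    qed
   qed (use finite_rec[OF fin] in simp)
   then have "real (card (rec_set (V n) \<inter> ?C)) <= b * real (card (rec_set (V n)))"
    using le[OF fin] F by (meson insert_subset of_nat_le_iff order_trans)
   then show "real (card (rec_set (V n) \<inter> ?C)) / real (card (rec_set (V n))) <= b"
    using card_rec_pos[OF fin] by (simp add: divide_le_eq)
  qed
  then show "measure M ?C <= b"
   using law_limit[OF M V cyl] by (intro tendsto_upperbound[OF _ _ sequentially_bot])
 qed
 finally show ?thesis .
qed

text \<open>A vertex of a stable configuration other than \<open>v\<close> becomes unstable only
  with a grain from a toppled neighbour.\<close>

lemma legal_stable:
 assumes st: "!!x. x \<in> K ==> \<eta> x < dg"
 shows "legal E K (add_grain v \<eta>) (xs @ [z]) ==> z = v \<or> (\<exists>u\<in>set xs. E z u)"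
proof (rule ccontr)
 assume l: "legal E K (add_grain v \<eta>) (xs @ [z])" and n: "\<not> (z = v \<or> (\<exists>u\<in>set xs. E z u))"
 have l': "legal E K (add_grain v \<eta>) xs" "z \<in> K" "dg <= fold (topple E K) xs (add_grain v \<eta>) z"
  using l by (auto simp: legal_append deg_E)
 have "(\<Sum>y\<in>{y \<in> K. E z y}. int (count_list xs y)) = 0"
  by (rule sum.neutral) (use n in \<open>auto simp: count_list_0_iff\<close>)
 then have "int (fold (topple E K) xs (add_grain v \<eta>) z) <= int (add_grain v \<eta> z)"
  unfolding fold_topple_int[OF l'(1,2)] lap_def by simp
 then show False using l'(2,3) st[of z] n by (simp add: add_grain_def)
qed

end

context egraph
begin

text \<open>The toppled set grows from \<open>v\<close> by adjacent vertices, and each new vertex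
  adds at most one to the distance.\<close>

lemma legal_near:
 assumes st: "!!x. x \<in> K ==> \<eta> x < dg"
 shows "legal E K (add_grain v \<eta>) xs ==> u \<in> set xs ==> v \<in> set xs & dd v u + 1 <= real (card (set xs))"
proof (induction xs arbitrary: u rule: rev_induct)
 case (snoc z xs)
 have l: "legal E K (add_grain v \<eta>) xs" using snoc.prems(1) by (simp add: legal_append)
 show ?case
 proof (cases "z \<in> set xs")
  case True
  then have "set (xs @ [z]) = set xs" by auto
  then show ?thesis using snoc.IH[OF l] snoc.prems(2) by simp
 next
  case False
  then have c: "card (set (xs @ [z])) = Suc (card (set xs))" by simp
  consider "z = v" | t where "t \<in> set xs" "E z t"
   using legal_stable[OF st snoc.prems(1)] by blast
  then have z: "v \<in> set (xs @ [z]) & dd v z + 1 <= real (card (set xs)) + 1"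
  proof cases
   case 1
   then show ?thesis using dd_self[of v] by simp
  next
   case 2
   have "dd v z <= dd v t + dd t z" by (rule dd_triangle)
   also have "dd t z <= 1" by (rule dd_step[OF E_sym[OF 2(2)]])
   finally show ?thesis using snoc.IH[OF l 2(1)] by simp
  qed
  show ?thesis
  proof (cases "u = z")
   case True
   then show ?thesis using z c by simp
  next
   case False
   then show ?thesis using snoc.IH[OF l, of u] snoc.prems(2) c by simp
  qed
 qed
qed simp

text \<open>Lower bounds need one cylinder event that works for all finite sets. Stop a legal list
  as soon as its set of entries satisfies \<open>G\<close>: before, it lies in the ball of radius R,
  so it ends within R + 1, and \<open>length_legal_le\<close> on this larger ball bounds its length.
  Finitely many lists remain.\<close>

lemma local_lists:
 assumes ball: "finite {x. dd v x <= R + 1}"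
  and G: "!!K \<eta> xs. (!!x. x \<in> K ==> \<eta> x < dg) ==> legal E K (add_grain v \<eta>) xs ==> \<not> G (set xs) ==>
   set xs \<subseteq> {x. dd v x <= R}" and R: "0 <= R"
 obtains Z where "finite Z" "!!zs. zs \<in> Z ==> G (set zs)"
  "!!L \<eta> xs. \<eta> \<in> rec_set L ==> legal E L (add_grain v \<eta>) xs ==> G (set xs) ==> \<eta> \<in> (\<Union>zs\<in>Z. legals E v {zs})"
proof -
 let ?B = "{x. dd v x <= R + 1}"
 obtain t where t: "!!x. 0 <= t x" "!!\<eta> xs. legal E ?B \<eta> xs ==> real (length xs) <= (\<Sum>x\<in>?B. t x * real (\<eta> x))"
  using length_legal_le[OF ball] by blast
 obtain T :: nat where T: "(\<Sum>x\<in>?B. t x * real dg) <= real T" using real_arch_simple by blast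
 define Z where "Z = {zs. set zs \<subseteq> ?B & length zs <= T} \<inter> {zs. G (set zs)}"
 show ?thesis
 proof (rule that[of Z])
  show "finite Z" unfolding Z_def by (intro finite_Int disjI1 finite_lists_length_le ball)
  show "G (set zs)" if "zs \<in> Z" for zs using that by (simp add: Z_def)
  fix L \<eta> xs assume r: "\<eta> \<in> rec_set L" and l: "legal E L (add_grain v \<eta>) xs" and g: "G (set xs)"
  have st: "\<eta> x < dg" for x
  proof (cases "x \<in> L")
   case True
   then show ?thesis using rec_setD[OF r] by (auto simp: stable_def deg_E)
  next
   case False
   then show ?thesis using rec_setD[OF r] dg_pos by simp
  qed
  define n where "n = (LEAST n. G (set (take n xs)))"
  have Gn: "G (set (take n xs))"
   unfolding n_def by (rule LeastI[of _ "length xs"]) (use g in simp)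
  define zs where "zs = take n xs"
  have lz: "legal E L (add_grain v \<eta>) zs"
   using l append_take_drop_id[of n xs] legal_append[of E L "add_grain v \<eta>" "take n xs" "drop n xs"]
   by (simp add: zs_def)
  have sub: "set zs \<subseteq> ?B"
  proof (cases zs rule: rev_cases)
   case (snoc ys z)
   have len: "length zs = Suc (length ys)" using snoc by simp
   then have "length ys < n" by (simp add: zs_def)
   then have "\<not> G (set (take (length ys) xs))" unfolding n_def by (rule not_less_Least)
   moreover have "take (length ys) xs = take (length ys) zs"
    using \<open>length ys < n\<close> by (simp add: zs_def min_def)
   ultimately have ng: "\<not> G (set ys)" using snoc by simp
   have ly: "legal E L (add_grain v \<eta>) ys" using lz snoc by (simp add: legal_append)
   have ys: "set ys \<subseteq> {x. dd v x <= R}" by (rule G[OF st ly ng])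
   have "dd v z <= R + 1"
   proof -
    consider "z = v" | u where "u \<in> set ys" "E z u"
     using legal_stable[of L \<eta> v ys z] st lz snoc by blast
    then show ?thesis
    proof cases
     case 1
     then show ?thesis using dd_self[of v] R by simp
    next
     case 2
     have "dd v z <= dd v u + dd u z" by (rule dd_triangle)
     also have "dd u z <= 1" by (rule dd_step[OF E_sym[OF 2(2)]])
     finally show ?thesis using ys 2(1) by fastforce
    qed
   qed
   then show ?thesis using ys snoc by auto
  qed simp
  have sL: "set zs \<subseteq> L" by (rule legal_subset[OF lz])
  have lB: "legal E ?B (add_grain v \<eta>) zs"
   using legal_cong[of zs L ?B "add_grain v \<eta>" "add_grain v \<eta>" E] sL sub lz by auto
  have "real (length zs) <= (\<Sum>x\<in>?B. t x * real (add_grain v \<eta> x))" by (rule t(2)[OF lB])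
  also have "... <= (\<Sum>x\<in>?B. t x * real dg)"
  proof (intro sum_mono mult_left_mono t(1))
   fix x show "real (add_grain v \<eta> x) <= real dg" using st[of x] by (auto simp: add_grain_def)
  qed
  finally have "length zs <= T" using T by linarith
  then have "zs \<in> Z" using sub Gn by (simp add: Z_def zs_def)
  moreover have "legal E UNIV (add_grain v \<eta>) zs"
   using legal_cong[of zs L UNIV "add_grain v \<eta>" "add_grain v \<eta>" E] sL lz by auto
  ultimately show "\<eta> \<in> (\<Union>zs\<in>Z. legals E v {zs})" by (auto simp: legals_def)
 qed
qed

end

context tgraph
begin

section \<open>Invariance under graph automorphisms\<close>

lemma legal_shift:
 assumes tau: "inj \<tau>" "!!x y. E (\<tau> x) (\<tau> y) \<longleftrightarrow> E x y"
 shows "legal E K (\<eta> \<circ> \<tau>) xs \<longleftrightarrow> legal E (\<tau> ` K) \<eta> (map \<tau> xs)"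
proof (induction xs arbitrary: \<eta>)
 case (Cons a xs)
 have eq: "topple E K a (\<eta> \<circ> \<tau>) = topple E (\<tau> ` K) (\<tau> a) \<eta> \<circ> \<tau>"
  using tau by (auto simp: topple_def fun_eq_iff deg_E inj_eq inj_image_mem_iff)
 show ?case unfolding legal.simps list.map eq Cons using tau by (simp add: deg_E inj_image_mem_iff)
qed simp

lemma rec_shift:
 assumes tau: "bij \<tau>" "!!x y. E (\<tau> x) (\<tau> y) \<longleftrightarrow> E x y"
 shows "\<eta> \<circ> \<tau> \<in> rec_set K \<longleftrightarrow> \<eta> \<in> rec_set (\<tau> ` K)"
proof -
 have inj: "inj \<tau>" and sur: "surj \<tau>" using tau by (auto simp: bij_def)
 have n: "nin (\<tau> ` P) (\<tau> x) = nin P x" for P x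
 proof -
  have "{y \<in> \<tau> ` P. E (\<tau> x) y} = \<tau> ` {y \<in> P. E x y}" using tau(2) by auto
  then show ?thesis unfolding nin_def using inj by (simp add: card_image inj_on_subset)
 qed
 have al: "allowed K (\<eta> \<circ> \<tau>) \<longleftrightarrow> allowed (\<tau> ` K) \<eta>"
  unfolding allowed_def by (simp add: all_subset_image n)
 have zo: "(\<forall>x. x \<notin> K --> (\<eta> \<circ> \<tau>) x = 0) \<longleftrightarrow> (\<forall>x. x \<notin> \<tau> ` K --> \<eta> x = 0)"
 proof
  assume a: "\<forall>x. x \<notin> K --> (\<eta> \<circ> \<tau>) x = 0"
  show "\<forall>x. x \<notin> \<tau> ` K --> \<eta> x = 0"
  proof (intro allI impI)
   fix x assume x: "x \<notin> \<tau> ` K"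
   obtain y where y: "x = \<tau> y" using sur by blast
   then have "y \<notin> K" using x by blast
   then show "\<eta> x = 0" using a y by simp
  qed
 qed (use inj in \<open>auto simp: inj_image_mem_iff\<close>)
 have s: "stable E K (\<eta> \<circ> \<tau>) \<longleftrightarrow> stable E (\<tau> ` K) \<eta>" by (simp add: stable_def deg_E)
 show ?thesis using al zo s by (simp add: rec_set_def stable_sandpiles_def sandpiles_def)
qed

lemma card_rec_shift:
 assumes tau: "bij \<tau>" "!!x y. E (\<tau> x) (\<tau> y) \<longleftrightarrow> E x y"
 shows "card {\<eta> \<in> rec_set (\<tau> ` K). P (\<eta> \<circ> \<tau>)} = card {\<eta> \<in> rec_set K. P \<eta>}"
proof (rule bij_betw_same_card[of "%\<eta>. \<eta> \<circ> \<tau>"])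
 have inj: "inj \<tau>" and sur: "surj \<tau>" using tau by (auto simp: bij_def)
 have a: "\<eta> \<circ> \<tau> \<circ> inv \<tau> = \<eta>" "\<eta> \<circ> inv \<tau> \<circ> \<tau> = \<eta>" for \<eta> :: "'v => nat"
  using inj sur by (auto simp: fun_eq_iff surj_f_inv_f)
 show "bij_betw (%\<eta>. \<eta> \<circ> \<tau>) {\<eta> \<in> rec_set (\<tau> ` K). P (\<eta> \<circ> \<tau>)} {\<eta> \<in> rec_set K. P \<eta>}"
 proof (rule bij_betw_byWitness[where f' = "%\<eta>. \<eta> \<circ> inv \<tau>"])
  show "(%\<eta>. \<eta> \<circ> \<tau>) ` {\<eta> \<in> rec_set (\<tau> ` K). P (\<eta> \<circ> \<tau>)} \<subseteq> {\<eta> \<in> rec_set K. P \<eta>}"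
   using rec_shift[OF tau] by blast
  show "(%\<eta>. \<eta> \<circ> inv \<tau>) ` {\<eta> \<in> rec_set K. P \<eta>} \<subseteq> {\<eta> \<in> rec_set (\<tau> ` K). P (\<eta> \<circ> \<tau>)}"
   using rec_shift[OF tau, of "\<eta> \<circ> inv \<tau>" K for \<eta>] by (auto simp: a)
 qed (use a in auto)
qed

end

section \<open>Avalanche events as unions of legality events\<close>

lemma avalanche_ge:
 "enat k <= avalanche E v \<eta> u \<longleftrightarrow> (\<exists>xs. legal E UNIV (add_grain v \<eta>) xs & k <= count_list xs u)"
proof
 assume a: "enat k <= avalanche E v \<eta> u"
 show "\<exists>xs. legal E UNIV (add_grain v \<eta>) xs & k <= count_list xs u"
 proof (rule ccontr)
  assume n: "\<not> ?thesis"
  have "\<not> 0 <= k - count_list [] u \<or> 0 < k" using n by (metis count_list.simps(1) legal.simps(1) not_gr_zero order_refl)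
  then have k: "0 < k" by simp
  have "avalanche E v \<eta> u <= enat (k - 1)"
   unfolding avalanche_def by (rule SUP_least) (use n k in fastforce)
  then have "enat k <= enat (k - 1)" using a by (rule order_trans[rotated])
  then show False using k by simp
 qed
next
 assume "\<exists>xs. legal E UNIV (add_grain v \<eta>) xs & k <= count_list xs u"
 then obtain xs where "legal E UNIV (add_grain v \<eta>) xs" "k <= count_list xs u" by blast
 then show "enat k <= avalanche E v \<eta> u" unfolding avalanche_def by (intro SUP_upper2[of xs]) auto
qed

lemma cluster_iff:
 "u \<in> avalanche_cluster E v \<eta> \<longleftrightarrow> (\<exists>xs. legal E UNIV (add_grain v \<eta>) xs & u \<in> set xs)"
proof -
 have "u \<in> avalanche_cluster E v \<eta> \<longleftrightarrow> enat 1 <= avalanche E v \<eta> u"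
  by (simp add: avalanche_cluster_def one_enat_def)
 also have "... \<longleftrightarrow> (\<exists>xs. legal E UNIV (add_grain v \<eta>) xs & 1 <= count_list xs u)" by (rule avalanche_ge)
 also have "... \<longleftrightarrow> (\<exists>xs. legal E UNIV (add_grain v \<eta>) xs & u \<in> set xs)"
  using count_list_0_iff by (metis One_nat_def Suc_leI not_gr_zero not_one_le_zero)
 finally show ?thesis .
qed

lemma enat_less_pred: "0 < n ==> \<not> enat n <= x ==> x <= enat (n - 1)"
 by (cases x) auto

lemma diam_ext_ge:
 assumes n: "0 < n"
 shows "enat n <= diam_ext E K \<longleftrightarrow> (\<exists>x\<in>K. \<exists>y\<in>K. enat n <= graph_dist E x y)"
proof
 assume a: "enat n <= diam_ext E K"
 show "\<exists>x\<in>K. \<exists>y\<in>K. enat n <= graph_dist E x y"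
 proof (rule ccontr)
  assume c: "\<not> ?thesis"
  have "diam_ext E K <= enat (n - 1)"
   unfolding diam_ext_def by (intro SUP_least enat_less_pred n) (use c in blast)
  then have "enat n <= enat (n - 1)" using a by (rule order_trans[rotated])
  then show False using n by simp
 qed
next
 assume "\<exists>x\<in>K. \<exists>y\<in>K. enat n <= graph_dist E x y"
 then obtain x y where "x \<in> K" "y \<in> K" "enat n <= graph_dist E x y" by blast
 then show "enat n <= diam_ext E K"
  unfolding diam_ext_def by (intro SUP_upper2[of x] SUP_upper2[of y])
qed

lemma ecard_ge: "enat n <= ecard K \<longleftrightarrow> (\<exists>U\<subseteq>K. finite U & card U = n)"
proof
 assume a: "enat n <= ecard K"
 show "\<exists>U\<subseteq>K. finite U & card U = n"
 proof (cases "finite K")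
  case True
  then have "n <= card K" using a by (simp add: ecard_def)
  then obtain U where "U \<subseteq> K" "card U = n" "finite U" by (rule obtain_subset_with_card_n)
  then show ?thesis by blast
 next
  case False
  then show ?thesis using infinite_arbitrarily_large by blast
 qed
next
 assume "\<exists>U\<subseteq>K. finite U & card U = n"
 then show "enat n <= ecard K" by (auto simp: ecard_def intro: card_mono)
qed

lemma sum_enat: "finite U ==> (\<Sum>u\<in>U. enat (m u)) = enat (\<Sum>u\<in>U. m u)"
 by (induction rule: finite_induct) (auto simp: zero_enat_def)

lemma avalanche_size_ge:
 assumes n: "0 < n"
 shows "enat n <= avalanche_size E v \<eta> \<longleftrightarrow>
  (\<exists>U m. finite U & n <= (\<Sum>u\<in>U. m u) & (\<forall>u\<in>U. enat (m u) <= avalanche E v \<eta> u))"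
proof
 let ?f = "avalanche E v \<eta>"
 have S: "avalanche_size E v \<eta> = (SUP F\<in>{F. finite F & F \<subseteq> UNIV}. sum ?f F)"
  unfolding avalanche_size_def by (rule nonneg_infsum_complete) simp
 {
  assume a: "enat n <= avalanche_size E v \<eta>"
  have "\<exists>F. finite F & enat n <= sum ?f F"
  proof (rule ccontr)
   assume c: "\<not> ?thesis"
   have "avalanche_size E v \<eta> <= enat (n - 1)"
    unfolding S by (intro SUP_least enat_less_pred n) (use c in blast)
   then have "enat n <= enat (n - 1)" using a by (rule order_trans[rotated])
   then show False using n by simp
  qed
  then obtain F where F: "finite F" "enat n <= sum ?f F" by blast
  \<comment> \<open>Truncation at \<open>n\<close> makes the multiplicities finite while their sum
    still reaches \<open>n\<close>.\<close>
  define m where "m u = the_enat (min (?f u) (enat n))" for u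
  have m: "enat (m u) = min (?f u) (enat n)" for u
   unfolding m_def by (cases "?f u") (auto simp: min_def)
  have "n <= (\<Sum>u\<in>F. m u)"
  proof (cases "\<exists>u\<in>F. enat n <= ?f u")
   case True
   then obtain u where u: "u \<in> F" "enat n <= ?f u" by blast
   then have "enat (m u) = enat n" unfolding m by (simp add: min_def)
   then have "m u = n" by simp
   then show ?thesis using member_le_sum[OF u(1) _ F(1), of m] by simp
  next
   case False
   then have "?f u = enat (m u)" if "u \<in> F" for u unfolding m using that by (auto simp: min_def)
   then have "sum ?f F = (\<Sum>u\<in>F. enat (m u))" by (intro sum.cong) auto
   then show ?thesis using F by (simp add: sum_enat)
  qed
  moreover have "enat (m u) <= ?f u" for u unfolding m by simp
  ultimately show "\<exists>U m. finite U & n <= (\<Sum>u\<in>U. m u) & (\<forall>u\<in>U. enat (m u) <= ?f u)"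
   using F(1) by blast
 }
 assume "\<exists>U m. finite U & n <= (\<Sum>u\<in>U. m u) & (\<forall>u\<in>U. enat (m u) <= ?f u)"
 then obtain U m where U: "finite U" "n <= (\<Sum>u\<in>U. m u)" "!!u. u \<in> U ==> enat (m u) <= ?f u" by blast
 have "enat n <= (\<Sum>u\<in>U. enat (m u))" using U by (simp add: sum_enat)
 also have "... <= sum ?f U" by (rule sum_mono) (rule U(3))
 also have "... <= avalanche_size E v \<eta>" unfolding S by (rule SUP_upper) (use U(1) in simp)
 finally show "enat n <= avalanche_size E v \<eta>" .
qed

lemma legals_choose:
 assumes U: "finite U" and ex: "!!u. u \<in> U ==> \<exists>xs. legal E UNIV (add_grain v \<eta>) xs & Q u xs"
 shows "\<exists>X. finite X & \<eta> \<in> legals E v X & (\<forall>u\<in>U. \<exists>xs\<in>X. Q u xs)"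
proof -
 obtain f where f: "!!u. u \<in> U ==> legal E UNIV (add_grain v \<eta>) (f u) & Q u (f u)" using ex by metis
 show ?thesis by (rule exI[of _ "f ` U"]) (use f U in \<open>auto simp: legals_def\<close>)
qed

lemma legals_cluster: "\<eta> \<in> legals E v X ==> xs \<in> X ==> u \<in> set xs ==> u \<in> avalanche_cluster E v \<eta>"
 unfolding cluster_iff legals_def by blast

lemma event_legals:
 assumes 1: "!!\<eta>. P \<eta> ==> \<exists>X. finite X & Q X & \<eta> \<in> legals E v X"
  and 2: "!!\<eta> X. Q X ==> \<eta> \<in> legals E v X ==> P \<eta>"
 shows "{\<eta>. P \<eta>} = (\<Union>X\<in>{X. finite X & Q X}. legals E v X)"
proof (intro equalityI subsetI)
 fix \<eta> assume "\<eta> \<in> {\<eta>. P \<eta>}"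
 then obtain X where "finite X" "Q X" "\<eta> \<in> legals E v X" using 1 by blast
 then show "\<eta> \<in> (\<Union>X\<in>{X. finite X & Q X}. legals E v X)" by (intro UN_I[of X] CollectI conjI)
next
 fix \<eta> assume "\<eta> \<in> (\<Union>X\<in>{X. finite X & Q X}. legals E v X)"
 then obtain X where "Q X" "\<eta> \<in> legals E v X" by (elim UN_E CollectE conjE)
 then show "\<eta> \<in> {\<eta>. P \<eta>}" by (intro CollectI 2)
qed

lemma diam_event:
 assumes n: "0 < n"
 shows "{\<eta>. enat n <= diam_ext E (avalanche_cluster E v \<eta>)} =
  (\<Union>X\<in>{X. finite X & (\<exists>x y. enat n <= graph_dist E x y & (\<forall>u\<in>{x, y}. \<exists>xs\<in>X. u \<in> set xs))}. legals E v X)"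
proof (rule event_legals)
 fix \<eta> assume "enat n <= diam_ext E (avalanche_cluster E v \<eta>)"
 then obtain x y where xy: "x \<in> avalanche_cluster E v \<eta>" "y \<in> avalanche_cluster E v \<eta>" "enat n <= graph_dist E x y"
  unfolding diam_ext_ge[OF n] by blast
 have "\<exists>X. finite X & \<eta> \<in> legals E v X & (\<forall>u\<in>{x, y}. \<exists>xs\<in>X. u \<in> set xs)"
  by (rule legals_choose) (use xy(1,2) in \<open>auto simp: cluster_iff[symmetric]\<close>)
 then obtain X where X: "finite X" "\<eta> \<in> legals E v X" "\<forall>u\<in>{x, y}. \<exists>xs\<in>X. u \<in> set xs" by (elim exE conjE)
 show "\<exists>X. finite X & (\<exists>x y. enat n <= graph_dist E x y & (\<forall>u\<in>{x, y}. \<exists>xs\<in>X. u \<in> set xs)) & \<eta> \<in> legals E v X"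
  by (rule exI[of _ X], rule conjI[OF X(1)], rule conjI[OF _ X(2)],
    rule exI[of _ x], rule exI[of _ y], rule conjI[OF xy(3) X(3)])
next
 fix \<eta> X assume "\<exists>x y. enat n <= graph_dist E x y & (\<forall>u\<in>{x, y}. \<exists>xs\<in>X. u \<in> set xs)" and l: "\<eta> \<in> legals E v X"
 then obtain x y where X: "enat n <= graph_dist E x y" "\<forall>u\<in>{x, y}. \<exists>xs\<in>X. u \<in> set xs" by (elim exE conjE)
 have "x \<in> avalanche_cluster E v \<eta>" "y \<in> avalanche_cluster E v \<eta>" using X(2) legals_cluster[OF l] by auto
 then show "enat n <= diam_ext E (avalanche_cluster E v \<eta>)" using diam_ext_ge[OF n] X(1) by blast
qed

lemma ecard_event:
 "{\<eta>. enat n <= ecard (avalanche_cluster E v \<eta>)} =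
  (\<Union>X\<in>{X. finite X & (\<exists>U. finite U & card U = n & (\<forall>u\<in>U. \<exists>xs\<in>X. u \<in> set xs))}. legals E v X)"
proof (rule event_legals)
 fix \<eta> assume "enat n <= ecard (avalanche_cluster E v \<eta>)"
 then obtain U where U: "U \<subseteq> avalanche_cluster E v \<eta>" "finite U" "card U = n" unfolding ecard_ge by blast
 have "\<exists>X. finite X & \<eta> \<in> legals E v X & (\<forall>u\<in>U. \<exists>xs\<in>X. u \<in> set xs)"
  by (rule legals_choose[OF U(2)]) (use U(1) in \<open>simp add: cluster_iff[symmetric] subset_iff\<close>)
 then obtain X where X: "finite X" "\<eta> \<in> legals E v X" "\<forall>u\<in>U. \<exists>xs\<in>X. u \<in> set xs" by (elim exE conjE)
 show "\<exists>X. finite X & (\<exists>U. finite U & card U = n & (\<forall>u\<in>U. \<exists>xs\<in>X. u \<in> set xs)) & \<eta> \<in> legals E v X"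
  by (rule exI[of _ X], rule conjI[OF X(1)], rule conjI[OF _ X(2)], rule exI[of _ U], intro conjI U(2,3) X(3))
next
 fix \<eta> X assume "\<exists>U. finite U & card U = n & (\<forall>u\<in>U. \<exists>xs\<in>X. u \<in> set xs)" and l: "\<eta> \<in> legals E v X"
 then obtain U where X: "finite U" "card U = n" "\<forall>u\<in>U. \<exists>xs\<in>X. u \<in> set xs" by (elim exE conjE)
 have "U \<subseteq> avalanche_cluster E v \<eta>" using X(3) legals_cluster[OF l] by auto
 then show "enat n <= ecard (avalanche_cluster E v \<eta>)" using ecard_ge X(1,2) by blast
qed

lemma size_event:
 assumes n: "0 < n"
 shows "{\<eta>. enat n <= avalanche_size E v \<eta>} =
  (\<Union>X\<in>{X. finite X & (\<exists>U m. finite U & n <= sum m U & (\<forall>u\<in>U. \<exists>xs\<in>X. m u <= count_list xs u))}. legals E v X)"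
proof (rule event_legals)
 fix \<eta> assume "enat n <= avalanche_size E v \<eta>"
 then obtain U m where U: "finite U" "n <= sum m U" "\<forall>u\<in>U. enat (m u) <= avalanche E v \<eta> u"
  unfolding avalanche_size_ge[OF n] by (elim exE conjE)
 have "\<exists>X. finite X & \<eta> \<in> legals E v X & (\<forall>u\<in>U. \<exists>xs\<in>X. m u <= count_list xs u)"
  by (rule legals_choose[OF U(1)]) (use U(3) in \<open>simp add: avalanche_ge[symmetric]\<close>)
 then obtain X where X: "finite X" "\<eta> \<in> legals E v X" "\<forall>u\<in>U. \<exists>xs\<in>X. m u <= count_list xs u" by (elim exE conjE)
 show "\<exists>X. finite X & (\<exists>U m. finite U & n <= sum m U & (\<forall>u\<in>U. \<exists>xs\<in>X. m u <= count_list xs u)) & \<eta> \<in> legals E v X"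
  by (rule exI[of _ X], rule conjI[OF X(1)], rule conjI[OF _ X(2)], rule exI[of _ U], rule exI[of _ m], intro conjI U(1,2) X(3))
next
 fix \<eta> X assume "\<exists>U m. finite U & n <= sum m U & (\<forall>u\<in>U. \<exists>xs\<in>X. m u <= count_list xs u)" and l: "\<eta> \<in> legals E v X"
 then obtain U m where X: "finite U" "n <= sum m U" "\<forall>u\<in>U. \<exists>xs\<in>X. m u <= count_list xs u" by (elim exE conjE)
 have "enat (m u) <= avalanche E v \<eta> u" if u: "u \<in> U" for u
 proof -
  obtain xs where xs: "xs \<in> X" "m u <= count_list xs u" using bspec[OF X(3) u] by (elim bexE)
  then have "legal E UNIV (add_grain v \<eta>) xs" using l by (simp add: legals_def)
  then show ?thesis unfolding avalanche_ge using xs(2) by (intro exI[of _ xs] conjI)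
 qed
 then show "enat n <= avalanche_size E v \<eta>"
  unfolding avalanche_size_ge[OF n] using X(1,2) by (intro exI[of _ U] exI[of _ m] conjI ballI)
qed

context tgraph
begin

lemma odo_legal:
 assumes L: "finite L"
 shows "{\<eta> \<in> rec_set L. \<exists>U. \<Psi> U & U \<subseteq> L & insert v U \<subseteq> {x. 1 <= odo L (add_grain v \<eta>) x}} \<subseteq>
  {\<eta> \<in> rec_set L. \<exists>xs. legal E L (add_grain v \<eta>) xs & (\<exists>U. \<Psi> U & insert v U \<subseteq> set xs)}"
proof
 fix \<eta> assume e: "\<eta> \<in> {\<eta> \<in> rec_set L. \<exists>U. \<Psi> U & U \<subseteq> L & insert v U \<subseteq> {x. 1 <= odo L (add_grain v \<eta>) x}}"
 then obtain U where U: "\<Psi> U" "insert v U \<subseteq> {x. 1 <= odo L (add_grain v \<eta>) x}" by blast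
 obtain xs where xs: "stabilizing L (add_grain v \<eta>) xs" "count_list xs = odo L (add_grain v \<eta>)"
  using odo_list[OF L] by blast
 have "x \<in> set xs" if "x \<in> insert v U" for x
 proof (rule ccontr)
  assume "x \<notin> set xs"
  then have "odo L (add_grain v \<eta>) x = 0" unfolding xs(2)[symmetric] by (simp add: count_list_0_iff)
  then show False using U(2) that by auto
 qed
 then show "\<eta> \<in> {\<eta> \<in> rec_set L. \<exists>xs. legal E L (add_grain v \<eta>) xs & (\<exists>U. \<Psi> U & insert v U \<subseteq> set xs)}"
  using e U(1) xs(1) unfolding stabilizing_def by blast
qed

end

context egraph
begin

text \<open>The hypothesis is an average over the positions v in \<open>X\<close>. Translating
  \<open>v\<close> to \<open>orig\<close> turns the exhaustion into another one with the same limit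
  \<open>M\<close>, so every summand tends to the same probability and the average drops
  out.\<close>

lemma lower_transfer:
 assumes M: "uniform_recurrent_law E M" and V: "exhaustion (V :: nat => 'v set)"
  and ball: "finite {x. dd orig x <= R + 1}" "0 <= R"
  and G: "!!K \<eta> xs. (!!x. x \<in> K ==> \<eta> x < dg) ==> legal E K (add_grain orig \<eta>) xs ==> \<not> G (set xs) ==>
   set xs \<subseteq> {x. dd orig x <= R}"
  and X: "finite X" "X ~= {}"
  and tau: "!!v. bij (\<tau> v)" "!!v x y. E (\<tau> v x) (\<tau> v y) \<longleftrightarrow> E x y" "!!v. \<tau> v v = orig"
  and avg: "!!L. finite L ==> X \<subseteq> L ==> c * real (card X) * real (card (rec_set L)) <=
   (\<Sum>v\<in>X. real (card {\<eta> \<in> rec_set L. \<exists>xs. legal E L (add_grain v \<eta>) xs & G (\<tau> v ` set xs)}))"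
  and A: "A \<in> sets M" "!!zs. G (set zs) ==> legals E orig {zs} \<subseteq> A"
 shows "c <= measure M A"
proof -
 interpret M: prob_space M using M by (simp add: uniform_recurrent_law_def)
 obtain Z where Z: "finite Z" "!!zs. zs \<in> Z ==> G (set zs)"
  "!!L \<eta> xs. \<eta> \<in> rec_set L ==> legal E L (add_grain orig \<eta>) xs ==> G (set xs) ==> \<eta> \<in> (\<Union>zs\<in>Z. legals E orig {zs})"
 proof (rule local_lists[of orig R G, OF ball(1) _ ball(2)])
  show "set xs \<subseteq> {x. dd orig x <= R}" if "!!x. x \<in> K ==> \<eta> x < dg" "legal E K (add_grain orig \<eta>) xs" "\<not> G (set xs)" for K \<eta> xs
   using that by (rule G)
  fix Z assume z: "finite Z" "!!zs. zs \<in> Z ==> G (set zs)"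
   "!!L \<eta> xs. \<eta> \<in> rec_set L ==> legal E L (add_grain orig \<eta>) xs ==> G (set xs) ==> \<eta> \<in> (\<Union>zs\<in>Z. legals E orig {zs})"
  show thesis by (rule that) (rule z(1), erule z(2), erule (2) z(3))
 qed
 let ?C = "\<Union>zs\<in>Z. legals E orig {zs}"
 have cyl: "cylinder ?C" by (intro cylinder_UN Z(1) cylinder_legals) simp
 have CA: "?C \<subseteq> A" using A(2) Z(2) by blast
 define p where "p v n = real (card (rec_set (\<tau> v ` V n) \<inter> ?C)) / real (card (rec_set (\<tau> v ` V n)))" for v n
 have exh: "exhaustion (%n. \<tau> v ` V n)" for v
 proof -
  have "incseq V" "(\<Union>n. V n) = UNIV" "!!n. finite (V n)" using V by (auto simp: exhaustion_def)
  moreover have "(\<Union>n. \<tau> v ` V n) = \<tau> v ` (\<Union>n. V n)" by blast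
  moreover have "range (\<tau> v) = UNIV" using tau(1)[of v] by (rule bij_is_surj)
  ultimately show ?thesis unfolding exhaustion_def incseq_def by (auto intro: image_mono)
 qed
 have "(%n. \<Sum>v\<in>X. p v n) \<longlonglongrightarrow> (\<Sum>v\<in>X. measure M ?C)"
  unfolding p_def by (intro tendsto_sum law_limit[OF M exh cyl])
 moreover have "\<forall>\<^sub>F n in sequentially. c * real (card X) <= (\<Sum>v\<in>X. p v n)"
  using exhaustion_covers[OF V X(1)]
 proof (rule eventually_mono)
  fix n assume XV: "X \<subseteq> V n"
  have fin: "finite (V n)" using V by (simp add: exhaustion_def)
  let ?N = "real (card (rec_set (V n)))"
  have N: "0 < ?N" by (rule card_rec_pos[OF fin])
  have "c * real (card X) * ?N <=
   (\<Sum>v\<in>X. real (card {\<eta> \<in> rec_set (V n). \<exists>xs. legal E (V n) (add_grain v \<eta>) xs & G (\<tau> v ` set xs)}))"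
   by (rule avg[OF fin XV])
  also have "... <= (\<Sum>v\<in>X. p v n * ?N)"
  proof (rule sum_mono)
   fix v
   have inj: "inj (\<tau> v)" using tau(1)[of v] by (rule bij_is_inj)
   have fin': "finite (\<tau> v ` V n)" using fin by simp
   have e: "card (rec_set (\<tau> v ` V n)) = card (rec_set (V n))"
    using card_rec_shift[OF tau(1,2), of v "V n" "%_. True"] by simp
   have ag: "add_grain v (\<eta> \<circ> \<tau> v) = add_grain orig \<eta> \<circ> \<tau> v" for \<eta>
   proof
    fix x
    have "\<tau> v x = orig \<longleftrightarrow> x = v" using inj_eq[OF inj, of x v] by (simp add: tau(3))
    then show "add_grain v (\<eta> \<circ> \<tau> v) x = (add_grain orig \<eta> \<circ> \<tau> v) x" by (auto simp: add_grain_def tau(3))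
   qed
   have "card {\<eta> \<in> rec_set (V n). \<exists>xs. legal E (V n) (add_grain v \<eta>) xs & G (\<tau> v ` set xs)} =
     card {\<eta> \<in> rec_set (\<tau> v ` V n). \<exists>xs. legal E (V n) (add_grain v (\<eta> \<circ> \<tau> v)) xs & G (\<tau> v ` set xs)}"
    by (rule card_rec_shift[OF tau(1,2), symmetric])
   also have "... <= card (rec_set (\<tau> v ` V n) \<inter> ?C)"
   proof (rule card_mono)
    show "finite (rec_set (\<tau> v ` V n) \<inter> ?C)" using finite_rec[OF fin'] by simp
    show "{\<eta> \<in> rec_set (\<tau> v ` V n). \<exists>xs. legal E (V n) (add_grain v (\<eta> \<circ> \<tau> v)) xs & G (\<tau> v ` set xs)} \<subseteq>
      rec_set (\<tau> v ` V n) \<inter> ?C"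
    proof
     fix \<eta> assume "\<eta> \<in> {\<eta> \<in> rec_set (\<tau> v ` V n). \<exists>xs. legal E (V n) (add_grain v (\<eta> \<circ> \<tau> v)) xs & G (\<tau> v ` set xs)}"
     then obtain xs where e: "\<eta> \<in> rec_set (\<tau> v ` V n)" "legal E (V n) (add_grain orig \<eta> \<circ> \<tau> v) xs" "G (\<tau> v ` set xs)"
      unfolding ag by blast
     have "legal E (\<tau> v ` V n) (add_grain orig \<eta>) (map (\<tau> v) xs)"
      using e(2) unfolding legal_shift[OF inj tau(2)] .
     then show "\<eta> \<in> rec_set (\<tau> v ` V n) \<inter> ?C" using Z(3)[OF e(1), of "map (\<tau> v) xs"] e(1,3) by simp
    qed
   qed
   finally show "real (card {\<eta> \<in> rec_set (V n). \<exists>xs. legal E (V n) (add_grain v \<eta>) xs & G (\<tau> v ` set xs)}) <= p v n * ?N"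
    using N unfolding p_def e by simp
  qed
  also have "... = (\<Sum>v\<in>X. p v n) * ?N" by (rule sum_distrib_right[symmetric])
  finally show "c * real (card X) <= (\<Sum>v\<in>X. p v n)" using N by (rule mult_right_le_imp_le)
 qed
 ultimately have "c * real (card X) <= (\<Sum>v\<in>X. measure M ?C)"
  by (intro tendsto_lowerbound[OF _ _ sequentially_bot])
 then have "c * real (card X) <= measure M ?C * real (card X)" by (simp add: mult.commute)
 moreover have "0 < real (card X)" using X by (simp add: card_gt_0_iff)
 ultimately have "c <= measure M ?C" by (rule mult_right_le_imp_le)
 also have "... <= measure M A" by (rule M.finite_measure_mono[OF CA A(1)])
 finally show ?thesis .
qed

end

section \<open>Boxes with a thin collar\<close>

definition box :: "int => (int ^ 'd) set" where
 "box R = {x. \<forall>i. \<bar>x $ i\<bar> <= R}"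

lemma box_PiE: "bij_betw (%x i. x $ i) (box R :: (int ^ 'd) set) (PiE UNIV (%_. {- R..R}))"
 by (rule bij_betw_byWitness[where f' = "%g. \<chi> i. g i"]) (auto simp: box_def abs_le_iff minus_le_iff)

lemma finite_box: "finite (box R :: (int ^ 'd) set)"
proof -
 have "finite (PiE (UNIV :: 'd set) (%_. {- R..R}))" by (rule finite_PiE) auto
 then show ?thesis unfolding bij_betw_finite[OF box_PiE[of R]] .
qed

lemma card_box: "0 <= R ==> card (box R :: (int ^ 'd) set) = (nat (2 * R + 1)) ^ CARD('d)"
proof -
 assume "0 <= R"
 have "card (box R :: (int ^ 'd) set) = card (PiE (UNIV :: 'd set) (%_. {- R..R}))"
  by (rule bij_betw_same_card[OF box_PiE])
 also have "... = card {- R..R} ^ CARD('d)" by (simp add: card_PiE del: card_atLeastAtMost_int)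
 also have "card {- R..R} = nat (2 * R + 1)"
  unfolding card_atLeastAtMost_int by (rule arg_cong[where f = nat]) simp
 finally show ?thesis .
qed

lemma abs_le_nrm1: "\<bar>x $ i\<bar> <= nrm1 x"
 unfolding nrm1_def by (rule member_le_sum) auto

lemma finite_nrm1_ball: "finite {x :: int ^ 'd. real_of_int (nrm1 (v - x)) <= R}"
proof -
 have "x \<in> box (\<lfloor>R\<rfloor> + nrm1 v)" if "real_of_int (nrm1 (v - x)) <= R" for x :: "int ^ 'd"
  unfolding box_def
 proof (intro CollectI allI)
  fix i
  have "nrm1 (v - x) <= \<lfloor>R\<rfloor>" using that by (simp add: le_floor_iff)
  moreover have "\<bar>(v - x) $ i\<bar> <= nrm1 (v - x)" "\<bar>v $ i\<bar> <= nrm1 v" by (rule abs_le_nrm1)+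
  ultimately show "\<bar>x $ i\<bar> <= \<lfloor>R\<rfloor> + nrm1 v" by simp
 qed
 then show ?thesis by (intro finite_subset[OF _ finite_box]) blast
qed

text \<open>With r = 4 k d the collar of width 2k takes at most the fraction 1/(2d) of each side, so
  by Bernoulli's inequality the inner box keeps half of the points.\<close>

lemma boxes:
 fixes k :: nat
 shows "\<exists>X I :: (int ^ 'd) set. finite X & X ~= {} & I \<subseteq> X & card X <= 2 * card I &
  (\<forall>x\<in>I. \<forall>y. real_of_int (nrm1 (y - x)) <= 2 * real k --> y \<in> X)"
proof -
 let ?d = "CARD('d)"
 define r where "r = 4 * int k * int ?d"
 let ?X = "box (r + 2 * int k) :: (int ^ 'd) set" and ?I = "box r :: (int ^ 'd) set"
 have r0: "0 <= r" by (simp add: r_def)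
 have "real (card ?X) <= 2 * real (card ?I)"
 proof -
  define N where "N = 2 * real_of_int r + 1 + 4 * real k"
  have r: "0 <= real_of_int r" "real_of_int r = 4 * real k * real ?d" using r0 by (simp_all add: r_def)
  have N: "0 < N" "8 * real k * real ?d <= N" unfolding N_def using r by linarith+
  have c: "real (card ?X) = N ^ ?d" "real (card ?I) = (N - 4 * real k) ^ ?d"
   using r0 by (simp_all add: card_box N_def add_ac)
  have "1 / 2 <= 1 + real ?d * (- (4 * real k / N))" using N by (simp add: field_simps)
  also have "... <= (1 + (- (4 * real k / N))) ^ ?d"
  proof (rule Bernoulli_inequality)
   have "4 * real k <= N" using r0 by (simp add: N_def)
   then show "- 1 <= - (4 * real k / N)" using N by simp
  qed
  finally have "N ^ ?d * (1 / 2) <= N ^ ?d * (1 + (- (4 * real k / N))) ^ ?d"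
   using N by (intro mult_left_mono) auto
  also have "... = (N - 4 * real k) ^ ?d"
   unfolding power_mult_distrib[symmetric] using N by (simp add: right_diff_distrib)
  finally show ?thesis unfolding c by simp
 qed
 then have c: "card ?X <= 2 * card ?I" by linarith
 have near: "y \<in> ?X" if "x \<in> ?I" "real_of_int (nrm1 (y - x)) <= 2 * real k" for x y
  unfolding box_def
 proof (intro CollectI allI)
  fix i
  have "real_of_int (nrm1 (y - x)) <= real_of_int (2 * int k)" using that(2) by simp
  then have "nrm1 (y - x) <= 2 * int k" by (simp only: of_int_le_iff)
  moreover have "\<bar>(y - x) $ i\<bar> <= nrm1 (y - x)" by (rule abs_le_nrm1)
  moreover have "\<bar>x $ i\<bar> <= r" using that(1) by (simp add: box_def)
  ultimately show "\<bar>y $ i\<bar> <= r + 2 * int k" by simp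
 qed
 have sub: "?I \<subseteq> ?X"
 proof
  fix x assume "x \<in> ?I"
  then have "\<bar>x $ i\<bar> <= r + 2 * int k" for i using add_increasing2[of "2 * int k" "\<bar>x $ i\<bar>" r] by (simp add: box_def)
  then show "x \<in> ?X" by (simp add: box_def)
 qed
 have "0 \<in> ?X" using r0 by (simp add: box_def)
 then have ne: "?X ~= {}" by (metis empty_iff)
 show ?thesis
  by (rule exI[of _ ?X], rule exI[of _ ?I]) (intro conjI finite_box ne sub c ballI allI impI, rule near)
qed

theorem theorem1p7:
  assumes "CARD('d::finite) \<ge> 5"
  shows "\<exists>a A :: real. 0 < a \<and> a \<le> A \<and>
    (\<forall>M :: (int ^ 'd) sandpile measure. uniform_recurrent_law lattice_adj M \<longrightarrow>
      (\<forall>n::nat. n \<ge> 1 \<longrightarrow>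
        measure M {\<eta> \<in> space M. diam_ext lattice_adj (avalanche_cluster lattice_adj 0 \<eta>) \<ge> enat n}
          \<in> {a * real n powr (-2) .. A * real n powr (-2)} \<and>
        measure M {\<eta> \<in> space M. ecard (avalanche_cluster lattice_adj 0 \<eta>) \<ge> enat n}
          \<in> {a * real n powr (-1/2) .. A * real n powr (-1/2)} \<and>
        measure M {\<eta> \<in> space M. avalanche_size lattice_adj 0 \<eta> \<ge> enat n}
          \<in> {a * real n powr (-1/2) .. A * real n powr (-1/2)}))"
proof -
 let ?E = "lattice_adj :: int ^ 'd => _"
 let ?dd = "%x y :: int ^ 'd. real_of_int (nrm1 (x - y))"
 let ?dg = "real (2 * CARD('d))"
 obtain gh B Ke Kt where eg: "egraph ?E (2 * CARD('d)) gh B ?dd Ke Kt" using lattice_egraph[OF assms] by blast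
 interpret egraph ?E "2 * CARD('d)" gh B ?dd Ke Kt by (rule eg)
 have dg0: "0 < ?dg" using assms by simp
 obtain Cq where Cq: "0 < Cq" and q: "!!(v :: int ^ 'd) r :: real. 1 <= r ==> \<exists>q. (\<forall>x. 0 <= q x) &
  (\<forall>x. (\<Sum>y\<in>{y. ?E x y}. q y) + of_bool (?dd v x < r) <= ?dg * q x) & ?dg * q v <= Cq * r\<^sup>2"
  using lattice_near[OF assms] by blast
 have near: "(\<Sum>x\<in>{x \<in> D. ?dd v x < r}. hit w D v x) <= Cq * r\<^sup>2"
  if D: "finite D" "v \<notin> D" and r: "1 <= r" for D :: "(int ^ 'd) set" and v and r :: real
 proof -
  obtain q where q: "!!x. 0 <= q x" "!!x. (\<Sum>y\<in>{y. ?E x y}. q y) + of_bool (?dd v x < r) <= ?dg * q x"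
   "?dg * q v <= Cq * r\<^sup>2" using q[OF r] by blast
  have "(\<Sum>x\<in>D \<inter> {x. ?dd v x < r}. hit w D v x) <= ?dg * q v"
   by (rule near_hit[OF q(1) _ D]) (use q(2) in simp)
  moreover have "D \<inter> {x. ?dd v x < r} = {x \<in> D. ?dd v x < r}" by auto
  ultimately show ?thesis using q(3) by simp
 qed
 have "\<exists>c>0. \<forall>r\<ge>1. \<exists>k :: nat. \<forall>D X I. finite D --> I \<subseteq> X --> X \<subseteq> D -->
   card X <= 2 * card I --> (\<forall>x\<in>I. \<forall>y. ?dd y x <= 2 * real k --> y \<in> X) -->
   c / r\<^sup>2 * card X * partn w D <= (\<Sum>v\<in>X. fosum w D (%f. of_bool (\<exists>x\<in>tree (D - {v}) f v. r <= ?dd v x)))"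
  by (rule lower_far[OF _ Cq]) (rule near)
 then obtain c1 where c1: "0 < c1" and low1: "!!r :: real. 1 <= r ==> \<exists>k :: nat. \<forall>D X I. finite D --> I \<subseteq> X --> X \<subseteq> D -->
   card X <= 2 * card I --> (\<forall>x\<in>I. \<forall>y. ?dd y x <= 2 * real k --> y \<in> X) -->
   c1 / r\<^sup>2 * card X * partn w D <= (\<Sum>v\<in>X. fosum w D (%f. of_bool (\<exists>x\<in>tree (D - {v}) f v. r <= ?dd v x)))"
 proof (elim exE conjE)
  fix c :: real assume c: "0 < c" "\<forall>r\<ge>1. \<exists>k :: nat. \<forall>D X I. finite D --> I \<subseteq> X --> X \<subseteq> D -->
   card X <= 2 * card I --> (\<forall>x\<in>I. \<forall>y. ?dd y x <= 2 * real k --> y \<in> X) -->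
   c / r\<^sup>2 * card X * partn w D <= (\<Sum>v\<in>X. fosum w D (%f. of_bool (\<exists>x\<in>tree (D - {v}) f v. r <= ?dd v x)))"
  show thesis by (rule that[OF c(1) mp[OF spec[OF c(2)]]])
 qed
 obtain c2 where c2: "0 < c2" and low2: "!!n :: nat. 1 <= n ==> \<exists>k. \<forall>D X I. finite D --> I \<subseteq> X --> X \<subseteq> D -->
   card X <= 2 * card I --> (\<forall>x\<in>I. \<forall>y. ?dd y x <= 2 * real k --> y \<in> X) -->
   c2 / sqrt (real n) * card X * partn w D <= (\<Sum>v\<in>X. fosum w D (%f. of_bool (n <= card (tree (D - {v}) f v))))"
 proof -
  from lower_size obtain c where c: "0 < c" "\<forall>n\<ge>1. \<exists>k. \<forall>D X I. finite D --> I \<subseteq> X --> X \<subseteq> D -->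
   card X <= 2 * card I --> (\<forall>x\<in>I. \<forall>y. ?dd y x <= 2 * real k --> y \<in> X) -->
   c / sqrt (real n) * card X * partn w D <= (\<Sum>v\<in>X. fosum w D (%f. of_bool (n <= card (tree (D - {v}) f v))))"
   by (elim exE conjE)
  show thesis by (rule that[OF c(1) mp[OF spec[OF c(2)]]])
 qed
 obtain C1 where C1: "0 < C1" and up1: "!!L v s. finite L ==> v \<in> L ==> 0 < s ==>
  real (card {\<eta> \<in> rec_set L. \<exists>x. 1 <= odo L (add_grain v \<eta>) x & s <= ?dd v x}) <= C1 / s\<^sup>2 * real (card (rec_set L))"
  using far_upper by blast
 define C2 where "C2 = (CA + 2 * CS + 1) * (1 + B)"
 have C2: "0 <= C2" unfolding C2_def using CA_ge CS_ge one_B_nonneg by (intro mult_nonneg_nonneg) auto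
 \<comment> \<open>The lower constants lose the degree from \<open>lower_count\<close>. The factor 4
   in the upper one arises because one of two vertices at distance n lies at distance at least n/2
   from 0.\<close>
 define a where "a = min (c1 / ?dg) (c2 / ?dg)"
 define A where "A = max a (max (4 * C1) C2)"
 have a: "0 < a" "a <= c1 / ?dg" "a <= c2 / ?dg" using c1 c2 dg0 by (auto simp: a_def)
 have A: "a <= A" "4 * C1 <= A" "C2 <= A" by (auto simp: A_def)
 define \<tau> where "\<tau> v x = x - v" for v x :: "int ^ 'd"
 have tau: "bij (\<tau> v)" "?E (\<tau> v x) (\<tau> v y) \<longleftrightarrow> ?E x y" "\<tau> v v = 0" for v x y
 proof -
  show "bij (\<tau> v)" by (rule bij_betw_byWitness[where f' = "%x. x + v"]) (auto simp: \<tau>_def)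
 qed (auto simp: \<tau>_def lattice_adj_nrm1)
 have cnt: "countable (UNIV :: (int ^ 'd) set)" by simp
 obtain V :: "nat => (int ^ 'd) set" where V: "exhaustion V" using exhaustion_exists[OF cnt] by blast
 have main: "a * real n powr (-2) <= measure M {\<eta>. enat n <= diam_ext ?E (avalanche_cluster ?E 0 \<eta>)} &
  measure M {\<eta>. enat n <= diam_ext ?E (avalanche_cluster ?E 0 \<eta>)} <= A * real n powr (-2) &
  a * real n powr (-1/2) <= measure M {\<eta>. enat n <= ecard (avalanche_cluster ?E 0 \<eta>)} &
  measure M {\<eta>. enat n <= ecard (avalanche_cluster ?E 0 \<eta>)} <= A * real n powr (-1/2) &
  a * real n powr (-1/2) <= measure M {\<eta>. enat n <= avalanche_size ?E 0 \<eta>} &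
  measure M {\<eta>. enat n <= avalanche_size ?E 0 \<eta>} <= A * real n powr (-1/2)"
  if M: "uniform_recurrent_law ?E M" and n: "1 <= n" for M and n :: nat
 proof -
  have n0: "0 < n" "0 < real n" "1 <= real n" using n by auto
  have pw2: "real n powr (-2) = 1 / (real n)\<^sup>2" using n0 by (simp add: powr_minus_divide powr_numeral)
  have pwh: "real n powr (-1/2) = 1 / sqrt (real n)" using n0 by (simp add: powr_minus_divide powr_half_sqrt)
  have sM: "sets M = sets borel" using M by (simp add: uniform_recurrent_law_def)
  have ms: "(\<Union>X\<in>W. legals ?E 0 X) \<in> sets M" if "!!X. X \<in> W ==> finite X" for W
   unfolding sM by (rule borel_open) (intro open_UN ballI cylinder_open cylinder_legals that)
  have size_le: "n <= (\<Sum>x\<in>L. odo L \<eta> x)"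
   if L: "finite L" and U: "finite U" "n <= sum m U" "!!u. u \<in> U ==> m u <= odo L \<eta> u" for L \<eta> and U :: "(int ^ 'd) set" and m
  proof -
   have "sum m U <= (\<Sum>u\<in>U. odo L \<eta> u)" by (rule sum_mono) (rule U(3))
   also have "... = (\<Sum>u\<in>U \<inter> L. odo L \<eta> u)"
    using U(1) odo_out[OF L] by (intro sum.mono_neutral_right) auto
   also have "... <= (\<Sum>u\<in>L. odo L \<eta> u)" using L by (intro sum_mono2) auto
   finally show ?thesis using U(2) by linarith
  qed
  \<comment> \<open>Serves both for the cluster and for the total: a cluster with \<open>n\<close>
    vertices accounts for at least \<open>n\<close> topplings.\<close>
  have size_up: "measure M (\<Union>X\<in>W. legals ?E 0 X) <= A * real n powr (-1/2)"
   if fin: "!!X. X \<in> W ==> finite X"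
    and W: "!!X. X \<in> W ==> \<exists>U m. finite U & n <= sum m U & (\<forall>u\<in>U. \<exists>xs\<in>X. m u <= count_list xs u)" for W
  proof -
   have "measure M (\<Union>X\<in>W. legals ?E 0 X) <= C2 / sqrt (real n)"
   proof (rule upper_transfer[OF M cnt _ fin order_refl])
    show "0 <= C2 / sqrt (real n)" using C2 by simp
    fix L :: "(int ^ 'd) set" assume L: "finite L" "0 \<in> L"
    have "{\<eta> \<in> rec_set L. \<exists>X\<in>W. \<forall>xs\<in>X. legal ?E L (add_grain 0 \<eta>) xs} \<subseteq>
     {\<eta> \<in> rec_set L. n <= (\<Sum>x\<in>L. odo L (add_grain 0 \<eta>) x)}"
    proof
     fix \<eta> assume e: "\<eta> \<in> {\<eta> \<in> rec_set L. \<exists>X\<in>W. \<forall>xs\<in>X. legal ?E L (add_grain 0 \<eta>) xs}"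
     then obtain X where X: "X \<in> W" "!!xs. xs \<in> X ==> legal ?E L (add_grain 0 \<eta>) xs" by blast
     obtain U m where U: "finite U" "n <= sum m U" "\<forall>u\<in>U. \<exists>xs\<in>X. m u <= count_list xs u" using W[OF X(1)] by blast
     have "m u <= odo L (add_grain 0 \<eta>) u" if "u \<in> U" for u
      using U(3) that odo_ge[OF L(1) X(2)] order_trans by blast
     then have "n <= (\<Sum>x\<in>L. odo L (add_grain 0 \<eta>) x)" by (rule size_le[OF L(1) U(1,2)])
     then show "\<eta> \<in> {\<eta> \<in> rec_set L. n <= (\<Sum>x\<in>L. odo L (add_grain 0 \<eta>) x)}" using e by blast
    qed
    then have "real (card {\<eta> \<in> rec_set L. \<exists>X\<in>W. \<forall>xs\<in>X. legal ?E L (add_grain 0 \<eta>) xs}) <=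
     real (card {\<eta> \<in> rec_set L. n <= (\<Sum>x\<in>L. odo L (add_grain 0 \<eta>) x)})"
     using finite_rec[OF L(1)] by (intro of_nat_mono card_mono) auto
    also have "... <= C2 / sqrt (real n) * real (card (rec_set L))"
     unfolding C2_def by (rule size_upper[OF L n])
    finally show "real (card {\<eta> \<in> rec_set L. \<exists>X\<in>W. \<forall>xs\<in>X. legal ?E L (add_grain 0 \<eta>) xs}) <=
     C2 / sqrt (real n) * real (card (rec_set L))" .
   qed
   also have "... <= A * real n powr (-1/2)" unfolding pwh using A(3) n0 by (simp add: divide_right_mono)
   finally show ?thesis .
  qed
  \<comment> \<open>Common scheme of the lower bounds: \<Psi> is the event for the tree at
    \<open>v\<close>, and \<open>G\<close> is the corresponding event for the entries of a legal
    list after \<open>v\<close> is moved to 0.\<close>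
  have lower: "c / ?dg <= measure M Ev"
   if ball: "finite {x. ?dd 0 x <= real n + 1}"
    and G: "!!K \<eta> xs. (!!x. x \<in> K ==> \<eta> x < 2 * CARD('d)) ==> legal ?E K (add_grain 0 \<eta>) xs ==> \<not> G (set xs) ==>
     set xs \<subseteq> {x. ?dd 0 x <= real n}"
    and k: "\<exists>k :: nat. \<forall>D X I. finite D --> I \<subseteq> X --> X \<subseteq> D -->
     card X <= 2 * card I --> (\<forall>x\<in>I. \<forall>y. ?dd y x <= 2 * real k --> y \<in> X) -->
     c * card X * partn w D <= (\<Sum>v\<in>X. fosum w D (%f. of_bool (\<Psi> v (tree (D - {v}) f v))))"
    and GP: "!!v U S. \<Psi> v U ==> insert v U \<subseteq> S ==> finite S ==> G (\<tau> v ` S)"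
    and Ev: "Ev \<in> sets M" "!!zs. G (set zs) ==> legals ?E 0 {zs} \<subseteq> Ev" for c :: real and G Ev \<Psi>
  proof -
   obtain k :: nat where k: "!!D X I. finite D ==> I \<subseteq> X ==> X \<subseteq> D ==>
     card X <= 2 * card I ==> (\<forall>x\<in>I. \<forall>y. ?dd y x <= 2 * real k --> y \<in> X) ==>
     c * card X * partn w D <= (\<Sum>v\<in>X. fosum w D (%f. of_bool (\<Psi> v (tree (D - {v}) f v))))"
    using k by blast
   obtain X I :: "(int ^ 'd) set" where X: "finite X" "X ~= {}" "I \<subseteq> X" "card X <= 2 * card I"
    "\<forall>x\<in>I. \<forall>y. ?dd y x <= 2 * real k --> y \<in> X" using boxes[of k] by blast
   show ?thesis
   proof (rule lower_transfer[where orig = 0 and R = "real n" and G = G and \<tau> = \<tau>, OF M V ball _ G X(1,2) tau _ Ev])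
    fix L :: "(int ^ 'd) set" assume L: "finite L" "X \<subseteq> L"
    have "c * real (card X) * real (card (rec_set L)) <= (\<Sum>v\<in>X. fosum w L (%f. of_bool (\<Psi> v (tree (L - {v}) f v))))"
     unfolding card_rec[OF L(1)] by (rule k[OF L(1) X(3) L(2) X(4,5)])
    also have "... <= (\<Sum>v\<in>X. ?dg * real (card {\<eta> \<in> rec_set L. \<exists>xs. legal ?E L (add_grain v \<eta>) xs & G (\<tau> v ` set xs)}))"
    proof (rule sum_mono)
     fix v assume v: "v \<in> X"
     have "fosum w L (%f. of_bool (\<Psi> v (tree (L - {v}) f v))) <=
      ?dg * real (card {\<eta> \<in> rec_set L. \<exists>U. \<Psi> v U & U \<subseteq> L & insert v U \<subseteq> {x. 1 <= odo L (add_grain v \<eta>) x}})"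
      using v L by (intro lower_count) auto
     also have "... <= ?dg * real (card {\<eta> \<in> rec_set L. \<exists>xs. legal ?E L (add_grain v \<eta>) xs & G (\<tau> v ` set xs)})"
     proof (intro mult_left_mono of_nat_mono card_mono)
      show "{\<eta> \<in> rec_set L. \<exists>U. \<Psi> v U & U \<subseteq> L & insert v U \<subseteq> {x. 1 <= odo L (add_grain v \<eta>) x}} \<subseteq>
       {\<eta> \<in> rec_set L. \<exists>xs. legal ?E L (add_grain v \<eta>) xs & G (\<tau> v ` set xs)}"
      proof
       fix \<eta> assume "\<eta> \<in> {\<eta> \<in> rec_set L. \<exists>U. \<Psi> v U & U \<subseteq> L & insert v U \<subseteq> {x. 1 <= odo L (add_grain v \<eta>) x}}"
       then have "\<eta> \<in> {\<eta> \<in> rec_set L. \<exists>xs. legal ?E L (add_grain v \<eta>) xs & (\<exists>U. \<Psi> v U & insert v U \<subseteq> set xs)}"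
        by (rule subsetD[OF odo_legal[OF L(1)]])
       then obtain xs U where h: "\<eta> \<in> rec_set L" "legal ?E L (add_grain v \<eta>) xs" "\<Psi> v U" "insert v U \<subseteq> set xs"
        by (elim CollectE conjE exE)
       have "G (\<tau> v ` set xs)" by (rule GP[OF h(3,4)]) simp
       then show "\<eta> \<in> {\<eta> \<in> rec_set L. \<exists>xs. legal ?E L (add_grain v \<eta>) xs & G (\<tau> v ` set xs)}"
        using h(1,2) by (intro CollectI conjI exI[of _ xs])
      qed
     qed (use finite_rec[OF L(1)] dg0 in auto)
     finally show "fosum w L (%f. of_bool (\<Psi> v (tree (L - {v}) f v))) <=
      ?dg * real (card {\<eta> \<in> rec_set L. \<exists>xs. legal ?E L (add_grain v \<eta>) xs & G (\<tau> v ` set xs)})" .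
    qed
    finally show "c / ?dg * real (card X) * real (card (rec_set L)) <=
     (\<Sum>v\<in>X. real (card {\<eta> \<in> rec_set L. \<exists>xs. legal ?E L (add_grain v \<eta>) xs & G (\<tau> v ` set xs)}))"
     unfolding sum_distrib_left[symmetric] using dg0 by (simp add: field_simps)
   qed simp_all
  qed
  let ?diam = "{\<eta>. enat n <= diam_ext ?E (avalanche_cluster ?E 0 \<eta>)}"
  let ?ecard = "{\<eta>. enat n <= ecard (avalanche_cluster ?E 0 \<eta>)}"
  let ?size = "{\<eta>. enat n <= avalanche_size ?E 0 \<eta>}"
  have sets: "?diam \<in> sets M" "?ecard \<in> sets M" "?size \<in> sets M"
   unfolding diam_event[OF n0(1)] ecard_event size_event[OF n0(1)] by (intro ms; simp)+
  have ball: "finite {x. ?dd 0 x <= real n + 1}" by (rule finite_nrm1_ball)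
  have 1: "measure M ?diam <= A * real n powr (-2)"
  proof -
   have "measure M ?diam <= C1 / (real n / 2)\<^sup>2"
    unfolding diam_event[OF n0(1)]
   proof (rule upper_transfer[OF M cnt _ _ order_refl])
    show "0 <= C1 / (real n / 2)\<^sup>2" using C1 by simp
    let ?W = "{X. finite X & (\<exists>x y. enat n <= graph_dist ?E x y & (\<forall>u\<in>{x, y}. \<exists>xs\<in>X. u \<in> set xs))}"
    show "finite X" if "X \<in> ?W" for X using that by blast
    fix L :: "(int ^ 'd) set" assume L: "finite L" "0 \<in> L"
    have "{\<eta> \<in> rec_set L. \<exists>X\<in>?W. \<forall>xs\<in>X. legal ?E L (add_grain 0 \<eta>) xs} \<subseteq>
     {\<eta> \<in> rec_set L. \<exists>x. 1 <= odo L (add_grain 0 \<eta>) x & real n / 2 <= ?dd 0 x}"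
    proof
     fix \<eta> assume e: "\<eta> \<in> {\<eta> \<in> rec_set L. \<exists>X\<in>?W. \<forall>xs\<in>X. legal ?E L (add_grain 0 \<eta>) xs}"
     then obtain X x y where X: "\<forall>xs\<in>X. legal ?E L (add_grain 0 \<eta>) xs"
      "enat n <= graph_dist ?E x y" "\<forall>u\<in>{x, y}. \<exists>xs\<in>X. u \<in> set xs"
      by (elim CollectE conjE bexE exE)
     have od: "1 <= odo L (add_grain 0 \<eta>) u" if u: "u \<in> {x, y}" for u
     proof -
      obtain xs where xs: "xs \<in> X" "u \<in> set xs" using bspec[OF X(3) u] by (elim bexE)
      then have "count_list xs u ~= 0" by (simp add: count_list_0_iff)
      then show ?thesis using odo_ge[OF L(1) bspec[OF X(1) xs(1)], of u] by linarith
     qed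
     have "int n <= nrm1 (x - y)"
      using X(2) nrm1_nonneg[of "x - y"] by (simp add: graph_dist_lattice)
     then have "real n <= ?dd x y" by linarith
     also have "... <= ?dd x 0 + ?dd 0 y" by (rule dd_triangle)
     also have "?dd x 0 = ?dd 0 x" by (simp only: nrm1_minus[of x 0])
     finally have "real n / 2 <= ?dd 0 x \<or> real n / 2 <= ?dd 0 y" by linarith
     then obtain z where z: "z \<in> {x, y}" "real n / 2 <= ?dd 0 z" by auto
     have "\<eta> \<in> rec_set L" using e by (elim CollectE conjE)
     then show "\<eta> \<in> {\<eta> \<in> rec_set L. \<exists>x. 1 <= odo L (add_grain 0 \<eta>) x & real n / 2 <= ?dd 0 x}"
      using od[OF z(1)] z(2) by (intro CollectI conjI exI[of _ z])
    qed
    then have "real (card {\<eta> \<in> rec_set L. \<exists>X\<in>?W. \<forall>xs\<in>X. legal ?E L (add_grain 0 \<eta>) xs}) <=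
     real (card {\<eta> \<in> rec_set L. \<exists>x. 1 <= odo L (add_grain 0 \<eta>) x & real n / 2 <= ?dd 0 x})"
     using finite_rec[OF L(1)] by (intro of_nat_mono card_mono) auto
    also have "... <= C1 / (real n / 2)\<^sup>2 * real (card (rec_set L))"
     by (rule up1[OF L]) (use n0 in simp)
    finally show "real (card {\<eta> \<in> rec_set L. \<exists>X\<in>?W. \<forall>xs\<in>X. legal ?E L (add_grain 0 \<eta>) xs}) <=
     C1 / (real n / 2)\<^sup>2 * real (card (rec_set L))" .
   qed
   also have "... = 4 * C1 / (real n)\<^sup>2" by (simp add: power_divide)
   also have "... <= A / (real n)\<^sup>2" using A(2) by (intro divide_right_mono) auto
   finally show ?thesis unfolding pw2 by simp
  qed
  have 2: "measure M ?ecard <= A * real n powr (-1/2)"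
   unfolding ecard_event
  proof (rule size_up)
   fix X assume "X \<in> {X. finite X & (\<exists>U :: (int ^ 'd) set. finite U & card U = n & (\<forall>u\<in>U. \<exists>xs\<in>X. u \<in> set xs))}"
   then obtain U :: "(int ^ 'd) set" where U: "finite U" "card U = n" "\<forall>u\<in>U. \<exists>xs\<in>X. u \<in> set xs"
    by (elim CollectE conjE exE)
   have "\<exists>xs\<in>X. 1 <= count_list xs u" if u: "u \<in> U" for u
   proof -
    obtain xs where "xs \<in> X" "u \<in> set xs" using bspec[OF U(3) u] by (elim bexE)
    then have "xs \<in> X" "count_list xs u ~= 0" by (simp_all add: count_list_0_iff)
    then show ?thesis by (intro bexI[of _ xs]) auto
   qed
   then show "\<exists>U m. finite U & n <= sum m U & (\<forall>u\<in>U. \<exists>xs\<in>X. m u <= count_list xs u)"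
    using U(1,2) by (intro exI[of _ U] exI[of _ "%_. 1"]) simp
  qed (elim CollectE conjE)
  have 3: "measure M ?size <= A * real n powr (-1/2)"
   unfolding size_event[OF n0(1)] by (rule size_up) (erule CollectE, erule conjE, assumption)+
  have 4: "a * real n powr (-2) <= measure M ?diam"
  proof -
   \<comment> \<open>Membership of 0 provides the second point for the diameter; for nonempty legal
     lists on stable configurations it follows from \<open>legal_near\<close>.\<close>
   let ?G = "%S. 0 \<in> S & (\<exists>u\<in>S. real n <= ?dd 0 u)"
   have "c1 / (real n)\<^sup>2 / ?dg <= measure M ?diam"
   proof (rule lower[OF ball, where G = ?G and \<Psi> = "%v U. \<exists>x\<in>U. real n <= ?dd v x"])
    fix K and \<eta> :: "int ^ 'd => nat" and xs
    assume st: "!!x. x \<in> K ==> \<eta> x < 2 * CARD('d)" and l: "legal ?E K (add_grain 0 \<eta>) xs" and g: "\<not> ?G (set xs)"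
    show "set xs \<subseteq> {x. ?dd 0 x <= real n}"
    proof
     fix u assume u: "u \<in> set xs"
     have "0 \<in> set xs & ?dd 0 u + 1 <= real (card (set xs))" by (rule legal_near[OF _ l u]) (rule st)
     then have "0 \<in> set xs" by (rule conjunct1)
     then have "\<not> real n <= ?dd 0 u" using g u by blast
     then show "u \<in> {x. ?dd 0 x <= real n}" by simp
    qed
   next
    show "\<exists>k :: nat. \<forall>D X I. finite D --> I \<subseteq> X --> X \<subseteq> D -->
     card X <= 2 * card I --> (\<forall>x\<in>I. \<forall>y. ?dd y x <= 2 * real k --> y \<in> X) -->
     c1 / (real n)\<^sup>2 * card X * partn w D <=
     (\<Sum>v\<in>X. fosum w D (%f. of_bool (\<exists>x\<in>tree (D - {v}) f v. real n <= ?dd v x)))"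
     by (rule low1[OF n0(3)])
   next
    fix v and U S :: "(int ^ 'd) set" assume U: "\<exists>x\<in>U. real n <= ?dd v x" "insert v U \<subseteq> S"
    then obtain x where x: "x \<in> U" "real n <= ?dd v x" by blast
    have "?dd 0 (\<tau> v x) = ?dd v x" by (simp add: \<tau>_def)
    moreover have "\<tau> v x \<in> \<tau> v ` S" "\<tau> v v \<in> \<tau> v ` S" by (rule imageI, use x U(2) in auto)+
    ultimately show "?G (\<tau> v ` S)" using x(2) unfolding tau(3) by (intro conjI bexI[of _ "\<tau> v x"]) simp_all
   next
    show "?diam \<in> sets M" by (rule sets)
    fix zs assume "?G (set zs)"
    then obtain u where u: "0 \<in> set zs" "u \<in> set zs" "real n <= ?dd 0 u" by (elim conjE bexE)
    show "legals ?E 0 {zs} \<subseteq> ?diam"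
    proof
     fix \<eta> assume "\<eta> \<in> legals ?E 0 {zs}"
     note cl = legals_cluster[OF this singletonI u(1)] legals_cluster[OF this singletonI u(2)]
     have "enat n <= graph_dist ?E 0 u"
     proof -
      have "int n <= nrm1 (0 - u)" using u(3) by linarith
      then show ?thesis by (simp add: graph_dist_lattice)
     qed
     then have "\<exists>y\<in>avalanche_cluster ?E 0 \<eta>. enat n <= graph_dist ?E 0 y" using cl(2) by (rule bexI)
     then have "\<exists>x\<in>avalanche_cluster ?E 0 \<eta>. \<exists>y\<in>avalanche_cluster ?E 0 \<eta>. enat n <= graph_dist ?E x y"
      using cl(1) by (rule bexI)
     then show "\<eta> \<in> ?diam" unfolding mem_Collect_eq diam_ext_ge[OF n0(1)] .
    qed
   qed
   moreover have "a * real n powr (-2) <= c1 / (real n)\<^sup>2 / ?dg"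
    using divide_right_mono[OF a(2), of "(real n)\<^sup>2"] unfolding pw2 by (simp add: divide_divide_eq_left mult.commute)
   ultimately show ?thesis by linarith
  qed
  \<comment> \<open>A legal list with \<open>n\<close> distinct entries bounds the size of the
    cluster and the number of topplings alike.\<close>
  have low: "a * real n powr (-1/2) <= measure M Ev"
   if Ev: "Ev \<in> sets M" "!!zs \<eta>. n <= card (set zs) ==> \<eta> \<in> legals ?E 0 {zs} ==> \<eta> \<in> Ev" for Ev
  proof -
   let ?G = "%S :: (int ^ 'd) set. n <= card S"
   have "c2 / sqrt (real n) / ?dg <= measure M Ev"
   proof (rule lower[OF ball, where G = ?G and \<Psi> = "%v U. n <= card U"])
    fix K and \<eta> :: "int ^ 'd => nat" and xs
    assume st: "!!x. x \<in> K ==> \<eta> x < 2 * CARD('d)" and l: "legal ?E K (add_grain 0 \<eta>) xs" and g: "\<not> ?G (set xs)"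
    show "set xs \<subseteq> {x. ?dd 0 x <= real n}"
    proof
     fix u assume u: "u \<in> set xs"
     have "0 \<in> set xs & ?dd 0 u + 1 <= real (card (set xs))" by (rule legal_near[OF _ l u]) (rule st)
     then show "u \<in> {x. ?dd 0 x <= real n}" using g by simp
    qed
   next
    show "\<exists>k :: nat. \<forall>D X I. finite D --> I \<subseteq> X --> X \<subseteq> D -->
     card X <= 2 * card I --> (\<forall>x\<in>I. \<forall>y. ?dd y x <= 2 * real k --> y \<in> X) -->
     c2 / sqrt (real n) * card X * partn w D <=
     (\<Sum>v\<in>X. fosum w D (%f. of_bool (n <= card (tree (D - {v}) f v))))"
     by (rule low2[OF n])
   next
    fix v and U S :: "(int ^ 'd) set" assume U: "n <= card U" "insert v U \<subseteq> S" "finite S"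
    have "card (\<tau> v ` S) = card S" by (rule card_image) (simp add: inj_on_def \<tau>_def)
    moreover have "card U <= card S" using U by (intro card_mono) auto
    ultimately show "n <= card (\<tau> v ` S)" using U(1) by simp
   next
    show "Ev \<in> sets M" by (rule Ev)
    show "legals ?E 0 {zs} \<subseteq> Ev" if "?G (set zs)" for zs
     by (rule subsetI) (rule Ev(2)[OF that])
   qed
   moreover have "a * real n powr (-1/2) <= c2 / sqrt (real n) / ?dg"
    using divide_right_mono[OF a(3), of "sqrt (real n)"] unfolding pwh by (simp add: divide_divide_eq_left mult.commute)
   ultimately show ?thesis by linarith
  qed
  have 5: "a * real n powr (-1/2) <= measure M ?ecard"
  proof (rule low[OF sets(2)])
   fix zs \<eta> assume z: "n <= card (set zs)" "\<eta> \<in> legals ?E 0 {zs}"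
   obtain U where U: "U \<subseteq> set zs" "card U = n" "finite U" by (rule obtain_subset_with_card_n[OF z(1)])
   have "U \<subseteq> avalanche_cluster ?E 0 \<eta>"
    by (rule subsetI) (rule legals_cluster[OF z(2) singletonI subsetD[OF U(1)]])
   then show "\<eta> \<in> ?ecard" unfolding mem_Collect_eq ecard_ge using U(2,3) by (intro exI[of _ U] conjI)
  qed
  have 6: "a * real n powr (-1/2) <= measure M ?size"
  proof (rule low[OF sets(3)])
   fix zs \<eta> assume z: "n <= card (set zs)" "\<eta> \<in> legals ?E 0 {zs}"
   have "enat 1 <= avalanche ?E 0 \<eta> u" if "u \<in> set zs" for u
   proof -
    have "count_list zs u ~= 0" using that by (simp add: count_list_0_iff)
    then show ?thesis unfolding avalanche_ge using z(2) by (intro exI[of _ zs]) (auto simp: legals_def)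
   qed
   then show "\<eta> \<in> ?size"
    unfolding mem_Collect_eq avalanche_size_ge[OF n0(1)]
    using z(1) by (intro exI[of _ "set zs"] exI[of _ "%_. 1"]) simp
  qed
  show ?thesis by (intro conjI 1 2 3 4 5 6)
 qed
 have sp: "space M = UNIV" if "uniform_recurrent_law ?E M" for M
  using sets_eq_imp_space_eq[of M borel] that by (simp add: uniform_recurrent_law_def)
 show ?thesis
 proof (rule exI[of _ a], rule exI[of _ A], intro conjI allI impI)
  fix M :: "(int ^ 'd) sandpile measure" and n :: nat
  assume M: "uniform_recurrent_law lattice_adj M" and n: "1 <= n"
  note m = main[OF M n]
  show "measure M {\<eta> \<in> space M. diam_ext lattice_adj (avalanche_cluster lattice_adj 0 \<eta>) \<ge> enat n}
     \<in> {a * real n powr (-2) .. A * real n powr (-2)}"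
   "measure M {\<eta> \<in> space M. ecard (avalanche_cluster lattice_adj 0 \<eta>) \<ge> enat n}
     \<in> {a * real n powr (-1/2) .. A * real n powr (-1/2)}"
   "measure M {\<eta> \<in> space M. avalanche_size lattice_adj 0 \<eta> \<ge> enat n}
     \<in> {a * real n powr (-1/2) .. A * real n powr (-1/2)}"
   using m unfolding sp[OF M] by simp_all
 qed (rule a(1), rule A(1))
qed

end
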